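(* (1) Let $(G \curvearrowright X, \mathcal{R})$ be a rotation system, let $o \in X$ be a vertex, and let $\mathcal{R}_o$ denote the set of the rotative-stabilisers of the cliques of $X$ containing $o$. Then $G$ is a periagroup with $\mathcal{R}_o$ as a basis, and $X$ is a mediangle graph isomorphic to $\mathrm{Cayl}(G,\mathcal{R}_o)$. (2) Conversely, if $G$ is a periagroup with $\mathcal{B}$ as a basis, then $Y := \mathrm{Cayl}(G,\mathcal{B})$ is a mediangle graph and $(G \curvearrowright Y, \{ gBg^{-1} \mid g \in G, B \in \mathcal{B}\})$ is a rotation system, where $G$ acts on $Y$ by left multiplication.
   Context: Graphs. All graphs are simplicial (no loops, no multiple edges). Subgraphs are identified with sets of vertices endowed with the induced adjacency relation; connected graphs are non-empty. $d$ denotes the graph distance and $I(x,y)=\{z \mid d(x,y)=d(x,z)+d(z,y)\}$. A subgraph $Y$ is convex if $I(x,y)\subset Y$ for all $x,y\in Y$. A convex cycle is a convex subgraph isomorphic to a cycle. A clique is a maximal complete subgraph (with at least one edge). Mediangle graphs. A connected graph $X$ is mediangle if: (Triangle Condition) for all vertices $o,x,y$ with $d(o,x)=d(o,y)$ and $d(x,y)=1$, there is a common neighbour $z$ of $x,y$ with $z\in I(o,x)\cap I(o,y)$; (Intersection of Triangles) $X$ contains no induced copy of $K_4^-$ (the complete graph $K_4$ minus an edge); (Cycle Condition) for all vertices $o,x,y,z$ with $x\neq y$, $d(o,x)=d(o,y)=d(o,z)-1$ and $d(x,z)=d(y,z)=1$, there is a convex cycle of even length containing the edges $[z,x],[z,y]$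 such that the vertex opposite to $z$ in it belongs to $I(o,x)\cap I(o,y)$; (Intersection of Even Cycles) the intersection of any two distinct convex cycles of even lengths contains at most one edge. Rotation systems. A rotation system $(G\curvearrowright \Omega,\mathcal{R})$ is the data of a group $G$, a collection $\mathcal{R}$ of subgroups of $G$, and a connected graph $\Omega$ on which $G$ acts (by automorphisms) such that: $\mathcal{R}$ is stable under conjugation and generates $G$; for every clique $C\subset\Omega$ there is a unique $R\in\mathcal{R}$ that (stabilises $C$ and) acts freely and transitively on the vertices of $C$, called the rotative-stabiliser of $C$; every subgroup in $\mathcal{R}$ is the rotative-stabiliser of some clique of $\Omega$; for every clique $C\subset \Omega$, removing the edges of all the cliques having the same rotative-stabiliser as $C$ separates any two distinct vertices of $C$. Periagroups. Let $\Gamma$ be a graph, $\lambda:E(\Gamma)\to\mathbb{N}_{\geq 2}$ a labelling, and $\mathcal{G}=\{G_u\mid u\in V(\Gamma)\}$ a collection of groups (the vertex-groups) such that for every edge $\{u,v\}$, if $\lambda(u,v)>2$ then $G_u,G_v$ have order two. The periagroup $\Pi(\Gamma,\lambda,\mathcal{G})$ is the quotient of the free product of the $G_u$ by the relations $\langle a,b\rangle^{\lambda(u,v)}=\langle b,a\rangle^{\lambda(u,v)}$ for all $\{u,v\}\in E(\Gamma)$ and all non-trivial $a\in G_u$, $b\in G_v$, where $\langle a,b\rangle^k$ is the word formed by the first $k$ letters of $ababab\cdots$. Bases. Let $G$ be a group and $\mathcal{B}$ a collection of non-trivial subgroups of $G$. Let $\Gamma$ be the graph with vertex-set $\mathcal{B}$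 in which two distinct $A,B\in\mathcal{B}$ are adjacent whenever $\langle A,B\rangle\neq A\ast B$ (i.e. the canonical map $A\ast B\to\langle A,B\rangle$ is not an isomorphism); the vertex-group of a vertex is the corresponding subgroup. $G$ is a periagroup with $\mathcal{B}$ as a basis if there is a labelling $\lambda:E(\Gamma)\to\mathbb{N}_{\geq2}$ (as required in the definition of a periagroup) such that the identity map $\mathcal{B}\to\mathcal{B}$ extends to an isomorphism $\Pi(\Gamma,\lambda,\mathcal{B})\to G$. For a collection $\mathcal{B}$ of subgroups generating $G$, $\mathrm{Cayl}(G,\mathcal{B})$ is the graph with vertex-set $G$ whose edges connect $g$ and $gs$ for all $g\in G$ and $s\in\bigcup_{B\in\mathcal{B}}B\setminus\{1\}$. *)

theory Defs
  imports "HOL-Algebra.Group_Action" "HOL-Algebra.Generated_Groups"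
begin

section \<open>Simple graphs\<close>

record 'v ugraph =
  verts :: "'v set"
  adj :: "'v \<Rightarrow> 'v \<Rightarrow> bool"

definition simple_graph :: "'v ugraph \<Rightarrow> bool" where
  "simple_graph X \<longleftrightarrow>
     (\<forall>x y. adj X x y \<longrightarrow> x \<in> verts X \<and> y \<in> verts X \<and> x \<noteq> y \<and> adj X y x)"

definition edges :: "'v ugraph \<Rightarrow> 'v set set" where
  "edges X = {{x, y} | x y. adj X x y}"

definition graph_iso :: "'v ugraph \<Rightarrow> 'w ugraph \<Rightarrow> ('v \<Rightarrow> 'w) \<Rightarrow> bool" where
  "graph_iso X Y f \<longleftrightarrow> bij_betw f (verts X) (verts Y) \<and>
     (\<forall>x\<in>verts X. \<forall>y\<in>verts X. adj Y (f x) (f y) \<longleftrightarrow> adj X x y)"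

definition isomorphic_graphs :: "'v ugraph \<Rightarrow> 'w ugraph \<Rightarrow> bool" (infix "\<cong>\<^sub>g" 50) where
  "X \<cong>\<^sub>g Y \<longleftrightarrow> (\<exists>f. graph_iso X Y f)"

definition induced :: "'v ugraph \<Rightarrow> 'v set \<Rightarrow> 'v ugraph" where
  "induced X S = \<lparr>verts = verts X \<inter> S, adj = (\<lambda>x y. x \<in> S \<and> y \<in> S \<and> adj X x y)\<rparr>"

definition delete_edges :: "'v ugraph \<Rightarrow> 'v set set \<Rightarrow> 'v ugraph" where
  "delete_edges X F = \<lparr>verts = verts X, adj = (\<lambda>x y. adj X x y \<and> {x, y} \<notin> F)\<rparr>"

definition walk_betw :: "'v ugraph \<Rightarrow> 'v \<Rightarrow> 'v list \<Rightarrow> 'v \<Rightarrow> bool" where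
  "walk_betw X x p y \<longleftrightarrow> p \<noteq> [] \<and> set p \<subseteq> verts X \<and> successively (adj X) p \<and>
     hd p = x \<and> last p = y"

definition connected_graph :: "'v ugraph \<Rightarrow> bool" where
  "connected_graph X \<longleftrightarrow> verts X \<noteq> {} \<and>
     (\<forall>x\<in>verts X. \<forall>y\<in>verts X. \<exists>p. walk_betw X x p y)"

text \<open>A walk with \<open>n\<close> edges is a list of \<open>Suc n\<close> vertices.  The distance is
  unspecified for vertices in different components, and is only used in connected graphs.\<close>

definition gdist :: "'v ugraph \<Rightarrow> 'v \<Rightarrow> 'v \<Rightarrow> nat" where
  "gdist X x y = (LEAST n. \<exists>p. walk_betw X x p y \<and> length p = Suc n)"

definition interval :: "'v ugraph \<Rightarrow> 'v \<Rightarrow> 'v \<Rightarrow> 'v set" where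
  "interval X x y = {z \<in> verts X. gdist X x y = gdist X x z + gdist X z y}"

definition convex_subgraph :: "'v ugraph \<Rightarrow> 'v set \<Rightarrow> bool" where
  "convex_subgraph X S \<longleftrightarrow> S \<subseteq> verts X \<and> (\<forall>x\<in>S. \<forall>y\<in>S. interval X x y \<subseteq> S)"

definition complete_subgraph :: "'v ugraph \<Rightarrow> 'v set \<Rightarrow> bool" where
  "complete_subgraph X S \<longleftrightarrow> S \<subseteq> verts X \<and> (\<forall>x\<in>S. \<forall>y\<in>S. x \<noteq> y \<longrightarrow> adj X x y)"

definition clique :: "'v ugraph \<Rightarrow> 'v set \<Rightarrow> bool" where
  "clique X C \<longleftrightarrow> complete_subgraph X C \<and>
     (\<forall>D. complete_subgraph X D \<and> C \<subseteq> D \<longrightarrow> D = C) \<and>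
     (\<exists>x\<in>C. \<exists>y\<in>C. adj X x y)"

text \<open>The cycle on the residues modulo \<open>n\<close>; only meaningful for \<open>n \<ge> 3\<close>.\<close>

definition cycle_graph :: "nat \<Rightarrow> nat ugraph" where
  "cycle_graph n = \<lparr>verts = {..<n},
     adj = (\<lambda>i j. i < n \<and> j < n \<and> (j = Suc i mod n \<or> i = Suc j mod n))\<rparr>"

definition convex_even_cycle :: "'v ugraph \<Rightarrow> 'v set \<Rightarrow> bool" where
  "convex_even_cycle X C \<longleftrightarrow> convex_subgraph X C \<and>
     (\<exists>n. 3 \<le> n \<and> even n \<and> induced X C \<cong>\<^sub>g cycle_graph n)"

text \<open>The vertex opposite to \<open>z\<close> in an even cycle is the one at distance half of the length of
  the cycle, the distance being measured along the cycle.\<close>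

definition opposite_vertex :: "'v ugraph \<Rightarrow> 'v set \<Rightarrow> 'v \<Rightarrow> 'v \<Rightarrow> bool" where
  "opposite_vertex X C z w \<longleftrightarrow> z \<in> C \<and> w \<in> C \<and> 2 * gdist (induced X C) z w = card C"

definition K4_minus :: "nat ugraph" where
  "K4_minus = \<lparr>verts = {..<4}, adj = (\<lambda>i j. i < 4 \<and> j < 4 \<and> i \<noteq> j \<and> {i, j} \<noteq> {0, 1})\<rparr>"


section \<open>Mediangle graphs\<close>

definition triangle_condition :: "'v ugraph \<Rightarrow> bool" where
  "triangle_condition X \<longleftrightarrow>
     (\<forall>v\<in>verts X. \<forall>x\<in>verts X. \<forall>y\<in>verts X.
        gdist X v x = gdist X v y \<and> gdist X x y = 1 \<longrightarrow>
        (\<exists>z. adj X x z \<and> adj X y z \<and> z \<in> interval X v x \<inter> interval X v y))"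

definition intersection_of_triangles :: "'v ugraph \<Rightarrow> bool" where
  "intersection_of_triangles X \<longleftrightarrow> \<not> (\<exists>S\<subseteq>verts X. induced X S \<cong>\<^sub>g K4_minus)"

definition cycle_condition :: "'v ugraph \<Rightarrow> bool" where
  "cycle_condition X \<longleftrightarrow>
     (\<forall>v\<in>verts X. \<forall>x\<in>verts X. \<forall>y\<in>verts X. \<forall>z\<in>verts X.
        x \<noteq> y \<and> gdist X v x = gdist X v y \<and> gdist X v z = gdist X v x + 1 \<and>
        gdist X x z = 1 \<and> gdist X y z = 1 \<longrightarrow>
        (\<exists>C. convex_even_cycle X C \<and>
           {{z, x}, {z, y}} \<subseteq> edges (induced X C) \<and>
           (\<exists>w. opposite_vertex X C z w \<and> w \<in> interval X v x \<inter> interval X v y)))"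

definition intersection_of_even_cycles :: "'v ugraph \<Rightarrow> bool" where
  "intersection_of_even_cycles X \<longleftrightarrow>
     (\<forall>C D. convex_even_cycle X C \<and> convex_even_cycle X D \<and> C \<noteq> D \<longrightarrow>
        (\<forall>e\<in>edges (induced X (C \<inter> D)). \<forall>f\<in>edges (induced X (C \<inter> D)). e = f))"

definition mediangle :: "'v ugraph \<Rightarrow> bool" where
  "mediangle X \<longleftrightarrow> simple_graph X \<and> connected_graph X \<and>
     triangle_condition X \<and> intersection_of_triangles X \<and>
     cycle_condition X \<and> intersection_of_even_cycles X"


section \<open>Rotation systems\<close>

definition conjugate :: "('g, 'm) monoid_scheme \<Rightarrow> 'g \<Rightarrow> 'g set \<Rightarrow> 'g set" where
  "conjugate G g H = g <#\<^bsub>G\<^esub> H #>\<^bsub>G\<^esub> inv\<^bsub>G\<^esub> g"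

definition stabilises :: "('g \<Rightarrow> 'v \<Rightarrow> 'v) \<Rightarrow> 'g set \<Rightarrow> 'v set \<Rightarrow> bool" where
  "stabilises \<phi> H C \<longleftrightarrow> (\<forall>h\<in>H. \<phi> h ` C = C)"

definition acts_freely ::
    "('g, 'm) monoid_scheme \<Rightarrow> ('g \<Rightarrow> 'v \<Rightarrow> 'v) \<Rightarrow> 'g set \<Rightarrow> 'v set \<Rightarrow> bool" where
  "acts_freely G \<phi> H C \<longleftrightarrow> (\<forall>h\<in>H. \<forall>x\<in>C. \<phi> h x = x \<longrightarrow> h = \<one>\<^bsub>G\<^esub>)"

definition acts_transitively :: "('g \<Rightarrow> 'v \<Rightarrow> 'v) \<Rightarrow> 'g set \<Rightarrow> 'v set \<Rightarrow> bool" where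
  "acts_transitively \<phi> H C \<longleftrightarrow> (\<forall>x\<in>C. \<forall>y\<in>C. \<exists>h\<in>H. \<phi> h x = y)"

definition is_rotative_stabiliser ::
    "('g, 'm) monoid_scheme \<Rightarrow> ('g \<Rightarrow> 'v \<Rightarrow> 'v) \<Rightarrow> 'g set set \<Rightarrow> 'v set \<Rightarrow> 'g set \<Rightarrow> bool" where
  "is_rotative_stabiliser G \<phi> \<R> C R \<longleftrightarrow> R \<in> \<R> \<and>
     stabilises \<phi> R C \<and> acts_freely G \<phi> R C \<and> acts_transitively \<phi> R C"

text \<open>Only meaningful when the rotative-stabiliser is unique, as it is in a rotation system.\<close>

definition rotative_stabiliser ::
    "('g, 'm) monoid_scheme \<Rightarrow> ('g \<Rightarrow> 'v \<Rightarrow> 'v) \<Rightarrow> 'g set set \<Rightarrow> 'v set \<Rightarrow> 'g set" where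
  "rotative_stabiliser G \<phi> \<R> C = (THE R. is_rotative_stabiliser G \<phi> \<R> C R)"

definition rotative_stabilisers_at ::
    "('g, 'm) monoid_scheme \<Rightarrow> 'v ugraph \<Rightarrow> ('g \<Rightarrow> 'v \<Rightarrow> 'v) \<Rightarrow> 'g set set \<Rightarrow> 'v \<Rightarrow> 'g set set" where
  "rotative_stabilisers_at G X \<phi> \<R> x =
     {rotative_stabiliser G \<phi> \<R> C | C. clique X C \<and> x \<in> C}"

definition rotation_system ::
    "('g, 'm) monoid_scheme \<Rightarrow> 'v ugraph \<Rightarrow> ('g \<Rightarrow> 'v \<Rightarrow> 'v) \<Rightarrow> 'g set set \<Rightarrow> bool" where
  "rotation_system G X \<phi> \<R> \<longleftrightarrow>
     group G \<and> (\<forall>R\<in>\<R>. subgroup R G) \<and>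
     simple_graph X \<and> connected_graph X \<and>
     group_action G (verts X) \<phi> \<and> (\<forall>g\<in>carrier G. graph_iso X X (\<phi> g)) \<and>
     (\<forall>g\<in>carrier G. \<forall>R\<in>\<R>. conjugate G g R \<in> \<R>) \<and>
     generate G (\<Union>\<R>) = carrier G \<and>
     (\<forall>C. clique X C \<longrightarrow> (\<exists>!R. is_rotative_stabiliser G \<phi> \<R> C R)) \<and>
     (\<forall>R\<in>\<R>. \<exists>C. clique X C \<and> rotative_stabiliser G \<phi> \<R> C = R) \<and>
     (\<forall>C. clique X C \<longrightarrow>
        (\<forall>x\<in>C. \<forall>y\<in>C. x \<noteq> y \<longrightarrow>
           \<not> (\<exists>p. walk_betw
                 (delete_edges X
                    (\<Union>{edges (induced X D) | D. clique X D \<and>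
                       rotative_stabiliser G \<phi> \<R> D = rotative_stabiliser G \<phi> \<R> C}))
                 x p y)))"


section \<open>Free products\<close>

text \<open>A letter \<open>(i, a)\<close> stands for the element \<open>a\<close> of the \<open>i\<close>-th factor.  The free product
  consists of the words over these letters, modulo the congruence generated by erasing a letter
  that is trivial and by multiplying two consecutive letters from the same factor.\<close>

definition free_product_words ::
    "'i set \<Rightarrow> ('i \<Rightarrow> ('a, 'm) monoid_scheme) \<Rightarrow> ('i \<times> 'a) list set" where
  "free_product_words I H = lists (SIGMA i:I. carrier (H i))"

inductive free_product_step ::
    "'i set \<Rightarrow> ('i \<Rightarrow> ('a, 'm) monoid_scheme) \<Rightarrow> ('i \<times> 'a) list \<Rightarrow> ('i \<times> 'a) list \<Rightarrow> bool"
  for I H where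
  erase: "\<lbrakk>u \<in> free_product_words I H; v \<in> free_product_words I H; i \<in> I\<rbrakk> \<Longrightarrow>
    free_product_step I H (u @ [(i, \<one>\<^bsub>H i\<^esub>)] @ v) (u @ v)"
| merge: "\<lbrakk>u \<in> free_product_words I H; v \<in> free_product_words I H; i \<in> I;
     a \<in> carrier (H i); b \<in> carrier (H i)\<rbrakk> \<Longrightarrow>
    free_product_step I H (u @ [(i, a), (i, b)] @ v) (u @ [(i, a \<otimes>\<^bsub>H i\<^esub> b)] @ v)"

definition free_product_rel ::
    "'i set \<Rightarrow> ('i \<Rightarrow> ('a, 'm) monoid_scheme) \<Rightarrow> (('i \<times> 'a) list \<times> ('i \<times> 'a) list) set" where
  "free_product_rel I H =
     {(v, w) \<in> free_product_words I H \<times> free_product_words I H.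
        equivclp (free_product_step I H) v w}"

definition free_product_class ::
    "'i set \<Rightarrow> ('i \<Rightarrow> ('a, 'm) monoid_scheme) \<Rightarrow> ('i \<times> 'a) list \<Rightarrow> ('i \<times> 'a) list set" where
  "free_product_class I H w = free_product_rel I H `` {w}"

definition free_product ::
    "'i set \<Rightarrow> ('i \<Rightarrow> ('a, 'm) monoid_scheme) \<Rightarrow> ('i \<times> 'a) list set monoid" where
  "free_product I H =
     \<lparr>carrier = free_product_words I H // free_product_rel I H,
      mult = (\<lambda>A B. \<Union>v\<in>A. \<Union>w\<in>B. free_product_class I H (v @ w)),
      one = free_product_class I H []\<rparr>"


section \<open>Periagroups\<close>

text \<open>The first \<open>k\<close> letters of \<open>ababab\<dots>\<close>.\<close>

fun alternating :: "nat \<Rightarrow> 'a \<Rightarrow> 'a \<Rightarrow> 'a list" where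
  "alternating 0 a b = []"
| "alternating (Suc k) a b = a # alternating k b a"

text \<open>The labelling is a function on unordered pairs; only its values on edges are relevant.\<close>

definition periagroup_data ::
    "'u ugraph \<Rightarrow> ('u set \<Rightarrow> nat) \<Rightarrow> ('u \<Rightarrow> ('a, 'm) monoid_scheme) \<Rightarrow> bool" where
  "periagroup_data \<Gamma> lab H \<longleftrightarrow> simple_graph \<Gamma> \<and>
     (\<forall>u\<in>verts \<Gamma>. group (H u)) \<and>
     (\<forall>e\<in>edges \<Gamma>. 2 \<le> lab e) \<and>
     (\<forall>u v. adj \<Gamma> u v \<and> lab {u, v} > 2 \<longrightarrow> order (H u) = 2 \<and> order (H v) = 2)"

definition normal_closure :: "('g, 'm) monoid_scheme \<Rightarrow> 'g set \<Rightarrow> 'g set" where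
  "normal_closure G S =
     generate G {g \<otimes>\<^bsub>G\<^esub> s \<otimes>\<^bsub>G\<^esub> inv\<^bsub>G\<^esub> g | g s. g \<in> carrier G \<and> s \<in> S}"

definition periagroup_relators ::
    "'u ugraph \<Rightarrow> ('u set \<Rightarrow> nat) \<Rightarrow> ('u \<Rightarrow> ('a, 'm) monoid_scheme) \<Rightarrow> ('u \<times> 'a) list set set" where
  "periagroup_relators \<Gamma> lab H =
     (let F = free_product (verts \<Gamma>) H; cls = free_product_class (verts \<Gamma>) H in
      {cls (alternating (lab {u, v}) (u, a) (v, b)) \<otimes>\<^bsub>F\<^esub>
         inv\<^bsub>F\<^esub> (cls (alternating (lab {u, v}) (v, b) (u, a))) | u v a b.
         adj \<Gamma> u v \<and> a \<in> carrier (H u) - {\<one>\<^bsub>H u\<^esub>} \<and> b \<in> carrier (H v) - {\<one>\<^bsub>H v\<^esub>}})"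

definition periagroup_kernel ::
    "'u ugraph \<Rightarrow> ('u set \<Rightarrow> nat) \<Rightarrow> ('u \<Rightarrow> ('a, 'm) monoid_scheme) \<Rightarrow> ('u \<times> 'a) list set set" where
  "periagroup_kernel \<Gamma> lab H =
     normal_closure (free_product (verts \<Gamma>) H) (periagroup_relators \<Gamma> lab H)"

definition periagroup ::
    "'u ugraph \<Rightarrow> ('u set \<Rightarrow> nat) \<Rightarrow> ('u \<Rightarrow> ('a, 'm) monoid_scheme) \<Rightarrow>
     ('u \<times> 'a) list set set monoid" where
  "periagroup \<Gamma> lab H = free_product (verts \<Gamma>) H Mod periagroup_kernel \<Gamma> lab H"

definition periagroup_inj ::
    "'u ugraph \<Rightarrow> ('u set \<Rightarrow> nat) \<Rightarrow> ('u \<Rightarrow> ('a, 'm) monoid_scheme) \<Rightarrow>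
     'u \<Rightarrow> 'a \<Rightarrow> ('u \<times> 'a) list set set" where
  "periagroup_inj \<Gamma> lab H u a =
     periagroup_kernel \<Gamma> lab H #>\<^bsub>free_product (verts \<Gamma>) H\<^esub>
       free_product_class (verts \<Gamma>) H [(u, a)]"


section \<open>Bases and Cayley graphs\<close>

definition as_group :: "('g, 'm) monoid_scheme \<Rightarrow> 'g set \<Rightarrow> ('g, 'm) monoid_scheme" where
  "as_group G A = G\<lparr>carrier := A\<rparr>"

text \<open>The canonical map from the free product of subgroups of \<open>G\<close> to \<open>G\<close> evaluates a word in
  \<open>G\<close>; all words of a class have the same value.\<close>

definition eval_word :: "('g, 'm) monoid_scheme \<Rightarrow> ('g set \<times> 'g) list \<Rightarrow> 'g" where
  "eval_word G w = foldr (\<lambda>(A, a) x. a \<otimes>\<^bsub>G\<^esub> x) w \<one>\<^bsub>G\<^esub>"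

definition canonical_map :: "('g, 'm) monoid_scheme \<Rightarrow> ('g set \<times> 'g) list set \<Rightarrow> 'g" where
  "canonical_map G c = the_elem (eval_word G ` c)"

definition basis_graph :: "('g, 'm) monoid_scheme \<Rightarrow> 'g set set \<Rightarrow> 'g set ugraph" where
  "basis_graph G \<B> = \<lparr>verts = \<B>,
     adj = (\<lambda>A B. A \<in> \<B> \<and> B \<in> \<B> \<and> A \<noteq> B \<and>
       canonical_map G \<notin> iso (free_product {A, B} (as_group G)) (subgroup_generated G (A \<union> B)))\<rparr>"

definition periagroup_with_basis :: "('g, 'm) monoid_scheme \<Rightarrow> 'g set set \<Rightarrow> bool" where
  "periagroup_with_basis G \<B> \<longleftrightarrow> group G \<and>
     (\<forall>B\<in>\<B>. subgroup B G \<and> B \<noteq> {\<one>\<^bsub>G\<^esub>}) \<and>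
     (\<exists>lab. periagroup_data (basis_graph G \<B>) lab (as_group G) \<and>
        (\<exists>h \<in> iso (periagroup (basis_graph G \<B>) lab (as_group G)) G.
           \<forall>B\<in>\<B>. \<forall>b\<in>B. h (periagroup_inj (basis_graph G \<B>) lab (as_group G) B b) = b))"

definition Cayl :: "('g, 'm) monoid_scheme \<Rightarrow> 'g set set \<Rightarrow> 'g ugraph" where
  "Cayl G \<B> = \<lparr>verts = carrier G,
     adj = (\<lambda>g h. g \<in> carrier G \<and> (\<exists>s \<in> \<Union>\<B> - {\<one>\<^bsub>G\<^esub>}. h = g \<otimes>\<^bsub>G\<^esub> s))\<rparr>"

definition left_mult :: "('g, 'm) monoid_scheme \<Rightarrow> 'g \<Rightarrow> 'g \<Rightarrow> 'g" where
  "left_mult G g = (\<lambda>h\<in>carrier G. g \<otimes>\<^bsub>G\<^esub> h)"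

end

theory Submission
  imports Defs
begin

text \<open>
  Both notions are compared with a third one, a basis with gates: every basis subgroup \<open>B\<close> carries a
  left \<open>B\<close>-equivariant map \<open>gate B\<close> from \<open>G\<close> to \<open>B\<close> which is constant along each edge of the Cayley
  graph that does not cross the wall \<open>B\<close>.  For a rotation system, \<open>gate B g\<close> is the unique \<open>b\<close> in \<open>B\<close>
  such that the vertices of \<open>b\<close> and \<open>g\<close> are not separated by the wall \<open>B\<close>.  For a periagroup, it is
  read off an action of \<open>G\<close> on sectors, in the way the root system of a Coxeter group is constructed
  from its presentation.

  Gates imply the exchange condition: a word is geodesic if and only if it crosses pairwise distinct
  walls, and a repeated wall allows one to merge two letters.  If two geodesic alternating words in
  \<open>A\<close> and \<open>B\<close> have the same value but start in different factors, exchange forces each of them,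
  without its last letter, to be the other one without its first letter; hence both alternate between the
  same two letters, the braid relation holds for all pairs of letters, and \<open>A\<close>, \<open>B\<close> have order two
  unless the length is two.  As in Matsumoto's theorem this yields the periagroup presentation, and
  the resulting dihedral subgroups and squares are the convex even cycles of the Cayley graph.
\<close>

section \<open>Words, walls and gates\<close>

text \<open>In a Coxeter group a wall has two sides and a repeated crossing cancels. Here the wall
  \<open>B\<close> has one side for each element of \<open>B\<close>, and \<open>B\<close> may have
  any order, so a sign is not enough: the gate records the side as an element of \<open>B\<close>,
  and a letter pulled to the front by exchange is merged with the first letter instead of cancelling
  it.

  Adjacency in the basis graph only says that a free product fails, and no length of a braid
  relation comes with it. The length is extracted from an alternating word that is not geodesic
  although its tail is. In the converse direction, the labels of the presentation are not known
  beforehand to be the lengths of shortest relations, so the action on sectors has to respect each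
  relator without any knowledge of whether the walls met along it are distinct.

  The intersection property of even cycles needs a cycle condition stronger than the axiom: the
  cycle must depend only on its two given edges, and not on the vertex from which distances are
  measured.\<close>

context group
begin

lemma inv_mult_cancel [simp]:
  assumes "x \<in> carrier G" "y \<in> carrier G"
  shows "inv x \<otimes> (x \<otimes> y) = y" "x \<otimes> (inv x \<otimes> y) = y"
  using assms by (simp_all flip: m_assoc)

lemma conjugate_eq:
  assumes "H \<subseteq> carrier G" "g \<in> carrier G"
  shows "conjugate G g H = (\<lambda>x. g \<otimes> x \<otimes> inv g) ` H"
  by (auto simp: conjugate_def l_coset_def r_coset_def)

lemma conjugate_subset:
  assumes "H \<subseteq> carrier G" "g \<in> carrier G"
  shows "conjugate G g H \<subseteq> carrier G"
  using assms by (auto simp: conjugate_eq)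

lemma conjugate_mult:
  assumes "H \<subseteq> carrier G" "g \<in> carrier G" "h \<in> carrier G"
  shows "conjugate G g (conjugate G h H) = conjugate G (g \<otimes> h) H"
proof -
  have "conjugate G g (conjugate G h H) = (\<lambda>x. g \<otimes> (h \<otimes> x \<otimes> inv h) \<otimes> inv g) ` H"
    using assms conjugate_subset[of H h] by (subst conjugate_eq) (auto simp: conjugate_eq)
  also have "\<dots> = (\<lambda>x. (g \<otimes> h) \<otimes> x \<otimes> inv (g \<otimes> h)) ` H"
    using assms by (intro image_cong) (auto simp: m_assoc inv_mult_group)
  also have "\<dots> = conjugate G (g \<otimes> h) H"
    using assms by (simp add: conjugate_eq)
  finally show ?thesis .
qed

lemma conjugate_one [simp]:
  assumes "H \<subseteq> carrier G"
  shows "conjugate G \<one> H = H"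
  using assms by (force simp: conjugate_eq subset_iff image_iff)

lemma conjugate_self:
  assumes "subgroup H G" "b \<in> H"
  shows "conjugate G b H = H"
proof -
  interpret H: subgroup H G by fact
  have b: "b \<in> carrier G" using assms by simp
  have "x \<in> (\<lambda>x. b \<otimes> x \<otimes> inv b) ` H" if x: "x \<in> H" for x
  proof (rule image_eqI)
    show "inv b \<otimes> x \<otimes> b \<in> H"
      using assms x by simp
    show "x = b \<otimes> (inv b \<otimes> x \<otimes> b) \<otimes> inv b"
      using b H.mem_carrier[OF x] by (simp add: m_assoc)
  qed
  moreover have "(\<lambda>x. b \<otimes> x \<otimes> inv b) ` H \<subseteq> H"
    using assms by (intro image_subsetI) simp
  ultimately show ?thesis
    using conjugate_eq[OF H.subset b] by blast
qed

lemma conjugate_eq_iff: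
  assumes "H \<subseteq> carrier G" "K \<subseteq> carrier G" "g \<in> carrier G"
  shows "conjugate G g H = K \<longleftrightarrow> H = conjugate G (inv g) K"
  using assms by (auto simp: conjugate_mult)

lemma mem_conjugate_iff:
  assumes "H \<subseteq> carrier G" "g \<in> carrier G" "x \<in> carrier G"
  shows "x \<in> conjugate G g H \<longleftrightarrow> inv g \<otimes> x \<otimes> g \<in> H"
proof
  assume "inv g \<otimes> x \<otimes> g \<in> H"
  thus "x \<in> conjugate G g H"
    using assms by (auto simp: conjugate_eq image_iff m_assoc intro!: bexI[of _ "inv g \<otimes> x \<otimes> g"])
qed (use assms in \<open>auto simp: conjugate_eq m_assoc subset_iff\<close>)

lemma subgroup_conjugate:
  assumes "subgroup H G" "g \<in> carrier G"
  shows "subgroup (conjugate G g H) G"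
proof -
  interpret H: subgroup H G by fact
  show ?thesis
  proof (rule subgroupI)
    show "conjugate G g H \<subseteq> carrier G"
      using assms H.subset by (simp add: conjugate_subset)
    show "conjugate G g H \<noteq> {}"
      using assms H.one_closed H.subset by (metis conjugate_eq empty_iff image_is_empty)
    fix a assume "a \<in> conjugate G g H"
    then obtain h where h: "h \<in> H" "a = g \<otimes> h \<otimes> inv g"
      using assms H.subset by (auto simp: conjugate_eq)
    hence "inv a = g \<otimes> inv h \<otimes> inv g"
      using assms by (simp add: inv_mult_group m_assoc)
    thus "inv a \<in> conjugate G g H"
      using assms h H.subset by (auto simp: conjugate_eq)
    fix b assume "b \<in> conjugate G g H"
    then obtain k where k: "k \<in> H" "b = g \<otimes> k \<otimes> inv g"
      using assms H.subset by (auto simp: conjugate_eq)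
    hence "a \<otimes> b = g \<otimes> (h \<otimes> k) \<otimes> inv g"
      using assms h by (simp add: inv_mult_group m_assoc)
    thus "a \<otimes> b \<in> conjugate G g H"
      using assms h k H.subset by (auto simp: conjugate_eq)
  qed
qed

definition prod_word :: "'a list \<Rightarrow> 'a"
  where "prod_word w = foldr (\<otimes>) w \<one>"

lemma prod_word_simps [simp]: "prod_word [] = \<one>" "prod_word (x # w) = x \<otimes> prod_word w"
  by (simp_all add: prod_word_def)

lemma prod_word_closed [simp, intro]: "set w \<subseteq> carrier G \<Longrightarrow> prod_word w \<in> carrier G"
  by (induction w) auto

lemma prod_word_append [simp]:
  "set v \<subseteq> carrier G \<Longrightarrow> set w \<subseteq> carrier G \<Longrightarrow>
    prod_word (v @ w) = prod_word v \<otimes> prod_word w"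
  by (induction v) (auto simp: m_assoc)

lemma prod_word_rev_inv:
  "set w \<subseteq> carrier G \<Longrightarrow> prod_word (rev (map (m_inv G) w)) = inv (prod_word w)"
proof (induction w)
  case (Cons a w)
  have "set (rev (map (m_inv G) w)) \<subseteq> carrier G" using Cons.prems by auto
  thus ?case using Cons by (simp add: inv_mult_group)
qed simp

end

text \<open>The last assumption carries the geometry: the edge from \<open>g\<close> to
  \<open>g \<otimes> s\<close> crosses the wall coded by the conjugate of \<open>D\<close> by
  \<open>g\<close>, and only a crossing of \<open>B\<close> may change \<open>gate B\<close>. Gates
  are given for walls at the neutral element; the side of \<open>x\<close> with respect to the
  conjugate of \<open>B\<close> by \<open>g\<close> is read off as
  \<open>gate B (inv g \<otimes> x)\<close>.\<close>

locale gated_basis = group G for G (structure) +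
  fixes \<B> :: "'a set set" and gate :: "'a set \<Rightarrow> 'a \<Rightarrow> 'a"
  assumes subgroup_basis: "B \<in> \<B> \<Longrightarrow> subgroup B G"
    and basis_nontrivial: "B \<in> \<B> \<Longrightarrow> B \<noteq> {\<one>}"
    and basis_generates: "generate G (\<Union>\<B>) = carrier G"
    and gate_mem: "B \<in> \<B> \<Longrightarrow> g \<in> carrier G \<Longrightarrow> gate B g \<in> B"
    and gate_one: "B \<in> \<B> \<Longrightarrow> gate B \<one> = \<one>"
    and gate_mult: "B \<in> \<B> \<Longrightarrow> b \<in> B \<Longrightarrow> g \<in> carrier G \<Longrightarrow> gate B (b \<otimes> g) = b \<otimes> gate B g"
    and gate_step: "B \<in> \<B> \<Longrightarrow> D \<in> \<B> \<Longrightarrow> s \<in> D \<Longrightarrow> g \<in> carrier G \<Longrightarrow> conjugate G g D \<noteq> B \<Longrightarrow>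
       gate B (g \<otimes> s) = gate B g"
begin

definition letters :: "'a set set \<Rightarrow> 'a set"
  where "letters J = \<Union>J - {\<one>}"

lemma basis_subset: "B \<in> \<B> \<Longrightarrow> B \<subseteq> carrier G"
  by (rule subgroup.subset[OF subgroup_basis])

lemma basis_carrier: "B \<in> \<B> \<Longrightarrow> b \<in> B \<Longrightarrow> b \<in> carrier G"
  using basis_subset by blast

lemma basis_one [simp]: "B \<in> \<B> \<Longrightarrow> \<one> \<in> B"
  by (rule subgroup.one_closed[OF subgroup_basis])

lemma basis_mult: "B \<in> \<B> \<Longrightarrow> a \<in> B \<Longrightarrow> b \<in> B \<Longrightarrow> a \<otimes> b \<in> B"
  by (rule subgroup.m_closed[OF subgroup_basis])

lemma basis_inv: "B \<in> \<B> \<Longrightarrow> a \<in> B \<Longrightarrow> inv a \<in> B"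
  by (rule subgroup.m_inv_closed[OF subgroup_basis])

lemma letters_mono: "J \<subseteq> K \<Longrightarrow> letters J \<subseteq> letters K"
  unfolding letters_def by blast

lemma letters_carrier: "letters \<B> \<subseteq> carrier G"
  unfolding letters_def using basis_carrier by blast

lemma letterI: "B \<in> J \<Longrightarrow> s \<in> B \<Longrightarrow> s \<noteq> \<one> \<Longrightarrow> s \<in> letters J"
  by (auto simp: letters_def)

lemma letterE:
  assumes "s \<in> letters J"
  obtains B where "B \<in> J" "s \<in> B" "s \<noteq> \<one>"
  using assms by (auto simp: letters_def)

lemma one_not_letter [simp]: "\<one> \<notin> letters J"
  by (simp add: letters_def)

lemma word_carrier: "set w \<subseteq> letters \<B> \<Longrightarrow> set w \<subseteq> carrier G"
  using letters_carrier by blast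

lemma conjugate_basis_self: "B \<in> \<B> \<Longrightarrow> b \<in> B \<Longrightarrow> conjugate G b B = B"
  by (rule conjugate_self[OF subgroup_basis])

lemma gate_self: "B \<in> \<B> \<Longrightarrow> b \<in> B \<Longrightarrow> gate B b = b"
  using gate_mult[of B b \<one>] basis_carrier[of B b] by (simp add: gate_one)

text \<open>If \<open>s\<close> lay in both, the edge from the neutral element to \<open>s\<close>
  would cross the wall \<open>B\<close> only, so \<open>gate A\<close> could not move along it,
  although \<open>gate A s = s\<close>.\<close>

lemma basis_disjoint:
  assumes "A \<in> \<B>" "B \<in> \<B>" "s \<in> A" "s \<in> B" "s \<noteq> \<one>"
  shows "A = B"
proof (rule ccontr)
  assume "A \<noteq> B"
  hence "gate A (\<one> \<otimes> s) = gate A \<one>"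
    using assms basis_subset[of B] by (intro gate_step[of A B]) auto
  thus False
    using assms gate_self[of A s] basis_carrier[of A s] by (simp add: gate_one)
qed

definition base :: "'a \<Rightarrow> 'a set"
  where "base s = (THE B. B \<in> \<B> \<and> s \<in> B)"

lemma base_eq: "B \<in> \<B> \<Longrightarrow> s \<in> B \<Longrightarrow> s \<noteq> \<one> \<Longrightarrow> base s = B"
  unfolding base_def by (rule the_equality) (use basis_disjoint in metis)+

lemma base_mem:
  assumes "s \<in> letters J" "J \<subseteq> \<B>"
  shows "base s \<in> J \<and> s \<in> base s"
proof -
  obtain B where "B \<in> J" "s \<in> B" "s \<noteq> \<one>" using assms(1) by (rule letterE)
  thus ?thesis using base_eq[of B s] assms by auto
qed

lemma base_mem': "s \<in> letters \<B> \<Longrightarrow> base s \<in> \<B> \<and> s \<in> base s"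
  by (rule base_mem) auto

lemma base_subset: "s \<in> letters \<B> \<Longrightarrow> base s \<subseteq> carrier G"
  using base_mem' basis_subset by blast

text \<open>These are the walls met by the path through the prefixes of the word, in order and with
  multiplicity. After the first letter, the rest of the path is a translate by \<open>s\<close> of a
  path starting at the neutral element.\<close>

primrec walls :: "'a list \<Rightarrow> 'a set list" where
  "walls [] = []"
| "walls (s # w) = base s # map (conjugate G s) (walls w)"

lemma length_walls [simp]: "length (walls w) = length w"
  by (induction w) auto

lemma walls_subset:
  "set w \<subseteq> letters \<B> \<Longrightarrow> R \<in> set (walls w) \<Longrightarrow> R \<subseteq> carrier G"
proof (induction w arbitrary: R)
  case (Cons s w)
  hence s: "s \<in> letters \<B>" "s \<in> carrier G" using letters_carrier by auto
  show ?case
  proof (cases "R = base s")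
    case False
    then obtain R' where "R' \<in> set (walls w)" "R = conjugate G s R'"
      using Cons.prems by auto
    thus ?thesis using Cons.IH Cons.prems s conjugate_subset by simp
  qed (use base_subset[OF s(1)] in simp)
qed auto

lemma walls_append:
  assumes "set v \<subseteq> letters \<B>" "set w \<subseteq> letters \<B>"
  shows "walls (v @ w) = walls v @ map (conjugate G (prod_word v)) (walls w)"
  using assms(1)
proof (induction v)
  case Nil
  show ?case
    using walls_subset[OF assms(2)] by (simp add: map_idI)
next
  case (Cons s v)
  have "conjugate G s (conjugate G (prod_word v) R) = conjugate G (s \<otimes> prod_word v) R"
    if "R \<in> set (walls w)" for R
    using that walls_subset[OF assms(2) that] letters_carrier word_carrier[of v] Cons.prems
    by (intro conjugate_mult) auto
  thus ?case using Cons by simp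
qed

lemma gate_avoid:
  assumes "B \<in> \<B>" "g \<in> carrier G" "set w \<subseteq> letters \<B>" "B \<notin> conjugate G g ` set (walls w)"
  shows "gate B (g \<otimes> prod_word w) = gate B g"
  using assms(2-)
proof (induction w arbitrary: g)
  case (Cons s w)
  have s: "s \<in> carrier G" "base s \<in> \<B>" "s \<in> base s"
    using Cons.prems letters_carrier base_mem'[of s] by auto
  have w: "set w \<subseteq> letters \<B>" "prod_word w \<in> carrier G"
    using Cons.prems word_carrier[of w] by auto
  have "conjugate G (g \<otimes> s) R = conjugate G g (conjugate G s R)" if "R \<in> set (walls w)" for R
    using walls_subset[OF w(1) that] s Cons.prems by (simp add: conjugate_mult)
  hence "B \<notin> conjugate G (g \<otimes> s) ` set (walls w)"
    using Cons.prems by auto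
  hence "gate B ((g \<otimes> s) \<otimes> prod_word w) = gate B (g \<otimes> s)"
    using Cons.prems s w by (intro Cons.IH) auto
  also have "\<dots> = gate B g"
    using Cons.prems s assms(1) by (intro gate_step[of B "base s"]) auto
  finally show ?case
    using Cons.prems s w by (simp add: m_assoc)
qed auto

text \<open>Distinct walls rather than minimal length: this form can be checked letter by letter.
  \<open>reduced_iff_len\<close> shows that the two notions agree.\<close>

definition reduced :: "'a list \<Rightarrow> bool"
  where "reduced w \<longleftrightarrow> set w \<subseteq> letters \<B> \<and> distinct (walls w)"

lemma reduced_letters: "reduced w \<Longrightarrow> set w \<subseteq> letters \<B>"
  by (simp add: reduced_def)

lemma conjugate_walls_iff:
  assumes "set w \<subseteq> letters \<B>" "B \<in> \<B>" "b \<in> B"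
  shows "B \<in> conjugate G b ` set (walls w) \<longleftrightarrow> B \<in> set (walls w)"
proof -
  have "B = conjugate G b R \<longleftrightarrow> R = B" if "R \<in> set (walls w)" for R
  proof -
    have "conjugate G (inv b) B = B"
      using assms basis_inv conjugate_basis_self by blast
    thus ?thesis
      using conjugate_eq_iff[of R B b] walls_subset[OF assms(1) that] assms basis_subset[of B]
        basis_carrier[of B b] by metis
  qed
  thus ?thesis unfolding image_iff by simp
qed

lemma inj_conjugate_walls:
  assumes "set w \<subseteq> letters \<B>" "g \<in> carrier G"
  shows "inj_on (conjugate G g) (set (walls w))"
proof (rule inj_onI)
  fix R S assume RS: "R \<in> set (walls w)" "S \<in> set (walls w)" "conjugate G g R = conjugate G g S"
  hence "conjugate G (inv g) (conjugate G g R) = conjugate G (inv g) (conjugate G g S)"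
    by simp
  moreover have "conjugate G (inv g) (conjugate G g T) = T" if "T \<in> set (walls w)" for T
    using walls_subset[OF assms(1) that] assms by (simp add: conjugate_mult)
  ultimately show "R = S"
    using RS(1,2) by metis
qed

text \<open>\<open>s\<close> normalises \<open>base s\<close>, so translating the walls of
  \<open>w\<close> by \<open>s\<close> neither creates nor removes an occurrence of
  \<open>base s\<close>; otherwise the translation is injective.\<close>

lemma reduced_Cons:
  "reduced (s # w) \<longleftrightarrow> s \<in> letters \<B> \<and> reduced w \<and> base s \<notin> set (walls w)"
proof (cases "s \<in> letters \<B> \<and> set w \<subseteq> letters \<B>")
  case True
  have "inj_on (conjugate G s) (set (walls w))"
    using inj_conjugate_walls[of w s] True letters_carrier by blast
  moreover have "base s \<in> conjugate G s ` set (walls w) \<longleftrightarrow> base s \<in> set (walls w)"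
    using conjugate_walls_iff[of w "base s" s] base_mem'[of s] True by blast
  ultimately show ?thesis
    using True by (simp add: reduced_def distinct_map) blast
qed (auto simp: reduced_def)

lemma reduced_append:
  assumes "reduced (v @ w)"
  shows "reduced v" "reduced w"
proof -
  have "reduced v \<and> reduced w"
    using assms
  proof (induction v)
    case (Cons s v)
    hence "set (v @ w) \<subseteq> letters \<B>" by (simp add: reduced_Cons reduced_def)
    thus ?case using Cons by (simp add: reduced_Cons walls_append)
  qed (simp add: reduced_def)
  thus "reduced v" "reduced w" by auto
qed

text \<open>Conjugating the letter that crosses \<open>B\<close> by the prefix before it gives an
  element \<open>\<rho>\<close> of \<open>B\<close>, and pulling \<open>\<rho>\<close> to the front
  deletes the letter. If the word is reduced, the shortened word no longer crosses \<open>B\<close>,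
  so its gate is trivial and \<open>\<rho>\<close> is the gate of the whole.\<close>

lemma exchange:
  assumes "set w \<subseteq> letters \<B>" "B \<in> set (walls w)" "B \<in> \<B>"
  obtains u t v \<rho> where "w = u @ t # v" "conjugate G (prod_word u) (base t) = B"
    "\<rho> = prod_word u \<otimes> t \<otimes> inv (prod_word u)" "\<rho> \<in> B" "\<rho> \<noteq> \<one>"
    "prod_word w = \<rho> \<otimes> prod_word (u @ v)" "reduced w \<Longrightarrow> gate B (prod_word w) = \<rho>"
proof -
  obtain i where i: "i < length w" "walls w ! i = B"
    using assms(2) by (auto simp: in_set_conv_nth)
  define u t v where "u = take i w" and "t = w ! i" and "v = drop (Suc i) w"
  have w: "w = u @ t # v"
    unfolding u_def t_def v_def using i by (simp add: id_take_nth_drop)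
  have l: "set u \<subseteq> letters \<B>" "t \<in> letters \<B>" "set v \<subseteq> letters \<B>"
    using assms(1) w by auto
  have c: "t \<in> carrier G" "set u \<subseteq> carrier G" "set v \<subseteq> carrier G"
    using l letters_carrier by auto
  have W: "walls w = walls u @ conjugate G (prod_word u) (base t) #
      map (conjugate G (prod_word u)) (map (conjugate G t) (walls v))"
  proof -
    have "walls (u @ t # v) = walls u @ map (conjugate G (prod_word u)) (walls (t # v))"
      by (rule walls_append) (use l in auto)
    thus ?thesis by (simp only: w walls.simps list.map)
  qed
  have B: "conjugate G (prod_word u) (base t) = B"
  proof -
    have "length u = i" using i by (simp add: u_def)
    thus ?thesis using i(2) W by (simp add: nth_append)
  qed
  define \<rho> where "\<rho> = prod_word u \<otimes> t \<otimes> inv (prod_word u)"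
  have \<rho>c: "\<rho> \<in> carrier G" using c by (auto simp: \<rho>_def)
  have \<rho>: "\<rho> \<in> B"
    using B c base_mem'[OF l(2)] base_subset[OF l(2)] by (auto simp: \<rho>_def conjugate_eq)
  have eq: "prod_word w = \<rho> \<otimes> prod_word (u @ v)"
    using c by (simp add: w \<rho>_def m_assoc)
  have "\<rho> \<noteq> \<one>"
  proof
    assume "\<rho> = \<one>"
    hence "inv (prod_word u) \<otimes> \<rho> \<otimes> prod_word u = \<one>" using c by simp
    thus False using c l by (simp add: \<rho>_def m_assoc)
  qed
  moreover have "gate B (prod_word w) = \<rho>" if "reduced w"
  proof -
    have d: "distinct (walls w)" using that by (simp add: reduced_def)
    have uv: "walls (u @ v) = walls u @ map (conjugate G (prod_word u)) (walls v)"
      using l by (simp add: walls_append)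
    \<comment> \<open>Without \<open>t\<close>, the walls of \<open>v\<close> are translated by
      \<open>prod_word u\<close> instead of \<open>prod_word u \<otimes> t\<close>. The two
      translations differ by \<open>\<rho>\<close>, which normalises \<open>B\<close>, so an
      occurrence of \<open>B\<close> among them would be a second occurrence of \<open>B\<close> in
      \<open>w\<close>.\<close>
    have "B \<notin> set (walls (u @ v))"
    proof
      assume "B \<in> set (walls (u @ v))"
      moreover have "B \<notin> set (walls u)" using d W B by auto
      ultimately obtain R where R: "R \<in> set (walls v)" "B = conjugate G (prod_word u) R"
        using uv by auto
      have Rc: "R \<subseteq> carrier G" using R l walls_subset by blast
      have "conjugate G \<rho> B = conjugate G (prod_word u \<otimes> t) R"
        using R Rc c \<rho>c by (simp add: conjugate_mult \<rho>_def m_assoc)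
      hence "B = conjugate G (prod_word u) (conjugate G t R)"
        using conjugate_basis_self[OF assms(3) \<rho>] Rc c by (simp add: conjugate_mult)
      thus False using d W B R by auto
    qed
    hence "gate B (\<one> \<otimes> prod_word (u @ v)) = gate B \<one>"
      using assms(3) l walls_subset[of "u @ v"] by (intro gate_avoid) (auto simp: image_iff)
    thus ?thesis
      using eq \<rho> c assms(3) \<rho>c by (simp add: gate_mult gate_one del: prod_word_append)
  qed
  ultimately show thesis
    using that[OF w B \<rho>_def \<rho> _ eq] by blast
qed

text \<open>If the wall of the first letter \<open>s\<close> is met again by the reduced rest, the
  element pulled out by exchange lies in \<open>base s\<close> and is absorbed by \<open>s\<close>.
  The merged letter stays in the same factor, so the shorter word is again a word over
  \<open>J\<close>.\<close>

lemma deletion: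
  assumes "J \<subseteq> \<B>" "set w \<subseteq> letters J" "\<not> distinct (walls w)"
  shows "\<exists>w'. set w' \<subseteq> letters J \<and> prod_word w' = prod_word w \<and> length w' < length w"
  using assms(2,3)
proof (induction w)
  case (Cons s w)
  have lJ: "letters J \<subseteq> letters \<B>" using assms(1) by (rule letters_mono)
  have w: "set w \<subseteq> letters \<B>" and s: "s \<in> letters \<B>" and wJ: "set w \<subseteq> letters J" and sJ: "s \<in> letters J"
    using lJ Cons.prems(1) by auto
  have sc: "s \<in> carrier G" "base s \<in> J" "base s \<in> \<B>" "s \<in> base s"
    using s letters_carrier base_mem[OF sJ assms(1)] assms(1) by auto
  show ?case
  proof (cases "distinct (walls w)")
    case True
    hence "reduced w" using w by (simp add: reduced_def)
    moreover have "\<not> reduced (s # w)"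
      using Cons.prems(2) by (simp only: reduced_def simp_thms)
    ultimately have "base s \<in> set (walls w)"
      using s by (simp only: reduced_Cons) simp
    then obtain u t v \<rho> where uv: "w = u @ t # v" "\<rho> \<in> base s" "prod_word w = \<rho> \<otimes> prod_word (u @ v)"
      using exchange[OF w _ sc(3)] by metis
    have c: "prod_word (u @ v) \<in> carrier G" "\<rho> \<in> carrier G"
      using word_carrier[OF w] uv basis_carrier[OF sc(3)] by auto
    have eq: "prod_word (s # w) = (s \<otimes> \<rho>) \<otimes> prod_word (u @ v)"
      using c sc uv(3) by (simp add: m_assoc del: prod_word_append)
    show ?thesis
    proof (cases "s \<otimes> \<rho> = \<one>")
      case True
      hence "prod_word (u @ v) = prod_word (s # w)" using eq c by simp
      moreover have "set (u @ v) \<subseteq> letters J" "length (u @ v) < length (s # w)"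
        using uv(1) wJ by auto
      ultimately show ?thesis by blast
    next
      case False
      have "s \<otimes> \<rho> \<in> letters J"
        using False basis_mult[OF sc(3,4) uv(2)] sc(2) letterI by blast
      hence "set ((s \<otimes> \<rho>) # u @ v) \<subseteq> letters J" "length ((s \<otimes> \<rho>) # u @ v) < length (s # w)"
        using uv(1) wJ by auto
      moreover have "prod_word ((s \<otimes> \<rho>) # u @ v) = prod_word (s # w)" using eq by simp
      ultimately show ?thesis by blast
    qed
  next
    case False
    then obtain w' where "set w' \<subseteq> letters J" "prod_word w' = prod_word w" "length w' < length w"
      using Cons.IH wJ by blast
    hence "set (s # w') \<subseteq> letters J" "prod_word (s # w') = prod_word (s # w)"
      "length (s # w') < length (s # w)" using sJ by auto
    thus ?thesis by blast
  qed
qed simp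

lemma reduced_word:
  assumes "J \<subseteq> \<B>" "set w \<subseteq> letters J"
  shows "\<exists>w'. set w' \<subseteq> letters J \<and> reduced w' \<and> prod_word w' = prod_word w \<and> length w' \<le> length w"
  using assms(2)
proof (induction w rule: measure_induct_rule[of length])
  case (less w)
  show ?case
  proof (cases "distinct (walls w)")
    case True
    hence "reduced w" using less.prems letters_mono[OF assms(1)] by (auto simp only: reduced_def)
    thus ?thesis using less.prems by blast
  next
    case False
    then obtain w' where "set w' \<subseteq> letters J" "prod_word w' = prod_word w" "length w' < length w"
      using deletion[OF assms(1) less.prems] by blast
    thus ?thesis using less.IH[of w'] by (metis less_imp_le_nat order_trans)
  qed
qed

lemma generate_word:
  assumes "J \<subseteq> \<B>" "p \<in> generate G (\<Union>J)"
  shows "\<exists>w. set w \<subseteq> letters J \<and> prod_word w = p"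
  using assms(2)
proof (induction p rule: generate.induct)
  case one
  show ?case by (rule exI[of _ "[]"]) simp
next
  case (incl h)
  show ?case
  proof (cases "h = \<one>")
    case False
    thus ?thesis using incl assms(1) basis_carrier by (intro exI[of _ "[h]"]) (auto simp: letters_def)
  qed (intro exI[of _ "[]"], simp)
next
  case (inv h)
  then obtain B where B: "B \<in> J" "h \<in> B" by blast
  hence h: "inv h \<in> B" "inv h \<in> carrier G"
    using assms(1) basis_inv[of B h] basis_carrier[of B h] by auto
  show ?case
  proof (cases "inv h = \<one>")
    case False
    thus ?thesis using h B by (intro exI[of _ "[inv h]"]) (auto simp: letters_def)
  qed (intro exI[of _ "[]"], simp)
next
  case (eng h1 h2)
  then obtain w1 w2 where w: "set w1 \<subseteq> letters J" "prod_word w1 = h1" "set w2 \<subseteq> letters J" "prod_word w2 = h2"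
    by blast
  hence "set w1 \<subseteq> carrier G" "set w2 \<subseteq> carrier G"
    using letters_mono[OF assms(1)] letters_carrier by (meson subset_trans)+
  thus ?case using w by (intro exI[of _ "w1 @ w2"]) simp
qed

lemma generate_reduced_word:
  assumes "J \<subseteq> \<B>" "p \<in> generate G (\<Union>J)"
  obtains w where "set w \<subseteq> letters J" "reduced w" "prod_word w = p"
  using generate_word[OF assms] reduced_word[OF assms(1)] by metis

lemma carrier_reduced_word:
  assumes "g \<in> carrier G"
  obtains w where "reduced w" "prod_word w = g"
  using generate_reduced_word[of \<B> g] assms basis_generates by auto

lemma gate_not_wall:
  assumes "B \<in> \<B>" "set w \<subseteq> letters \<B>" "B \<notin> set (walls w)"
  shows "gate B (prod_word w) = \<one>"
proof -
  have "conjugate G \<one> ` set (walls w) = set (walls w)"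
    using walls_subset[OF assms(2)] by (force simp: image_iff)
  hence "gate B (\<one> \<otimes> prod_word w) = gate B \<one>"
    using assms by (intro gate_avoid) auto
  thus ?thesis using assms word_carrier[OF assms(2)] by (simp add: gate_one)
qed

lemma gate_eq_one_iff:
  assumes "B \<in> \<B>" "reduced w"
  shows "gate B (prod_word w) = \<one> \<longleftrightarrow> B \<notin> set (walls w)"
proof
  assume g: "gate B (prod_word w) = \<one>"
  show "B \<notin> set (walls w)"
  proof
    assume "B \<in> set (walls w)"
    then obtain \<rho> where "\<rho> \<noteq> \<one>" "reduced w \<Longrightarrow> gate B (prod_word w) = \<rho>"
      using exchange[OF reduced_letters[OF assms(2)] _ assms(1)] by metis
    thus False using g assms(2) by simp
  qed
qed (use assms gate_not_wall reduced_letters in blast)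

text \<open>The rest of the word does not cross \<open>base s\<close>. Consequently the value of a
  reduced word together with the factor of its first letter determines that letter.\<close>

lemma gate_reduced_Cons:
  assumes "reduced (s # w)"
  shows "gate (base s) (prod_word (s # w)) = s"
proof -
  have s: "s \<in> letters \<B>" "reduced w" "base s \<notin> set (walls w)"
    using assms by (simp_all add: reduced_Cons)
  have "gate (base s) (s \<otimes> prod_word w) = s \<otimes> gate (base s) (prod_word w)"
    using s base_mem'[OF s(1)] word_carrier[OF reduced_letters[OF s(2)]] by (intro gate_mult) auto
  moreover have "gate (base s) (prod_word w) = \<one>"
    using gate_eq_one_iff[of "base s" w] s base_mem' by blast
  ultimately show ?thesis using s letters_carrier by auto
qed

text \<open>A reduced competitor has the same gate \<open>s\<close> in \<open>base s\<close>, so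
  exchange pulls exactly \<open>s\<close> out of it. Cancelling \<open>s\<close> shortens both words
  by one letter.\<close>

lemma reduced_length_le:
  assumes "reduced w" "set v \<subseteq> letters \<B>" "prod_word v = prod_word w"
  shows "length w \<le> length v"
  using assms
proof (induction w arbitrary: v)
  case (Cons s w)
  have s: "s \<in> letters \<B>" "reduced w" using Cons.prems(1) by (simp_all add: reduced_Cons)
  have b: "base s \<in> \<B>" "s \<in> base s" "s \<noteq> \<one>" "s \<in> carrier G"
    using s base_mem'[OF s(1)] letters_carrier by (auto elim: letterE)
  obtain v0 where v0: "reduced v0" "prod_word v0 = prod_word v" "length v0 \<le> length v"
    using reduced_word[of \<B> v] Cons.prems by blast
  have gs: "gate (base s) (prod_word v0) = s"
    using gate_reduced_Cons[OF Cons.prems(1)] v0(2) Cons.prems(3) by simp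
  hence "base s \<in> set (walls v0)"
    using gate_eq_one_iff[OF b(1) v0(1)] b(3) by simp
  then obtain x t y where xy: "v0 = x @ t # y" "prod_word v0 = s \<otimes> prod_word (x @ y)"
    using exchange[OF reduced_letters[OF v0(1)] _ b(1)] v0(1) gs by metis
  have xyl: "set (x @ y) \<subseteq> letters \<B>"
    using reduced_letters[OF v0(1)] xy(1) by simp
  have "s \<otimes> prod_word (x @ y) = s \<otimes> prod_word w"
    using xy(2) v0(2) Cons.prems(3) by simp
  moreover have "prod_word (x @ y) \<in> carrier G" "prod_word w \<in> carrier G"
    using word_carrier[OF xyl] word_carrier[OF reduced_letters[OF s(2)]] by blast+
  ultimately have "prod_word (x @ y) = prod_word w" using b(4) by simp
  hence "length w \<le> length (x @ y)" using Cons.IH[OF s(2) xyl] by blast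
  thus ?case using xy(1) v0(3) by simp
qed simp

section \<open>Word length and projection to a factor\<close>

definition len :: "'a \<Rightarrow> nat"
  where "len g = (LEAST n. \<exists>w. set w \<subseteq> letters \<B> \<and> prod_word w = g \<and> length w = n)"

lemma len_reduced: "reduced w \<Longrightarrow> len (prod_word w) = length w"
  unfolding len_def using reduced_length_le[of w] reduced_letters[of w]
  by (intro Least_equality) auto

lemma len_le: "set w \<subseteq> letters \<B> \<Longrightarrow> len (prod_word w) \<le> length w"
  unfolding len_def by (rule Least_le) blast

lemma reduced_iff_len:
  assumes "set w \<subseteq> letters \<B>"
  shows "reduced w \<longleftrightarrow> len (prod_word w) = length w"
proof
  assume *: "len (prod_word w) = length w"
  show "reduced w"
  proof (rule ccontr)
    assume "\<not> reduced w"
    hence "\<not> distinct (walls w)" using assms by (simp only: reduced_def simp_thms)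
    then obtain w' where "set w' \<subseteq> letters \<B>" "prod_word w' = prod_word w" "length w' < length w"
      using deletion[of \<B> w] assms by blast
    thus False using len_le[of w'] * by simp
  qed
qed (rule len_reduced)

lemma len_one [simp]: "len \<one> = 0"
  using len_le[of "[]"] by simp

lemma len_eq_1_iff:
  assumes "g \<in> carrier G"
  shows "len g = 1 \<longleftrightarrow> g \<in> letters \<B>"
proof
  assume "len g = 1"
  moreover obtain w where w: "reduced w" "prod_word w = g" using assms carrier_reduced_word by blast
  ultimately have "length w = 1" using len_reduced by metis
  then obtain s where "w = [s]" by (cases w) auto
  thus "g \<in> letters \<B>" using w letters_carrier by (auto simp: reduced_Cons)
next
  assume g: "g \<in> letters \<B>"
  hence "reduced [g]" by (simp add: reduced_Cons) (simp add: reduced_def)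
  thus "len g = 1" using len_reduced[of "[g]"] assms by simp
qed

lemma len_mult_le:
  assumes "g \<in> carrier G" "h \<in> carrier G"
  shows "len (g \<otimes> h) \<le> len g + len h"
proof -
  obtain v w where vw: "reduced v" "prod_word v = g" "reduced w" "prod_word w = h"
    using assms carrier_reduced_word by metis
  hence "prod_word (v @ w) = g \<otimes> h" "set (v @ w) \<subseteq> letters \<B>"
    using word_carrier reduced_letters by auto
  thus ?thesis using len_le[of "v @ w"] vw len_reduced by auto
qed

lemma inv_letter: "s \<in> letters J \<Longrightarrow> J \<subseteq> \<B> \<Longrightarrow> inv s \<in> letters J"
proof -
  assume a: "s \<in> letters J" "J \<subseteq> \<B>"
  then obtain B where B: "B \<in> J" "s \<in> B" "s \<noteq> \<one>" by (auto elim: letterE)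
  hence "inv s \<in> B" "s \<in> carrier G" using basis_inv[of B s] basis_carrier[of B s] a(2) by auto
  moreover have "inv s \<noteq> \<one>" using B \<open>s \<in> carrier G\<close> inv_eq_1_iff by blast
  ultimately show ?thesis using B(1) letterI by blast
qed

lemma len_mult_gate_one:
  assumes "B \<in> \<B>" "g \<in> carrier G" "gate B g = \<one>" "b \<in> B" "b \<noteq> \<one>"
  shows "len (b \<otimes> g) = len g + 1"
proof -
  obtain w where w: "reduced w" "prod_word w = g" using assms carrier_reduced_word by blast
  have "reduced (b # w)"
    using w assms gate_eq_one_iff[OF assms(1) w(1)] base_eq[OF assms(1,4,5)] letterI[OF assms(1,4,5)] by (simp add: reduced_Cons)
  thus ?thesis using len_reduced[of "b # w"] len_reduced[of w] w by simp
qed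

text \<open>\<open>gate B g\<close> is the projection of \<open>g\<close> to \<open>B\<close>: after
  translating it to the neutral element, every other \<open>b\<close> becomes a nontrivial letter
  that can be put in front of a reduced word without meeting a wall twice. So all other vertices of
  \<open>B\<close> are exactly one step further away.\<close>

lemma len_gate:
  assumes "B \<in> \<B>" "g \<in> carrier G" "b \<in> B" "b \<noteq> gate B g"
  shows "len (inv b \<otimes> g) = len (inv (gate B g) \<otimes> g) + 1"
proof -
  define p where "p = gate B g"
  have p: "p \<in> B" "p \<in> carrier G" "b \<in> carrier G" "inv p \<in> B"
    using assms gate_mem[of B g] basis_carrier[of B] basis_inv[of B p] by (auto simp: p_def)
  have "gate B (inv p \<otimes> g) = \<one>"
    using gate_mult[OF assms(1) p(4) assms(2)] p(2) by (simp flip: p_def)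
  moreover have "inv b \<otimes> p \<in> B" using basis_mult basis_inv assms p by simp
  moreover have "inv b \<otimes> p \<noteq> \<one>"
  proof
    assume "inv b \<otimes> p = \<one>"
    hence "b \<otimes> (inv b \<otimes> p) = b" using p by simp
    thus False using p assms(4) by (simp add: p_def)
  qed
  ultimately have "len ((inv b \<otimes> p) \<otimes> (inv p \<otimes> g)) = len (inv p \<otimes> g) + 1"
    using assms p by (intro len_mult_gate_one[OF assms(1)]) auto
  thus ?thesis using p assms(2) by (simp add: m_assoc flip: p_def)
qed

lemma gate_eqI:
  assumes "B \<in> \<B>" "g \<in> carrier G" "b \<in> B" "len (inv b \<otimes> g) < len g"
  shows "gate B g = b"
proof (rule ccontr)
  assume "gate B g \<noteq> b"
  hence *: "len (inv b \<otimes> g) = len (inv (gate B g) \<otimes> g) + 1" using len_gate assms by metis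
  show False
  proof (cases "gate B g = \<one>")
    case False
    thus ?thesis using * assms len_gate[of B g \<one>] by simp
  qed (use * assms in simp)
qed

lemma prod_word_generate: "set w \<subseteq> letters J \<Longrightarrow> prod_word w \<in> generate G (\<Union>J)"
proof (induction w)
  case (Cons s w)
  hence "s \<in> \<Union>J" by (auto elim: letterE)
  hence "s \<in> generate G (\<Union>J)" by (rule generate.incl)
  thus ?case using Cons by (simp add: generate.eng)
qed (simp add: generate.one)

text \<open>Exchange in a reduced word over \<open>J\<close> of the same value exhibits the first
  letter \<open>s\<close> as a conjugate inside the subgroup generated by \<open>J\<close>. A
  reduced word over \<open>J\<close> for \<open>s\<close> has length one, so \<open>s\<close> is
  itself a letter of \<open>J\<close>, and the tail remains in the subgroup.\<close>

lemma reduced_parabolic: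
  assumes "J \<subseteq> \<B>" "reduced w" "prod_word w \<in> generate G (\<Union>J)"
  shows "set w \<subseteq> letters J"
  using assms(2,3)
proof (induction w)
  case (Cons s w)
  have J: "\<Union>J \<subseteq> carrier G" using assms(1) basis_subset by blast
  have s: "s \<in> letters \<B>" "reduced w" "s \<in> carrier G" "base s \<in> \<B>" "s \<in> base s" "s \<noteq> \<one>"
    using Cons.prems(1) letters_carrier base_mem'[of s] by (auto simp: reduced_Cons elim: letterE)
  obtain v where v: "set v \<subseteq> letters J" "reduced v" "prod_word v = prod_word (s # w)"
    using generate_reduced_word[OF assms(1) Cons.prems(2)] by blast
  have "gate (base s) (prod_word v) = s" using gate_reduced_Cons[OF Cons.prems(1)] v by simp
  then obtain u t z where uz: "v = u @ t # z" "s = prod_word u \<otimes> t \<otimes> inv (prod_word u)"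
    using exchange[OF reduced_letters[OF v(2)] _ s(4)] gate_eq_one_iff[OF s(4) v(2)] v(2) s(6) by metis
  have gt: "prod_word u \<in> generate G (\<Union>J)" "t \<in> generate G (\<Union>J)"
    using prod_word_generate[of u J] prod_word_generate[of "[t]" J] s(3) v uz letters_mono[OF assms(1)] letters_carrier by auto
  hence sg: "s \<in> generate G (\<Union>J)"
    unfolding uz(2) using generate_m_inv_closed[OF J] by (intro generate.eng) auto
  obtain x where x: "set x \<subseteq> letters J" "reduced x" "prod_word x = s"
    using generate_reduced_word[OF assms(1) sg] by blast
  have "length x = 1" using len_reduced[OF x(2)] x(3) len_eq_1_iff[OF s(3)] s(1) by simp
  then obtain s' where "x = [s']" by (cases x) auto
  hence "s \<in> letters J" using x letters_mono[OF assms(1)] letters_carrier by force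
  moreover have "prod_word w = inv s \<otimes> prod_word (s # w)"
    using s word_carrier[OF reduced_letters[OF s(2)]] by simp
  hence "prod_word w \<in> generate G (\<Union>J)"
    using generate_m_inv_closed[OF J sg] Cons.prems(2) by (metis generate.eng)
  ultimately show ?case using Cons.IH s(2) by simp
qed simp

end

section \<open>Alternating words\<close>

lemma alternating_append:
  "alternating (m + k) a b = alternating m a b @ (if even m then alternating k a b else alternating k b a)"
  by (induction m arbitrary: a b) auto

lemma length_alternating [simp]: "length (alternating m a b) = m"
  by (induction m arbitrary: a b) auto

lemma alternating_eq_Nil_iff [simp]: "alternating m a b = [] \<longleftrightarrow> m = 0"
  by (cases m) auto

text \<open>Each word is the other one shifted by one place, so the two first letters propagate in
  turn along both words.\<close>

lemma alternating_eqI: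
  assumes "butlast ys = tl xs" "butlast xs = tl ys" "length xs = length ys" "xs \<noteq> []"
  shows "xs = alternating (length xs) (hd xs) (hd ys)"
  using assms
proof (induction "length xs" arbitrary: xs ys)
  case (Suc n)
  then obtain x xs' y ys' where xy: "xs = x # xs'" "ys = y # ys'"
    by (metis length_0_conv list.exhaust)
  show ?case
  proof (cases "xs' = []")
    case False
    hence ne: "butlast ys \<noteq> []" "butlast xs \<noteq> []" "ys' \<noteq> []" using Suc.prems xy by auto
    have "butlast ys = alternating (length (butlast ys)) (hd (butlast ys)) (hd (butlast xs))"
      using Suc.prems Suc.hyps(2) ne
      by (intro Suc.hyps(1)) (auto simp: butlast_tl)
    thus ?thesis using Suc.prems xy ne False by simp
  qed (use xy in simp)
qed simp

context gated_basis
begin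

primrec alternates :: "'a set \<Rightarrow> 'a set \<Rightarrow> 'a list \<Rightarrow> bool" where
  "alternates A B [] \<longleftrightarrow> True"
| "alternates A B (x # w) \<longleftrightarrow> x \<in> A - {\<one>} \<and> alternates B A w"

lemma alternates_letters: "alternates A B w \<Longrightarrow> set w \<subseteq> letters {A, B}"
  by (induction w arbitrary: A B) (auto simp: letters_def)

lemma alternates_append_left: "alternates A B (u @ v) \<Longrightarrow> alternates A B u"
  by (induction u arbitrary: A B) auto

lemma alternates_alternating:
  "a \<in> A - {\<one>} \<Longrightarrow> b \<in> B - {\<one>} \<Longrightarrow> alternates A B (alternating m a b)"
  by (induction m arbitrary: A B a b) auto

lemma alternates_inner:
  "alternates A B (u @ a # t # b # v) \<Longrightarrow> a \<in> A \<and> b \<in> A \<or> a \<in> B \<and> b \<in> B"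
  by (induction u arbitrary: A B) auto

lemma alternates_last:
  assumes "alternates A B (u @ [t])" "A \<in> \<B>" "B \<in> \<B>" "t' \<in> base t" "t' \<noteq> \<one>"
  shows "alternates A B (u @ [t'])"
  using assms
proof (induction u arbitrary: A B)
  case Nil
  thus ?case using base_eq[of A t] by simp
qed simp

lemma reduced_alternates:
  assumes "A \<in> \<B>" "B \<in> \<B>" "reduced w" "set w \<subseteq> letters {A, B}" "w \<noteq> [] \<Longrightarrow> hd w \<in> A"
  shows "alternates A B w"
  using assms
proof (induction w arbitrary: A B)
  case (Cons s w)
  have s: "s \<in> A - {\<one>}" "base s = A"
    using Cons.prems base_eq[of A s] by (auto elim: letterE)
  have "hd w \<in> B" if ne: "w \<noteq> []"
  proof -
    obtain t v where w: "w = t # v" using ne by (cases w) auto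
    hence "t \<noteq> \<one>" "t \<in> A \<union> B" "base t \<noteq> A"
      using Cons.prems(3,4) s by (auto simp: reduced_Cons elim: letterE)
    thus ?thesis using base_eq[of A t] Cons.prems(1) w by auto
  qed
  moreover have "reduced w" "set w \<subseteq> letters {B, A}"
    using Cons.prems(3,4) by (simp_all add: reduced_Cons insert_commute)
  ultimately show ?case using Cons.IH[of B A] Cons.prems(1,2) s by simp
qed simp

lemma reduced_consecutive: "reduced (u @ s # t # v) \<Longrightarrow> base s \<noteq> base t"
  by (drule reduced_append(2)) (simp add: reduced_Cons)

text \<open>Both words start in the same factor, so a single gate reads the first letter of both;
  the tails then start in the other factor.\<close>

lemma alternates_unique:
  assumes "A \<in> \<B>" "B \<in> \<B>" "reduced v" "reduced w" "alternates A B v" "alternates A B w"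
    "prod_word v = prod_word w"
  shows "v = w"
  using assms
proof (induction v arbitrary: A B w)
  case Nil
  hence "length w = 0" by (metis len_one len_reduced prod_word_simps(1))
  thus ?case by simp
next
  case (Cons s v)
  have "length w = Suc (length v)"
    using Cons.prems(3,4,7) len_reduced by (metis length_Cons)
  then obtain t x where w: "w = t # x" by (cases w) auto
  have b: "base s = A" "base t = A" "s \<in> carrier G"
    using Cons.prems w base_eq[of A] basis_carrier by auto
  have st: "s = t"
    using gate_reduced_Cons[of s v] gate_reduced_Cons[of t x] Cons.prems w b by simp
  have "prod_word v = prod_word x"
    using Cons.prems(3,4,7) w st b(3) word_carrier[OF reduced_letters] by (auto simp: reduced_Cons)
  thus ?case
    using Cons.IH[of B A x] Cons.prems w st by (auto simp: reduced_Cons)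
qed

text \<open>\<open>gate A\<close> reads the first letter of \<open>xs\<close>, so exchange removes a
  letter from \<open>ys\<close>. Removing an inner letter of an alternating word brings two letters
  of one factor together, which a reduced word excludes; removing a first letter that is not the
  last would put it in \<open>A\<close>, although \<open>ys\<close> starts in \<open>B\<close>. So
  the last letter goes, and the rest is the tail of \<open>xs\<close> by uniqueness.\<close>

lemma alternates_tl:
  assumes "A \<in> \<B>" "B \<in> \<B>" "A \<noteq> B" "reduced xs" "reduced ys"
    "alternates A B xs" "alternates B A ys" "prod_word xs = prod_word ys" "xs \<noteq> []"
  shows "butlast ys = tl xs \<and> conjugate G (prod_word (butlast ys)) (base (last ys)) = A"
proof -
  obtain a x where xs: "xs = a # x" using assms(9) by (cases xs) auto
  have a: "a \<in> A" "a \<noteq> \<one>" "base a = A" "a \<in> carrier G" "reduced x" "alternates B A x"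
    using assms xs base_eq[of A a] basis_carrier[of A a] by (auto simp: reduced_Cons)
  have gA: "gate A (prod_word ys) = a"
    using gate_reduced_Cons[of a x] assms(4,8) xs a by simp
  hence "A \<in> set (walls ys)" using gate_eq_one_iff[OF assms(1,5)] a by simp
  then obtain u t v where uv: "ys = u @ t # v" "conjugate G (prod_word u) (base t) = A"
      "prod_word ys = a \<otimes> prod_word (u @ v)"
    using exchange[OF reduced_letters[OF assms(5)] _ assms(1)] assms(5) gA by metis
  have uvl: "set (u @ v) \<subseteq> letters \<B>" using reduced_letters[OF assms(5)] uv by simp
  have t: "t \<in> letters \<B>" using reduced_letters[OF assms(5)] uv by simp
  have "a \<otimes> prod_word x = a \<otimes> prod_word (u @ v)"
    using assms(8) xs uv by simp
  hence eq: "prod_word (u @ v) = prod_word x"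
    using a(4) prod_word_closed[OF word_carrier[OF uvl]]
      prod_word_closed[OF word_carrier[OF reduced_letters[OF a(5)]]] by simp
  have "length xs = length ys" using len_reduced assms(4,5,8) by metis
  hence "length (u @ v) = length x" using xs uv by simp
  hence r: "reduced (u @ v)"
    using reduced_iff_len[OF uvl] eq len_reduced[OF a(5)] by simp
  have "v = []"
  proof (rule ccontr)
    assume "v \<noteq> []"
    then obtain b v' where v: "v = b # v'" by (cases v) auto
    show False
    proof (cases u rule: rev_cases)
      case Nil
      hence "base t = A" using uv(2) base_subset[OF t] by simp
      moreover have "base t = B" using Nil uv(1) assms(2,7) base_eq[of B t] by simp
      ultimately show False using assms(3) by simp
    next
      case (snoc u' c)
      hence "c \<in> A \<and> b \<in> A \<or> c \<in> B \<and> b \<in> B"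
        using alternates_inner[of B A u' c t b v'] assms(7) uv(1) v by auto
      moreover have "c \<noteq> \<one>" "b \<noteq> \<one>" using uvl snoc v by (auto elim: letterE)
      ultimately have "base c = base b" using base_eq assms(1,2) by metis
      thus False using reduced_consecutive[of u' c b v'] r snoc v by simp
    qed
  qed
  hence "alternates B A (butlast ys)" "butlast ys = u"
    using assms(7) uv(1) alternates_append_left[of B A u "[t]"] by auto
  moreover have "reduced u" "prod_word u = prod_word x" using r eq \<open>v = []\<close> by auto
  ultimately have "butlast ys = x"
    using alternates_unique[of B A u x] a assms by simp
  thus ?thesis using uv \<open>v = []\<close> xs by simp
qed

lemma alternates_both:
  assumes "A \<in> \<B>" "B \<in> \<B>" "A \<noteq> B" "reduced xs" "reduced ys"
    "alternates A B xs" "alternates B A ys" "prod_word xs = prod_word ys" "xs \<noteq> []"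
  shows "xs = alternating (length xs) (hd xs) (hd ys)" "ys = alternating (length xs) (hd ys) (hd xs)"
    "length xs = length ys" "2 \<le> length xs"
proof -
  show l: "length xs = length ys" using len_reduced assms(4,5,8) by metis
  hence ne: "ys \<noteq> []" using assms(9) by auto
  note 1 = alternates_tl[OF assms] alternates_tl[OF assms(2,1) assms(3)[symmetric] assms(5,4,7,6) assms(8)[symmetric] ne]
  show "xs = alternating (length xs) (hd xs) (hd ys)"
    by (rule alternating_eqI) (use 1 l assms(9) in auto)
  have "ys = alternating (length ys) (hd ys) (hd xs)"
    by (rule alternating_eqI) (use 1 l ne in auto)
  thus "ys = alternating (length xs) (hd ys) (hd xs)" using l by simp
  show "2 \<le> length xs"
  proof (rule ccontr)
    assume "\<not> 2 \<le> length xs"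
    moreover have "length xs \<noteq> 0" using assms(9) by simp
    ultimately have "length xs = 1" by linarith
    then obtain a b where "xs = [a]" "ys = [b]" using l by (metis One_nat_def length_0_conv length_Suc_conv)
    thus False using assms basis_carrier basis_disjoint by auto
  qed
qed

text \<open>Reducedness of both sides singles out the shortest relation of this kind between
  \<open>a\<close> and \<open>b\<close>; without it every sufficiently divisible length would
  qualify for involutions.\<close>

definition braid_pair :: "nat \<Rightarrow> 'a \<Rightarrow> 'a \<Rightarrow> bool" where
  "braid_pair m a b \<longleftrightarrow> reduced (alternating m a b) \<and> reduced (alternating m b a) \<and>
     prod_word (alternating m a b) = prod_word (alternating m b a)"

definition braided :: "'a set \<Rightarrow> 'a set \<Rightarrow> nat \<Rightarrow> bool" where
  "braided A B m \<longleftrightarrow> 2 \<le> m \<and> (\<forall>a \<in> A - {\<one>}. \<forall>b \<in> B - {\<one>}. braid_pair m a b) \<and>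
     (2 < m \<longrightarrow> card A = 2 \<and> card B = 2)"

lemma braid_pair_sym: "braid_pair m a b \<longleftrightarrow> braid_pair m b a"
  by (auto simp: braid_pair_def)

lemma braided_sym: "braided A B m \<longleftrightarrow> braided B A m"
  unfolding braided_def using braid_pair_sym by metis

text \<open>Write \<open>alternating m b a\<close> as \<open>u @ [t]\<close>. The wall of its last
  letter is \<open>A\<close>, so every \<open>a'\<close> in \<open>A\<close> can be moved across
  \<open>u\<close> to some \<open>y\<close> in \<open>base t\<close>. The wall of the last letter
  depends only on its factor, so \<open>u @ [y]\<close> is still reduced, and comparing it with
  \<open>a' # u\<close> forces both to alternate between \<open>a'\<close> and \<open>b\<close>. For
  \<open>m > 2\<close> the second letter \<open>a\<close> has survived in \<open>u\<close>, whence
  \<open>a' = a\<close>.\<close>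

lemma braid_pair_vary:
  assumes "A \<in> \<B>" "B \<in> \<B>" "A \<noteq> B" "a \<in> A - {\<one>}" "b \<in> B - {\<one>}" "a' \<in> A - {\<one>}"
    "braid_pair m a b" "2 \<le> m"
  shows "braid_pair m a' b \<and> (2 < m \<longrightarrow> a' = a)"
proof -
  define xs ys where "xs = alternating m a b" and "ys = alternating m b a"
  have alt: "alternates A B xs" "alternates B A ys"
    using assms alternates_alternating by (auto simp: xs_def ys_def)
  have red: "reduced xs" "reduced ys" "prod_word xs = prod_word ys"
    using assms(7) by (auto simp: braid_pair_def xs_def ys_def)
  have len: "length xs = m" "length ys = m" "xs \<noteq> []" "ys \<noteq> []"
    using assms(8) by (auto simp: xs_def ys_def)
  define u t where "u = butlast ys" and "t = last ys"
  have ys: "ys = u @ [t]" using len by (simp add: u_def t_def)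
  have t1: "conjugate G (prod_word u) (base t) = A"
    using alternates_tl[OF assms(1-3) red(1,2) alt red(3) len(3)] unfolding u_def t_def by (rule conjunct2)
  have l: "set u \<subseteq> letters \<B>" "t \<in> letters \<B>" using reduced_letters[OF red(2)] ys by auto
  define q where "q = prod_word u"
  have q: "q \<in> carrier G" using word_carrier[OF l(1)] by (auto simp: q_def)
  have a': "a' \<in> carrier G" "a' \<in> A" "a' \<noteq> \<one>" using assms basis_carrier by auto
  define y where "y = inv q \<otimes> a' \<otimes> q"
  have y: "y \<in> base t"
    using mem_conjugate_iff[OF base_subset[OF l(2)] q a'(1)] t1 a' by (simp add: q_def y_def)
  have yc: "y \<in> carrier G" using q a' by (simp add: y_def)
  have qy: "q \<otimes> y = a' \<otimes> q" using q a' by (simp add: y_def m_assoc)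
  have y1: "y \<noteq> \<one>"
  proof
    assume "y = \<one>"
    hence "a' \<otimes> q = \<one> \<otimes> q" using qy q by simp
    thus False using q a' by simp
  qed
  define xs' ys' where "xs' = a' # u" and "ys' = u @ [y]"
  have uc: "set u \<subseteq> carrier G" using word_carrier l by blast
  have ys'l: "set ys' \<subseteq> letters \<B>"
    using l y y1 base_mem'[of t] letterI[of "base t" \<B> y] by (auto simp: ys'_def)
  have "walls ys' = walls ys"
    using l y y1 base_mem'[of t] base_eq[of "base t" y] ys'l
    by (simp add: ys ys'_def walls_append)
  hence ry: "reduced ys'" using red(2) ys'l by (simp add: reduced_def)
  have aly: "alternates B A ys'"
    using alternates_last[of B A u t y] alt(2) assms(1,2) y y1 by (simp add: ys ys'_def)
  have pr: "prod_word xs' = prod_word ys'" using qy uc yc by (simp add: xs'_def ys'_def q_def)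
  have xl: "set xs' \<subseteq> letters \<B>" using l a' letterI[of A \<B>] assms(1) by (simp add: xs'_def)
  have rx: "reduced xs'"
    using reduced_iff_len[OF xl] pr len_reduced[OF ry] by (simp add: xs'_def ys'_def)
  have alx: "alternates A B xs'"
    using alternates_append_left[of B A u "[t]"] alt(2) ys a' by (simp add: xs'_def)
  have m: "length xs' = m" using len ys by (simp add: xs'_def)
  have "m = Suc (Suc (m - 2))" using assms(8) by simp
  hence ysb: "ys = b # a # alternating (m - 2) b a" by (metis alternating.simps(2) ys_def)
  hence ub: "u \<noteq> []" "hd u = b" "2 < m \<Longrightarrow> u ! 1 = a" using assms(8)
    by (auto simp: u_def numeral_2_eq_2)
  have hd: "hd ys' = b" "hd xs' = a'" using ub by (auto simp: ys'_def xs'_def)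
  note ab = alternates_both[OF assms(1-3) rx ry alx aly pr]
  have x'eq: "xs' = alternating m a' b" "ys' = alternating m b a'"
    using ab(1,2) hd m by (auto simp: xs'_def)
  hence bp: "braid_pair m a' b" using rx ry pr by (simp add: braid_pair_def)
  moreover have "a' = a" if "2 < m"
  proof -
    have "length u > 1" using that len ys by simp
    hence "ys' ! 1 = a" using ub(3)[OF that] by (simp add: ys'_def nth_append)
    moreover have "ys' ! 1 = a'"
      using x'eq(2) \<open>m = Suc (Suc (m - 2))\<close> by (metis One_nat_def alternating.simps(2) nth_Cons_0 nth_Cons_Suc)
    ultimately show ?thesis by simp
  qed
  ultimately show ?thesis by blast
qed

lemma braid_pair_braided:
  assumes "A \<in> \<B>" "B \<in> \<B>" "A \<noteq> B" "a \<in> A - {\<one>}" "b \<in> B - {\<one>}" "braid_pair m a b" "2 \<le> m"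
  shows "braided A B m"
proof -
  have 1: "braid_pair m a' b \<and> (2 < m \<longrightarrow> a' = a)" if "a' \<in> A - {\<one>}" for a'
    using braid_pair_vary[OF assms(1-5) that assms(6,7)] .
  have 2: "braid_pair m b' a' \<and> (2 < m \<longrightarrow> b' = b)" if "a' \<in> A - {\<one>}" "b' \<in> B - {\<one>}" for a' b'
    by (rule braid_pair_vary[OF assms(2,1) assms(3)[symmetric] assms(5) that(1,2) _ assms(7)])
      (use 1[OF that(1)] braid_pair_sym[of m a' b] in simp)
  have "card A = 2" "card B = 2" if "2 < m"
  proof -
    have "x = a" if "x \<in> A - {\<one>}" for x using 1[OF that] \<open>2 < m\<close> by simp
    hence "A = {\<one>, a}" using assms(4) basis_one[OF assms(1)] by blast
    moreover have "x = b" if "x \<in> B - {\<one>}" for x using 2[OF assms(4) that] \<open>2 < m\<close> by simp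
    hence "B = {\<one>, b}" using assms(5) basis_one[OF assms(2)] by blast
    moreover have "\<one> \<noteq> a" "\<one> \<noteq> b" using assms(4,5) by auto
    ultimately show "card A = 2" "card B = 2" by simp_all
  qed
  moreover have "braid_pair m a' b'" if "a' \<in> A - {\<one>}" "b' \<in> B - {\<one>}" for a' b'
    using 2[OF that] braid_pair_sym[of m a' b'] by simp
  ultimately show ?thesis using assms(7) unfolding braided_def by blast
qed

lemma basis_nontrivial_elem:
  assumes "B \<in> \<B>"
  obtains b where "b \<in> B - {\<one>}"
  using basis_nontrivial[OF assms] basis_one[OF assms] by blast

text \<open>In the reduced word of length \<open>n\<close>, trading the prefix of length
  \<open>m\<close> for the other side of the shorter relation changes neither length nor value, but
  it makes the prefix end in the letter \<open>c\<close> that comes next.\<close>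

lemma braided_not_less:
  assumes "A \<in> \<B>" "B \<in> \<B>" "braided A B m" "braided A B n"
  shows "\<not> m < n"
proof
  assume "m < n"
  obtain a b where ab: "a \<in> A - {\<one>}" "b \<in> B - {\<one>}"
    using basis_nontrivial_elem[OF assms(1)] basis_nontrivial_elem[OF assms(2)] by metis
  have bp: "braid_pair m a b" "braid_pair n a b" "2 \<le> m" using assms ab by (auto simp: braided_def)
  define m' where "m' = m - 1"
  have m: "m = m' + 1" using bp(3) by (simp add: m'_def)
  obtain r where r: "n = m + Suc r" using less_imp_Suc_add[OF \<open>m < n\<close>] by auto
  define c d where "c = (if even m' then b else a)" and "d = (if even m' then a else b)"
  have n: "alternating n a b = alternating m a b @ c # alternating r d c"
    unfolding r alternating_append by (simp add: m c_def d_def)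
  have mb: "alternating m b a = alternating m' b a @ [c]"
    unfolding m alternating_append by (simp add: c_def)
  have l: "set (alternating m a b @ c # alternating r d c) \<subseteq> letters \<B>"
    "set (alternating m b a) \<subseteq> letters \<B>" "set (alternating m a b) \<subseteq> letters \<B>"
    using bp n reduced_letters by (metis braid_pair_def)+
  have carr: "set (alternating m a b) \<subseteq> carrier G" "set (alternating m b a) \<subseteq> carrier G"
    "set (c # alternating r d c) \<subseteq> carrier G"
    using word_carrier[OF l(1)] word_carrier[OF l(2)] by auto
  define w where "w = alternating m b a @ c # alternating r d c"
  have "prod_word w = prod_word (alternating n a b)"
    unfolding n w_def prod_word_append[OF carr(1,3)] prod_word_append[OF carr(2,3)]
    using bp(1) by (simp add: braid_pair_def)
  moreover have "set w \<subseteq> letters \<B>" using l by (simp add: w_def)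
  moreover have "length w = n" by (simp add: w_def r)
  moreover have "reduced (alternating n a b)" using bp(2) by (simp add: braid_pair_def)
  ultimately have "reduced w" using reduced_iff_len len_reduced by (metis length_alternating)
  thus False using reduced_consecutive[of "alternating m' b a" c c "alternating r d c"]
    by (simp add: w_def mb)
qed

lemma braided_unique:
  "A \<in> \<B> \<Longrightarrow> B \<in> \<B> \<Longrightarrow> braided A B m \<Longrightarrow> braided A B n \<Longrightarrow> m = n"
  using braided_not_less by (meson linorder_neqE_nat)

section \<open>Parabolic subgroups and shortest coset representatives\<close>

lemma generate_closed: "J \<subseteq> \<B> \<Longrightarrow> p \<in> generate G (\<Union>J) \<Longrightarrow> p \<in> carrier G"
  using generate_in_carrier[of "\<Union>J" p] basis_subset by blast

lemma generate_inv_closed: "J \<subseteq> \<B> \<Longrightarrow> p \<in> generate G (\<Union>J) \<Longrightarrow> inv p \<in> generate G (\<Union>J)"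
  using generate_m_inv_closed[of "\<Union>J" p] basis_subset by blast

text \<open>\<open>k\<close> is a shortest element of the coset of \<open>g\<close>. If a reduced
  word over \<open>J\<close> followed by a reduced word for \<open>k\<close> met a wall twice,
  exchange would delete a letter from the part spelling \<open>k\<close> and produce a shorter
  element of the same coset.\<close>

lemma parabolic_decomposition:
  assumes "J \<subseteq> \<B>" "g \<in> carrier G"
  obtains p k where "p \<in> generate G (\<Union>J)" "k \<in> carrier G" "g = p \<otimes> k"
    "\<And>q. q \<in> generate G (\<Union>J) \<Longrightarrow> len (q \<otimes> k) = len q + len k"
proof -
  define P where "P = generate G (\<Union>J)"
  have Pc: "p \<in> carrier G" if "p \<in> P" for p
    using that generate_closed[OF assms(1)] by (simp add: P_def)
  obtain h where h: "h \<in> P" "\<And>q. q \<in> P \<Longrightarrow> len (h \<otimes> g) \<le> len (q \<otimes> g)"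
    using ex_has_least_nat[of "\<lambda>h. h \<in> P" \<one> "\<lambda>h. len (h \<otimes> g)"] generate.one[of G "\<Union>J"]
    by (auto simp: P_def)
  have hc: "h \<in> carrier G" using h(1) Pc by blast
  define k where "k = h \<otimes> g"
  have kc: "k \<in> carrier G" using hc assms(2) by (simp add: k_def)
  have min: "len k \<le> len (q \<otimes> k)" if "q \<in> P" for q
  proof -
    have "q \<otimes> h \<in> P" using that h(1) by (simp add: P_def generate.eng)
    thus ?thesis using h(2)[of "q \<otimes> h"] that Pc hc assms(2) by (simp add: k_def m_assoc)
  qed
  obtain u where u: "reduced u" "prod_word u = k" using carrier_reduced_word[OF kc] by blast
  have ul: "set u \<subseteq> letters \<B>" using reduced_letters[OF u(1)] .
  have red: "reduced (v @ u)" if "reduced v" "set v \<subseteq> letters J" for v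
    using that
  proof (induction v)
    case (Cons s v)
    have sv: "s \<in> letters \<B>" "reduced v" "base s \<notin> set (walls v)" "set v \<subseteq> letters J"
      using Cons.prems by (auto simp: reduced_Cons)
    have vl: "set v \<subseteq> letters \<B>" using reduced_letters[OF sv(2)] .
    have b: "base s \<in> J" "base s \<in> \<B>" using base_mem[of s J] Cons.prems(2) assms(1) by auto
    have "base s \<notin> set (walls (v @ u))"
    proof
      assume in_walls: "base s \<in> set (walls (v @ u))"
      have vul: "set (v @ u) \<subseteq> letters \<B>" using vl ul by simp
      obtain x t y \<rho> where x: "v @ u = x @ t # y" "conjugate G (prod_word x) (base t) = base s"
        "\<rho> \<in> base s" "prod_word (v @ u) = \<rho> \<otimes> prod_word (x @ y)"
        using exchange[OF vul in_walls b(2)] by metis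
      \<comment> \<open>A deletion inside \<open>v\<close> would mean that \<open>v\<close> itself
        crosses \<open>base s\<close>, against reducedness of \<open>s # v\<close>.\<close>
      have "length v \<le> length x"
      proof (rule ccontr)
        assume "\<not> length v \<le> length x"
        then obtain z where z: "v = x @ t # z"
          using x(1) by (auto simp: append_eq_append_conv2 Cons_eq_append_conv append_eq_Cons_conv)
        hence "base s \<in> set (walls v)"
          using walls_append[of x "t # z"] vl x(2) by simp
        thus False using sv by simp
      qed
      then obtain z where z: "x = v @ z" "u = z @ t # y"
        using x(1) by (auto simp: append_eq_append_conv2)
      \<comment> \<open>\<open>q\<close> is chosen so that \<open>q \<otimes> k\<close> is the value
        of \<open>u\<close> with the letter \<open>t\<close> removed; it is built from
        \<open>v\<close> and \<open>\<rho>\<close> only, so it lies in the parabolic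
        subgroup.\<close>
      define q where "q = inv (prod_word v) \<otimes> (inv \<rho> \<otimes> prod_word v)"
      have vP: "prod_word v \<in> P" using prod_word_generate[OF sv(4)] by (simp add: P_def)
      have \<rho>P: "\<rho> \<in> P" using x(3) b(1) by (auto simp: P_def intro: generate.incl)
      have c: "prod_word v \<in> carrier G" "\<rho> \<in> carrier G" "prod_word (z @ y) \<in> carrier G" "set z \<subseteq> carrier G"
          "set y \<subseteq> carrier G"
        using vP \<rho>P Pc word_carrier[of "z @ y"] ul z by auto
      have q: "q \<in> P"
        unfolding q_def using vP \<rho>P generate_inv_closed[OF assms(1)] by (auto simp: P_def intro!: generate.eng)
      have "prod_word v \<otimes> k = \<rho> \<otimes> (prod_word v \<otimes> prod_word (z @ y))"
        using x(4) z(1) c word_carrier[OF vl] word_carrier[OF ul] u(2) by (simp add: m_assoc)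
      hence "inv \<rho> \<otimes> (prod_word v \<otimes> k) = prod_word v \<otimes> prod_word (z @ y)"
        using c by (simp del: prod_word_append)
      hence "inv (prod_word v) \<otimes> (inv \<rho> \<otimes> (prod_word v \<otimes> k)) = prod_word (z @ y)"
        using c by (simp del: prod_word_append)
      hence "q \<otimes> k = prod_word (z @ y)"
        using c kc by (simp add: q_def m_assoc del: prod_word_append)
      moreover have "len (prod_word (z @ y)) \<le> length (z @ y)"
        using ul z by (intro len_le) auto
      ultimately have "len (q \<otimes> k) < len k"
        using len_reduced[OF u(1)] u(2) z(2) by simp
      thus False using min[OF q] by simp
    qed
    thus ?case using Cons.IH sv by (simp add: reduced_Cons)
  qed (use u in simp)
  have "len (q \<otimes> k) = len q + len k" if q: "q \<in> P" for q
  proof -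
    obtain v where v: "set v \<subseteq> letters J" "reduced v" "prod_word v = q"
      using generate_reduced_word[OF assms(1) q[unfolded P_def]] by blast
    have "prod_word (v @ u) = q \<otimes> k"
      using v(3) u(2) word_carrier[OF reduced_letters[OF v(2)]] word_carrier[OF ul] by simp
    thus ?thesis
      using len_reduced[OF red[OF v(2,1)]] len_reduced[OF v(2)] len_reduced[OF u(1)] v u by simp
  qed
  moreover have "g = inv h \<otimes> k" using hc assms(2) by (simp add: k_def)
  moreover have "inv h \<in> P" using h(1) generate_inv_closed[OF assms(1)] by (simp add: P_def)
  ultimately show thesis using that[of "inv h" k] kc by (simp add: P_def)
qed

lemma descent_word:
  assumes "J \<subseteq> \<B>" "p \<in> generate G (\<Union>J)" "B \<in> J" "s \<in> B" "s \<noteq> \<one>" "len (inv s \<otimes> p) < len p"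
  obtains x where "reduced (s # x)" "set (s # x) \<subseteq> letters J" "prod_word (s # x) = p"
proof -
  have sP: "s \<in> generate G (\<Union>J)" using assms by (auto intro: generate.incl)
  have c: "s \<in> carrier G" "p \<in> carrier G" using sP assms(2) generate_closed[OF assms(1)] by auto
  have "inv s \<otimes> p \<in> generate G (\<Union>J)"
    using generate_inv_closed[OF assms(1) sP] assms(2) by (rule generate.eng)
  then obtain x where x: "set x \<subseteq> letters J" "reduced x" "prod_word x = inv s \<otimes> p"
    using generate_reduced_word[OF assms(1)] by blast
  have l: "set (s # x) \<subseteq> letters J" using x letterI[OF assms(3-5)] by simp
  hence l': "set (s # x) \<subseteq> letters \<B>" using letters_mono[OF assms(1)] by blast
  have pr: "prod_word (s # x) = p" using x c by simp
  have "len p \<le> length (s # x)" using len_le[OF l'] pr by simp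
  moreover have "length (s # x) \<le> len p" using len_reduced[OF x(2)] x(3) assms(6) by simp
  ultimately have "reduced (s # x)" using reduced_iff_len[OF l'] pr by simp
  thus thesis using that l pr by blast
qed

text \<open>Lengths add in the decomposition along the subgroup generated by \<open>A\<close> and
  \<open>B\<close>, so both descents of \<open>g\<close> are descents of its parabolic part. That
  part has reduced alternating words beginning with \<open>s\<close> and with \<open>t\<close>, and
  their comparison is a braid relation.\<close>

lemma dihedral_descent:
  assumes "A \<in> \<B>" "B \<in> \<B>" "A \<noteq> B" "s \<in> A - {\<one>}" "t \<in> B - {\<one>}" "g \<in> carrier G"
    "len (inv s \<otimes> g) < len g" "len (inv t \<otimes> g) < len g"
  obtains m k where "braided A B m" "k \<in> carrier G" "g = prod_word (alternating m s t) \<otimes> k"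
    "\<And>q. q \<in> generate G (A \<union> B) \<Longrightarrow> len (q \<otimes> k) = len q + len k"
proof -
  have J: "{A, B} \<subseteq> \<B>" using assms by simp
  obtain p k where pk: "p \<in> generate G (\<Union>{A, B})" "k \<in> carrier G" "g = p \<otimes> k"
    "\<And>q. q \<in> generate G (\<Union>{A, B}) \<Longrightarrow> len (q \<otimes> k) = len q + len k"
    using parabolic_decomposition[OF J assms(6)] by blast
  have pc: "p \<in> carrier G" using generate_closed[OF J pk(1)] .
  have less: "len (inv r \<otimes> p) < len p" if "r \<in> A \<union> B" "len (inv r \<otimes> g) < len g" for r
  proof -
    have rP: "r \<in> generate G (\<Union>{A, B})" using that by (auto intro: generate.incl)
    have "inv r \<otimes> p \<in> generate G (\<Union>{A, B})"
      using generate_inv_closed[OF J rP] pk(1) by (rule generate.eng)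
    hence "len ((inv r \<otimes> p) \<otimes> k) = len (inv r \<otimes> p) + len k" by (rule pk(4))
    moreover have "r \<in> carrier G" using generate_closed[OF J rP] .
    ultimately show ?thesis using that(2) pk(4)[OF pk(1)] pk(2,3) pc by (simp add: m_assoc)
  qed
  obtain x where x: "reduced (s # x)" "set (s # x) \<subseteq> letters {A, B}" "prod_word (s # x) = p"
    using descent_word[OF J pk(1), of A s] less[of s] assms by auto
  obtain y where y: "reduced (t # y)" "set (t # y) \<subseteq> letters {A, B}" "prod_word (t # y) = p"
    using descent_word[OF J pk(1), of B t] less[of t] assms by auto
  have ax: "alternates A B (s # x)"
    using reduced_alternates[OF assms(1,2) x(1,2)] assms(4) by simp
  have "set (t # y) \<subseteq> letters {B, A}" using y(2) by (simp only: insert_commute)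
  hence ay: "alternates B A (t # y)"
    using reduced_alternates[OF assms(2,1) y(1)] assms(5) by simp
  have ne: "s # x \<noteq> []" and pr: "prod_word (s # x) = prod_word (t # y)" using x y by simp_all
  note ab = alternates_both[OF assms(1-3) x(1) y(1) ax ay pr ne]
  define m where "m = length (s # x)"
  have eq: "s # x = alternating m s t" "t # y = alternating m t s"
    using ab(1,2) unfolding m_def by (simp_all only: list.sel)
  have "braid_pair m s t" using eq x(1) y(1) pr unfolding braid_pair_def by metis
  hence "braided A B m" using braid_pair_braided[OF assms(1-5)] ab(4) by (simp add: m_def)
  moreover have "g = prod_word (alternating m s t) \<otimes> k" using pk(3) x(3) eq by metis
  ultimately show thesis using that pk by simp
qed

text \<open>Pass to a suffix \<open>s # w\<close> that is not reduced while \<open>w\<close> is.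
  Exchange rewrites \<open>w\<close> as a word \<open>\<rho> # u\<close> of the same length with
  \<open>\<rho>\<close> in the factor of \<open>s\<close>, so one element has reduced alternating
  words starting in either factor. This is where the length of a braid relation comes from.\<close>

lemma braided_if_not_reduced:
  assumes "A \<in> \<B>" "B \<in> \<B>" "A \<noteq> B" "alternates A B w" "\<not> reduced w"
  shows "\<exists>m. braided A B m"
  using assms
proof (induction w arbitrary: A B)
  case Nil
  thus ?case by (simp add: reduced_def)
next
  case (Cons s w)
  have s: "s \<in> A" "s \<noteq> \<one>" "base s = A" "s \<in> letters \<B>" and altw: "alternates B A w"
    using Cons.prems base_eq[of A s] letterI[of A \<B> s] by auto
  show ?case
  proof (cases "reduced w")
    case False
    thus ?thesis using Cons.IH[of B A] Cons.prems(1-3) altw braided_sym by metis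
  next
    case True
    hence "A \<in> set (walls w)" using Cons.prems(5) s by (simp add: reduced_Cons)
    then obtain u t v \<rho> where uv: "w = u @ t # v" "conjugate G (prod_word u) (base t) = A"
      "\<rho> \<in> A" "\<rho> \<noteq> \<one>" "prod_word w = \<rho> \<otimes> prod_word (u @ v)"
      using exchange[OF reduced_letters[OF True] _ Cons.prems(1)] by metis
    have l: "set (\<rho> # u @ v) \<subseteq> letters \<B>"
      using reduced_letters[OF True] uv letterI[OF Cons.prems(1) uv(3,4)] by simp
    have "len (prod_word (\<rho> # u @ v)) = length (\<rho> # u @ v)"
      using len_reduced[OF True] uv by simp
    hence r: "reduced (\<rho> # u @ v)" using reduced_iff_len[OF l] by blast
    have t: "t \<in> letters \<B>" using reduced_letters[OF True] uv(1) by simp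
    have "v = []"
    proof (rule ccontr)
      assume "v \<noteq> []"
      then obtain b v' where v: "v = b # v'" by (cases v) auto
      show False
      proof (cases u rule: rev_cases)
        case Nil
        hence "base t = A" using uv(2) base_subset[OF t] by simp
        moreover have "base t = B" using Nil uv(1) Cons.prems(2) altw base_eq[of B t] by simp
        ultimately show False using Cons.prems(3) by simp
      next
        case (snoc u' c)
        hence "c \<in> A \<and> b \<in> A \<or> c \<in> B \<and> b \<in> B"
          using alternates_inner[of B A u' c t b v'] altw uv(1) v by auto
        moreover have "c \<noteq> \<one>" "b \<noteq> \<one>" using l snoc v by (auto elim: letterE)
        ultimately have "base c = base b" using base_eq Cons.prems(1,2) by metis
        thus False using reduced_consecutive[of "\<rho> # u'" c b v'] r snoc v by simp
      qed
    qed
    hence r': "reduced (\<rho> # u)" "alternates A B (\<rho> # u)" "prod_word (\<rho> # u) = prod_word w"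
      using r uv altw alternates_append_left[of B A u "[t]"] by auto
    note ab = alternates_both[OF Cons.prems(1-3) r'(1) True r'(2) altw r'(3)]
    define m where "m = length (\<rho> # u)"
    have "w \<noteq> []" using uv by simp
    hence b: "hd w \<in> B - {\<one>}" using altw by (cases w) auto
    have eq: "\<rho> # u = alternating m \<rho> (hd w)" "w = alternating m (hd w) \<rho>"
      using ab(1,2) unfolding m_def by (simp_all only: list.sel list.distinct not_False_eq_True)
    have "braid_pair m \<rho> (hd w)" using eq r' True unfolding braid_pair_def by metis
    moreover have "\<rho> \<in> A - {\<one>}" "2 \<le> m" using uv(3,4) ab(4) by (auto simp: m_def)
    ultimately show ?thesis
      using braid_pair_braided[OF Cons.prems(1-3) _ b] by blast
  qed
qed

end

text \<open>\<open>f\<close> is prescribed on the basis subgroups only. The target is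
  \<open>rep_word_eq\<close>: words with the same value in \<open>G\<close> have the same image in
  \<open>K\<close>, so every relation of \<open>G\<close> follows from those of the factors and the
  braid relations.\<close>

locale braid_representation = gated_basis G \<B> gate + K: group K
  for G (structure) and \<B> gate and K (structure) +
  fixes f :: "'a \<Rightarrow> 'c"
  assumes rep_closed: "B \<in> \<B> \<Longrightarrow> b \<in> B \<Longrightarrow> f b \<in> carrier K"
    and rep_mult: "B \<in> \<B> \<Longrightarrow> a \<in> B \<Longrightarrow> b \<in> B \<Longrightarrow> f (a \<otimes> b) = f a \<otimes>\<^bsub>K\<^esub> f b"
    and rep_braid: "A \<in> \<B> \<Longrightarrow> B \<in> \<B> \<Longrightarrow> A \<noteq> B \<Longrightarrow> a \<in> A - {\<one>} \<Longrightarrow> b \<in> B - {\<one>} \<Longrightarrow>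
      braided A B m \<Longrightarrow>
      K.prod_word (map f (alternating m a b)) = K.prod_word (map f (alternating m b a))"
begin

lemma rep_word_closed: "set w \<subseteq> letters \<B> \<Longrightarrow> set (map f w) \<subseteq> carrier K"
  using rep_closed by (auto elim!: letterE)

lemma rep_one: "B \<in> \<B> \<Longrightarrow> f \<one> = \<one>\<^bsub>K\<^esub>"
  using rep_mult[of B \<one> \<one>] rep_closed[of B \<one>] by simp

lemma rep_reduced:
  assumes "reduced v" "reduced w" "prod_word v = prod_word w"
  shows "K.prod_word (map f v) = K.prod_word (map f w)"
  using assms
proof (induction "length v" arbitrary: v w)
  case 0
  hence "length w = 0" using len_reduced by metis
  thus ?case using 0 by simp
next
  case (Suc n)
  have lw: "length w = Suc n" using Suc.hyps(2) Suc.prems len_reduced by metis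
  obtain s x where v: "v = s # x" using Suc.hyps(2) by (cases v) auto
  obtain t y where w: "w = t # y" using lw by (cases w) auto
  have s: "s \<in> letters \<B>" "reduced x" "s \<in> carrier G" "base s \<in> \<B>" "s \<in> base s" "s \<noteq> \<one>"
    using Suc.prems(1) v letters_carrier base_mem'[of s] by (auto simp: reduced_Cons)
  have t: "t \<in> letters \<B>" "reduced y" "t \<in> carrier G" "base t \<in> \<B>" "t \<in> base t" "t \<noteq> \<one>"
    using Suc.prems(2) w letters_carrier base_mem'[of t] by (auto simp: reduced_Cons)
  have xc: "prod_word x \<in> carrier G" "prod_word y \<in> carrier G"
    using word_carrier[OF reduced_letters[OF s(2)]] word_carrier[OF reduced_letters[OF t(2)]] by auto
  have eqst: "s \<otimes> prod_word x = t \<otimes> prod_word y" using Suc.prems(3) v w by simp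
  have n: "length x = n" "length y = n" using Suc.hyps(2) v w lw by auto
  show ?case
  proof (cases "base s = base t")
    case True
    have "s = t"
      using gate_reduced_Cons[of s x] gate_reduced_Cons[of t y] Suc.prems v w True by metis
    hence "prod_word x = prod_word y" using eqst xc s by simp
    thus ?thesis using Suc.hyps(1)[OF n(1)[symmetric] s(2) t(2)] v w \<open>s = t\<close> by simp
  next
    case False
    define g where "g = prod_word v"
    have g: "g \<in> carrier G" "len g = Suc n" "inv s \<otimes> g = prod_word x" "inv t \<otimes> g = prod_word y"
      using xc s(3) t(3) len_reduced[OF Suc.prems(1)] Suc.hyps(2)
      by (auto simp: g_def v) (simp add: eqst)
    have "len (inv s \<otimes> g) < len g" "len (inv t \<otimes> g) < len g"
      using g len_reduced[OF s(2)] len_reduced[OF t(2)] n by auto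
    then obtain m k where mk: "braided (base s) (base t) m" "k \<in> carrier G"
        "g = prod_word (alternating m s t) \<otimes> k"
        "\<And>q. q \<in> generate G (base s \<union> base t) \<Longrightarrow> len (q \<otimes> k) = len q + len k"
      using dihedral_descent[OF s(4) t(4) False _ _ g(1), of s t] s t by auto
    have bp: "braid_pair m s t" "2 \<le> m" using mk(1) s t by (auto simp: braided_def)
    obtain m' where m: "m = Suc m'" using bp(2) by (cases m) auto
    obtain u where u: "reduced u" "prod_word u = k" using carrier_reduced_word[OF mk(2)] by blast
    have red: "reduced (alternating m s t)" "reduced (alternating m t s)"
      "prod_word (alternating m s t) = prod_word (alternating m t s)"
      using bp by (auto simp: braid_pair_def)
    have l: "set (alternating m s t) \<subseteq> letters \<B>" "set (alternating m t s) \<subseteq> letters \<B>" "set u \<subseteq> letters \<B>"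
      using red u reduced_letters by auto
    have pg: "prod_word (alternating m s t @ u) = g" "prod_word (alternating m t s @ u) = g"
      using mk(3) u(2) red(3) word_carrier[OF l(1)] word_carrier[OF l(2)] word_carrier[OF l(3)] by auto
    have "alternates (base s) (base t) (alternating m s t)"
      using s t by (intro alternates_alternating) auto
    hence "prod_word (alternating m s t) \<in> generate G (\<Union>{base s, base t})"
      by (intro prod_word_generate alternates_letters)
    hence "len g = m + len k"
      using mk(3) mk(4)[of "prod_word (alternating m s t)"] len_reduced[OF red(1)] by simp
    hence "length (alternating m s t @ u) = len g" using len_reduced[OF u(1)] u(2) by simp
    hence r: "reduced (alternating m s t @ u)" "reduced (alternating m t s @ u)"
      using reduced_iff_len[of "alternating m s t @ u"] reduced_iff_len[of "alternating m t s @ u"] l pg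
      by auto
    have step: "K.prod_word (map f (c # z)) = K.prod_word (map f (c # z'))"
      if "reduced (c # z)" "reduced (c # z')" "prod_word (c # z) = prod_word (c # z')" "length z = n"
      for c z z'
    proof -
      have c: "c \<in> carrier G" "reduced z" "reduced z'"
        using that letters_carrier by (auto simp: reduced_Cons)
      hence "prod_word z = prod_word z'"
        using that(3) word_carrier[OF reduced_letters[OF c(2)]] word_carrier[OF reduced_letters[OF c(3)]]
        by auto
      thus ?thesis using Suc.hyps(1)[OF that(4)[symmetric] c(2,3)] by simp
    qed
    have "K.prod_word (map f (s # x)) = K.prod_word (map f (s # alternating m' t s @ u))"
      using Suc.prems v pg r n m by (intro step) (auto simp: g_def)
    also have "\<dots> = K.prod_word (map f (alternating m s t)) \<otimes>\<^bsub>K\<^esub> K.prod_word (map f u)"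
      using rep_word_closed[OF l(1)] rep_word_closed[OF l(3)] m by (simp add: K.m_assoc)
    also have "K.prod_word (map f (alternating m s t)) = K.prod_word (map f (alternating m t s))"
      by (rule rep_braid[OF s(4) t(4) False _ _ mk(1)]) (use s t in auto)
    also have "\<dots> \<otimes>\<^bsub>K\<^esub> K.prod_word (map f u) = K.prod_word (map f (t # alternating m' s t @ u))"
      using rep_word_closed[OF l(2)] rep_word_closed[OF l(3)] m by (simp add: K.m_assoc)
    also have "\<dots> = K.prod_word (map f (t # y))"
      using Suc.prems v w pg r n m by (intro step[symmetric]) (auto simp: g_def)
    finally show ?thesis using v w by simp
  qed
qed

text \<open>A letter put in front of a reduced word either keeps it reduced or, after an exchange,
  merges with the new first letter. The image survives the exchange by \<open>rep_reduced\<close>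
  and the merging by \<open>rep_mult\<close>.\<close>

lemma rep_reduced_word:
  assumes "set w \<subseteq> letters \<B>"
  shows "\<exists>r. reduced r \<and> prod_word r = prod_word w \<and> K.prod_word (map f r) = K.prod_word (map f w)"
  using assms
proof (induction w)
  case Nil
  show ?case by (rule exI[of _ "[]"]) (simp add: reduced_def)
next
  case (Cons s w)
  then obtain r where r: "reduced r" "prod_word r = prod_word w"
    "K.prod_word (map f r) = K.prod_word (map f w)" by auto
  have s: "s \<in> letters \<B>" "s \<in> carrier G" "base s \<in> \<B>" "s \<in> base s" "s \<noteq> \<one>"
    using Cons.prems letters_carrier base_mem'[of s] by auto
  show ?case
  proof (cases "base s \<in> set (walls r)")
    case False
    hence "reduced (s # r)" using r s by (simp add: reduced_Cons)
    thus ?thesis using r by (intro exI[of _ "s # r"]) simp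
  next
    case True
    then obtain u t v \<rho> where uv: "r = u @ t # v" "\<rho> \<in> base s" "\<rho> \<noteq> \<one>"
      "prod_word r = \<rho> \<otimes> prod_word (u @ v)"
      using exchange[OF reduced_letters[OF r(1)] True s(3)] by metis
    have l: "set (\<rho> # u @ v) \<subseteq> letters \<B>"
      using reduced_letters[OF r(1)] uv letterI[OF s(3) uv(2,3)] by simp
    have "len (prod_word (\<rho> # u @ v)) = length (\<rho> # u @ v)"
      using len_reduced[OF r(1)] uv by simp
    hence red: "reduced (\<rho> # u @ v)" using reduced_iff_len[OF l] by blast
    have "K.prod_word (map f r) = K.prod_word (map f (\<rho> # u @ v))"
      using rep_reduced[OF r(1) red] uv by simp
    hence fr: "K.prod_word (map f w) = f \<rho> \<otimes>\<^bsub>K\<^esub> K.prod_word (map f (u @ v))" using r by simp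
    have pw: "prod_word w = \<rho> \<otimes> prod_word (u @ v)" using r uv by simp
    have luv: "set (u @ v) \<subseteq> letters \<B>" using l by simp
    have c: "\<rho> \<in> carrier G" "prod_word (u @ v) \<in> carrier G"
      using word_carrier[OF luv] basis_carrier[OF s(3) uv(2)] by blast+
    have kc: "f s \<in> carrier K" "f \<rho> \<in> carrier K" "K.prod_word (map f (u @ v)) \<in> carrier K"
      using rep_closed[OF s(3)] s(4) uv(2) K.prod_word_closed[OF rep_word_closed[OF luv]] by auto
    have e1: "prod_word (s # w) = (s \<otimes> \<rho>) \<otimes> prod_word (u @ v)"
      using pw c s by (simp add: m_assoc del: prod_word_append)
    have e2: "K.prod_word (map f (s # w)) = f (s \<otimes> \<rho>) \<otimes>\<^bsub>K\<^esub> K.prod_word (map f (u @ v))"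
      using fr kc rep_mult[OF s(3,4) uv(2)] by (simp add: K.m_assoc del: map_append)
    have ruv: "reduced (u @ v)" using red by (simp add: reduced_Cons)
    show ?thesis
    proof (cases "s \<otimes> \<rho> = \<one>")
      case True
      hence "prod_word (u @ v) = prod_word (s # w)" using e1 c by (simp del: prod_word_append)
      moreover have "K.prod_word (map f (u @ v)) = K.prod_word (map f (s # w))"
        using e2 True kc rep_one[OF s(3)] by (simp del: map_append)
      ultimately show ?thesis using ruv by blast
    next
      case False
      have m: "s \<otimes> \<rho> \<in> base s" using basis_mult[OF s(3,4) uv(2)] .
      have "base \<rho> = base s" "base (s \<otimes> \<rho>) = base s" using base_eq s(3) uv m False by auto
      hence "reduced ((s \<otimes> \<rho>) # u @ v)"
        using red letterI[OF s(3) m False] by (simp add: reduced_Cons)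
      moreover have "prod_word ((s \<otimes> \<rho>) # u @ v) = prod_word (s # w)"
        using e1 by (simp del: prod_word_append)
      moreover have "K.prod_word (map f ((s \<otimes> \<rho>) # u @ v)) = K.prod_word (map f (s # w))"
        using e2 by simp
      ultimately show ?thesis by blast
    qed
  qed
qed

lemma rep_word_eq:
  assumes "set v \<subseteq> letters \<B>" "set w \<subseteq> letters \<B>" "prod_word v = prod_word w"
  shows "K.prod_word (map f v) = K.prod_word (map f w)"
  using rep_reduced_word[OF assms(1)] rep_reduced_word[OF assms(2)] rep_reduced assms(3) by metis

end

section \<open>Distances and cycles in graphs\<close>

lemma walk_betw_single [simp]: "walk_betw X x [z] y \<longleftrightarrow> x \<in> verts X \<and> z = x \<and> y = x"
  by (auto simp: walk_betw_def)

lemma walk_betw_Cons: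
  "walk_betw X x (z # w # p) y \<longleftrightarrow> z = x \<and> x \<in> verts X \<and> adj X x w \<and> walk_betw X w (w # p) y"
  by (auto simp: walk_betw_def)

lemma walk_betw_append:
  assumes "walk_betw X x p y" "walk_betw X y q z"
  shows "walk_betw X x (p @ tl q) z"
proof (cases q)
  case (Cons b q')
  show ?thesis
  proof (cases q')
    case Nil
    thus ?thesis using assms Cons by (auto simp: walk_betw_def)
  next
    case (Cons c q'')
    thus ?thesis using assms \<open>q = b # q'\<close> by (auto simp: walk_betw_def successively_append_iff)
  qed
qed (use assms in \<open>auto simp: walk_betw_def\<close>)

lemma walk_betw_split:
  assumes "walk_betw X x (u @ z # v) y"
  shows "walk_betw X x (u @ [z]) z" "walk_betw X z (z # v) y"
  using assms by (auto simp: walk_betw_def successively_append_iff hd_append)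

lemma walk_betw_rev:
  assumes "simple_graph X" "walk_betw X x p y"
  shows "walk_betw X y (rev p) x"
  using assms
  by (auto simp: walk_betw_def hd_rev last_rev simple_graph_def elim!: successively_mono)

lemma walk_betw_mono:
  assumes "walk_betw X x p y" "set p \<subseteq> verts Y"
    "\<And>a b. a \<in> set p \<Longrightarrow> b \<in> set p \<Longrightarrow> adj X a b \<Longrightarrow> adj Y a b"
  shows "walk_betw Y x p y"
  using assms by (auto simp: walk_betw_def elim: successively_mono)

lemma gdist_le: "walk_betw X x p y \<Longrightarrow> length p = Suc n \<Longrightarrow> gdist X x y \<le> n"
  unfolding gdist_def by (rule Least_le) blast

lemma gdist_attained:
  assumes "walk_betw X x p y"
  obtains q where "walk_betw X x q y" "length q = Suc (gdist X x y)"
proof -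
  have "length p = Suc (length p - 1)" using assms by (cases p) (auto simp: walk_betw_def)
  hence "\<exists>n q. walk_betw X x q y \<and> length q = Suc n" using assms by blast
  from LeastI_ex[OF this] show thesis using that unfolding gdist_def by blast
qed

locale simple_connected_graph =
  fixes X :: "'v ugraph"
  assumes simple: "simple_graph X" and connected: "connected_graph X"
begin

lemma adj_verts: "adj X x y \<Longrightarrow> x \<in> verts X \<and> y \<in> verts X \<and> x \<noteq> y"
  using simple by (simp add: simple_graph_def)

lemma adj_sym: "adj X x y \<longleftrightarrow> adj X y x"
  using simple unfolding simple_graph_def by metis

lemma geodesic:
  assumes "x \<in> verts X" "y \<in> verts X"
  obtains p where "walk_betw X x p y" "length p = Suc (gdist X x y)"
  using assms connected gdist_attained unfolding connected_graph_def by metis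

lemma gdist_self [simp]: "x \<in> verts X \<Longrightarrow> gdist X x x = 0"
  using gdist_le[of X x "[x]" x 0] by simp

lemma gdist_eq_0_iff: "x \<in> verts X \<Longrightarrow> y \<in> verts X \<Longrightarrow> gdist X x y = 0 \<longleftrightarrow> x = y"
proof
  assume a: "x \<in> verts X" "y \<in> verts X" "gdist X x y = 0"
  then obtain p where "walk_betw X x p y" "length p = 1" using geodesic by (metis One_nat_def)
  thus "x = y" by (cases p) auto
qed simp

lemma gdist_eq_1_iff: "x \<in> verts X \<Longrightarrow> y \<in> verts X \<Longrightarrow> gdist X x y = 1 \<longleftrightarrow> adj X x y"
proof
  assume a: "x \<in> verts X" "y \<in> verts X" "gdist X x y = 1"
  then obtain p where p: "walk_betw X x p y" "length p = Suc (Suc 0)" using geodesic by (metis One_nat_def)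
  then obtain a b where "p = [a, b]" by (metis length_0_conv length_Suc_conv)
  thus "adj X x y" using p by (simp add: walk_betw_Cons)
next
  assume a: "x \<in> verts X" "y \<in> verts X" "adj X x y"
  have "gdist X x y \<le> 1" using a by (intro gdist_le[of X x "[x, y]"]) (auto simp: walk_betw_Cons)
  moreover have "gdist X x y \<noteq> 0" using a gdist_eq_0_iff adj_verts by blast
  ultimately show "gdist X x y = 1" by simp
qed

lemma gdist_triangle:
  assumes "x \<in> verts X" "y \<in> verts X" "z \<in> verts X"
  shows "gdist X x z \<le> gdist X x y + gdist X y z"
proof -
  obtain p q where "walk_betw X x p y" "length p = Suc (gdist X x y)"
    "walk_betw X y q z" "length q = Suc (gdist X y z)"
    using assms geodesic by metis
  thus ?thesis using gdist_le[OF walk_betw_append, of X x p y q z] by simp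
qed

lemma gdist_sym:
  assumes "x \<in> verts X" "y \<in> verts X"
  shows "gdist X x y = gdist X y x"
proof -
  have "gdist X x y \<le> gdist X y x" if xy: "x \<in> verts X" "y \<in> verts X" for x y
  proof -
    obtain p where p: "walk_betw X y p x" "length p = Suc (gdist X y x)" using geodesic xy by blast
    show ?thesis using gdist_le[OF walk_betw_rev[OF simple p(1)]] p(2) by simp
  qed
  thus ?thesis using assms by (simp add: le_antisym)
qed

lemma geodesic_interval:
  assumes "walk_betw X x p y" "length p = Suc (gdist X x y)" "z \<in> set p"
  shows "z \<in> interval X x y"
proof -
  obtain u v where p: "p = u @ z # v" using assms(3) by (meson split_list)
  note w = walk_betw_split[OF assms(1)[unfolded p]]
  have "gdist X x z \<le> length u" "gdist X z y \<le> length v"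
    using gdist_le[OF w(1)] gdist_le[OF w(2)] by auto
  moreover have v: "x \<in> verts X" "y \<in> verts X" "z \<in> verts X"
    using assms(1,3) by (auto simp: walk_betw_def)
  hence "gdist X x y \<le> gdist X x z + gdist X z y" using gdist_triangle by blast
  ultimately show ?thesis using assms(2) v by (auto simp: interval_def p)
qed

lemma convex_geodesic:
  assumes "convex_subgraph X S" "x \<in> S" "y \<in> S"
  obtains p where "walk_betw X x p y" "length p = Suc (gdist X x y)" "set p \<subseteq> S"
proof -
  have "x \<in> verts X" "y \<in> verts X" using assms by (auto simp: convex_subgraph_def)
  then obtain p where p: "walk_betw X x p y" "length p = Suc (gdist X x y)" using geodesic by blast
  moreover have "set p \<subseteq> S"
    using geodesic_interval[OF p] assms unfolding convex_subgraph_def by blast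
  ultimately show thesis using that by blast
qed

text \<open>Geodesics between vertices of a convex set stay inside the set.\<close>

lemma gdist_induced_convex:
  assumes "convex_subgraph X S" "x \<in> S" "y \<in> S"
  shows "gdist (induced X S) x y = gdist X x y"
proof (rule antisym)
  obtain p where p: "walk_betw X x p y" "length p = Suc (gdist X x y)" "set p \<subseteq> S"
    using convex_geodesic[OF assms] by blast
  have w: "walk_betw (induced X S) x p y"
    by (rule walk_betw_mono[OF p(1)]) (use p(1,3) in \<open>auto simp: induced_def walk_betw_def\<close>)
  thus "gdist (induced X S) x y \<le> gdist X x y" using p(2) by (rule gdist_le)
  obtain q where q: "walk_betw (induced X S) x q y" "length q = Suc (gdist (induced X S) x y)"
    using gdist_attained[OF w] by blast
  have "walk_betw X x q y"
    by (rule walk_betw_mono[OF q(1)]) (use q(1) in \<open>auto simp: induced_def walk_betw_def\<close>)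
  thus "gdist X x y \<le> gdist (induced X S) x y" using q(2) by (rule gdist_le)
qed

end

text \<open>A convex even cycle is handled through a periodic parametrisation by the integers.\<close>

definition cycle_param :: "'v ugraph \<Rightarrow> nat \<Rightarrow> (int \<Rightarrow> 'v) \<Rightarrow> bool" where
  "cycle_param X m \<gamma> \<longleftrightarrow> 2 \<le> m \<and> (\<forall>i. \<gamma> i \<in> verts X) \<and> (\<forall>i. \<gamma> (i + 2 * int m) = \<gamma> i) \<and>
     (\<forall>i. \<forall>j\<le>m. gdist X (\<gamma> i) (\<gamma> (i + int j)) = j)"

lemma cycle_param_short:
  "cycle_param X m \<gamma> \<Longrightarrow> j \<le> m \<Longrightarrow> gdist X (\<gamma> i) (\<gamma> (i + int j)) = j"
  by (simp add: cycle_param_def)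

lemma graph_iso_inv:
  assumes "graph_iso X Y f"
  shows "graph_iso Y X (inv_into (verts X) f)"
proof -
  have f: "bij_betw f (verts X) (verts Y)"
    "\<And>x y. x \<in> verts X \<Longrightarrow> y \<in> verts X \<Longrightarrow> adj Y (f x) (f y) \<longleftrightarrow> adj X x y"
    using assms by (auto simp: graph_iso_def)
  have "inv_into (verts X) f x \<in> verts X \<and> f (inv_into (verts X) f x) = x" if "x \<in> verts Y" for x
    using that f(1) bij_betw_inv_into_right[OF f(1)] bij_betw_apply[OF bij_betw_inv_into[OF f(1)]] by blast
  thus ?thesis using f bij_betw_inv_into[OF f(1)] unfolding graph_iso_def by metis
qed

context simple_connected_graph
begin

lemma cycle_param_periodic:
  assumes "cycle_param X m \<gamma>"
  shows "\<gamma> (i + 2 * int m * k) = \<gamma> i"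
proof -
  have *: "\<gamma> (i + 2 * int m * int n) = \<gamma> i" for i n
  proof (induction n)
    case (Suc n)
    have "\<gamma> (i + 2 * int m * int (Suc n)) = \<gamma> (i + 2 * int m * int n + 2 * int m)"
      by (simp add: algebra_simps)
    thus ?case using Suc assms by (simp add: cycle_param_def)
  qed simp
  show ?thesis
  proof (cases "0 \<le> k")
    case False
    have "\<gamma> (i + 2 * int m * k + 2 * int m * int (nat (- k))) = \<gamma> (i + 2 * int m * k)"
      by (rule *)
    thus ?thesis using False by simp
  qed (use *[of i "nat k"] in simp)
qed

lemma cycle_param_dist:
  assumes "cycle_param X m \<gamma>" "j \<le> 2 * m"
  shows "gdist X (\<gamma> i) (\<gamma> (i + int j)) = min j (2 * m - j)"
proof (cases "j \<le> m")
  case True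
  thus ?thesis using assms by (simp add: cycle_param_def)
next
  case False
  have g: "\<gamma> k \<in> verts X" for k using assms(1) by (simp add: cycle_param_def)
  have "gdist X (\<gamma> (i + int j)) (\<gamma> (i + int j + int (2 * m - j))) = 2 * m - j"
    by (rule cycle_param_short[OF assms(1)]) (use False in simp)
  moreover have "i + int j + int (2 * m - j) = i + 2 * int m" using assms(2) by simp
  moreover have "\<gamma> (i + 2 * int m) = \<gamma> i" using assms(1) by (simp add: cycle_param_def)
  ultimately have "gdist X (\<gamma> (i + int j)) (\<gamma> i) = 2 * m - j" by simp
  thus ?thesis using False gdist_sym[OF g g] by (simp add: min_def)
qed

lemma cycle_param_adj:
  assumes "cycle_param X m \<gamma>"
  shows "adj X (\<gamma> i) (\<gamma> (i + 1))" "adj X (\<gamma> i) (\<gamma> (i - 1))"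
proof -
  have g: "\<gamma> k \<in> verts X" for k using assms by (simp add: cycle_param_def)
  have "gdist X (\<gamma> k) (\<gamma> (k + 1)) = 1" for k
    using cycle_param_dist[OF assms, of 1 k] assms by (simp add: cycle_param_def)
  hence *: "adj X (\<gamma> k) (\<gamma> (k + 1))" for k using gdist_eq_1_iff[OF g g] by blast
  show "adj X (\<gamma> i) (\<gamma> (i + 1))" by (rule *)
  show "adj X (\<gamma> i) (\<gamma> (i - 1))" using *[of "i - 1"] adj_sym by simp
qed

lemma cycle_param_range:
  assumes "cycle_param X m \<gamma>" "x \<in> range \<gamma>"
  obtains j where "j < 2 * m" "x = \<gamma> (i + int j)"
proof -
  obtain k where k: "x = \<gamma> k" using assms(2) by blast
  have m: "2 \<le> m" using assms(1) by (simp add: cycle_param_def)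
  define j where "j = nat ((k - i) mod (2 * int m))"
  have "int j = (k - i) mod (2 * int m)" using m by (simp add: j_def)
  moreover have "k = i + (k - i) mod (2 * int m) + 2 * int m * ((k - i) div (2 * int m))"
    by (metis add.assoc add_diff_cancel_left' diff_add_cancel mod_mult_div_eq)
  ultimately have "x = \<gamma> (i + int j + 2 * int m * ((k - i) div (2 * int m)))" using k by simp
  hence "x = \<gamma> (i + int j)" using cycle_param_periodic[OF assms(1)] by simp
  moreover have "(k - i) mod (2 * int m) < 2 * int m" using m by (intro pos_mod_bound) simp
  hence "j < 2 * m" using \<open>int j = _\<close> by linarith
  ultimately show thesis using that by blast
qed

lemma cycle_param_neighbour:
  assumes "cycle_param X m \<gamma>" "x \<in> range \<gamma>" "adj X (\<gamma> i) x"
  shows "x = \<gamma> (i + 1) \<or> x = \<gamma> (i - 1)"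
proof -
  obtain j where j: "j < 2 * m" "x = \<gamma> (i + int j)" using cycle_param_range[OF assms(1,2)] by blast
  have "gdist X (\<gamma> i) x = 1" using assms(3) gdist_eq_1_iff adj_verts by blast
  hence "min j (2 * m - j) = 1" using cycle_param_dist[OF assms(1), of j i] j by simp
  hence "j = 1 \<or> int j = 2 * int m - 1" using j(1) by (auto simp: min_def split: if_splits)
  thus ?thesis
  proof
    assume "int j = 2 * int m - 1"
    hence "i + int j = i - 1 + 2 * int m" by simp
    hence "x = \<gamma> (i - 1 + 2 * int m)" using j(2) by (simp only:)
    thus ?thesis using assms(1) by (simp add: cycle_param_def)
  qed (use j in simp)
qed

lemma cycle_param_bij:
  assumes "cycle_param X m \<gamma>"
  shows "bij_betw (\<lambda>k. \<gamma> (int k)) {..<2 * m} (range \<gamma>)"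
proof -
  have "a = b" if ab: "a \<le> b" "b < 2 * m" "\<gamma> (int a) = \<gamma> (int b)" for a b
  proof -
    have "\<gamma> (int b) \<in> verts X" using assms by (simp add: cycle_param_def)
    hence "gdist X (\<gamma> (int a)) (\<gamma> (int a + int (b - a))) = 0" using ab by simp
    hence "min (b - a) (2 * m - (b - a)) = 0"
      using cycle_param_dist[OF assms, of "b - a" "int a"] ab by simp
    thus ?thesis using ab by (simp add: min_def split: if_splits)
  qed
  hence "inj_on (\<lambda>k. \<gamma> (int k)) {..<2 * m}"
    by (intro inj_onI) (metis lessThan_iff nat_le_linear)
  moreover have "range \<gamma> \<subseteq> (\<lambda>k. \<gamma> (int k)) ` {..<2 * m}"
  proof
    fix x assume "x \<in> range \<gamma>"
    then obtain j where "j < 2 * m" "x = \<gamma> (0 + int j)" using cycle_param_range[OF assms] by blast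
    thus "x \<in> (\<lambda>k. \<gamma> (int k)) ` {..<2 * m}" by simp
  qed
  ultimately show ?thesis by (auto simp: bij_betw_def)
qed

lemma cycle_param_convex_even_cycle:
  assumes "cycle_param X m \<gamma>" "convex_subgraph X (range \<gamma>)"
  shows "convex_even_cycle X (range \<gamma>)"
    and "opposite_vertex X (range \<gamma>) (\<gamma> i) (\<gamma> (i + int m))"
proof -
  have m: "2 \<le> m" and g: "\<And>k. \<gamma> k \<in> verts X" using assms(1) by (auto simp: cycle_param_def)
  define f where "f = (\<lambda>k. \<gamma> (int k))"
  have bij: "bij_betw f {..<2 * m} (range \<gamma>)" using cycle_param_bij[OF assms(1)] by (simp add: f_def)
  have adj_less: "adj X (f a) (f b) \<longleftrightarrow> b = Suc a mod (2 * m) \<or> a = Suc b mod (2 * m)"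
    if ab: "a < b" "b < 2 * m" for a b
  proof -
    have "gdist X (f a) (f b) = min (b - a) (2 * m - (b - a))"
      using cycle_param_dist[OF assms(1), of "b - a" "int a"] ab by (simp add: f_def)
    hence "adj X (f a) (f b) \<longleftrightarrow> min (b - a) (2 * m - (b - a)) = 1"
      using gdist_eq_1_iff[OF g g, of "int a" "int b"] unfolding f_def by simp
    also have "\<dots> \<longleftrightarrow> b = Suc a \<or> (a = 0 \<and> Suc b = 2 * m)" using ab by (auto simp: min_def)
    also have "\<dots> \<longleftrightarrow> b = Suc a mod (2 * m) \<or> a = Suc b mod (2 * m)"
      using ab by (auto simp: mod_Suc)
    finally show ?thesis .
  qed
  have adj_f: "adj X (f a) (f b) \<longleftrightarrow> b = Suc a mod (2 * m) \<or> a = Suc b mod (2 * m)"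
    if ab: "a < 2 * m" "b < 2 * m" for a b
  proof (cases a b rule: linorder_cases)
    case equal
    thus ?thesis using adj_verts[of "f a" "f a"] ab m by (auto simp: mod_Suc split: if_splits)
  next
    case greater
    thus ?thesis using adj_less[of b a] ab adj_sym by auto
  qed (use adj_less ab in simp)
  have "graph_iso (cycle_graph (2 * m)) (induced X (range \<gamma>)) f"
    using bij g adj_f
    by (auto simp: graph_iso_def cycle_graph_def induced_def Int_absorb1 image_subset_iff f_def)
  hence "induced X (range \<gamma>) \<cong>\<^sub>g cycle_graph (2 * m)"
    using graph_iso_inv unfolding isomorphic_graphs_def by blast
  moreover have "3 \<le> 2 * m" "even (2 * m)" using m by auto
  ultimately show "convex_even_cycle X (range \<gamma>)"
    using assms(2) unfolding convex_even_cycle_def by blast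
  have "card (range \<gamma>) = 2 * m" using bij_betw_same_card[OF bij] by simp
  moreover have "gdist (induced X (range \<gamma>)) (\<gamma> i) (\<gamma> (i + int m)) = m"
    using gdist_induced_convex[OF assms(2)] assms(1) by (simp add: cycle_param_def)
  ultimately show "opposite_vertex X (range \<gamma>) (\<gamma> i) (\<gamma> (i + int m))"
    by (simp add: opposite_vertex_def)
qed

text \<open>An isomorphism with a cycle controls adjacency only. Convexity turns it into control of
  distances: a geodesic of \<open>X\<close> between two vertices of \<open>C\<close> stays in
  \<open>C\<close> and therefore runs along the cycle.\<close>

lemma convex_even_cycle_param:
  assumes "convex_even_cycle X C"
  obtains m \<gamma> where "cycle_param X m \<gamma>" "range \<gamma> = C"
proof -
  obtain n f where n: "3 \<le> n" "even n" "graph_iso (induced X C) (cycle_graph n) f"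
    and cv: "convex_subgraph X C"
    using assms by (auto simp: convex_even_cycle_def isomorphic_graphs_def)
  have CX: "C \<subseteq> verts X" using cv by (simp add: convex_subgraph_def)
  define h where "h = inv_into (verts (induced X C)) f"
  have "graph_iso (cycle_graph n) (induced X C) h" using graph_iso_inv[OF n(3)] by (simp add: h_def)
  hence h: "bij_betw h {..<n} C"
    "\<And>a b. a < n \<Longrightarrow> b < n \<Longrightarrow> adj X (h a) (h b) \<longleftrightarrow> (b = Suc a mod n \<or> a = Suc b mod n)"
    using CX by (auto simp: graph_iso_def cycle_graph_def induced_def Int_absorb1 bij_betw_def image_subset_iff)
  define \<gamma> where "\<gamma> = (\<lambda>i::int. h (nat (i mod int n)))"
  have nn: "nat (i mod int n) < n" for i using n(1) by (simp add: nat_less_iff)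
  have \<gamma>C: "\<gamma> i \<in> C" for i using bij_betw_apply[OF h(1)] nn by (simp add: \<gamma>_def)
  have per: "\<gamma> (i + int n * k) = \<gamma> i" for i k by (simp add: \<gamma>_def)
  have \<gamma>h: "\<gamma> (int a) = h a" if "a < n" for a using that by (simp add: \<gamma>_def)
  have surj: "\<exists>a<n. x = h a" if "x \<in> C" for x using that h(1) by (auto simp: bij_betw_def)
  have inj: "i mod int n = j mod int n" if "\<gamma> i = \<gamma> j" for i j
  proof -
    have "nat (i mod int n) = nat (j mod int n)"
      using that nn h(1) unfolding \<gamma>_def bij_betw_def inj_on_def by blast
    thus ?thesis using n(1) by (simp add: nat_eq_iff2)
  qed
  have suc: "Suc (nat (i mod int n)) mod n = nat ((i + 1) mod int n)" for i
  proof -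
    have "int (Suc (nat (i mod int n)) mod n) = (i mod int n + 1) mod int n"
      using n(1) by (simp add: zmod_int add.commute)
    also have "\<dots> = (i + 1) mod int n" by (simp add: mod_add_left_eq)
    finally show ?thesis by (metis nat_int)
  qed
  have adj_suc: "adj X (\<gamma> i) (\<gamma> (i + 1))" for i
    using h(2)[OF nn nn, of i "i + 1"] suc[of i] by (simp add: \<gamma>_def)
  have nb: "x = \<gamma> (i + 1) \<or> x = \<gamma> (i - 1)" if x: "x \<in> C" "adj X (\<gamma> i) x" for x i
  proof -
    obtain b where b: "b < n" "x = h b" using surj x(1) by blast
    hence "b = Suc (nat (i mod int n)) mod n \<or> nat (i mod int n) = Suc b mod n"
      using h(2)[OF nn[of i], of b] x(2) by (simp add: \<gamma>_def)
    thus ?thesis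
    proof
      assume "b = Suc (nat (i mod int n)) mod n"
      thus ?thesis using b(2) suc[of i] by (simp add: \<gamma>_def)
    next
      assume "nat (i mod int n) = Suc b mod n"
      hence "int (nat (i mod int n)) = (int b + 1) mod int n" by (simp add: zmod_int add.commute)
      hence "i mod int n = (int b + 1) mod int n" using n(1) by simp
      hence "(i - 1) mod int n = (int b + 1 - 1) mod int n" by (rule mod_diff_cong) simp
      hence "\<gamma> (i - 1) = \<gamma> (int b)" by (simp add: \<gamma>_def)
      thus ?thesis using b \<gamma>h by simp
    qed
  qed
  \<comment> \<open>Each edge of a walk inside \<open>C\<close> shifts the index by one, up or down;
    the number of edges is \<open>length p - 1\<close>.\<close>
  have walk: "\<exists>e. \<bar>e\<bar> \<le> int (length p) - 1 \<and> y = \<gamma> (i + e)"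
    if "walk_betw X (\<gamma> i) p y" "set p \<subseteq> C" for p i y
    using that
  proof (induction p arbitrary: i)
    case (Cons a p)
    show ?case
    proof (cases p)
      case Nil
      thus ?thesis using Cons.prems by (intro exI[of _ 0]) simp
    next
      case (Cons b q)
      hence b: "adj X (\<gamma> i) b" "walk_betw X b p y" "b \<in> C" "set p \<subseteq> C"
        using Cons.prems by (auto simp: walk_betw_Cons)
      obtain s where s: "\<bar>s\<bar> = 1" "b = \<gamma> (i + s)" using nb[OF b(3,1)] by (metis abs_1 abs_minus_cancel diff_conv_add_uminus)
      obtain e where "\<bar>e\<bar> \<le> int (length p) - 1" "y = \<gamma> (i + s + e)"
        using Cons.IH[of "i + s"] b s by auto
      thus ?thesis using s(1) by (intro exI[of _ "s + e"]) (auto simp: add.assoc)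
    qed
  qed (simp add: walk_betw_def)
  obtain m where m: "n = 2 * m" using n(2) by blast
  have up: "gdist X (\<gamma> i) (\<gamma> (i + int j)) \<le> j" for i j
  proof (induction j)
    case 0
    have "\<gamma> i \<in> verts X" using \<gamma>C CX by blast
    thus ?case by simp
  next
    case (Suc j)
    have v: "\<gamma> k \<in> verts X" for k using \<gamma>C CX by blast
    have "gdist X (\<gamma> (i + int j)) (\<gamma> (i + int j + 1)) = 1" using adj_suc gdist_eq_1_iff[OF v v] by blast
    thus ?case using gdist_triangle[OF v[of i] v[of "i + int j"] v[of "i + int j + 1"]] Suc
      by (simp add: add.assoc add.commute[of 1])
  qed
  have dist: "gdist X (\<gamma> i) (\<gamma> (i + int j)) = j" if j: "j \<le> m" for i j
  proof (rule antisym[OF up])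
    obtain p where p: "walk_betw X (\<gamma> i) p (\<gamma> (i + int j))" "length p = Suc (gdist X (\<gamma> i) (\<gamma> (i + int j)))"
      "set p \<subseteq> C" using convex_geodesic[OF cv \<gamma>C \<gamma>C] by blast
    then obtain e where e: "\<bar>e\<bar> \<le> int (gdist X (\<gamma> i) (\<gamma> (i + int j)))" "\<gamma> (i + int j) = \<gamma> (i + e)"
      using walk by fastforce
    \<comment> \<open>The total shift \<open>e\<close> agrees with \<open>j\<close> modulo
      \<open>2 * m\<close>. Since \<open>j \<le> m\<close>, no representative of this class has
      absolute value smaller than \<open>j\<close>.\<close>
    have "int n dvd (i + int j) - (i + e)" using inj[OF e(2)] by (simp add: mod_eq_dvd_iff)
    then obtain q where q: "int j - e = 2 * int m * q" using m by (auto simp: dvd_def)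
    have "int j \<le> \<bar>e\<bar>"
    proof (cases "q = 0")
      case False
      hence "2 * int m * 1 \<le> 2 * int m * \<bar>q\<bar>" by (intro mult_left_mono) auto
      also have "\<dots> = \<bar>int j - e\<bar>" by (simp add: q abs_mult)
      finally show ?thesis using j by linarith
    qed (use q in simp)
    thus "j \<le> gdist X (\<gamma> i) (\<gamma> (i + int j))" using e(1) by linarith
  qed
  have "\<gamma> (i + 2 * int m) = \<gamma> i" for i using per[of i 1] m by simp
  moreover have "\<gamma> i \<in> verts X" for i using \<gamma>C CX by blast
  moreover have "2 \<le> m" using n(1) m by linarith
  ultimately have "cycle_param X m \<gamma>"
    using dist unfolding cycle_param_def by blast
  moreover have "range \<gamma> = C"
  proof
    show "C \<subseteq> range \<gamma>" using surj \<gamma>h by (metis range_eqI subsetI)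
  qed (use \<gamma>C in blast)
  ultimately show thesis using that by blast
qed

lemma cycle_param_shift: "cycle_param X m \<gamma> \<Longrightarrow> cycle_param X m (\<lambda>i. \<gamma> (k + i))"
  unfolding cycle_param_def by (metis add.assoc)

lemma range_shift: "range (\<lambda>i. \<gamma> (k + i)) = range \<gamma>" for \<gamma> :: "int \<Rightarrow> 'v"
proof -
  have "\<gamma> i \<in> range (\<lambda>i. \<gamma> (k + i))" for i by (rule range_eqI[of _ _ "i - k"]) simp
  thus ?thesis by auto
qed

text \<open>Both arcs between opposite vertices are geodesics.\<close>

lemma cycle_param_interval:
  assumes "cycle_param X m \<gamma>"
  shows "range \<gamma> \<subseteq> interval X (\<gamma> i) (\<gamma> (i + int m))"
proof
  fix x assume x: "x \<in> range \<gamma>"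
  obtain j where j: "j < 2 * m" "x = \<gamma> (i + int j)" using cycle_param_range[OF assms x] by blast
  have g: "\<gamma> k \<in> verts X" for k using assms by (simp add: cycle_param_def)
  have d: "gdist X (\<gamma> i) x = min j (2 * m - j)" "gdist X (\<gamma> i) (\<gamma> (i + int m)) = m"
    using cycle_param_dist[OF assms, of j i] cycle_param_dist[OF assms, of m i] j by auto
  show "x \<in> interval X (\<gamma> i) (\<gamma> (i + int m))"
  proof (cases "j \<le> m")
    case True
    have "gdist X x (\<gamma> (i + int j + int (m - j))) = m - j"
      using cycle_param_dist[OF assms, of "m - j" "i + int j"] j by simp
    thus ?thesis using d True g j by (auto simp: interval_def)
  next
    case False
    have "gdist X (\<gamma> (i + int m)) (\<gamma> (i + int m + int (j - m))) = j - m"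
      using cycle_param_dist[OF assms, of "j - m" "i + int m"] j by simp
    hence "gdist X x (\<gamma> (i + int m)) = j - m" using gdist_sym[OF g g] False j by simp
    thus ?thesis using d False g j by (auto simp: interval_def)
  qed
qed

text \<open>A shortest arc of the cycle from one edge to the other is a geodesic of the graph, hence
  contained in \<open>S\<close>, and it leaves the edge from \<open>\<gamma> 0\<close> to
  \<open>\<gamma> 1\<close> through one of its two neighbours on the cycle.\<close>

lemma consecutive_in_convex:
  assumes "cycle_param X m \<gamma>" "convex_subgraph X S" "\<gamma> 0 \<in> S" "\<gamma> 1 \<in> S" "\<gamma> i \<in> S" "\<gamma> (i + 1) \<in> S"
    "{\<gamma> 0, \<gamma> 1} \<noteq> {\<gamma> i, \<gamma> (i + 1)}"
  shows "\<gamma> 2 \<in> S \<or> \<gamma> (- 1) \<in> S"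
proof -
  have g: "\<gamma> k \<in> verts X" for k using assms(1) by (simp add: cycle_param_def)
  have m: "2 \<le> m" using assms(1) by (simp add: cycle_param_def)
  obtain j where j: "j < 2 * m" "\<gamma> i = \<gamma> (0 + int j)" using cycle_param_range[OF assms(1), of "\<gamma> i" 0] by blast
  have j1: "\<gamma> (i + 1) = \<gamma> (int j + 1)"
  proof -
    have red: "\<gamma> (i + l) = \<gamma> (int (nat (i mod (2 * int m))) + l)" for l
    proof -
      have "i + l = (i mod (2 * int m) + l) + 2 * int m * (i div (2 * int m))" by simp
      hence "\<gamma> (i + l) = \<gamma> (i mod (2 * int m) + l)" using cycle_param_periodic[OF assms(1)] by metis
      thus ?thesis using m by simp
    qed
    have "nat (i mod (2 * int m)) < 2 * m" using m by (simp add: nat_less_iff)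
    moreover have "\<gamma> (int (nat (i mod (2 * int m)))) = \<gamma> (int j)" using red[of 0] j(2) by simp
    ultimately have "nat (i mod (2 * int m)) = j"
      using cycle_param_bij[OF assms(1)] j(1) unfolding bij_betw_def inj_on_def by auto
    thus ?thesis using red[of 1] by simp
  qed
  have j0: "j \<noteq> 0" using assms(7) j j1 by auto
  show ?thesis
  proof (cases "j < m")
    case True
    have "gdist X (\<gamma> 0) (\<gamma> (0 + int (j + 1))) = j + 1" "gdist X (\<gamma> 0) (\<gamma> (0 + int 2)) = 2"
      "gdist X (\<gamma> 2) (\<gamma> (2 + int (j - 1))) = j - 1"
      by (rule cycle_param_short[OF assms(1)], use True m in simp)+
    hence "\<gamma> 2 \<in> interval X (\<gamma> 0) (\<gamma> (int j + 1))"
      using g j0 by (simp add: interval_def algebra_simps)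
    moreover have "interval X (\<gamma> 0) (\<gamma> (int j + 1)) \<subseteq> S"
      using assms(2,3,6) j1 by (simp add: convex_subgraph_def)
    ultimately show ?thesis by blast
  next
    case False
    \<comment> \<open>For \<open>j \<ge> m\<close> the short way is backwards: by periodicity
      \<open>\<gamma> (int j)\<close> is \<open>\<gamma> (- int r)\<close>, at distance
      \<open>r \<le> m\<close> from \<open>\<gamma> 0\<close>, and the arc between them passes
      through \<open>\<gamma> (- 1)\<close>.\<close>
    define r where "r = 2 * m - j"
    have r: "1 \<le> r" "r \<le> m" using False j by (auto simp: r_def)
    have "\<gamma> (int j) = \<gamma> (- int r + 2 * int m)" using j by (simp add: r_def)
    hence e: "\<gamma> (int j) = \<gamma> (- int r)" using assms(1) unfolding cycle_param_def by metis
    have "gdist X (\<gamma> (- int r)) (\<gamma> (- int r + int r)) = r"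
      "gdist X (\<gamma> (- int r)) (\<gamma> (- int r + int (r - 1))) = r - 1"
      "gdist X (\<gamma> (- 1)) (\<gamma> (- 1 + int 1)) = 1"
      by (rule cycle_param_short[OF assms(1)], use r m in simp)+
    hence "\<gamma> (- 1) \<in> interval X (\<gamma> (- int r)) (\<gamma> 0)"
      using g r by (simp add: interval_def algebra_simps)
    moreover have "\<gamma> (- int r) \<in> S" using e j assms(5) by simp
    ultimately show ?thesis using assms(2,3) unfolding convex_subgraph_def by blast
  qed
qed

text \<open>Two consecutive edges of a convex even cycle determine it: applying the strong form of the
  cycle condition to the vertex opposite to their common endpoint recovers the whole cycle.\<close>

lemma mediangle_cycles:
  fixes cyc :: "'v \<Rightarrow> 'v \<Rightarrow> 'v \<Rightarrow> 'v set"
  assumes cyc: "\<And>v x y z. \<lbrakk>v \<in> verts X; adj X x z; adj X y z; x \<noteq> y;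
      gdist X v x = gdist X v y; gdist X v z = gdist X v x + 1\<rbrakk> \<Longrightarrow>
      \<exists>m \<gamma>. cycle_param X m \<gamma> \<and> range \<gamma> = cyc z x y \<and> convex_subgraph X (cyc z x y) \<and>
        \<gamma> 0 = z \<and> \<gamma> 1 = x \<and> \<gamma> (- 1) = y \<and>
        \<gamma> (int m) \<in> interval X v x \<inter> interval X v y"
  shows "cycle_condition X" "intersection_of_even_cycles X"
proof -
  show "cycle_condition X"
    unfolding cycle_condition_def
  proof (intro ballI impI, elim conjE)
    fix v x y z
    assume a: "v \<in> verts X" "x \<in> verts X" "y \<in> verts X" "z \<in> verts X" "x \<noteq> y"
      "gdist X v x = gdist X v y" "gdist X v z = gdist X v x + 1" "gdist X x z = 1" "gdist X y z = 1"
    hence "adj X x z" "adj X y z" using gdist_eq_1_iff by auto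
    then obtain m \<gamma> where g: "cycle_param X m \<gamma>" "range \<gamma> = cyc z x y" "convex_subgraph X (range \<gamma>)"
      "\<gamma> 0 = z" "\<gamma> 1 = x" "\<gamma> (- 1) = y" "\<gamma> (int m) \<in> interval X v x \<inter> interval X v y"
      using cyc[of v x z y] a by auto
    have "{\<gamma> 0, \<gamma> 1} \<in> edges (induced X (range \<gamma>))" "{\<gamma> 0, \<gamma> (- 1)} \<in> edges (induced X (range \<gamma>))"
      using cycle_param_adj[OF g(1), of 0] by (auto simp: edges_def induced_def)
    hence "{{z, x}, {z, y}} \<subseteq> edges (induced X (range \<gamma>))" using g by simp
    moreover have "opposite_vertex X (range \<gamma>) z (\<gamma> (int m))"
      using cycle_param_convex_even_cycle(2)[OF g(1,3), of 0] g(4) by simp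
    ultimately show "\<exists>C. convex_even_cycle X C \<and> {{z, x}, {z, y}} \<subseteq> edges (induced X C) \<and>
        (\<exists>w. opposite_vertex X C z w \<and> w \<in> interval X v x \<inter> interval X v y)"
      using cycle_param_convex_even_cycle(1)[OF g(1,3)] g(7) by blast
  qed
  \<comment> \<open>\<open>w\<close> is opposite to \<open>\<gamma> 0\<close>. The cycle
    \<open>\<delta>\<close> that the hypothesis provides for the two edges at
    \<open>\<gamma> 0\<close>, with distances measured from \<open>w\<close>, is shown to have
    \<open>w\<close> as its opposite vertex too. Both cycles then coincide with the interval from
    \<open>\<gamma> 0\<close> to \<open>w\<close>.\<close>
  have determined: "C = cyc (\<gamma> 0) (\<gamma> 1) (\<gamma> (- 1)) "
    if C: "convex_subgraph X C" "cycle_param X m \<gamma>" "range \<gamma> = C" for C m \<gamma>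
  proof -
    have g: "\<gamma> k \<in> verts X" for k using C(2) by (simp add: cycle_param_def)
    have m: "2 \<le> m" using C(2) by (simp add: cycle_param_def)
    define w where "w = \<gamma> (int m)"
    have dw: "gdist X w (\<gamma> k) = nat (int m - \<bar>k\<bar>)" if k: "\<bar>k\<bar> \<le> int m" for k
    proof (cases "0 \<le> k")
      case True
      have "gdist X (\<gamma> k) (\<gamma> (k + int (nat (int m - k)))) = nat (int m - k)"
        by (rule cycle_param_short[OF C(2)]) (use True in simp)
      moreover have "k + int (nat (int m - k)) = int m" using k by simp
      ultimately show ?thesis using gdist_sym[OF g g, of "int m" k] True by (simp add: w_def)
    next
      case False
      have "\<gamma> (int m) = \<gamma> (- int m)" using C(2) unfolding cycle_param_def
        by (metis add.commute add_diff_cancel_left' diff_conv_add_uminus mult_2)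
      moreover have "gdist X (\<gamma> (- int m)) (\<gamma> (- int m + int (nat (int m + k)))) = nat (int m + k)"
        by (rule cycle_param_short[OF C(2)]) (use False in simp)
      ultimately show ?thesis using False k by (simp add: w_def)
    qed
    have "adj X (\<gamma> 1) (\<gamma> 0)" "adj X (\<gamma> (- 1)) (\<gamma> 0)"
      using cycle_param_adj[OF C(2), of 0] adj_sym by auto
    moreover have "gdist X (\<gamma> (- 1)) (\<gamma> (- 1 + int 2)) = 2"
      by (rule cycle_param_short[OF C(2)]) (use m in simp)
    hence "\<gamma> 1 \<noteq> \<gamma> (- 1)" using g by auto
    moreover have "gdist X w (\<gamma> 1) = gdist X w (\<gamma> (- 1))" "gdist X w (\<gamma> 0) = gdist X w (\<gamma> 1) + 1"
      using dw[of 1] dw[of "- 1"] dw[of 0] m by auto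
    moreover have "w \<in> verts X" using g by (simp add: w_def)
    ultimately obtain n \<delta> where d: "cycle_param X n \<delta>" "range \<delta> = cyc (\<gamma> 0) (\<gamma> 1) (\<gamma> (- 1))"
      "convex_subgraph X (range \<delta>)" "\<delta> 0 = \<gamma> 0" "\<delta> 1 = \<gamma> 1" "\<delta> (- 1) = \<gamma> (- 1)"
      "\<delta> (int n) \<in> interval X w (\<gamma> 1) \<inter> interval X w (\<gamma> (- 1))"
      using cyc[of w "\<gamma> 1" "\<gamma> 0" "\<gamma> (- 1)"] by auto
    have "w \<in> C" "\<gamma> 1 \<in> C" "\<gamma> 0 \<in> C" using C by (auto simp: w_def)
    hence "\<delta> (int n) \<in> C" using d(7) C(1) unfolding convex_subgraph_def by blast
    \<comment> \<open>Starting the count at \<open>- int m\<close> puts the index \<open>k\<close>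
      between \<open>- m\<close> and \<open>m - 1\<close>. In this range only
      \<open>k = - m\<close>, which is \<open>w\<close> itself, lies on geodesics from
      \<open>w\<close> to both \<open>\<gamma> 1\<close> and \<open>\<gamma> (- 1)\<close>.\<close>
    then obtain j where j: "j < 2 * m" "\<delta> (int n) = \<gamma> (- int m + int j)"
      using cycle_param_range[OF C(2), of "\<delta> (int n)" "- int m"] C(3) by blast
    define k where "k = - int m + int j"
    have k: "\<bar>k\<bar> \<le> int m" "k < int m" "\<delta> (int n) = \<gamma> k" using j by (auto simp: k_def)
    have iv: "gdist X w (\<gamma> 1) = gdist X w (\<gamma> k) + gdist X (\<gamma> k) (\<gamma> 1)"
      "gdist X w (\<gamma> (- 1)) = gdist X w (\<gamma> k) + gdist X (\<gamma> k) (\<gamma> (- 1))"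
      using d(7) k(3) by (auto simp: interval_def)
    have "k = - int m"
    proof (rule ccontr)
      assume ne: "k \<noteq> - int m"
      show False
      proof (cases "0 \<le> k")
        case True
        have "gdist X (\<gamma> (- 1)) (\<gamma> (- 1 + int (nat (k + 1)))) = nat (k + 1)"
          by (rule cycle_param_short[OF C(2)]) (use k in simp)
        hence "gdist X (\<gamma> k) (\<gamma> (- 1)) = nat (k + 1)" using gdist_sym[OF g g] True by simp
        thus False using iv(2) dw[of k] dw[of "- 1"] k True m by simp
      next
        case False
        have "nat (1 - k) \<le> m" using ne k False by linarith
        hence "gdist X (\<gamma> k) (\<gamma> (k + int (nat (1 - k)))) = nat (1 - k)"
          by (rule cycle_param_short[OF C(2)])
        hence "gdist X (\<gamma> k) (\<gamma> 1) = nat (1 - k)" using False by simp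
        thus False using iv(1) dw[of k] dw[of 1] k False m by simp
      qed
    qed
    hence "gdist X w (\<delta> (int n)) = 0" using dw[of k] k by simp
    hence dn: "\<delta> (int n) = w" using gdist_eq_0_iff \<open>w \<in> verts X\<close> g k(3) by metis
    have "range \<delta> \<subseteq> interval X (\<gamma> 0) w" using cycle_param_interval[OF d(1), of 0] d(4) dn by simp
    moreover have "interval X (\<gamma> 0) w \<subseteq> C"
      using C(1) \<open>\<gamma> 0 \<in> C\<close> \<open>w \<in> C\<close> unfolding convex_subgraph_def by blast
    moreover have "C \<subseteq> interval X (\<gamma> 0) w"
      using cycle_param_interval[OF C(2), of 0] C(3) by (simp add: w_def)
    moreover have "\<gamma> 0 \<in> range \<delta>" "w \<in> range \<delta>" using d(4) dn by (metis rangeI)+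
    hence "interval X (\<gamma> 0) w \<subseteq> range \<delta>"
      using d(3) unfolding convex_subgraph_def by blast
    ultimately show ?thesis using d(2) by blast
  qed
  \<comment> \<open>A set of vertices has no orientation, whereas \<open>determined\<close> uses
    one; reversal settles the case in which \<open>x\<close> is
    \<open>\<gamma> (- 1)\<close>.\<close>
  have reflect: "cycle_param X m (\<lambda>i. \<gamma> (- i))" if p: "cycle_param X m \<gamma>" for m \<gamma>
  proof -
    have g: "\<gamma> k \<in> verts X" for k using p by (simp add: cycle_param_def)
    have "\<gamma> (- (i + 2 * int m)) = \<gamma> (- i)" for i
      using p unfolding cycle_param_def by (metis add.commute minus_add_cancel)
    moreover have "gdist X (\<gamma> (- i)) (\<gamma> (- (i + int j))) = j" if "j \<le> m" for i j
    proof -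
      have "gdist X (\<gamma> (- i - int j)) (\<gamma> (- i - int j + int j)) = j"
        by (rule cycle_param_short[OF p that])
      thus ?thesis using gdist_sym[OF g g] by (simp add: algebra_simps)
    qed
    ultimately show ?thesis using p unfolding cycle_param_def by blast
  qed
  have determined': "C = cyc z x y"
    if C: "convex_even_cycle X C" "z \<in> C" "x \<in> C" "y \<in> C" "adj X z x" "adj X z y" "x \<noteq> y" for C x y z
  proof -
    have cv: "convex_subgraph X C" using C(1) by (simp add: convex_even_cycle_def)
    obtain m \<gamma>0 where g0: "cycle_param X m \<gamma>0" "range \<gamma>0 = C" using convex_even_cycle_param[OF C(1)] by blast
    obtain k where k: "z = \<gamma>0 k" using g0 C(2) by blast
    define \<gamma> where "\<gamma> = (\<lambda>i. \<gamma>0 (k + i))"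
    have g: "cycle_param X m \<gamma>" "range \<gamma> = C" "\<gamma> 0 = z"
      using cycle_param_shift[OF g0(1)] range_shift[of \<gamma>0 k] g0(2) k by (auto simp: \<gamma>_def)
    have "x = \<gamma> 1 \<or> x = \<gamma> (- 1)" "y = \<gamma> 1 \<or> y = \<gamma> (- 1)"
      using cycle_param_neighbour[OF g(1), of x 0] cycle_param_neighbour[OF g(1), of y 0] C g by auto
    then consider "x = \<gamma> 1" "y = \<gamma> (- 1)" | "x = \<gamma> (- 1)" "y = \<gamma> 1" using C(7) by blast
    thus ?thesis
    proof cases
      case 1
      thus ?thesis using determined[OF cv g(1,2)] g(3) by simp
    next
      case 2
      have "range (\<lambda>i. \<gamma> (- i)) = C" using g(2) by (metis surj_uminus image_image)
      thus ?thesis using determined[OF cv reflect[OF g(1)]] 2 g(3) by simp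
    qed
  qed
  show "intersection_of_even_cycles X"
    unfolding intersection_of_even_cycles_def
  proof (intro allI impI ballI, elim conjE)
    fix C D e f
    assume CD: "convex_even_cycle X C" "convex_even_cycle X D" "C \<noteq> D"
      and ef: "e \<in> edges (induced X (C \<inter> D))" "f \<in> edges (induced X (C \<inter> D))"
    show "e = f"
    proof (rule ccontr)
      assume ne: "e \<noteq> f"
      have cv: "convex_subgraph X (C \<inter> D)"
        using CD(1,2) unfolding convex_even_cycle_def convex_subgraph_def by blast
      obtain a b c d where ab: "e = {a, b}" "f = {c, d}" "a \<in> C" "b \<in> C" "c \<in> C" "d \<in> C"
        "a \<in> D" "b \<in> D" "c \<in> D" "d \<in> D" "adj X a b" "adj X c d"
        using ef by (auto simp: edges_def induced_def)
      obtain m \<gamma>0 where g0: "cycle_param X m \<gamma>0" "range \<gamma>0 = C" using convex_even_cycle_param[OF CD(1)] by blast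
      obtain \<gamma> where g: "cycle_param X m \<gamma>" "range \<gamma> = C" "e = {\<gamma> 0, \<gamma> 1}"
      proof -
        obtain k where k: "a = \<gamma>0 k" using g0 ab by blast
        hence "b = \<gamma>0 (k + 1) \<or> b = \<gamma>0 (k - 1)" using cycle_param_neighbour[OF g0(1)] ab g0 by blast
        then obtain l where "e = {\<gamma>0 l, \<gamma>0 (l + 1)}" using k ab(1)
          by (metis diff_add_cancel insert_commute)
        thus thesis
          using that[OF cycle_param_shift[OF g0(1), of l]] range_shift[of \<gamma>0 l] g0(2) by simp
      qed
      obtain i where i: "f = {\<gamma> i, \<gamma> (i + 1)}"
      proof -
        obtain k where k: "c = \<gamma> k" using g ab by blast
        hence "d = \<gamma> (k + 1) \<or> d = \<gamma> (k - 1)" using cycle_param_neighbour[OF g(1)] ab g by blast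
        thus thesis using that k ab(2) by (metis diff_add_cancel insert_commute)
      qed
      have S: "\<gamma> 0 \<in> C \<inter> D" "\<gamma> 1 \<in> C \<inter> D" "\<gamma> i \<in> C \<inter> D" "\<gamma> (i + 1) \<in> C \<inter> D"
        using ab g(3) i by auto
      have gg: "\<gamma> k \<in> verts X" "2 \<le> m" for k using g(1) by (auto simp: cycle_param_def)
      have distinct: "\<gamma> k \<noteq> \<gamma> (k + 2)" for k
      proof -
        have "gdist X (\<gamma> k) (\<gamma> (k + int 2)) = 2" 
          by (rule cycle_param_short[OF g(1)]) (use gg(2) in simp)
        thus ?thesis using gg by auto
      qed
      \<comment> \<open>The intersection is convex, so two distinct common edges yield two
        consecutive common edges, and those determine the cycle.\<close>
      have "\<gamma> 2 \<in> C \<inter> D \<or> \<gamma> (- 1) \<in> C \<inter> D"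
        using consecutive_in_convex[OF g(1) cv S] ne g(3) i by simp
      then obtain k where k: "\<gamma> k \<in> C \<inter> D" "\<gamma> (k + 1) \<in> C \<inter> D" "\<gamma> (k - 1) \<in> C \<inter> D"
      proof
        assume "\<gamma> 2 \<in> C \<inter> D"
        thus thesis using that[of 1] S by simp
      next
        assume "\<gamma> (- 1) \<in> C \<inter> D"
        thus thesis using that[of 0] S by simp
      qed
      have "\<gamma> (k + 1) \<noteq> \<gamma> (k - 1)" using distinct[of "k - 1"] by (simp add: algebra_simps)
      hence "E = cyc (\<gamma> k) (\<gamma> (k + 1)) (\<gamma> (k - 1))" if "E = C \<or> E = D" for E
        using determined'[of E "\<gamma> k" "\<gamma> (k + 1)" "\<gamma> (k - 1)"] that CD k cycle_param_adj[OF g(1), of k] by auto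
      thus False using CD(3) by metis
    qed
  qed
qed

end

section \<open>The Cayley graph\<close>

lemma rev_alternating: "rev (alternating m a b) = (if even m then alternating m b a else alternating m a b)"
proof (induction m)
  case (Suc m)
  show ?case using alternating_append[of m 1 a b] Suc by simp
qed simp

context group
begin

lemma subgroup_card_two:
  assumes "subgroup B G" "card B = 2" "s \<in> B - {\<one>}"
  shows "B = {\<one>, s}" "s \<otimes> s = \<one>" "inv s = s"
proof -
  interpret B: subgroup B G by fact
  have "finite B" using assms(2) by (metis card.infinite zero_neq_numeral)
  moreover have "card {\<one>, s} = 2" "{\<one>, s} \<subseteq> B" using assms(3) by auto
  ultimately show B: "B = {\<one>, s}" using assms(2) card_subset_eq by metis
  have s: "s \<in> carrier G" using assms(3) by auto
  have "s \<otimes> s \<in> B" "s \<otimes> s \<noteq> s" using assms(3) s by auto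
  thus ss: "s \<otimes> s = \<one>" using B by blast
  show "inv s = s" using inv_equality[OF ss s s] .
qed

lemma alternating_carrier:
  "a \<in> carrier G \<Longrightarrow> b \<in> carrier G \<Longrightarrow> set (alternating m a b) \<subseteq> carrier G"
  by (induction m arbitrary: a b) auto

lemma prod_rev_alternating:
  assumes "a \<in> carrier G" "b \<in> carrier G" "inv a = a" "inv b = b"
  shows "prod_word (rev (alternating m a b)) = inv (prod_word (alternating m a b))"
proof -
  have "set (alternating m a b) \<subseteq> {a, b}" by (induction m arbitrary: a b) auto
  hence "map (m_inv G) (alternating m a b) = alternating m a b" using assms by (intro map_idI) auto
  thus ?thesis using prod_word_rev_inv[OF alternating_carrier[OF assms(1,2)], of m] by simp
qed

text \<open>Reversing an alternating word in two involutions inverts its value. The reversed word is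
  one of the two sides of the relation, whatever the parity of \<open>m\<close>, so the common value
  is its own inverse.\<close>

lemma prod_alternating_double:
  assumes "a \<in> carrier G" "b \<in> carrier G" "inv a = a" "inv b = b"
    "prod_word (alternating m a b) = prod_word (alternating m b a)"
  shows "prod_word (alternating (m + m) a b) = \<one>"
proof -
  define p where "p = prod_word (alternating m a b)"
  have c: "set (alternating m a b) \<subseteq> carrier G" "set (alternating m b a) \<subseteq> carrier G"
    using alternating_carrier assms by auto
  have "p = inv p"
    using prod_rev_alternating[OF assms(1-4), of m] assms(5) by (simp add: rev_alternating p_def split: if_splits)
  moreover have "p \<in> carrier G" using c by (auto simp: p_def)
  ultimately have "p \<otimes> p = \<one>" by (metis r_inv)
  thus ?thesis using c assms(5) by (simp add: alternating_append p_def)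
qed

text \<open>All the letters are powers of \<open>r\<close> and commute. The intended words are the
  contributions of one wall of order two along a relator.\<close>

lemma prod_word_rev_commuting:
  assumes "set w \<subseteq> {\<one>, r}" "r \<in> carrier G"
  shows "prod_word (rev w) = prod_word w"
proof -
  have c: "set v \<subseteq> carrier G" if "set v \<subseteq> {\<one>, r}" for v using that assms(2) by auto
  have comm: "prod_word v \<otimes> x = x \<otimes> prod_word v" if "set v \<subseteq> {\<one>, r}" "x \<in> {\<one>, r}" for v x
    using that
  proof (induction v)
    case Nil
    thus ?case using assms(2) by auto
  next
    case (Cons y v)
    have yx: "y \<otimes> x = x \<otimes> y" "y \<in> carrier G" "x \<in> carrier G" using Cons.prems assms(2) by auto
    have v: "prod_word v \<in> carrier G" "set v \<subseteq> {\<one>, r}" using Cons.prems c by auto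
    have "prod_word (y # v) \<otimes> x = y \<otimes> (prod_word v \<otimes> x)" using yx v by (simp add: m_assoc)
    also have "\<dots> = (y \<otimes> x) \<otimes> prod_word v" using Cons.IH[OF v(2) Cons.prems(2)] yx(2,3) v by (simp add: m_assoc)
    also have "\<dots> = (x \<otimes> y) \<otimes> prod_word v" by (simp only: yx(1))
    also have "\<dots> = x \<otimes> prod_word (y # v)" using yx(2,3) v by (simp add: m_assoc)
    finally show ?case .
  qed
  show ?thesis
    using assms(1)
  proof (induction w)
    case (Cons x w)
    hence "set w \<subseteq> {\<one>, r}" "x \<in> {\<one>, r}" by auto
    thus ?case using Cons.IH comm[of w x] c[of w] c[of "[x]"] by (simp add: insert_absorb)
  qed simp
qed

end

context gated_basis
begin

lemma verts_Cayl [simp]: "verts (Cayl G \<B>) = carrier G"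
  by (simp add: Cayl_def)

lemma adj_Cayl:
  "adj (Cayl G \<B>) g h \<longleftrightarrow> g \<in> carrier G \<and> h \<in> carrier G \<and> inv g \<otimes> h \<in> letters \<B>"
proof
  assume "adj (Cayl G \<B>) g h"
  then obtain s where "g \<in> carrier G" "s \<in> letters \<B>" "h = g \<otimes> s"
    by (auto simp: Cayl_def letters_def)
  thus "g \<in> carrier G \<and> h \<in> carrier G \<and> inv g \<otimes> h \<in> letters \<B>"
    using letters_carrier by auto
next
  assume a: "g \<in> carrier G \<and> h \<in> carrier G \<and> inv g \<otimes> h \<in> letters \<B>"
  hence "h = g \<otimes> (inv g \<otimes> h)" by simp
  thus "adj (Cayl G \<B>) g h"
    using a unfolding Cayl_def letters_def ugraph.simps by blast
qed

lemma Cayl_walk: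
  assumes "set w \<subseteq> letters \<B>" "g \<in> carrier G"
  shows "\<exists>p. walk_betw (Cayl G \<B>) g (g # p) (g \<otimes> prod_word w) \<and> length p = length w"
  using assms
proof (induction w arbitrary: g)
  case (Cons s w)
  have s: "s \<in> letters \<B>" "s \<in> carrier G" "set w \<subseteq> letters \<B>" "g \<otimes> s \<in> carrier G"
    using Cons.prems letters_carrier by auto
  obtain p where p: "walk_betw (Cayl G \<B>) (g \<otimes> s) ((g \<otimes> s) # p) (g \<otimes> s \<otimes> prod_word w)" "length p = length w"
    using Cons.IH[OF s(3,4)] by blast
  have "adj (Cayl G \<B>) g (g \<otimes> s)" using s Cons.prems by (simp add: adj_Cayl)
  hence "walk_betw (Cayl G \<B>) g (g # (g \<otimes> s) # p) (g \<otimes> prod_word (s # w))"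
    using p s Cons.prems word_carrier[OF s(3)] by (simp add: walk_betw_Cons m_assoc)
  thus ?case using p(2) by (intro exI[of _ "(g \<otimes> s) # p"]) simp
qed simp

lemma len_le_walk:
  assumes "walk_betw (Cayl G \<B>) g p h"
  shows "len (inv g \<otimes> h) < length p"
  using assms
proof (induction p arbitrary: g)
  case (Cons a p)
  show ?case
  proof (cases p)
    case Nil
    thus ?thesis using Cons.prems by simp
  next
    case (Cons b q)
    hence b: "adj (Cayl G \<B>) g b" "walk_betw (Cayl G \<B>) b p h" "h \<in> carrier G"
      using Cons.prems last_in_set[of p] by (auto simp: walk_betw_Cons) (auto simp: walk_betw_def)
    hence c: "g \<in> carrier G" "b \<in> carrier G" "inv g \<otimes> b \<in> letters \<B>" by (auto simp: adj_Cayl)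
    have "len ((inv g \<otimes> b) \<otimes> (inv b \<otimes> h)) \<le> len (inv g \<otimes> b) + len (inv b \<otimes> h)"
      using c b by (intro len_mult_le) auto
    moreover have "len (inv g \<otimes> b) = 1" using c len_eq_1_iff[of "inv g \<otimes> b"] by simp
    ultimately show ?thesis using Cons.IH[OF b(2)] c b(3) by (simp add: m_assoc)
  qed
qed (simp add: walk_betw_def)

lemma Cayl_simple_connected: "simple_connected_graph (Cayl G \<B>)"
proof
  have "inv h \<otimes> g \<in> letters \<B>" "g \<noteq> h"
    if a: "g \<in> carrier G" "h \<in> carrier G" "inv g \<otimes> h \<in> letters \<B>" for g h
  proof -
    show "inv h \<otimes> g \<in> letters \<B>" using inv_letter[OF a(3)] a by (simp add: inv_mult_group)
    show "g \<noteq> h" using a by auto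
  qed
  thus "simple_graph (Cayl G \<B>)"
    by (auto simp: simple_graph_def adj_Cayl)
  show "connected_graph (Cayl G \<B>)"
    unfolding connected_graph_def
  proof (intro conjI ballI)
    fix g h assume gh: "g \<in> verts (Cayl G \<B>)" "h \<in> verts (Cayl G \<B>)"
    then obtain w where "reduced w" "prod_word w = inv g \<otimes> h"
      using carrier_reduced_word[of "inv g \<otimes> h"] by auto
    thus "\<exists>p. walk_betw (Cayl G \<B>) g p h"
      using Cayl_walk[of w g] reduced_letters gh by fastforce
  qed (use one_closed in auto)
qed

lemma gdist_Cayl:
  assumes "g \<in> carrier G" "h \<in> carrier G"
  shows "gdist (Cayl G \<B>) g h = len (inv g \<otimes> h)"
proof (rule antisym)
  obtain w where w: "reduced w" "prod_word w = inv g \<otimes> h"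
    using carrier_reduced_word[of "inv g \<otimes> h"] assms by auto
  then obtain p where "walk_betw (Cayl G \<B>) g (g # p) h" "length p = length w"
    using Cayl_walk[OF reduced_letters[OF w(1)] assms(1)] assms by auto
  thus "gdist (Cayl G \<B>) g h \<le> len (inv g \<otimes> h)"
    using gdist_le[of "Cayl G \<B>" g "g # p" h] len_reduced[OF w(1)] w(2) by simp
  interpret simple_connected_graph "Cayl G \<B>" by (rule Cayl_simple_connected)
  obtain p where "walk_betw (Cayl G \<B>) g p h" "length p = Suc (gdist (Cayl G \<B>) g h)"
    using geodesic[of g h] assms by auto
  thus "len (inv g \<otimes> h) \<le> gdist (Cayl G \<B>) g h"
    using len_le_walk by fastforce
qed

text \<open>\<open>x\<close> and \<open>y\<close> lie in one left coset of a factor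
  \<open>B\<close>. Being equally far from \<open>v\<close>, neither of them can be the projection
  of \<open>v\<close> to this coset; that projection is the common neighbour, one step closer to
  \<open>v\<close> than both.\<close>

lemma Cayl_triangle_condition: "triangle_condition (Cayl G \<B>)"
  unfolding triangle_condition_def
proof (intro ballI impI, elim conjE)
  interpret simple_connected_graph "Cayl G \<B>" by (rule Cayl_simple_connected)
  fix v x y
  assume "v \<in> verts (Cayl G \<B>)" "x \<in> verts (Cayl G \<B>)" "y \<in> verts (Cayl G \<B>)"
    and d: "gdist (Cayl G \<B>) v x = gdist (Cayl G \<B>) v y" "gdist (Cayl G \<B>) x y = 1"
  hence c: "v \<in> carrier G" "x \<in> carrier G" "y \<in> carrier G" by auto
  define s u where "s = inv x \<otimes> y" and "u = inv x \<otimes> v"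
  have su: "s \<in> carrier G" "u \<in> carrier G" "y = x \<otimes> s" using c by (auto simp: s_def u_def)
  have "len s = 1" using d(2) gdist_Cayl[OF c(2,3)] by (simp add: s_def)
  then obtain B where B: "B \<in> \<B>" "s \<in> B" "s \<noteq> \<one>" using len_eq_1_iff[OF su(1)] by (auto elim: letterE)
  have dv: "gdist (Cayl G \<B>) v (x \<otimes> b) = len (inv b \<otimes> u)" if "b \<in> carrier G" for b
    using gdist_sym[of v "x \<otimes> b"] gdist_Cayl[of "x \<otimes> b" v] c that
    by (simp add: u_def inv_mult_group m_assoc)
  have eq: "len (inv s \<otimes> u) = len (inv \<one> \<otimes> u)"
    using d(1) dv[of \<one>] dv[of s] su c by simp
  define b where "b = gate B u"
  have b: "b \<in> B" "b \<in> carrier G" using gate_mem[OF B(1) su(2)] basis_carrier[OF B(1)] by (auto simp: b_def)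
  have bs: "b \<noteq> s" "b \<noteq> \<one>"
  proof -
    show "b \<noteq> s"
    proof
      assume "b = s"
      hence "len (inv \<one> \<otimes> u) = len (inv s \<otimes> u) + 1"
        using len_gate[OF B(1) su(2) basis_one[OF B(1)]] B(3) unfolding b_def by metis
      thus False using eq by simp
    qed
    show "b \<noteq> \<one>"
    proof
      assume "b = \<one>"
      hence "len (inv s \<otimes> u) = len (inv \<one> \<otimes> u) + 1"
        using len_gate[OF B(1) su(2) B(2)] B(3) unfolding b_def by metis
      thus False using eq by simp
    qed
  qed
  have l: "len (inv s \<otimes> u) = len (inv b \<otimes> u) + 1" "len (inv \<one> \<otimes> u) = len (inv b \<otimes> u) + 1"
    using len_gate[OF B(1) su(2) B(2)] eq bs(1) unfolding b_def by metis+
  have sb: "inv s \<otimes> b \<in> B" "inv s \<otimes> b \<noteq> \<one>"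
  proof -
    show "inv s \<otimes> b \<in> B" using basis_mult basis_inv B b by simp
    show "inv s \<otimes> b \<noteq> \<one>"
    proof
      assume "inv s \<otimes> b = \<one>"
      hence "s \<otimes> (inv s \<otimes> b) = s" using su by simp
      thus False using su b bs by simp
    qed
  qed
  have a: "adj (Cayl G \<B>) x (x \<otimes> b)" "adj (Cayl G \<B>) y (x \<otimes> b)"
    using c b su letterI[OF B(1) b(1) bs(2)] letterI[OF B(1) sb]
    by (auto simp: adj_Cayl inv_mult_group m_assoc)
  hence "gdist (Cayl G \<B>) (x \<otimes> b) x = 1" "gdist (Cayl G \<B>) (x \<otimes> b) y = 1"
    using gdist_eq_1_iff adj_sym c b by auto
  hence "x \<otimes> b \<in> interval (Cayl G \<B>) v x \<inter> interval (Cayl G \<B>) v y"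
    using c b l dv[of b] dv[of \<one>] dv[of s] su by (auto simp: interval_def)
  thus "\<exists>z. adj (Cayl G \<B>) x z \<and> adj (Cayl G \<B>) y z \<and>
      z \<in> interval (Cayl G \<B>) v x \<inter> interval (Cayl G \<B>) v y"
    using a by blast
qed

text \<open>The product of nontrivial elements of two different factors has length two, so a
  triangle cannot leave the coset of one factor.\<close>

lemma Cayl_triangle_base:
  assumes "adj (Cayl G \<B>) x y" "adj (Cayl G \<B>) x z" "adj (Cayl G \<B>) y z"
  shows "base (inv x \<otimes> y) = base (inv x \<otimes> z)"
proof (rule ccontr)
  define s t where "s = inv x \<otimes> y" and "t = inv x \<otimes> z"
  have st: "s \<in> letters \<B>" "t \<in> letters \<B>" "s \<in> carrier G" "t \<in> carrier G"
    using assms by (auto simp: adj_Cayl s_def t_def)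
  have "inv s \<otimes> t = inv y \<otimes> z"
    using assms by (simp add: adj_Cayl s_def t_def inv_mult_group m_assoc)
  hence l: "len (inv s \<otimes> t) = 1" "len t = 1"
    using len_eq_1_iff[of "inv s \<otimes> t"] len_eq_1_iff[of t] assms(3) st by (auto simp: adj_Cayl)
  assume "base (inv x \<otimes> y) \<noteq> base (inv x \<otimes> z)"
  hence ne: "base t \<noteq> base s" by (simp add: s_def t_def)
  have b: "base s \<in> \<B>" "s \<in> base s" "base t \<in> \<B>" "t \<in> base t" using base_mem' st by auto
  have "gate (base s) (\<one> \<otimes> t) = gate (base s) \<one>"
    using ne b basis_subset[OF b(3)] by (intro gate_step[OF b(1,3,4)]) auto
  hence "gate (base s) t = \<one>" using st b gate_one by simp
  moreover have "inv s \<in> base s" using basis_inv b by simp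
  moreover have "inv s \<noteq> \<one>" using st inv_eq_1_iff by auto
  ultimately have "len (inv s \<otimes> t) = len t + 1" using len_mult_gate_one b(1) st(4) by blast
  thus False using l by simp
qed

text \<open>The two triangles of the configuration share an edge, hence lie in the same left coset
  of a factor, and such a coset is complete.\<close>

lemma Cayl_intersection_of_triangles: "intersection_of_triangles (Cayl G \<B>)"
  unfolding intersection_of_triangles_def isomorphic_graphs_def
proof (rule notI, elim exE conjE)
  fix S f assume S: "S \<subseteq> verts (Cayl G \<B>)" "graph_iso (induced (Cayl G \<B>) S) K4_minus f"
  define h where "h = inv_into (verts (induced (Cayl G \<B>) S)) f"
  have "graph_iso K4_minus (induced (Cayl G \<B>) S) h" using graph_iso_inv[OF S(2)] by (simp add: h_def)
  hence h: "bij_betw h {..<4} S" "\<And>i j. i < 4 \<Longrightarrow> j < 4 \<Longrightarrow>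
      (h i \<in> S \<and> h j \<in> S \<and> adj (Cayl G \<B>) (h i) (h j)) \<longleftrightarrow> i \<noteq> j \<and> {i, j} \<noteq> {0, 1}"
    using S(1) by (auto simp: graph_iso_def K4_minus_def induced_def Int_absorb1)
  have hS: "h i \<in> S" if "i < 4" for i using h(1) that by (auto simp: bij_betw_def)
  have a: "adj (Cayl G \<B>) (h i) (h j) \<longleftrightarrow> i \<noteq> j \<and> {i, j} \<noteq> {0, 1}" if "i < 4" "j < 4" for i j
    using h(2)[OF that] hS that by auto
  have adj: "adj (Cayl G \<B>) (h 2) (h 3)" "adj (Cayl G \<B>) (h 2) (h 0)" "adj (Cayl G \<B>) (h 2) (h 1)"
    "adj (Cayl G \<B>) (h 3) (h 0)" "adj (Cayl G \<B>) (h 3) (h 1)" "\<not> adj (Cayl G \<B>) (h 0) (h 1)"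
    by (simp_all add: a doubleton_eq_iff)
  define s t where "s = inv (h 2) \<otimes> h 0" and "t = inv (h 2) \<otimes> h 1"
  have st: "s \<in> letters \<B>" "t \<in> letters \<B>" "s \<in> carrier G" "t \<in> carrier G" "base s = base t"
    "inv s \<otimes> t = inv (h 0) \<otimes> h 1"
    using adj Cayl_triangle_base[OF adj(1,2,4)] Cayl_triangle_base[OF adj(1,3,5)]
    by (auto simp: adj_Cayl s_def t_def inv_mult_group m_assoc)
  have "inv s \<otimes> t \<in> base s" using base_mem'[OF st(1)] base_mem'[OF st(2)] st(5) basis_mult basis_inv by metis
  moreover have "inv s \<otimes> t \<noteq> \<one>"
  proof
    assume "inv s \<otimes> t = \<one>"
    hence "h 0 \<otimes> (inv (h 0) \<otimes> h 1) = h 0" using st adj by (simp add: adj_Cayl)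
    hence "h 1 = h 0" using adj by (simp add: adj_Cayl)
    moreover have "(0::nat) \<in> {..<4}" "(1::nat) \<in> {..<4}" by auto
    ultimately show False using h(1) unfolding bij_betw_def inj_on_def by (metis zero_neq_one)
  qed
  ultimately have "inv (h 0) \<otimes> h 1 \<in> letters \<B>" using letterI base_mem'[OF st(1)] st(6) by metis
  thus False using adj by (simp add: adj_Cayl)
qed

text \<open>The closed walk around the cycle spanned by \<open>s\<close> and \<open>t\<close>: if \<open>m > 2\<close>, then \<open>s\<close> and \<open>t\<close> are
  involutions and the cycle is the whole dihedral group they generate.\<close>

definition dihedral_walk :: "nat \<Rightarrow> 'a \<Rightarrow> 'a \<Rightarrow> int \<Rightarrow> 'a" where
  "dihedral_walk m s t i =
     (if m = 2 then [\<one>, s, s \<otimes> t, t] ! nat (i mod 4)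
      else (s \<otimes> t) [^] (i div 2) \<otimes> (if even i then \<one> else s))"

lemma dihedral_window:
  assumes "A \<in> \<B>" "B \<in> \<B>" "braided A B m" "2 < m" "s \<in> A - {\<one>}" "t \<in> B - {\<one>}"
  shows "dihedral_walk m s t (i + int j) = dihedral_walk m s t i \<otimes>
      prod_word (if even i then alternating j s t else alternating j t s)"
proof -
  have c: "s \<in> carrier G" "t \<in> carrier G" using assms basis_carrier by auto
  have closed: "dihedral_walk m s t i \<in> carrier G" for i
    using c assms(4) by (auto simp: dihedral_walk_def)
  have wc: "set (alternating j a b) \<subseteq> carrier G" if "a \<in> carrier G" "b \<in> carrier G" for j a b
    using that by (induction j arbitrary: a b) auto
  have step: "dihedral_walk m s t (i + 1) = dihedral_walk m s t i \<otimes> (if even i then s else t)" for i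
  proof (cases "even i")
    case True
    thus ?thesis using c assms(4) by (auto simp: dihedral_walk_def elim!: evenE)
  next
    case False
    then obtain l where l: "i = 2 * l + 1" by (auto elim: oddE)
    have "(i + 1) div 2 = l + 1" "i div 2 = l" by (simp_all add: l)
    thus ?thesis using c assms(4) False by (simp add: dihedral_walk_def int_pow_mult m_assoc)
  qed
  show ?thesis
  proof (induction j arbitrary: i)
    case 0
    show ?case using closed by simp
  next
    case (Suc j)
    have "dihedral_walk m s t (i + int (Suc j)) = dihedral_walk m s t (i + 1 + int j)"
      by (simp add: algebra_simps)
    also have "\<dots> = dihedral_walk m s t (i + 1) \<otimes>
        prod_word (if even i then alternating j t s else alternating j s t)"
      by (subst Suc) simp
    finally show ?case
      using step[of i] closed[of i] c wc[OF c] wc[OF c(2,1)] by (simp add: m_assoc)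
  qed
qed

text \<open>For \<open>m = 2\<close> the factors may have any order and the walk is the square
  \<open>\<one>\<close>, \<open>s\<close>, \<open>s \<otimes> t\<close>, \<open>t\<close>; the
  letters read along it are \<open>s\<close>, \<open>t\<close>, \<open>inv s\<close>,
  \<open>inv t\<close>. The pair \<open>a\<close>, \<open>b\<close> therefore depends on the
  starting index, which is why it is existentially quantified for each \<open>i\<close>.\<close>

lemma dihedral_windows:
  assumes "A \<in> \<B>" "B \<in> \<B>" "braided A B m" "s \<in> A - {\<one>}" "t \<in> B - {\<one>}"
  shows "\<exists>a b. (a \<in> A - {\<one>} \<and> b \<in> B - {\<one>} \<or> a \<in> B - {\<one>} \<and> b \<in> A - {\<one>}) \<and>
     (\<forall>j\<le>m. dihedral_walk m s t (i + int j) = dihedral_walk m s t i \<otimes> prod_word (alternating j a b))"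
proof (cases "m = 2")
  case False
  hence m: "2 < m" using assms(3) by (simp add: braided_def)
  show ?thesis
  proof (cases "even i")
    case True
    thus ?thesis using dihedral_window[OF assms(1-3) m assms(4,5), of i] assms(4,5)
      by (intro exI[of _ s] exI[of _ t]) auto
  next
    case odd: False
    thus ?thesis using dihedral_window[OF assms(1-3) m assms(4,5), of i] assms(4,5)
      by (intro exI[of _ t] exI[of _ s]) auto
  qed
next
  case True
  have c: "s \<in> carrier G" "t \<in> carrier G" using assms basis_carrier by auto
  have "braid_pair 2 s t" using assms True by (auto simp: braided_def)
  hence st: "s \<otimes> t = t \<otimes> s" using c by (simp add: braid_pair_def numeral_2_eq_2)
  have inv: "inv s \<in> A - {\<one>}" "inv t \<in> B - {\<one>}"
    using assms basis_inv c inv_eq_1_iff by auto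
  have ts: "s \<otimes> (t \<otimes> x) = t \<otimes> (s \<otimes> x)" if "x \<in> carrier G" for x
    using st c that by (metis m_assoc)
  have j: "(\<forall>j\<le>(2::nat). P j) \<longleftrightarrow> P 0 \<and> P 1 \<and> P 2" for P
    by (auto simp: le_Suc_eq numeral_2_eq_2)
  define r where "r = i mod 4"
  have r4: "nat ((i + int k) mod 4) = nat ((r + int k) mod 4)" for k
    by (simp add: r_def mod_add_left_eq)
  have "0 \<le> r" "r < 4" by (auto simp: r_def)
  then consider "r = 0" | "r = 1" | "r = 2" | "r = 3" by linarith
  thus ?thesis
  proof cases
    case 1
    thus ?thesis
      unfolding True j dihedral_walk_def r4
      using assms(4,5) c r4[of 0]
      by (intro exI[of _ s] exI[of _ t]) (simp add: numeral_2_eq_2 numeral_3_eq_3 r_def)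
  next
    case 2
    thus ?thesis
      unfolding True j dihedral_walk_def r4
      using assms(5) inv c r4[of 0]
      by (intro exI[of _ t] exI[of _ "inv s"]) (simp add: numeral_2_eq_2 numeral_3_eq_3 r_def ts m_assoc)
  next
    case 3
    thus ?thesis
      unfolding True j dihedral_walk_def r4
      using inv c r4[of 0]
      by (intro exI[of _ "inv s"] exI[of _ "inv t"])
        (simp add: numeral_2_eq_2 numeral_3_eq_3 r_def st m_assoc)
  next
    case 4
    thus ?thesis
      unfolding True j dihedral_walk_def r4
      using inv(2) assms(4) c r4[of 0]
      by (intro exI[of _ "inv t"] exI[of _ s]) (simp add: numeral_2_eq_2 numeral_3_eq_3 r_def)
  qed
qed

lemma dihedral_walk_closed:
  assumes "s \<in> carrier G" "t \<in> carrier G"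
  shows "dihedral_walk m s t i \<in> carrier G"
proof (cases "m = 2")
  case True
  have "nat (i mod 4) < 4" by (simp add: nat_less_iff)
  hence "[\<one>, s, s \<otimes> t, t] ! nat (i mod 4) \<in> set [\<one>, s, s \<otimes> t, t]" by (intro nth_mem) simp
  thus ?thesis using True assms by (auto simp: dihedral_walk_def)
qed (use assms in \<open>auto simp: dihedral_walk_def\<close>)

lemma dihedral_periodic:
  assumes "A \<in> \<B>" "B \<in> \<B>" "braided A B m" "s \<in> A - {\<one>}" "t \<in> B - {\<one>}"
  shows "dihedral_walk m s t (i + 2 * int m) = dihedral_walk m s t i"
proof (cases "m = 2")
  case False
  hence m: "2 < m" using assms(3) by (simp add: braided_def)
  have c: "s \<in> carrier G" "t \<in> carrier G" using assms basis_carrier by auto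
  have inv: "inv s = s" "inv t = t"
    using subgroup_card_two[of A s] subgroup_card_two[of B t] subgroup_basis assms m by (auto simp: braided_def)
  have rel: "prod_word (alternating m s t) = prod_word (alternating m t s)"
    using assms by (auto simp: braided_def braid_pair_def)
  have "dihedral_walk m s t (0 + int (m + m)) = dihedral_walk m s t 0 \<otimes> prod_word (alternating (m + m) s t)"
    by (subst dihedral_window[OF assms(1-3) m assms(4,5)]) simp
  hence "(s \<otimes> t) [^] int m = \<one>"
    using c m prod_alternating_double[OF c inv rel] by (simp add: dihedral_walk_def)
  moreover have "(i + 2 * int m) div 2 = i div 2 + int m" by simp
  ultimately show ?thesis
    using c m by (simp add: dihedral_walk_def int_pow_mult)
qed (simp add: dihedral_walk_def)

text \<open>A stretch of at most \<open>m\<close> steps spells a prefix of one side of a braid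
  relation, and prefixes of reduced words are geodesic.\<close>

lemma dihedral_cycle_param:
  assumes "A \<in> \<B>" "B \<in> \<B>" "braided A B m" "s \<in> A - {\<one>}" "t \<in> B - {\<one>}" "z \<in> carrier G"
  shows "cycle_param (Cayl G \<B>) m (\<lambda>i. z \<otimes> dihedral_walk m s t i)"
  unfolding cycle_param_def
proof (intro conjI allI impI)
  have c: "s \<in> carrier G" "t \<in> carrier G" using assms basis_carrier by auto
  note closed = dihedral_walk_closed[OF c]
  show "2 \<le> m" using assms(3) by (simp add: braided_def)
  show "z \<otimes> dihedral_walk m s t i \<in> verts (Cayl G \<B>)" for i using closed assms by simp
  show "z \<otimes> dihedral_walk m s t (i + 2 * int m) = z \<otimes> dihedral_walk m s t i" for i
    using dihedral_periodic[OF assms(1-5)] by simp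
  fix i j assume j: "j \<le> m"
  obtain a b where ab: "a \<in> A - {\<one>} \<and> b \<in> B - {\<one>} \<or> a \<in> B - {\<one>} \<and> b \<in> A - {\<one>}"
    "dihedral_walk m s t (i + int j) = dihedral_walk m s t i \<otimes> prod_word (alternating j a b)"
    using dihedral_windows[OF assms(1-5), of i] j by blast
  have "braid_pair m a b" using ab(1) assms(3) braid_pair_sym[of m a b] unfolding braided_def by blast
  moreover have "alternating m a b = alternating j a b @ (if even j then alternating (m - j) a b else alternating (m - j) b a)"
    using alternating_append[of j "m - j" a b] j by simp
  ultimately have "reduced (alternating j a b)"
    unfolding braid_pair_def by (metis reduced_append(1))
  moreover from this have "prod_word (alternating j a b) \<in> carrier G"
    using word_carrier[OF reduced_letters] by blast
  ultimately show "gdist (Cayl G \<B>) (z \<otimes> dihedral_walk m s t i) (z \<otimes> dihedral_walk m s t (i + int j)) = j"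
    using len_reduced[of "alternating j a b"] ab(2) closed[of m i] closed[of m "i + int j"] assms(6)
    by (simp add: gdist_Cayl inv_mult_group m_assoc)
qed

text \<open>This is the convexity of parabolic subgroups: the concatenated word is reduced because
  lengths add, so by \<open>reduced_parabolic\<close> all of its letters belong to \<open>J\<close>,
  in particular those spelling \<open>u\<close>.\<close>

lemma parabolic_interval:
  assumes "J \<subseteq> \<B>" "u \<in> carrier G" "v \<in> carrier G" "u \<otimes> v \<in> generate G (\<Union>J)"
    "len (u \<otimes> v) = len u + len v"
  shows "u \<in> generate G (\<Union>J)"
proof -
  obtain x y where xy: "reduced x" "prod_word x = u" "reduced y" "prod_word y = v"
    using assms carrier_reduced_word by metis
  have l: "set x \<subseteq> letters \<B>" "set y \<subseteq> letters \<B>" using reduced_letters xy by auto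
  have pr: "prod_word (x @ y) = u \<otimes> v" using word_carrier[OF l(1)] word_carrier[OF l(2)] xy by simp
  have "length (x @ y) = len (u \<otimes> v)" using len_reduced xy assms(5) by fastforce
  hence "reduced (x @ y)" using reduced_iff_len[of "x @ y"] l pr by simp
  hence "set (x @ y) \<subseteq> letters J" using reduced_parabolic[OF assms(1)] pr assms(4) by metis
  thus ?thesis using prod_word_generate[of x J] xy by simp
qed

text \<open>Two stages: a vertex between two points of the cycle lies in the coset of the subgroup
  generated by \<open>A\<close> and \<open>B\<close>, and inside that subgroup the cycle is closed
  under geodesics. For \<open>m > 2\<close> the cycle is the whole subgroup; for
  \<open>m = 2\<close> it is a square inside the product of two complete graphs.\<close>

lemma dihedral_convex:
  assumes "A \<in> \<B>" "B \<in> \<B>" "A \<noteq> B" "braided A B m" "s \<in> A - {\<one>}" "t \<in> B - {\<one>}" "z \<in> carrier G"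
  shows "convex_subgraph (Cayl G \<B>) (range (\<lambda>i. z \<otimes> dihedral_walk m s t i))"
proof -
  interpret simple_connected_graph "Cayl G \<B>" by (rule Cayl_simple_connected)
  have c: "s \<in> carrier G" "t \<in> carrier G" using assms basis_carrier by auto
  note closed = dihedral_walk_closed[OF c]
  have J: "{A, B} \<subseteq> \<B>" using assms by simp
  define P where "P = generate G (\<Union>{A, B})"
  have Pc: "p \<in> carrier G" if "p \<in> P" for p using generate_closed[OF J] that by (simp add: P_def)
  have Pm: "p \<otimes> q \<in> P" "inv p \<in> P" if "p \<in> P" "q \<in> P" for p q
    using that generate_inv_closed[OF J] by (auto simp: P_def generate.eng)
  define C where "C = range (dihedral_walk m s t)"
  have CC: "range (\<lambda>i. z \<otimes> dihedral_walk m s t i) = (\<lambda>x. z \<otimes> x) ` C"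
    by (simp add: C_def image_image)
  have key: "C \<subseteq> P \<and> (\<forall>p\<in>C. \<forall>q\<in>C. \<forall>u\<in>P. len (inv p \<otimes> q) = len (inv p \<otimes> u) + len (inv u \<otimes> q) \<longrightarrow> u \<in> C)"
  proof (cases "m = 2")
    case False
    hence m: "2 < m" using assms(4) by (simp add: braided_def)
    have AB: "A = {\<one>, s}" "B = {\<one>, t}" "s \<otimes> s = \<one>" "t \<otimes> t = \<one>"
      using subgroup_card_two[of A s] subgroup_card_two[of B t] subgroup_basis assms m by (auto simp: braided_def)
    have "C \<subseteq> P"
    proof
      fix x assume "x \<in> C"
      hence "\<one> \<otimes> x \<in> range (\<lambda>i. \<one> \<otimes> dihedral_walk m s t i)" by (auto simp: C_def)
      then obtain j where "\<one> \<otimes> x = \<one> \<otimes> dihedral_walk m s t (0 + int j)"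
        using cycle_param_range[OF dihedral_cycle_param[OF assms(1,2,4-6) one_closed], of "\<one> \<otimes> x" 0] by blast
      moreover have "x \<in> carrier G" using \<open>x \<in> C\<close> closed by (auto simp: C_def)
      ultimately have "x = dihedral_walk m s t (0 + int j)" using closed by simp
      hence "x = dihedral_walk m s t 0 \<otimes> prod_word (alternating j s t)"
        by (subst (asm) dihedral_window[OF assms(1,2,4) m assms(5,6)]) simp
      moreover have "set (alternating j s t) \<subseteq> letters {A, B}"
        using alternates_alternating[OF assms(5,6)] alternates_letters by blast
      hence "prod_word (alternating j s t) \<in> P" unfolding P_def by (rule prod_word_generate)
      ultimately show "x \<in> P" using m Pc by (simp add: dihedral_walk_def)
    qed
    \<comment> \<open>Right multiplication by either involution moves one step along the walk,
      forwards or backwards according to the parity of the index.\<close>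
    moreover have "P \<subseteq> C"
    proof
      fix p assume "p \<in> P"
      then obtain w where w: "set w \<subseteq> letters {A, B}" "prod_word w = p"
        using generate_word[OF J] by (auto simp: P_def)
      have "dihedral_walk m s t i \<otimes> prod_word w \<in> C" for i
        using w(1)
      proof (induction w arbitrary: i)
        case Nil
        thus ?case using closed by (simp add: C_def)
      next
        case (Cons r w)
        have r: "r = s \<or> r = t" using Cons.prems AB by (auto elim: letterE)
        have wc: "prod_word w \<in> carrier G"
          using Cons.prems letters_mono[OF J] letters_carrier by (intro prod_word_closed) auto
        have st: "dihedral_walk m s t (k + 1) = dihedral_walk m s t k \<otimes> (if even k then s else t)" for k
          using dihedral_window[OF assms(1,2,4) m assms(5,6), of k 1] c by (auto split: if_splits)
        have "\<exists>k. dihedral_walk m s t i \<otimes> r = dihedral_walk m s t k"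
        proof (cases "r = (if even i then s else t)")
          case True
          thus ?thesis using st[of i] by metis
        next
          case False
          hence "r = (if even (i - 1) then s else t)" using r by auto
          hence "dihedral_walk m s t i = dihedral_walk m s t (i - 1) \<otimes> r" "r \<otimes> r = \<one>"
            using st[of "i - 1"] AB r by auto
          hence "dihedral_walk m s t i \<otimes> r = dihedral_walk m s t (i - 1)"
            using c r closed[of m "i - 1"] by (auto simp: m_assoc)
          thus ?thesis by blast
        qed
        then obtain k where "dihedral_walk m s t i \<otimes> r = dihedral_walk m s t k" by blast
        moreover have "dihedral_walk m s t k \<otimes> prod_word w \<in> C" using Cons.IH Cons.prems by simp
        ultimately show ?case using wc r c closed[of m i] by (auto simp: m_assoc[symmetric])
      qed
      from this[of 0] show "p \<in> C" using w m Pc[OF \<open>p \<in> P\<close>] by (simp add: dihedral_walk_def)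
    qed
    ultimately show ?thesis by blast
  next
    case True
    define S where "S = {\<alpha> \<otimes> \<beta> | \<alpha> \<beta>. \<alpha> \<in> {\<one>, s} \<and> \<beta> \<in> {\<one>, t}}"
    have CS: "C = S"
    proof
      show "C \<subseteq> S"
      proof
        fix x assume "x \<in> C"
        then obtain i where i: "x = [\<one>, s, s \<otimes> t, t] ! nat (i mod 4)"
          using True by (auto simp: C_def dihedral_walk_def)
        have "nat (i mod 4) < length [\<one>, s, s \<otimes> t, t]" by (simp add: nat_less_iff)
        hence "x \<in> set [\<one>, s, s \<otimes> t, t]" using i nth_mem by metis
        thus "x \<in> S" using c by (force simp: S_def)
      qed
      have "dihedral_walk m s t 0 = \<one>" "dihedral_walk m s t 1 = s" "dihedral_walk m s t 2 = s \<otimes> t"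
        "dihedral_walk m s t 3 = t"
        using True by (simp_all add: dihedral_walk_def numeral_2_eq_2 numeral_3_eq_3)
      hence "{\<one>, s, s \<otimes> t, t} \<subseteq> C" unfolding C_def by (metis empty_subsetI insert_subset rangeI)
      thus "S \<subseteq> C" using c by (auto simp: S_def)
    qed
    have comm: "b \<otimes> a = a \<otimes> b" if "a \<in> A" "b \<in> B" for a b
    proof (cases "a = \<one> \<or> b = \<one>")
      case False
      hence "braid_pair 2 a b" using that assms(4) True by (auto simp: braided_def)
      thus ?thesis using that assms basis_carrier by (auto simp: braid_pair_def numeral_2_eq_2)
    qed (use that assms basis_carrier in auto)
    have lenab: "len (a \<otimes> b) = (if a = \<one> then 0 else 1) + (if b = \<one> then 0 else 1)" if ab: "a \<in> A" "b \<in> B" for a b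
    proof -
      have cc: "a \<in> carrier G" "b \<in> carrier G" using ab assms(1,2) basis_carrier by auto
      have l1: "len a = 1" if "a \<noteq> \<one>" using len_eq_1_iff[OF cc(1)] letterI[OF assms(1) ab(1) that] by simp
      have l2: "len b = 1" if "b \<noteq> \<one>" using len_eq_1_iff[OF cc(2)] letterI[OF assms(2) ab(2) that] by simp
      have l3: "len (a \<otimes> b) = 2" if "a \<noteq> \<one>" "b \<noteq> \<one>"
      proof -
        have "braid_pair 2 a b" using that ab assms(4) True by (auto simp: braided_def)
        hence "reduced [a, b]" by (simp add: braid_pair_def numeral_2_eq_2)
        thus ?thesis using len_reduced[of "[a, b]"] cc by simp
      qed
      show ?thesis using l1 l2 l3 cc by auto
    qed
    have PAB: "\<exists>a\<in>A. \<exists>b\<in>B. p = a \<otimes> b" if p: "p \<in> P" for p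
    proof -
      obtain w where w: "set w \<subseteq> letters {A, B}" "prod_word w = p"
        using generate_word[OF J] p unfolding P_def by blast
      have "\<exists>a\<in>A. \<exists>b\<in>B. prod_word w = a \<otimes> b"
        using w(1)
      proof (induction w)
        case Nil
        show ?case using assms(1,2) by (intro bexI[of _ \<one>]) auto
      next
        case (Cons r w)
        then obtain a b where ab: "a \<in> A" "b \<in> B" "prod_word w = a \<otimes> b" by auto
        have cc: "a \<in> carrier G" "b \<in> carrier G" using ab assms(1,2) basis_carrier by auto
        have "r \<in> A \<or> r \<in> B" using Cons.prems by (auto elim: letterE)
        thus ?case
        proof
          assume r: "r \<in> A"
          hence "prod_word (r # w) = (r \<otimes> a) \<otimes> b" using ab cc basis_carrier[OF assms(1)] by (simp add: m_assoc)
          thus ?thesis using ab r basis_mult[OF assms(1)] by blast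
        next
          assume r: "r \<in> B"
          have rc: "r \<in> carrier G" using r basis_carrier[OF assms(2)] by blast
          have "prod_word (r # w) = (r \<otimes> a) \<otimes> b" using ab cc rc by (simp add: m_assoc)
          hence "prod_word (r # w) = a \<otimes> (r \<otimes> b)" using comm[OF ab(1) r] cc rc by (simp add: m_assoc)
          thus ?thesis using ab r basis_mult[OF assms(2)] by blast
        qed
      qed
      thus ?thesis using w by simp
    qed
    \<comment> \<open>The distance between two elements of the product counts the coordinates in
      which they differ. A vertex between two others therefore takes each coordinate from one of
      them.\<close>
    have d: "len (inv (a \<otimes> b) \<otimes> (a' \<otimes> b')) = (if a = a' then 0 else 1) + (if b = b' then 0 else 1)"
      if ab: "a \<in> A" "b \<in> B" "a' \<in> A" "b' \<in> B" for a b a' b'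
    proof -
      have cc: "a \<in> carrier G" "b \<in> carrier G" "a' \<in> carrier G" "b' \<in> carrier G"
        using ab assms(1,2) basis_carrier by auto
      have m: "inv a \<otimes> a' \<in> A" "inv b \<otimes> b' \<in> B" "inv b \<in> B"
        using ab assms(1,2) basis_inv basis_mult by auto
      have "inv (a \<otimes> b) \<otimes> (a' \<otimes> b') = (inv b \<otimes> (inv a \<otimes> a')) \<otimes> b'"
        using cc by (simp add: inv_mult_group m_assoc)
      also have "\<dots> = (inv a \<otimes> a') \<otimes> (inv b \<otimes> b')"
        using comm[OF m(1) m(3)] cc by (simp add: m_assoc)
      finally have e: "len (inv (a \<otimes> b) \<otimes> (a' \<otimes> b')) = (if inv a \<otimes> a' = \<one> then 0 else 1) + (if inv b \<otimes> b' = \<one> then 0 else 1)"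
        using lenab[OF m(1,2)] by simp
      have "inv x \<otimes> y = \<one> \<longleftrightarrow> x = y" if "x \<in> carrier G" "y \<in> carrier G" for x y
        using that by (metis inv_mult_cancel(2) l_inv r_one)
      thus ?thesis using e cc by simp
    qed
    have "C \<subseteq> P"
    proof -
      have "\<alpha> \<otimes> \<beta> \<in> P" if "\<alpha> \<in> {\<one>, s}" "\<beta> \<in> {\<one>, t}" for \<alpha> \<beta>
      proof -
        have "\<alpha> \<in> A" "\<beta> \<in> B" using that assms by auto
        hence "\<alpha> \<in> P" "\<beta> \<in> P" by (auto simp: P_def intro: generate.incl)
        thus ?thesis by (rule Pm(1))
      qed
      thus ?thesis unfolding CS S_def by blast
    qed
    moreover have "u \<in> C" if pq: "p \<in> C" "q \<in> C" "u \<in> P"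
      "len (inv p \<otimes> q) = len (inv p \<otimes> u) + len (inv u \<otimes> q)" for p q u
    proof -
      obtain a b a' b' where ab: "p = a \<otimes> b" "q = a' \<otimes> b'" "a \<in> {\<one>, s}" "a' \<in> {\<one>, s}" "b \<in> {\<one>, t}" "b' \<in> {\<one>, t}"
        using pq(1,2) unfolding CS S_def by blast
      hence m: "a \<in> A" "a' \<in> A" "b \<in> B" "b' \<in> B" using assms by auto
      obtain x y where xy: "x \<in> A" "y \<in> B" "u = x \<otimes> y" using PAB[OF pq(3)] by blast
      have "x = a \<or> x = a'" "y = b \<or> y = b'"
        using pq(4) d[OF m(1,3) m(2,4)] d[OF m(1,3) xy(1,2)] d[OF xy(1,2) m(2,4)]
        by (auto simp: ab(1,2) xy(3) split: if_splits)
      thus ?thesis using ab xy unfolding CS S_def by blast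
    qed
    ultimately show ?thesis by blast
  qed
  have Cc: "C \<subseteq> carrier G" using closed by (auto simp: C_def)
  show ?thesis
    unfolding convex_subgraph_def CC
  proof (intro conjI ballI subsetI)
    show "x \<in> verts (Cayl G \<B>)" if "x \<in> (\<lambda>x. z \<otimes> x) ` C" for x
      using that Cc assms(7) by auto
    fix x y w assume xy: "x \<in> (\<lambda>x. z \<otimes> x) ` C" "y \<in> (\<lambda>x. z \<otimes> x) ` C" "w \<in> interval (Cayl G \<B>) x y"
    obtain p q where pq: "p \<in> C" "q \<in> C" "x = z \<otimes> p" "y = z \<otimes> q" using xy by blast
    have pc: "p \<in> carrier G" "q \<in> carrier G" using pq Cc by auto
    have w: "w \<in> carrier G" "gdist (Cayl G \<B>) x y = gdist (Cayl G \<B>) x w + gdist (Cayl G \<B>) w y"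
      using xy(3) by (auto simp: interval_def)
    define u where "u = inv z \<otimes> w"
    have u: "u \<in> carrier G" "w = z \<otimes> u" using w assms(7) by (auto simp: u_def)
    have len: "len (inv p \<otimes> q) = len (inv p \<otimes> u) + len (inv u \<otimes> q)"
      using w(2) pc u assms(7) by (simp add: pq(3,4) u(2) gdist_Cayl inv_mult_group m_assoc)
    have pP: "p \<in> P" "q \<in> P" using conjunct1[OF key] pq(1,2) by blast+
    have "inv p \<otimes> u \<in> P"
      unfolding P_def
    proof (rule parabolic_interval[OF J, of _ "inv u \<otimes> q"])
      have eq: "(inv p \<otimes> u) \<otimes> (inv u \<otimes> q) = inv p \<otimes> q" using pc u by (simp add: m_assoc)
      show "(inv p \<otimes> u) \<otimes> (inv u \<otimes> q) \<in> generate G (\<Union>{A, B})"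
        unfolding eq using Pm pP by (simp add: P_def)
      show "len (inv p \<otimes> u \<otimes> (inv u \<otimes> q)) = len (inv p \<otimes> u) + len (inv u \<otimes> q)"
        unfolding eq by (rule len)
    qed (use pc u in auto)
    hence "p \<otimes> (inv p \<otimes> u) \<in> P" using Pm(1)[OF pP(1)] by blast
    hence "u \<in> P" using pc u by simp
    hence "u \<in> C" using conjunct2[OF key] pq(1,2) len by blast
    thus "w \<in> (\<lambda>x. z \<otimes> x) ` C" using u by blast
  qed
qed

text \<open>Translating \<open>z\<close> to the neutral element turns \<open>x\<close> and
  \<open>y\<close> into letters \<open>s\<close> and \<open>t\<close> that are both descents of
  \<open>g\<close>. By \<open>dihedral_descent\<close> the value \<open>p\<close> of
  \<open>alternating m s t\<close> splits off from \<open>g\<close>, and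
  \<open>z \<otimes> p\<close> is the vertex opposite to \<open>z\<close>. The range of the cycle is
  described without \<open>v\<close>, as the uniqueness argument for convex cycles requires.\<close>

lemma Cayl_cycles:
  assumes "v \<in> verts (Cayl G \<B>)" "adj (Cayl G \<B>) x z" "adj (Cayl G \<B>) y z" "x \<noteq> y"
    "gdist (Cayl G \<B>) v x = gdist (Cayl G \<B>) v y" "gdist (Cayl G \<B>) v z = gdist (Cayl G \<B>) v x + 1"
  shows "\<exists>m \<gamma>. cycle_param (Cayl G \<B>) m \<gamma> \<and>
      range \<gamma> = range (\<lambda>i. z \<otimes> dihedral_walk
        (THE m. braided (base (inv z \<otimes> x)) (base (inv z \<otimes> y)) m) (inv z \<otimes> x) (inv z \<otimes> y) i) \<and>
      convex_subgraph (Cayl G \<B>) (range \<gamma>) \<and> \<gamma> 0 = z \<and> \<gamma> 1 = x \<and> \<gamma> (- 1) = y \<and>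
      \<gamma> (int m) \<in> interval (Cayl G \<B>) v x \<inter> interval (Cayl G \<B>) v y"
proof -
  interpret simple_connected_graph "Cayl G \<B>" by (rule Cayl_simple_connected)
  have c: "v \<in> carrier G" "x \<in> carrier G" "y \<in> carrier G" "z \<in> carrier G"
    using assms by (auto simp: adj_Cayl)
  define s t g where "s = inv z \<otimes> x" and "t = inv z \<otimes> y" and "g = inv z \<otimes> v"
  have stc: "s \<in> carrier G" "t \<in> carrier G" "g \<in> carrier G" "x = z \<otimes> s" "y = z \<otimes> t" "v = z \<otimes> g"
    using c by (auto simp: s_def t_def g_def)
  have sl: "s \<in> letters \<B>" "t \<in> letters \<B>" using assms(2,3) adj_sym by (auto simp: adj_Cayl s_def t_def)
  define A B where "A = base s" and "B = base t"
  have AB: "A \<in> \<B>" "B \<in> \<B>" "s \<in> A - {\<one>}" "t \<in> B - {\<one>}"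
    using base_mem'[OF sl(1)] base_mem'[OF sl(2)] sl by (auto simp: A_def B_def)
  have dv: "gdist (Cayl G \<B>) v (z \<otimes> b) = len (inv b \<otimes> g)" if "b \<in> carrier G" for b
    using gdist_sym[of v "z \<otimes> b"] gdist_Cayl[of "z \<otimes> b" v] c that
    by (simp add: g_def inv_mult_group m_assoc)
  have l: "len g = len (inv s \<otimes> g) + 1" "len (inv t \<otimes> g) = len (inv s \<otimes> g)"
    using assms(5,6) dv[of \<one>] dv[OF stc(1)] dv[OF stc(2)] stc c by auto
  \<comment> \<open>Two different descents cannot come from one factor, since each of them would be
    the gate of \<open>g\<close> there.\<close>
  have ne: "A \<noteq> B"
  proof
    assume "A = B"
    hence "s = t" using gate_eqI[OF AB(1) stc(3), of s] gate_eqI[OF AB(1) stc(3), of t] l AB by auto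
    thus False using assms(4) stc by simp
  qed
  have less: "len (inv s \<otimes> g) < len g" "len (inv t \<otimes> g) < len g" using l by auto
  obtain m k where m: "braided A B m" "k \<in> carrier G" "g = prod_word (alternating m s t) \<otimes> k"
    "\<And>q. q \<in> generate G (A \<union> B) \<Longrightarrow> len (q \<otimes> k) = len q + len k"
    using dihedral_descent[OF AB(1,2) ne AB(3,4) stc(3) less] by blast
  \<comment> \<open>Braid lengths are unique, so the length found with the help of \<open>v\<close>
    is the one named by the description in the statement.\<close>
  have the: "(THE m. braided A B m) = m" using m(1) braided_unique[OF AB(1,2)] by blast
  define \<gamma> where "\<gamma> = (\<lambda>i. z \<otimes> dihedral_walk m s t i)"
  have cp: "cycle_param (Cayl G \<B>) m \<gamma>" unfolding \<gamma>_def by (rule dihedral_cycle_param[OF AB(1,2) m(1) AB(3,4) c(4)])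
  have cv: "convex_subgraph (Cayl G \<B>) (range \<gamma>)"
    unfolding \<gamma>_def by (rule dihedral_convex[OF AB(1,2) ne m(1) AB(3,4) c(4)])
  have m2: "2 \<le> m" using m(1) by (simp add: braided_def)
  have d: "dihedral_walk m s t 0 = \<one>" "dihedral_walk m s t 1 = s" "dihedral_walk m s t (- 1) = t"
  proof -
    show "dihedral_walk m s t 0 = \<one>" by (auto simp: dihedral_walk_def)
    show "dihedral_walk m s t 1 = s" using stc by (simp add: dihedral_walk_def)
    \<comment> \<open>For \<open>m > 2\<close> the definition gives \<open>inv t\<close> at this
      index, and \<open>t\<close> is an involution; for \<open>m = 2\<close> the index
      \<open>- 1\<close> is reduced to \<open>3\<close> modulo \<open>4\<close>.\<close>
    show "dihedral_walk m s t (- 1) = t"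
    proof (cases "m = 2")
      case True
      thus ?thesis by (simp add: dihedral_walk_def numeral_3_eq_3)
    next
      case False
      hence "inv t = t" using subgroup_card_two[OF subgroup_basis[OF AB(2)], of t] AB m(1) m2 by (auto simp: braided_def)
      thus ?thesis using False stc by (simp add: dihedral_walk_def int_pow_neg inv_mult_group m_assoc)
    qed
  qed
  have dm: "dihedral_walk m s t (int m) = prod_word (alternating m s t)"
  proof (cases "m = 2")
    case True
    thus ?thesis using stc by (simp add: dihedral_walk_def numeral_2_eq_2)
  next
    case False
    hence "2 < m" using m2 by simp
    from dihedral_window[OF AB(1,2) m(1) this AB(3,4), of 0 m]
    have "dihedral_walk m s t (int m) = \<one> \<otimes> prod_word (alternating m s t)" using d by simp
    moreover have "prod_word (alternating m s t) \<in> carrier G"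
      using alternates_letters[OF alternates_alternating[OF AB(3,4)], of m] letters_mono[of "{A, B}" \<B>] AB
      by (intro prod_word_closed word_carrier) auto
    ultimately show ?thesis by simp
  qed
  define p where "p = prod_word (alternating m s t)"
  have bp: "reduced (alternating m s t)" using m(1) AB by (auto simp: braided_def braid_pair_def)
  have p: "p \<in> carrier G" "len p = m" using word_carrier[OF reduced_letters[OF bp]] len_reduced[OF bp]
    by (auto simp: p_def)
  have "p \<in> generate G (\<Union>{A, B})"
    unfolding p_def by (intro prod_word_generate alternates_letters alternates_alternating AB)
  hence lg: "len g = m + len k" using m(3,4) p by (simp add: p_def)
  have \<gamma>m: "\<gamma> (int m) = z \<otimes> p" by (simp add: \<gamma>_def dm p_def)
  have \<gamma>c: "\<gamma> i \<in> carrier G" for i using cp by (simp add: cycle_param_def)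
  have d1: "gdist (Cayl G \<B>) v (\<gamma> (int m)) = len k"
    using dv[OF p(1)] m(2,3) p(1) by (simp add: \<gamma>m p_def)
  have d2: "gdist (Cayl G \<B>) (\<gamma> (int m)) (\<gamma> 1) = m - 1"
  proof -
    have "gdist (Cayl G \<B>) (\<gamma> 1) (\<gamma> (1 + int (m - 1))) = m - 1" by (rule cycle_param_short[OF cp]) simp
    moreover have "1 + int (m - 1) = int m" using m2 by simp
    ultimately show ?thesis using gdist_sym[of "\<gamma> 1" "\<gamma> (int m)"] \<gamma>c by simp
  qed
  have d3: "gdist (Cayl G \<B>) (\<gamma> (int m)) (\<gamma> (- 1)) = m - 1"
  proof -
    have "gdist (Cayl G \<B>) (\<gamma> (- int m)) (\<gamma> (- int m + int (m - 1))) = m - 1"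
      by (rule cycle_param_short[OF cp]) simp
    moreover have "- int m + int (m - 1) = - 1" using m2 by simp
    moreover have "\<gamma> (- int m + 2 * int m) = \<gamma> (- int m)" using cp unfolding cycle_param_def by blast
    ultimately show ?thesis by simp
  qed
  have \<gamma>1: "\<gamma> 0 = z" "\<gamma> 1 = x" "\<gamma> (- 1) = y" using d stc c by (auto simp: \<gamma>_def)
  have "gdist (Cayl G \<B>) v x = len k + (m - 1)" "gdist (Cayl G \<B>) v y = len k + (m - 1)"
    using dv[OF stc(1)] dv[OF stc(2)] l lg m2 stc by auto
  hence "\<gamma> (int m) \<in> interval (Cayl G \<B>) v x \<inter> interval (Cayl G \<B>) v y"
    using d1 d2 d3 \<gamma>1 \<gamma>c[of "int m"] by (simp add: interval_def)
  moreover have "range \<gamma> = range (\<lambda>i. z \<otimes> dihedral_walk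
        (THE m. braided (base (inv z \<otimes> x)) (base (inv z \<otimes> y)) m) (inv z \<otimes> x) (inv z \<otimes> y) i)"
    using the by (simp add: \<gamma>_def s_def t_def A_def B_def)
  ultimately show ?thesis using cp cv \<gamma>1 by blast
qed

theorem mediangle_Cayl: "mediangle (Cayl G \<B>)"
proof -
  interpret simple_connected_graph "Cayl G \<B>" by (rule Cayl_simple_connected)
  define cyc where "cyc = (\<lambda>z x y. range (\<lambda>i. z \<otimes> dihedral_walk
        (THE m. braided (base (inv z \<otimes> x)) (base (inv z \<otimes> y)) m) (inv z \<otimes> x) (inv z \<otimes> y) i))"
  have 1: "\<exists>m \<gamma>. cycle_param (Cayl G \<B>) m \<gamma> \<and> range \<gamma> = cyc z x y \<and> convex_subgraph (Cayl G \<B>) (cyc z x y) \<and>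
        \<gamma> 0 = z \<and> \<gamma> 1 = x \<and> \<gamma> (- 1) = y \<and>
        \<gamma> (int m) \<in> interval (Cayl G \<B>) v x \<inter> interval (Cayl G \<B>) v y"
    if "v \<in> verts (Cayl G \<B>)" "adj (Cayl G \<B>) x z" "adj (Cayl G \<B>) y z" "x \<noteq> y"
      "gdist (Cayl G \<B>) v x = gdist (Cayl G \<B>) v y" "gdist (Cayl G \<B>) v z = gdist (Cayl G \<B>) v x + 1"
    for v x y z
    using Cayl_cycles[OF that] unfolding cyc_def by metis
  show ?thesis
    unfolding mediangle_def
    using simple connected Cayl_triangle_condition Cayl_intersection_of_triangles
      mediangle_cycles[of cyc, OF 1] by blast
qed

end

section \<open>The rotation system on the Cayley graph\<close>

context gated_basis
begin

lemma mem_left_coset_iff: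
  assumes "B \<in> \<B>" "g \<in> carrier G" "h \<in> carrier G"
  shows "h \<in> (\<lambda>b. g \<otimes> b) ` B \<longleftrightarrow> inv g \<otimes> h \<in> B"
proof
  assume "inv g \<otimes> h \<in> B"
  thus "h \<in> (\<lambda>b. g \<otimes> b) ` B" using assms by (intro image_eqI[of _ _ "inv g \<otimes> h"]) auto
qed (use assms basis_carrier in auto)

lemma left_coset_carrier: "B \<in> \<B> \<Longrightarrow> g \<in> carrier G \<Longrightarrow> (\<lambda>b. g \<otimes> b) ` B \<subseteq> carrier G"
  using basis_carrier by auto

lemma complete_left_coset:
  assumes "B \<in> \<B>" "g \<in> carrier G"
  shows "complete_subgraph (Cayl G \<B>) ((\<lambda>b. g \<otimes> b) ` B)"
proof -
  have "inv (g \<otimes> b) \<otimes> (g \<otimes> b') \<in> letters \<B>" if "b \<in> B" "b' \<in> B" "b \<noteq> b'" for b b'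
  proof -
    have c: "b \<in> carrier G" "b' \<in> carrier G" using that assms basis_carrier by auto
    have "inv b \<otimes> b' \<noteq> \<one>"
    proof
      assume "inv b \<otimes> b' = \<one>"
      hence "b \<otimes> (inv b \<otimes> b') = b" using c by simp
      thus False using c that by simp
    qed
    moreover have "inv b \<otimes> b' \<in> B" using that assms basis_mult basis_inv by simp
    ultimately have "inv b \<otimes> b' \<in> letters \<B>" using letterI assms by blast
    thus ?thesis using c assms by (simp add: inv_mult_group m_assoc)
  qed
  thus ?thesis using assms basis_carrier by (auto simp: complete_subgraph_def adj_Cayl)
qed

text \<open>A vertex adjacent to two points of the coset forms a triangle with them, and a triangle
  stays in one coset.\<close>

lemma clique_left_coset:
  assumes "B \<in> \<B>" "g \<in> carrier G"
  shows "clique (Cayl G \<B>) ((\<lambda>b. g \<otimes> b) ` B)"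
  unfolding clique_def
proof (intro conjI allI impI)
  show "complete_subgraph (Cayl G \<B>) ((\<lambda>b. g \<otimes> b) ` B)" by (rule complete_left_coset[OF assms])
  obtain b where b: "b \<in> B - {\<one>}" using basis_nontrivial_elem[OF assms(1)] by blast
  have bc: "b \<in> carrier G" using b basis_carrier assms by blast
  have gb: "g \<in> (\<lambda>b. g \<otimes> b) ` B" "g \<otimes> b \<in> (\<lambda>b. g \<otimes> b) ` B" "g \<otimes> b \<noteq> g"
    using b assms bc by (auto intro!: image_eqI[of _ _ \<one>])
  thus "\<exists>x\<in>(\<lambda>b. g \<otimes> b) ` B. \<exists>y\<in>(\<lambda>b. g \<otimes> b) ` B. adj (Cayl G \<B>) x y"
    using complete_left_coset[OF assms] unfolding complete_subgraph_def by metis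
  fix D assume "complete_subgraph (Cayl G \<B>) D \<and> (\<lambda>b. g \<otimes> b) ` B \<subseteq> D"
  hence D: "complete_subgraph (Cayl G \<B>) D" "(\<lambda>b. g \<otimes> b) ` B \<subseteq> D" by auto
  have gD: "g \<in> D" "g \<otimes> b \<in> D" using gb D by auto
  have "d \<in> (\<lambda>b. g \<otimes> b) ` B" if d: "d \<in> D" for d
  proof (cases "d = g \<or> d = g \<otimes> b")
    case False
    have "adj (Cayl G \<B>) g (g \<otimes> b)" "adj (Cayl G \<B>) g d" "adj (Cayl G \<B>) (g \<otimes> b) d"
      using D(1) gD d False gb(3) unfolding complete_subgraph_def by auto
    hence "base (inv g \<otimes> (g \<otimes> b)) = base (inv g \<otimes> d)" "inv g \<otimes> d \<in> letters \<B>" "d \<in> carrier G"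
      using Cayl_triangle_base by (auto simp: adj_Cayl)
    hence "inv g \<otimes> d \<in> B" using base_mem' base_eq[OF assms(1), of b] b bc assms by auto
    thus ?thesis using mem_left_coset_iff assms \<open>d \<in> carrier G\<close> by blast
  qed (use gb in auto)
  thus "D = (\<lambda>b. g \<otimes> b) ` B" using D(2) by blast
qed

lemma clique_Cayl_iff:
  "clique (Cayl G \<B>) C \<longleftrightarrow> (\<exists>g\<in>carrier G. \<exists>B\<in>\<B>. C = (\<lambda>b. g \<otimes> b) ` B)"
proof
  assume C: "clique (Cayl G \<B>) C"
  then obtain x y where xy: "x \<in> C" "y \<in> C" "adj (Cayl G \<B>) x y" by (auto simp: clique_def)
  define B where "B = base (inv x \<otimes> y)"
  have c: "x \<in> carrier G" "y \<in> carrier G" "B \<in> \<B>" "inv x \<otimes> y \<in> B"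
    using xy base_mem' by (auto simp: adj_Cayl B_def)
  have "C \<subseteq> (\<lambda>b. x \<otimes> b) ` B"
  proof
    fix z assume z: "z \<in> C"
    hence zc: "z \<in> carrier G" using C by (auto simp: clique_def complete_subgraph_def)
    have "inv x \<otimes> z \<in> B"
    proof (cases "z = x \<or> z = y")
      case False
      hence "adj (Cayl G \<B>) x z" "adj (Cayl G \<B>) y z"
        using C xy z unfolding clique_def complete_subgraph_def by metis+
      thus ?thesis using Cayl_triangle_base[OF xy(3)] base_mem' by (auto simp: adj_Cayl B_def)
    qed (use c in auto)
    thus "z \<in> (\<lambda>b. x \<otimes> b) ` B" using mem_left_coset_iff c zc by blast
  qed
  hence "(\<lambda>b. x \<otimes> b) ` B = C"
    using C complete_left_coset[OF c(3,1)] unfolding clique_def by blast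
  thus "\<exists>g\<in>carrier G. \<exists>B\<in>\<B>. C = (\<lambda>b. g \<otimes> b) ` B" using c by blast
qed (use clique_left_coset in blast)

abbreviation conjugates :: "'a set set"
  where "conjugates \<equiv> {conjugate G g B | g B. g \<in> carrier G \<and> B \<in> \<B>}"

text \<open>Uniqueness: since \<open>R\<close> stabilises the coset, looking at the image of
  \<open>g\<close> puts \<open>R\<close> inside the conjugate. Transitivity gives, for each
  \<open>x\<close> in the conjugate, some \<open>r\<close> in \<open>R\<close> with the same effect
  on \<open>g\<close>, and right cancellation yields \<open>r = x\<close>.\<close>

lemma is_rotative_stabiliser_Cayl_iff:
  assumes "B \<in> \<B>" "g \<in> carrier G"
  shows "is_rotative_stabiliser G (left_mult G) conjugates ((\<lambda>b. g \<otimes> b) ` B) R \<longleftrightarrow> R = conjugate G g B"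
proof
  let ?C = "(\<lambda>b. g \<otimes> b) ` B"
  assume "is_rotative_stabiliser G (left_mult G) conjugates ?C R"
  hence R: "R \<in> conjugates" "stabilises (left_mult G) R ?C" "acts_transitively (left_mult G) R ?C"
    by (auto simp: is_rotative_stabiliser_def)
  have Rc: "R \<subseteq> carrier G" using R(1) conjugate_subset basis_subset by blast
  have g: "g \<in> ?C" using assms by (auto intro!: image_eqI[of _ _ \<one>])
  show "R = conjugate G g B"
  proof (intro subset_antisym subsetI)
    fix r assume r: "r \<in> R"
    hence rc: "r \<in> carrier G" using Rc by blast
    have "left_mult G r g \<in> ?C" using R(2) r g unfolding stabilises_def by blast
    hence "r \<otimes> g \<in> ?C" using assms by (simp add: left_mult_def)
    hence "inv g \<otimes> (r \<otimes> g) \<in> B" using mem_left_coset_iff[OF assms, of "r \<otimes> g"] rc assms by simp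
    thus "r \<in> conjugate G g B"
      using mem_conjugate_iff[OF basis_subset[OF assms(1)] assms(2) rc] rc assms by (simp add: m_assoc)
  next
    fix x assume x: "x \<in> conjugate G g B"
    hence xc: "x \<in> carrier G" using conjugate_subset[OF basis_subset[OF assms(1)] assms(2)] by blast
    have "inv g \<otimes> x \<otimes> g \<in> B"
      using x mem_conjugate_iff[OF basis_subset[OF assms(1)] assms(2) xc] by simp
    hence "x \<otimes> g \<in> ?C" using mem_left_coset_iff[OF assms, of "x \<otimes> g"] xc assms by (simp add: m_assoc)
    then obtain r where r: "r \<in> R" "left_mult G r g = x \<otimes> g"
      using R(3) g unfolding acts_transitively_def by blast
    hence "r \<otimes> g = x \<otimes> g" using assms by (simp add: left_mult_def)
    hence "r = x" using r(1) Rc xc assms by auto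
    thus "x \<in> R" using r by simp
  qed
next
  let ?C = "(\<lambda>b. g \<otimes> b) ` B"
  assume R: "R = conjugate G g B"
  have Rc: "R \<subseteq> carrier G" using R conjugate_subset[OF basis_subset[OF assms(1)] assms(2)] by simp
  have mem: "r \<in> R \<longleftrightarrow> inv g \<otimes> r \<otimes> g \<in> B" if "r \<in> carrier G" for r
    using mem_conjugate_iff[OF basis_subset[OF assms(1)] assms(2) that] R by simp
  have Cc: "?C \<subseteq> carrier G" using left_coset_carrier[OF assms] .
  have act: "r \<otimes> x \<in> ?C" if rx: "r \<in> R" "x \<in> ?C" for r x
  proof -
    obtain b where b: "b \<in> B" "x = g \<otimes> b" using rx(2) by blast
    have c: "r \<in> carrier G" "b \<in> carrier G" using rx(1) Rc b basis_carrier[OF assms(1)] by auto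
    have "(inv g \<otimes> r \<otimes> g) \<otimes> b \<in> B" using basis_mult[OF assms(1)] mem[OF c(1)] rx(1) b by blast
    thus ?thesis using mem_left_coset_iff[OF assms, of "r \<otimes> x"] b c assms by (simp add: m_assoc)
  qed
  have inv: "inv r \<in> R" if "r \<in> R" for r
    using subgroup.m_inv_closed[OF subgroup_conjugate[OF subgroup_basis[OF assms(1)] assms(2)]] that R by simp
  have "stabilises (left_mult G) R ?C"
    unfolding stabilises_def
  proof (intro ballI subset_antisym subsetI)
    fix r x assume r: "r \<in> R"
    show "x \<in> ?C" if "x \<in> left_mult G r ` ?C"
    proof -
      obtain y where "y \<in> ?C" "x = left_mult G r y" using \<open>x \<in> left_mult G r ` ?C\<close> by blast
      moreover from this have "y \<in> carrier G" using Cc by blast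
      ultimately show ?thesis using act[OF r] by (simp add: left_mult_def)
    qed
    show "x \<in> left_mult G r ` ?C" if x: "x \<in> ?C"
    proof (rule image_eqI)
      show "inv r \<otimes> x \<in> ?C" using act[OF inv[OF r] x] .
      have "x \<in> carrier G" "r \<in> carrier G" using x Cc r Rc by auto
      thus "x = left_mult G r (inv r \<otimes> x)" by (simp add: left_mult_def)
    qed
  qed
  moreover have "acts_freely G (left_mult G) R ?C"
    unfolding acts_freely_def
  proof (intro ballI impI)
    fix r x assume r: "r \<in> R" and x: "x \<in> ?C" and rx: "left_mult G r x = x"
    have "x \<in> carrier G" "r \<in> carrier G" using x Cc r Rc by auto
    thus "r = \<one>" using rx by (simp add: left_mult_def)
  qed
  moreover have "acts_transitively (left_mult G) R ?C"
    unfolding acts_transitively_def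
  proof (intro ballI)
    fix x y assume xy: "x \<in> ?C" "y \<in> ?C"
    have c: "x \<in> carrier G" "y \<in> carrier G" using xy Cc by auto
    have "inv (inv g \<otimes> x) \<in> B" "inv g \<otimes> y \<in> B"
      using mem_left_coset_iff[OF assms c(1)] mem_left_coset_iff[OF assms c(2)] xy basis_inv[OF assms(1)] by auto
    hence "(inv g \<otimes> y) \<otimes> inv (inv g \<otimes> x) \<in> B" using basis_mult[OF assms(1)] by blast
    hence "y \<otimes> inv x \<in> R" using mem[of "y \<otimes> inv x"] c assms by (simp add: inv_mult_group m_assoc)
    moreover have "left_mult G (y \<otimes> inv x) x = y" using c by (simp add: left_mult_def m_assoc)
    ultimately show "\<exists>h\<in>R. left_mult G h x = y" by blast
  qed
  ultimately show "is_rotative_stabiliser G (left_mult G) conjugates ?C R"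
    using R assms unfolding is_rotative_stabiliser_def by blast
qed

lemma rotative_stabiliser_Cayl:
  assumes "B \<in> \<B>" "g \<in> carrier G"
  shows "rotative_stabiliser G (left_mult G) conjugates ((\<lambda>b. g \<otimes> b) ` B) = conjugate G g B"
  unfolding rotative_stabiliser_def is_rotative_stabiliser_Cayl_iff[OF assms] by simp

lemma left_mult_action: "group_action G (carrier G) (left_mult G)"
  unfolding group_action_def group_hom_def group_hom_axioms_def
proof (intro conjI)
  show "group G" by (rule is_group)
  show "group (BijGroup (carrier G))" by (rule group_BijGroup)
  have bij: "left_mult G g \<in> Bij (carrier G)" if g: "g \<in> carrier G" for g
  proof -
    have "bij_betw (left_mult G g) (carrier G) (carrier G)"
      by (rule bij_betw_byWitness[of _ "left_mult G (inv g)"])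
        (use g in \<open>auto simp: left_mult_def\<close>)
    thus ?thesis by (simp add: Bij_def left_mult_def)
  qed
  have "left_mult G (g \<otimes> h) = compose (carrier G) (left_mult G g) (left_mult G h)"
    if "g \<in> carrier G" "h \<in> carrier G" for g h
    using that by (auto simp: left_mult_def compose_def m_assoc restrict_def)
  thus "left_mult G \<in> hom G (BijGroup (carrier G))"
    using bij by (auto simp: hom_def BijGroup_def)
qed

text \<open>The translated gate changes only along edges in cliques whose rotative-stabiliser is the
  conjugate of \<open>B\<close> by \<open>g\<close>. On the clique \<open>g B\<close> itself it
  takes distinct values at distinct vertices, so it witnesses their separation.\<close>

lemma gate_const_off_wall:
  assumes "B \<in> \<B>" "g \<in> carrier G" "walk_betw (delete_edges (Cayl G \<B>)
      (\<Union>{edges (induced (Cayl G \<B>) D) | D. clique (Cayl G \<B>) D \<and>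
         rotative_stabiliser G (left_mult G) conjugates D = conjugate G g B})) x p y"
  shows "gate B (inv g \<otimes> x) = gate B (inv g \<otimes> y)"
  using assms(3)
proof (induction p arbitrary: x)
  case (Cons a p)
  show ?case
  proof (cases p)
    case Nil
    hence "x = y" using Cons.prems by (auto simp: walk_betw_def)
    thus ?thesis by simp
  next
    case (Cons b q)
    let ?F = "\<Union>{edges (induced (Cayl G \<B>) D) | D. clique (Cayl G \<B>) D \<and>
         rotative_stabiliser G (left_mult G) conjugates D = conjugate G g B}"
    have b: "adj (Cayl G \<B>) x b" "{x, b} \<notin> ?F"
      "walk_betw (delete_edges (Cayl G \<B>) ?F) b p y"
      using Cons.prems unfolding Cons walk_betw_Cons by (auto simp: delete_edges_def)
    define s where "s = inv x \<otimes> b"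
    have s: "s \<in> letters \<B>" "x \<in> carrier G" "b \<in> carrier G" "s \<in> carrier G" "b = x \<otimes> s"
      using b(1) by (auto simp: adj_Cayl s_def)
    have D: "base s \<in> \<B>" "s \<in> base s" using base_mem'[OF s(1)] by auto
    let ?D = "(\<lambda>b. x \<otimes> b) ` base s"
    have "x \<in> ?D" "b \<in> ?D" using s D by (auto intro!: image_eqI[of _ _ \<one>])
    hence "{x, b} \<in> edges (induced (Cayl G \<B>) ?D)"
      using b(1) by (auto simp: edges_def induced_def)
    hence "conjugate G x (base s) \<noteq> conjugate G g B"
      using b(2) clique_left_coset[OF D(1) s(2)] rotative_stabiliser_Cayl[OF D(1) s(2)] by blast
    moreover have "conjugate G g (conjugate G (inv g \<otimes> x) (base s)) = conjugate G x (base s)"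
      using s(2) assms(2) basis_subset[OF D(1)] by (simp add: conjugate_mult)
    ultimately have "conjugate G (inv g \<otimes> x) (base s) \<noteq> B" by metis
    hence "gate B ((inv g \<otimes> x) \<otimes> s) = gate B (inv g \<otimes> x)"
      using s assms by (intro gate_step[OF assms(1) D]) auto
    thus ?thesis using Cons.IH[OF b(3)] s assms(2) by (simp add: m_assoc)
  qed
qed (simp add: walk_betw_def)

theorem rotation_system_Cayl: "rotation_system G (Cayl G \<B>) (left_mult G) conjugates"
  unfolding rotation_system_def
proof (intro conjI ballI allI impI)
  interpret simple_connected_graph "Cayl G \<B>" by (rule Cayl_simple_connected)
  show "group G" by (rule is_group)
  show "simple_graph (Cayl G \<B>)" "connected_graph (Cayl G \<B>)" by (rule simple, rule connected)
  show "subgroup R G" if "R \<in> conjugates" for R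
    using that subgroup_conjugate subgroup_basis by blast
  show act: "group_action G (verts (Cayl G \<B>)) (left_mult G)" using left_mult_action by simp
  show "graph_iso (Cayl G \<B>) (Cayl G \<B>) (left_mult G g)" if g: "g \<in> carrier G" for g
  proof -
    have "bij_betw (left_mult G g) (carrier G) (carrier G)"
      using group_action.bij_prop0[OF left_mult_action g] by (simp add: Bij_def)
    moreover have "adj (Cayl G \<B>) (left_mult G g x) (left_mult G g y) \<longleftrightarrow> adj (Cayl G \<B>) x y"
      if "x \<in> carrier G" "y \<in> carrier G" for x y
      using that g by (simp add: adj_Cayl left_mult_def inv_mult_group m_assoc)
    ultimately show ?thesis by (simp add: graph_iso_def)
  qed
  show "conjugate G g R \<in> conjugates" if gR: "g \<in> carrier G" "R \<in> conjugates" for g R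
  proof -
    obtain h B where "R = conjugate G h B" "h \<in> carrier G" "B \<in> \<B>" using gR(2) by blast
    moreover from this have "conjugate G g R = conjugate G (g \<otimes> h) B"
      using conjugate_mult basis_subset gR(1) by simp
    ultimately show ?thesis using gR(1) by blast
  qed
  have sub: "\<Union>conjugates \<subseteq> carrier G" using conjugate_subset basis_subset by blast
  have "B \<in> conjugates" if "B \<in> \<B>" for B
    using conjugate_one[OF basis_subset[OF that]] that one_closed by blast
  hence "\<Union>\<B> \<subseteq> \<Union>conjugates" by blast
  from mono_generate[OF this] have "carrier G \<subseteq> generate G (\<Union>conjugates)"
    by (simp only: basis_generates)
  thus "generate G (\<Union>conjugates) = carrier G" using generate_incl[OF sub] by blast
  show "\<exists>!R. is_rotative_stabiliser G (left_mult G) conjugates C R" if "clique (Cayl G \<B>) C" for C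
    using that is_rotative_stabiliser_Cayl_iff unfolding clique_Cayl_iff by (elim bexE) simp
  show "\<exists>C. clique (Cayl G \<B>) C \<and> rotative_stabiliser G (left_mult G) conjugates C = R"
    if "R \<in> conjugates" for R
    using that rotative_stabiliser_Cayl clique_left_coset by blast
  fix C x y
  assume C: "clique (Cayl G \<B>) C" "x \<in> C" "y \<in> C" "x \<noteq> y"
  then obtain g B where gB: "g \<in> carrier G" "B \<in> \<B>" "C = (\<lambda>b. g \<otimes> b) ` B"
    unfolding clique_Cayl_iff by blast
  obtain b b' where b: "b \<in> B" "b' \<in> B" "x = g \<otimes> b" "y = g \<otimes> b'" using C gB by blast
  have "gate B (inv g \<otimes> x) = b" "gate B (inv g \<otimes> y) = b'"
    using b gB basis_carrier[OF gB(2)] gate_self[OF gB(2)] by auto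
  thus "\<nexists>p. walk_betw (delete_edges (Cayl G \<B>) (\<Union>{edges (induced (Cayl G \<B>) D) | D.
      clique (Cayl G \<B>) D \<and> rotative_stabiliser G (left_mult G) conjugates D =
        rotative_stabiliser G (left_mult G) conjugates C})) x p y"
    using gate_const_off_wall[OF gB(2,1), of x _ y] b C(4) rotative_stabiliser_Cayl[OF gB(2,1)] gB(3)
    by auto
qed

end

section \<open>Invariance under isomorphisms\<close>

locale graph_isomorphism =
  fixes X :: "'v ugraph" and Y :: "'w ugraph" and f :: "'v \<Rightarrow> 'w"
  assumes iso: "graph_iso X Y f"
begin

lemma inj: "inj_on f (verts X)" and image_verts: "f ` verts X = verts Y"
  and f_verts: "x \<in> verts X \<Longrightarrow> f x \<in> verts Y"
  using iso by (auto simp: graph_iso_def bij_betw_def)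

lemma adj_f: "x \<in> verts X \<Longrightarrow> y \<in> verts X \<Longrightarrow> adj Y (f x) (f y) \<longleftrightarrow> adj X x y"
  using iso by (simp add: graph_iso_def)

lemma vertsE:
  assumes "y \<in> verts Y"
  obtains x where "x \<in> verts X" "y = f x"
  using assms image_verts by auto

lemma walk_map: "walk_betw X x p y \<Longrightarrow> walk_betw Y (f x) (map f p) (f y)"
  using f_verts adj_f
  by (auto simp: walk_betw_def hd_map last_map successively_map elim!: successively_mono)

lemma inverse: "graph_isomorphism Y X (inv_into (verts X) f)"
  using graph_iso_inv[OF iso] by (rule graph_isomorphism.intro)

lemma inverse_f [simp]: "x \<in> verts X \<Longrightarrow> inv_into (verts X) f (f x) = x"
  using inj by simp

lemma f_inverse [simp]: "y \<in> verts Y \<Longrightarrow> f (inv_into (verts X) f y) = y"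
  using image_verts by (simp add: f_inv_into_f)

lemma gdist_f:
  assumes "x \<in> verts X" "y \<in> verts X"
  shows "gdist Y (f x) (f y) = gdist X x y"
proof -
  have "(\<exists>p. walk_betw Y (f x) p (f y) \<and> length p = Suc n) \<longleftrightarrow> (\<exists>p. walk_betw X x p y \<and> length p = Suc n)" for n
  proof
    assume "\<exists>p. walk_betw Y (f x) p (f y) \<and> length p = Suc n"
    then obtain p where "walk_betw Y (f x) p (f y)" "length p = Suc n" by blast
    hence "walk_betw X x (map (inv_into (verts X) f) p) y" "length (map (inv_into (verts X) f) p) = Suc n"
      using graph_isomorphism.walk_map[OF inverse, of "f x" p "f y"] assms by auto
    thus "\<exists>p. walk_betw X x p y \<and> length p = Suc n" by blast
  next
    assume "\<exists>p. walk_betw X x p y \<and> length p = Suc n"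
    thus "\<exists>p. walk_betw Y (f x) p (f y) \<and> length p = Suc n" using walk_map by (metis length_map)
  qed
  thus ?thesis by (simp add: gdist_def)
qed

lemma interval_f:
  assumes "x \<in> verts X" "y \<in> verts X"
  shows "interval Y (f x) (f y) = f ` interval X x y"
proof (intro subset_antisym subsetI)
  fix z assume z: "z \<in> interval Y (f x) (f y)"
  then obtain u where "u \<in> verts X" "z = f u" by (auto simp: interval_def elim: vertsE)
  thus "z \<in> f ` interval X x y" using z assms by (auto simp: interval_def gdist_f)
qed (use assms in \<open>auto simp: interval_def gdist_f f_verts\<close>)

lemma convex_f:
  assumes "convex_subgraph X S"
  shows "convex_subgraph Y (f ` S)"
proof -
  have S: "S \<subseteq> verts X" using assms by (simp add: convex_subgraph_def)
  have "interval Y (f x) (f y) \<subseteq> f ` S" if "x \<in> S" "y \<in> S" for x y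
    using interval_f[of x y] that S assms unfolding convex_subgraph_def by blast
  thus ?thesis using S f_verts by (auto simp: convex_subgraph_def)
qed

lemma induced_f:
  assumes "S \<subseteq> verts X"
  shows "graph_isomorphism (induced X S) (induced Y (f ` S)) f"
proof
  have "inj_on f S" using inj_on_subset[OF inj assms] .
  moreover have "f ` S \<subseteq> verts Y" using assms f_verts by blast
  ultimately show "graph_iso (induced X S) (induced Y (f ` S)) f"
    using assms adj_f[OF subsetD[OF assms] subsetD[OF assms]]
    by (auto simp: graph_iso_def induced_def bij_betw_def Int_absorb1)
qed

lemma isomorphic_f:
  assumes "X \<cong>\<^sub>g Z"
  shows "Y \<cong>\<^sub>g Z"
proof -
  obtain g where g: "graph_iso X Z g" using assms by (auto simp: isomorphic_graphs_def)
  have h: "graph_iso Y X (inv_into (verts X) f)" using graph_iso_inv[OF iso] .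
  have "graph_iso Y Z (g \<circ> inv_into (verts X) f)"
    unfolding graph_iso_def
  proof (intro conjI ballI)
    show "bij_betw (g \<circ> inv_into (verts X) f) (verts Y) (verts Z)"
      using g h by (auto simp: graph_iso_def intro: bij_betw_trans)
    fix x y assume xy: "x \<in> verts Y" "y \<in> verts Y"
    hence "inv_into (verts X) f x \<in> verts X" "inv_into (verts X) f y \<in> verts X"
      using graph_isomorphism.f_verts[OF inverse] by auto
    thus "adj Z ((g \<circ> inv_into (verts X) f) x) ((g \<circ> inv_into (verts X) f) y) \<longleftrightarrow> adj Y x y"
      using g h xy by (simp add: graph_iso_def)
  qed
  thus ?thesis by (auto simp: isomorphic_graphs_def)
qed

lemma convex_even_cycle_f:
  assumes "convex_even_cycle X C"
  shows "convex_even_cycle Y (f ` C)"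
proof -
  have C: "C \<subseteq> verts X" using assms by (simp add: convex_even_cycle_def convex_subgraph_def)
  show ?thesis
    using assms convex_f graph_isomorphism.isomorphic_f[OF induced_f[OF C]]
    unfolding convex_even_cycle_def by blast
qed

lemma opposite_f:
  assumes "opposite_vertex X C z w" "C \<subseteq> verts X"
  shows "opposite_vertex Y (f ` C) (f z) (f w)"
proof -
  have "z \<in> verts (induced X C)" "w \<in> verts (induced X C)"
    using assms by (auto simp: opposite_vertex_def induced_def)
  moreover have "card (f ` C) = card C" using inj_on_subset[OF inj assms(2)] by (rule card_image)
  ultimately show ?thesis
    using assms(1) graph_isomorphism.gdist_f[OF induced_f[OF assms(2)]] by (simp add: opposite_vertex_def)
qed

lemma edges_f:
  assumes "e \<in> edges (induced X S)" "S \<subseteq> verts X"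
  shows "f ` e \<in> edges (induced Y (f ` S))"
proof -
  obtain x y where e: "e = {x, y}" "x \<in> S" "y \<in> S" "adj X x y" using assms(1) by (auto simp: edges_def induced_def)
  hence "adj Y (f x) (f y)" using adj_f assms(2) by blast
  hence "adj (induced Y (f ` S)) (f x) (f y)" using e by (simp add: induced_def)
  thus ?thesis using e by (auto simp: edges_def)
qed

text \<open>\<open>graph_iso\<close> says nothing about \<open>adj Y\<close> outside \<open>verts Y\<close>, so \<open>simple_graph Y\<close> is not inherited.\<close>

lemma mediangle_f:
  assumes "mediangle X" "simple_graph Y"
  shows "mediangle Y"
proof -
  define g where "g = inv_into (verts X) f"
  interpret g: graph_isomorphism Y X g unfolding g_def by (rule inverse)
  have X: "simple_graph X" "connected_graph X" "triangle_condition X" "intersection_of_triangles X"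
    "cycle_condition X" "intersection_of_even_cycles X"
    using assms(1) by (auto simp: mediangle_def)
  have fg: "f (g y) = y" if "y \<in> verts Y" for y using that by (simp add: g_def)
  show ?thesis
    unfolding mediangle_def
  proof (intro conjI)
    show "connected_graph Y"
      unfolding connected_graph_def
    proof (intro conjI ballI)
      show "verts Y \<noteq> {}" using X(2) image_verts by (auto simp: connected_graph_def)
      fix x y assume xy: "x \<in> verts Y" "y \<in> verts Y"
      then obtain p where "walk_betw X (g x) p (g y)"
        using X(2) g.f_verts unfolding connected_graph_def by blast
      thus "\<exists>p. walk_betw Y x p y" using walk_map[of "g x" p "g y"] fg xy by auto
    qed
    show tri: "triangle_condition Y"
      unfolding triangle_condition_def
    proof (intro ballI impI, elim conjE)
      fix v x y assume a: "v \<in> verts Y" "x \<in> verts Y" "y \<in> verts Y"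
        "gdist Y v x = gdist Y v y" "gdist Y x y = 1"
      then obtain v' x' y' where v: "v' \<in> verts X" "x' \<in> verts X" "y' \<in> verts X"
        "v = f v'" "x = f x'" "y = f y'" using vertsE by metis
      hence "gdist X v' x' = gdist X v' y'" "gdist X x' y' = 1" using a gdist_f by auto
      then obtain z where z: "adj X x' z" "adj X y' z" "z \<in> interval X v' x' \<inter> interval X v' y'"
        using X(3) v unfolding triangle_condition_def by blast
      hence "z \<in> verts X" by (auto simp: interval_def)
      hence "adj Y x (f z)" "adj Y y (f z)" "f z \<in> interval Y v x \<inter> interval Y v y"
        using z v adj_f interval_f by auto
      thus "\<exists>z. adj Y x z \<and> adj Y y z \<and> z \<in> interval Y v x \<inter> interval Y v y" by blast
    qed
    show "intersection_of_triangles Y"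
      unfolding intersection_of_triangles_def
    proof (intro notI, elim exE conjE)
      fix S assume S: "S \<subseteq> verts Y" "induced Y S \<cong>\<^sub>g K4_minus"
      have "induced X (g ` S) \<cong>\<^sub>g K4_minus"
        using graph_isomorphism.isomorphic_f[OF g.induced_f[OF S(1)] S(2)] .
      moreover have "g ` S \<subseteq> verts X" using S(1) g.f_verts by blast
      ultimately show False using X(4) by (auto simp: intersection_of_triangles_def)
    qed
    show "cycle_condition Y"
      unfolding cycle_condition_def
    proof (intro ballI impI, elim conjE)
      fix v x y z assume a: "v \<in> verts Y" "x \<in> verts Y" "y \<in> verts Y" "z \<in> verts Y" "x \<noteq> y"
        "gdist Y v x = gdist Y v y" "gdist Y v z = gdist Y v x + 1" "gdist Y x z = 1" "gdist Y y z = 1"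
      then obtain v' x' y' z' where v: "v' \<in> verts X" "x' \<in> verts X" "y' \<in> verts X" "z' \<in> verts X"
        "v = f v'" "x = f x'" "y = f y'" "z = f z'" using vertsE by metis
      hence "x' \<noteq> y' \<and> gdist X v' x' = gdist X v' y' \<and> gdist X v' z' = gdist X v' x' + 1 \<and>
          gdist X x' z' = 1 \<and> gdist X y' z' = 1"
        using a gdist_f by auto
      then obtain C w where C: "convex_even_cycle X C" "{{z', x'}, {z', y'}} \<subseteq> edges (induced X C)"
        "opposite_vertex X C z' w" "w \<in> interval X v' x' \<inter> interval X v' y'"
        using X(5)[unfolded cycle_condition_def, rule_format, OF v(1-4)] by blast
      have CX: "C \<subseteq> verts X" using C(1) by (simp add: convex_even_cycle_def convex_subgraph_def)
      have "{{z, x}, {z, y}} \<subseteq> edges (induced Y (f ` C))"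
        using edges_f[OF _ CX, of "{z', x'}"] edges_f[OF _ CX, of "{z', y'}"] C(2) v by simp
      moreover have "opposite_vertex Y (f ` C) z (f w)" using opposite_f[OF C(3) CX] v by simp
      moreover have "f w \<in> interval Y v x \<inter> interval Y v y" using C(4) interval_f v by auto
      ultimately show "\<exists>C. convex_even_cycle Y C \<and> {{z, x}, {z, y}} \<subseteq> edges (induced Y C) \<and>
          (\<exists>w. opposite_vertex Y C z w \<and> w \<in> interval Y v x \<inter> interval Y v y)"
        using convex_even_cycle_f[OF C(1)] by blast
    qed
    show "intersection_of_even_cycles Y"
      unfolding intersection_of_even_cycles_def
    proof (intro allI impI ballI, elim conjE)
      fix C D d e
      assume CD: "convex_even_cycle Y C" "convex_even_cycle Y D" "C \<noteq> D"
        and de: "d \<in> edges (induced Y (C \<inter> D))" "e \<in> edges (induced Y (C \<inter> D))"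
      have CY: "C \<subseteq> verts Y" "D \<subseteq> verts Y"
        using CD by (auto simp: convex_even_cycle_def convex_subgraph_def)
      have "g ` C \<noteq> g ` D" using inj_on_image_eq_iff[OF g.inj CY] CD(3) by simp
      moreover have "g ` (C \<inter> D) = g ` C \<inter> g ` D" using inj_on_image_Int[OF g.inj CY] .
      moreover have "C \<inter> D \<subseteq> verts Y" using CY by blast
      hence "g ` d \<in> edges (induced X (g ` (C \<inter> D)))" "g ` e \<in> edges (induced X (g ` (C \<inter> D)))"
        using g.edges_f de by auto
      ultimately have "g ` d = g ` e"
        using X(6) g.convex_even_cycle_f[OF CD(1)] g.convex_even_cycle_f[OF CD(2)]
        unfolding intersection_of_even_cycles_def by metis
      moreover have "d \<subseteq> verts Y" "e \<subseteq> verts Y" using de CY by (auto simp: edges_def induced_def)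
      ultimately show "d = e" using inj_on_image_eq_iff[OF g.inj] by blast
    qed
  qed (rule assms(2))
qed

end

section \<open>From rotation systems to gated bases\<close>

text \<open>Cliques may be infinite, so a maximal complete subgraph containing the edge is obtained
  from Zorn's lemma.\<close>

lemma clique_exists:
  assumes "simple_graph X" "adj X x y"
  obtains C where "clique X C" "x \<in> C" "y \<in> C"
proof -
  define \<A> where "\<A> = {S. complete_subgraph X S \<and> {x, y} \<subseteq> S}"
  have "{x, y} \<in> \<A>"
    using assms by (auto simp: \<A>_def complete_subgraph_def simple_graph_def)
  hence "\<A> \<noteq> {}" by blast
  moreover have "\<Union>\<C> \<in> \<A>" if \<C>: "\<C> \<noteq> {}" "subset.chain \<A> \<C>" for \<C>
  proof -
    have sub: "S \<in> \<A>" if "S \<in> \<C>" for S using \<C>(2) that by (auto simp: subset.chain_def)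
    have "adj X a b" if ab: "a \<in> \<Union>\<C>" "b \<in> \<Union>\<C>" "a \<noteq> b" for a b
    proof -
      obtain S T where ST: "S \<in> \<C>" "T \<in> \<C>" "a \<in> S" "b \<in> T" using ab by blast
      then obtain U where "U \<in> \<C>" "a \<in> U" "b \<in> U" using \<C>(2) unfolding subset_chain_def by blast
      thus ?thesis using sub ab(3) unfolding \<A>_def complete_subgraph_def by blast
    qed
    moreover have "\<Union>\<C> \<subseteq> verts X"
      by (rule Union_least) (use sub in \<open>auto simp: \<A>_def complete_subgraph_def\<close>)
    moreover obtain S where "S \<in> \<C>" using \<C>(1) by blast
    hence "{x, y} \<subseteq> \<Union>\<C>" using sub[of S] by (auto simp: \<A>_def)
    ultimately show ?thesis unfolding \<A>_def complete_subgraph_def by simp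
  qed
  ultimately obtain M where M: "M \<in> \<A>" "\<And>S. S \<in> \<A> \<Longrightarrow> M \<subseteq> S \<Longrightarrow> S = M"
    using subset_Zorn_nonempty[of \<A>] by metis
  have "clique X M"
    using M assms(2) unfolding clique_def \<A>_def by blast
  thus thesis using that M(1) by (auto simp: \<A>_def)
qed

lemma adj_delete_edges: "adj (delete_edges X F) x y \<longleftrightarrow> adj X x y \<and> {x, y} \<notin> F"
  by (simp add: delete_edges_def)

locale rotation_system_at = group G for G (structure) +
  fixes X :: "'v ugraph" and \<phi> :: "'a \<Rightarrow> 'v \<Rightarrow> 'v" and \<R> :: "'a set set" and x\<^sub>0 :: 'v
  assumes rotation_system: "rotation_system G X \<phi> \<R>" and x0: "x\<^sub>0 \<in> verts X"
begin

abbreviation rot :: "'v set \<Rightarrow> 'a set"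
  where "rot \<equiv> rotative_stabiliser G \<phi> \<R>"

abbreviation is_rot :: "'v set \<Rightarrow> 'a set \<Rightarrow> bool"
  where "is_rot \<equiv> is_rotative_stabiliser G \<phi> \<R>"

abbreviation wall :: "'a set \<Rightarrow> 'v set set"
  where "wall R \<equiv> \<Union>{edges (induced X D) | D. clique X D \<and> rot D = R}"

definition same_side :: "'a set \<Rightarrow> 'v \<Rightarrow> 'v \<Rightarrow> bool"
  where "same_side R x y \<longleftrightarrow> (\<exists>p. walk_betw (delete_edges X (wall R)) x p y)"

sublocale simple_connected_graph X
  using rotation_system by unfold_locales (auto simp: rotation_system_def)

sublocale action: group_action G "verts X" \<phi>
  using rotation_system by (simp add: rotation_system_def)

lemma subgroup_rotations: "R \<in> \<R> \<Longrightarrow> subgroup R G"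
  using rotation_system by (simp add: rotation_system_def)

lemma conjugate_rotations: "g \<in> carrier G \<Longrightarrow> R \<in> \<R> \<Longrightarrow> conjugate G g R \<in> \<R>"
  using rotation_system by (simp add: rotation_system_def)

lemma act_one [simp]: "x \<in> verts X \<Longrightarrow> \<phi> \<one> x = x"
  using action.id_eq_one by (metis restrict_apply')

lemma act_mult: "x \<in> verts X \<Longrightarrow> g \<in> carrier G \<Longrightarrow> h \<in> carrier G \<Longrightarrow> \<phi> (g \<otimes> h) x = \<phi> g (\<phi> h x)"
  by (rule action.composition_rule)

lemma act_verts [simp]: "g \<in> carrier G \<Longrightarrow> x \<in> verts X \<Longrightarrow> \<phi> g x \<in> verts X"
  using action.element_image by blast

lemma act_inv [simp]:
  "g \<in> carrier G \<Longrightarrow> x \<in> verts X \<Longrightarrow> \<phi> (inv g) (\<phi> g x) = x"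
  "g \<in> carrier G \<Longrightarrow> x \<in> verts X \<Longrightarrow> \<phi> g (\<phi> (inv g) x) = x"
  using act_mult[of x "inv g" g] act_mult[of x g "inv g"] by auto

lemma act_adj: "g \<in> carrier G \<Longrightarrow> x \<in> verts X \<Longrightarrow> y \<in> verts X \<Longrightarrow> adj X (\<phi> g x) (\<phi> g y) \<longleftrightarrow> adj X x y"
  using rotation_system by (simp add: rotation_system_def graph_iso_def)

lemma act_inj: "g \<in> carrier G \<Longrightarrow> x \<in> verts X \<Longrightarrow> y \<in> verts X \<Longrightarrow> \<phi> g x = \<phi> g y \<Longrightarrow> x = y"
  using act_inv(1) by metis

lemma act_image_inv:
  assumes "g \<in> carrier G" "C \<subseteq> verts X"
  shows "\<phi> (inv g) ` \<phi> g ` C = C" "\<phi> g ` \<phi> (inv g) ` C = C"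
proof -
  have "(\<lambda>x. \<phi> (inv g) (\<phi> g x)) ` C = (\<lambda>x. x) ` C"
    by (rule image_cong) (use assms in auto)
  moreover have "(\<lambda>x. \<phi> g (\<phi> (inv g) x)) ` C = (\<lambda>x. x) ` C"
    by (rule image_cong) (use assms in auto)
  ultimately show "\<phi> (inv g) ` \<phi> g ` C = C" "\<phi> g ` \<phi> (inv g) ` C = C" by (simp_all add: image_image)
qed

lemma clique_subset: "clique X C \<Longrightarrow> C \<subseteq> verts X"
  by (simp add: clique_def complete_subgraph_def)

lemma act_complete:
  assumes "g \<in> carrier G" "complete_subgraph X C"
  shows "complete_subgraph X (\<phi> g ` C)"
  using assms act_adj by (auto simp: complete_subgraph_def subset_iff)

lemma act_clique:
  assumes "g \<in> carrier G" "clique X C"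
  shows "clique X (\<phi> g ` C)"
  unfolding clique_def
proof (intro conjI allI impI)
  have C: "complete_subgraph X C" "C \<subseteq> verts X" using assms(2) clique_subset by (auto simp: clique_def)
  show "complete_subgraph X (\<phi> g ` C)" using act_complete assms(1) C(1) .
  obtain x y where "x \<in> C" "y \<in> C" "adj X x y" using assms(2) by (auto simp: clique_def)
  thus "\<exists>x\<in>\<phi> g ` C. \<exists>y\<in>\<phi> g ` C. adj X x y" using act_adj assms(1) C(2) by blast
  fix D assume "complete_subgraph X D \<and> \<phi> g ` C \<subseteq> D"
  hence D: "complete_subgraph X D" "\<phi> g ` C \<subseteq> D" by auto
  hence DX: "D \<subseteq> verts X" by (simp add: complete_subgraph_def)
  have "complete_subgraph X (\<phi> (inv g) ` D)" using act_complete assms(1) D(1) by simp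
  moreover have "C \<subseteq> \<phi> (inv g) ` D"
    using image_mono[OF D(2), of "\<phi> (inv g)"] act_image_inv(1)[OF assms(1) C(2)] by simp
  ultimately have "\<phi> (inv g) ` D = C" using assms(2) by (auto simp: clique_def)
  thus "D = \<phi> g ` C" using act_image_inv(2)[OF assms(1) DX] by simp
qed

lemma rot_unique: "clique X C \<Longrightarrow> \<exists>!R. is_rot C R"
  using rotation_system by (simp add: rotation_system_def)

lemma is_rot_rot: "clique X C \<Longrightarrow> is_rot C (rot C)"
  unfolding rotative_stabiliser_def by (rule theI') (rule rot_unique)

lemma rot_eq: "clique X C \<Longrightarrow> is_rot C R \<Longrightarrow> rot C = R"
  using rot_unique is_rot_rot by blast

lemma rot_mem: "clique X C \<Longrightarrow> rot C \<in> \<R>"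
  using is_rot_rot by (simp add: is_rotative_stabiliser_def)

lemma rot_carrier: "clique X C \<Longrightarrow> rot C \<subseteq> carrier G"
  using rot_mem subgroup_rotations subgroup.subset by blast

lemma rot_free: "clique X C \<Longrightarrow> r \<in> rot C \<Longrightarrow> x \<in> C \<Longrightarrow> \<phi> r x = x \<Longrightarrow> r = \<one>"
  using is_rot_rot[of C] unfolding is_rotative_stabiliser_def acts_freely_def by blast

text \<open>A clique is recovered from its rotative-stabiliser and any one of its vertices. Hence
  two cliques that meet and have the same rotative-stabiliser are equal.\<close>

lemma clique_orbit:
  assumes "clique X C" "x \<in> C"
  shows "C = (\<lambda>r. \<phi> r x) ` rot C"
proof -
  have "stabilises \<phi> (rot C) C" "acts_transitively \<phi> (rot C) C"
    using is_rot_rot[OF assms(1)] by (auto simp: is_rotative_stabiliser_def)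
  hence st: "\<phi> r ` C = C" "\<exists>h\<in>rot C. \<phi> h x = y" if "r \<in> rot C" "y \<in> C" for r y
    using that assms(2) unfolding stabilises_def acts_transitively_def by auto
  show ?thesis
  proof (intro subset_antisym subsetI)
    fix y assume "y \<in> C"
    moreover have "\<one> \<in> rot C" using rot_mem[OF assms(1)] subgroup_rotations subgroup.one_closed by blast
    ultimately show "y \<in> (\<lambda>r. \<phi> r x) ` rot C" using st(2) by blast
  next
    fix y assume "y \<in> (\<lambda>r. \<phi> r x) ` rot C"
    then obtain r where "r \<in> rot C" "y = \<phi> r x" by blast
    thus "y \<in> C" using st(1)[of r x] assms(2) by blast
  qed
qed

lemma rot_act:
  assumes "g \<in> carrier G" "clique X C"
  shows "rot (\<phi> g ` C) = conjugate G g (rot C)"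
proof (rule rot_eq[OF act_clique[OF assms]])
  let ?R = "rot C"
  have R: "?R \<in> \<R>" "stabilises \<phi> ?R C" "acts_freely G \<phi> ?R C" "acts_transitively \<phi> ?R C"
    using is_rot_rot[OF assms(2)] by (auto simp: is_rotative_stabiliser_def)
  have Rc: "?R \<subseteq> carrier G" using rot_carrier[OF assms(2)] .
  have CX: "C \<subseteq> verts X" using clique_subset[OF assms(2)] .
  have act: "\<phi> (g \<otimes> r \<otimes> inv g) (\<phi> g x) = \<phi> g (\<phi> r x)" if "r \<in> ?R" "x \<in> C" for r x
    using that Rc CX assms(1) by (auto simp: act_mult subset_iff)
  have conj: "conjugate G g ?R = (\<lambda>r. g \<otimes> r \<otimes> inv g) ` ?R" using conjugate_eq[OF Rc assms(1)] .
  have "\<phi> (g \<otimes> r \<otimes> inv g) ` \<phi> g ` C = \<phi> g ` C" if r: "r \<in> ?R" for r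
  proof -
    have "\<phi> (g \<otimes> r \<otimes> inv g) ` \<phi> g ` C = \<phi> g ` \<phi> r ` C"
      using act[OF r] by (simp add: image_image cong: image_cong)
    thus ?thesis using R(2) r by (simp add: stabilises_def)
  qed
  hence "stabilises \<phi> (conjugate G g ?R) (\<phi> g ` C)" by (auto simp: stabilises_def conj)
  moreover have "acts_freely G \<phi> (conjugate G g ?R) (\<phi> g ` C)"
    unfolding acts_freely_def conj
  proof (intro ballI impI)
    fix h y assume h: "h \<in> (\<lambda>r. g \<otimes> r \<otimes> inv g) ` ?R" and y: "y \<in> \<phi> g ` C" and fixed: "\<phi> h y = y"
    obtain r x where r: "r \<in> ?R" "x \<in> C" "h = g \<otimes> r \<otimes> inv g" "y = \<phi> g x" using h y by blast
    hence "\<phi> g (\<phi> r x) = \<phi> g x" using fixed act by simp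
    hence "\<phi> r x = x" using act_inj[OF assms(1)] r Rc CX by (meson act_verts subsetD)
    hence "r = \<one>" using R(3) r(1,2) unfolding acts_freely_def by blast
    thus "h = \<one>" using r(3) assms(1) by simp
  qed
  moreover have "acts_transitively \<phi> (conjugate G g ?R) (\<phi> g ` C)"
    unfolding acts_transitively_def conj
  proof (intro ballI)
    fix y z assume "y \<in> \<phi> g ` C" "z \<in> \<phi> g ` C"
    then obtain a b where ab: "a \<in> C" "b \<in> C" "y = \<phi> g a" "z = \<phi> g b" by blast
    then obtain r where "r \<in> ?R" "\<phi> r a = b" using R(4) by (auto simp: acts_transitively_def)
    thus "\<exists>h\<in>(\<lambda>r. g \<otimes> r \<otimes> inv g) ` ?R. \<phi> h y = z" using ab act by blast
  qed
  ultimately show "is_rot (\<phi> g ` C) (conjugate G g ?R)"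
    using conjugate_rotations[OF assms(1) R(1)] by (simp add: is_rotative_stabiliser_def)
qed

section \<open>Sides of a wall, and uniqueness of the clique through an edge\<close>

lemma same_side_refl: "x \<in> verts X \<Longrightarrow> same_side R x x"
  unfolding same_side_def by (rule exI[of _ "[x]"]) (simp add: delete_edges_def)

lemma same_side_trans: "same_side R x y \<Longrightarrow> same_side R y z \<Longrightarrow> same_side R x z"
  unfolding same_side_def by (elim exE) (rule exI, rule walk_betw_append)

lemma same_side_sym: "same_side R x y \<Longrightarrow> same_side R y x"
proof -
  have "simple_graph (delete_edges X (wall R))"
    unfolding simple_graph_def
  proof (intro allI impI)
    fix a b assume ab: "adj (delete_edges X (wall R)) a b"
    have "{b, a} = {a, b}" by auto
    thus "a \<in> verts (delete_edges X (wall R)) \<and> b \<in> verts (delete_edges X (wall R)) \<and> a \<noteq> b \<and>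
        adj (delete_edges X (wall R)) b a"
      using ab adj_verts[of a b] adj_sym[of a b] unfolding delete_edges_def by simp
  qed
  thus "same_side R x y \<Longrightarrow> same_side R y x"
    unfolding same_side_def by (elim exE) (rule exI, rule walk_betw_rev)
qed

lemma same_side_adj: "adj X x y \<Longrightarrow> {x, y} \<notin> wall R \<Longrightarrow> same_side R x y"
  unfolding same_side_def using adj_verts
  by (intro exI[of _ "[x, y]"]) (simp add: delete_edges_def walk_betw_Cons)

lemma separated: "clique X C \<Longrightarrow> x \<in> C \<Longrightarrow> y \<in> C \<Longrightarrow> x \<noteq> y \<Longrightarrow> \<not> same_side (rot C) x y"
proof -
  have "\<forall>C. clique X C \<longrightarrow> (\<forall>x\<in>C. \<forall>y\<in>C. x \<noteq> y \<longrightarrow> \<not> same_side (rot C) x y)"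
    using rotation_system unfolding rotation_system_def same_side_def by (elim conjE)
  thus "clique X C \<Longrightarrow> x \<in> C \<Longrightarrow> y \<in> C \<Longrightarrow> x \<noteq> y \<Longrightarrow> \<not> same_side (rot C) x y" by simp
qed

text \<open>A vertex \<open>z\<close> of \<open>D\<close> outside \<open>C\<close> gives the path
  \<open>x\<close>, \<open>z\<close>, \<open>y\<close>. It avoids the wall of \<open>C\<close>: an
  edge of that wall from a vertex of \<open>C\<close> to \<open>z\<close> would lie in a clique that
  meets \<open>C\<close> and has the same rotative-stabiliser, so \<open>z\<close> would be in
  \<open>C\<close>. But \<open>x\<close> and \<open>y\<close> are separated by this wall.\<close>

lemma clique_unique:
  assumes "clique X C" "clique X D" "x \<in> C" "x \<in> D" "y \<in> C" "y \<in> D" "x \<noteq> y"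
  shows "C = D"
proof (rule ccontr)
  assume "C \<noteq> D"
  hence "\<not> D \<subseteq> C" using assms(1,2) unfolding clique_def by blast
  then obtain z where z: "z \<in> D" "z \<notin> C" by blast
  hence adj: "adj X x z" "adj X z y"
    using assms unfolding clique_def complete_subgraph_def by metis+
  have "{w, z} \<notin> wall (rot C)" if w: "w \<in> C" for w
  proof
    assume "{w, z} \<in> wall (rot C)"
    then obtain E where E: "clique X E" "rot E = rot C" "w \<in> E" "z \<in> E"
      by (auto simp: edges_def induced_def doubleton_eq_iff)
    hence "E = C" using clique_orbit[OF E(1,3)] clique_orbit[OF assms(1) w] by simp
    thus False using z E by simp
  qed
  hence "same_side (rot C) x z" "same_side (rot C) z y"
    using same_side_adj adj assms(3,5) by (auto simp: insert_commute)
  thus False using same_side_trans separated assms by blast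
qed

lemma same_side_act:
  assumes "g \<in> carrier G" "R \<subseteq> carrier G" "same_side R x y"
  shows "same_side (conjugate G g R) (\<phi> g x) (\<phi> g y)"
proof -
  obtain p where p: "walk_betw (delete_edges X (wall R)) x p y" using assms(3) by (auto simp: same_side_def)
  have pX: "set p \<subseteq> verts X" using p by (simp add: walk_betw_def delete_edges_def)
  have "adj (delete_edges X (wall (conjugate G g R))) (\<phi> g a) (\<phi> g b)"
    if ab: "a \<in> set p" "b \<in> set p" "adj (delete_edges X (wall R)) a b" for a b
  proof -
    have v: "a \<in> verts X" "b \<in> verts X" using ab pX by auto
    have "{\<phi> g a, \<phi> g b} \<notin> wall (conjugate G g R)"
    proof
      assume "{\<phi> g a, \<phi> g b} \<in> wall (conjugate G g R)"
      then obtain D where D: "clique X D" "rot D = conjugate G g R" "\<phi> g a \<in> D" "\<phi> g b \<in> D"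
        by (auto simp: edges_def induced_def doubleton_eq_iff)
      define E where "E = \<phi> (inv g) ` D"
      have "\<phi> (inv g) (\<phi> g a) \<in> E" "\<phi> (inv g) (\<phi> g b) \<in> E" using D(3,4) unfolding E_def by blast+
      hence "a \<in> E" "b \<in> E" using v assms(1) by auto
      moreover have "clique X E" using act_clique D(1) assms(1) by (simp add: E_def)
      moreover have "rot E = R" using rot_act[of "inv g" D] D assms by (simp add: E_def conjugate_mult)
      moreover have "adj X a b" using ab(3) by (simp add: delete_edges_def)
      ultimately have "{a, b} \<in> wall R" by (auto simp: edges_def induced_def)
      thus False using ab(3) unfolding adj_delete_edges by (elim conjE notE)
    qed
    thus ?thesis using ab(3) act_adj[OF assms(1) v] unfolding adj_delete_edges by (intro conjI) simp_all
  qed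
  hence "successively (adj (delete_edges X (wall (conjugate G g R)))) (map (\<phi> g) p)"
    using p unfolding successively_map walk_betw_def by (auto elim!: successively_mono)
  hence "walk_betw (delete_edges X (wall (conjugate G g R))) (\<phi> g x) (map (\<phi> g) p) (\<phi> g y)"
    using p pX assms(1) by (auto simp: walk_betw_def hd_map last_map delete_edges_def)
  thus ?thesis by (auto simp: same_side_def)
qed

abbreviation basis :: "'a set set"
  where "basis \<equiv> rotative_stabilisers_at G X \<phi> \<R> x\<^sub>0"

lemma basisE:
  assumes "B \<in> basis"
  obtains C where "clique X C" "x\<^sub>0 \<in> C" "rot C = B" "C = (\<lambda>b. \<phi> b x\<^sub>0) ` B"
proof -
  obtain C where C: "clique X C" "x\<^sub>0 \<in> C" "rot C = B" using assms by (auto simp: rotative_stabilisers_at_def)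
  moreover from this have "C = (\<lambda>b. \<phi> b x\<^sub>0) ` B" using clique_orbit[OF C(1,2)] by simp
  ultimately show thesis using that by blast
qed

lemma basisI: "clique X C \<Longrightarrow> x\<^sub>0 \<in> C \<Longrightarrow> rot C \<in> basis"
  by (auto simp: rotative_stabilisers_at_def)

lemma basis_sub: "B \<in> basis \<Longrightarrow> subgroup B G"
  using rot_mem subgroup_rotations by (metis basisE)

lemma basis_carr: "B \<in> basis \<Longrightarrow> b \<in> B \<Longrightarrow> b \<in> carrier G"
  using basis_sub subgroup.mem_carrier by metis

lemma basis_inj:
  assumes "B \<in> basis" "b \<in> B" "b' \<in> B" "\<phi> b x\<^sub>0 = \<phi> b' x\<^sub>0"
  shows "b = b'"
proof -
  obtain C where C: "clique X C" "x\<^sub>0 \<in> C" "rot C = B" using basisE[OF assms(1)] by metis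
  interpret B: subgroup B G using basis_sub[OF assms(1)] .
  have c: "b \<in> carrier G" "b' \<in> carrier G" using assms by auto
  have "\<phi> (inv b' \<otimes> b) x\<^sub>0 = x\<^sub>0" using assms(4) c x0 by (simp add: act_mult)
  hence "inv b' \<otimes> b = \<one>" using rot_free[OF C(1) _ C(2)] C(3) assms(2,3) by auto
  hence "b' \<otimes> (inv b' \<otimes> b) = b'" using c by simp
  thus ?thesis using c by simp
qed

text \<open>Follow a walk starting at the base vertex. Each next edge is pulled back to
  \<open>x\<^sub>0\<close>, where a clique containing it is rotated by an element of the basis; this
  appends one generator on the right.\<close>

lemma orbit_transitive:
  assumes "x \<in> verts X"
  shows "\<exists>h\<in>generate G (\<Union>basis). x = \<phi> h x\<^sub>0"
proof -
  have sub: "\<Union>basis \<subseteq> carrier G" using basis_carr by blast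
  have "\<exists>h'\<in>generate G (\<Union>basis). x = \<phi> h' x\<^sub>0"
    if "walk_betw X (\<phi> h x\<^sub>0) p x" "h \<in> generate G (\<Union>basis)" for p h
    using that
  proof (induction p arbitrary: h)
    case (Cons a p)
    show ?case
    proof (cases p)
      case Nil
      hence "x = \<phi> h x\<^sub>0" using Cons.prems(1) by auto
      thus ?thesis using Cons.prems(2) by blast
    next
      case (Cons y q)
      have y: "adj X (\<phi> h x\<^sub>0) y" "walk_betw X y p x" "y \<in> verts X"
        using Cons.prems(1) adj_verts unfolding Cons by (auto simp: walk_betw_Cons)
      have hc: "h \<in> carrier G" using generate_in_carrier[OF sub Cons.prems(2)] .
      have "adj X (\<phi> (inv h) (\<phi> h x\<^sub>0)) (\<phi> (inv h) y)" 
        using act_adj[of "inv h" "\<phi> h x\<^sub>0" y] y hc x0 by (simp del: act_inv)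
      hence "adj X x\<^sub>0 (\<phi> (inv h) y)" using hc x0 by simp
      then obtain C where C: "clique X C" "x\<^sub>0 \<in> C" "\<phi> (inv h) y \<in> C"
        using clique_exists[OF simple] by metis
      then obtain r where r: "r \<in> rot C" "\<phi> (inv h) y = \<phi> r x\<^sub>0" using clique_orbit[OF C(1,2)] by blast
      have rb: "r \<in> \<Union>basis" using r(1) basisI[OF C(1,2)] by blast
      hence rc: "r \<in> carrier G" using sub by blast
      have "\<phi> h (\<phi> (inv h) y) = \<phi> (h \<otimes> r) x\<^sub>0" using r(2) hc rc x0 by (simp add: act_mult)
      hence "y = \<phi> (h \<otimes> r) x\<^sub>0" using y(3) hc by simp
      moreover have "h \<otimes> r \<in> generate G (\<Union>basis)"
        using Cons.prems(2) generate.incl[OF rb] by (rule generate.eng)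
      ultimately show ?thesis using Cons.IH y(2) by metis
    qed
  qed (simp add: walk_betw_def)
  moreover obtain p where "walk_betw X x\<^sub>0 p x" using connected x0 assms by (auto simp: connected_graph_def)
  ultimately show ?thesis using generate.one[of G "\<Union>basis"] x0 by (metis act_one)
qed

text \<open>Every member of \<open>\<R>\<close> belongs to some clique, and an element already
  generated by the basis carries that clique to one at \<open>x\<^sub>0\<close>. So the member is a
  conjugate of a basis subgroup by a generated element.\<close>

lemma basis_generates': "generate G (\<Union>basis) = carrier G"
proof
  have sub: "\<Union>basis \<subseteq> carrier G" using basis_carr by blast
  show "generate G (\<Union>basis) \<subseteq> carrier G" using generate_incl[OF sub] .
  have "R \<subseteq> generate G (\<Union>basis)" if R: "R \<in> \<R>" for R
  proof
    fix r assume r: "r \<in> R"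
    have "\<forall>R\<in>\<R>. \<exists>C. clique X C \<and> rot C = R"
      using rotation_system unfolding rotation_system_def by (elim conjE)
    then obtain C where C: "clique X C" "rot C = R" using R by auto
    then obtain x where x: "x \<in> C" by (auto simp: clique_def)
    hence "x \<in> verts X" using clique_subset C by blast
    then obtain h where h: "h \<in> generate G (\<Union>basis)" "x = \<phi> h x\<^sub>0" using orbit_transitive by blast
    have hc: "h \<in> carrier G" using generate_in_carrier[OF sub h(1)] .
    have rc: "r \<in> carrier G" using r R subgroup_rotations subgroup.mem_carrier by metis
    have Rc: "R \<subseteq> carrier G" using C rot_carrier by blast
    have "\<phi> (inv h) x \<in> \<phi> (inv h) ` C" using x by blast
    hence "x\<^sub>0 \<in> \<phi> (inv h) ` C" using h hc x0 by simp
    hence "rot (\<phi> (inv h) ` C) \<in> basis" using act_clique C(1) hc by (intro basisI) auto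
    hence "conjugate G (inv h) R \<in> basis" using rot_act[of "inv h" C] C hc by simp
    moreover have "inv h \<otimes> r \<otimes> h \<in> conjugate G (inv h) R"
      using r rc hc Rc mem_conjugate_iff[of R "inv h" "inv h \<otimes> r \<otimes> h"] by (simp add: m_assoc)
    ultimately have "inv h \<otimes> r \<otimes> h \<in> generate G (\<Union>basis)" by (blast intro: generate.incl)
    hence "h \<otimes> (inv h \<otimes> r \<otimes> h) \<otimes> inv h \<in> generate G (\<Union>basis)"
      using h(1) generate_m_inv_closed[OF sub h(1)] by (blast intro: generate.eng)
    thus "r \<in> generate G (\<Union>basis)" using hc rc by (simp add: m_assoc)
  qed
  hence "generate G (\<Union>\<R>) \<subseteq> generate G (\<Union>basis)"
    by (intro generate_subgroup_incl generate_is_subgroup[OF sub]) blast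
  thus "carrier G \<subseteq> generate G (\<Union>basis)" using rotation_system by (simp add: rotation_system_def)
qed

section \<open>Gates of a rotation system\<close>

definition gate :: "'a set \<Rightarrow> 'a \<Rightarrow> 'a"
  where "gate B g = (THE b. b \<in> B \<and> same_side B (\<phi> b x\<^sub>0) (\<phi> g x\<^sub>0))"

lemma same_side_unique:
  assumes "B \<in> basis" "b \<in> B" "b' \<in> B" "same_side B (\<phi> b x\<^sub>0) x" "same_side B (\<phi> b' x\<^sub>0) x"
  shows "b = b'"
proof -
  obtain C where C: "clique X C" "x\<^sub>0 \<in> C" "rot C = B" "C = (\<lambda>b. \<phi> b x\<^sub>0) ` B" using basisE[OF assms(1)] by metis
  have "same_side B (\<phi> b x\<^sub>0) (\<phi> b' x\<^sub>0)" using assms(4,5) same_side_trans same_side_sym by blast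
  moreover have "\<phi> b x\<^sub>0 \<in> C" "\<phi> b' x\<^sub>0 \<in> C" using C(4) assms by auto
  ultimately have "\<phi> b x\<^sub>0 = \<phi> b' x\<^sub>0" using separated[OF C(1)] C(3) by blast
  thus ?thesis using basis_inj assms by blast
qed

lemma gate_unique: "B \<in> basis \<Longrightarrow> b \<in> B \<Longrightarrow> same_side B (\<phi> b x\<^sub>0) (\<phi> g x\<^sub>0) \<Longrightarrow> gate B g = b"
  unfolding gate_def using same_side_unique by (intro the_equality) auto

lemma same_side_mult:
  assumes "B \<in> basis" "b \<in> B" "g \<in> carrier G" "h \<in> carrier G" "same_side B (\<phi> h x\<^sub>0) (\<phi> g x\<^sub>0)"
  shows "same_side B (\<phi> (b \<otimes> h) x\<^sub>0) (\<phi> (b \<otimes> g) x\<^sub>0)"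
proof -
  have bc: "b \<in> carrier G" "B \<subseteq> carrier G" using basis_carr assms by auto
  have "same_side (conjugate G b B) (\<phi> b (\<phi> h x\<^sub>0)) (\<phi> b (\<phi> g x\<^sub>0))"
    using same_side_act[OF bc assms(5)] .
  thus ?thesis using conjugate_self[OF basis_sub[OF assms(1)] assms(2)] bc assms x0 by (simp add: act_mult)
qed

text \<open>If the two vertices are distinct, the only clique through their edge is the translate of
  the clique of \<open>D\<close>, whose rotative-stabiliser is the conjugate of \<open>D\<close> by
  \<open>g\<close>. So the edge is not in the wall \<open>B\<close>.\<close>

lemma same_side_step:
  assumes "B \<in> basis" "D \<in> basis" "s \<in> D" "g \<in> carrier G" "conjugate G g D \<noteq> B"
  shows "same_side B (\<phi> g x\<^sub>0) (\<phi> (g \<otimes> s) x\<^sub>0)"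
proof -
  have sc: "s \<in> carrier G" using basis_carr assms by blast
  show ?thesis
  proof (cases "\<phi> (g \<otimes> s) x\<^sub>0 = \<phi> g x\<^sub>0")
    case True
    thus ?thesis using same_side_refl assms(4) x0 by simp
  next
    case False
    obtain C where C: "clique X C" "x\<^sub>0 \<in> C" "rot C = D" "C = (\<lambda>b. \<phi> b x\<^sub>0) ` D" using basisE[OF assms(2)] by metis
    define E where "E = \<phi> g ` C"
    have E: "clique X E" "rot E = conjugate G g D" using act_clique rot_act C assms(4) by (auto simp: E_def)
    have "\<phi> s x\<^sub>0 \<in> C" using C(4) assms(3) by blast
    hence v: "\<phi> g x\<^sub>0 \<in> E" "\<phi> (g \<otimes> s) x\<^sub>0 \<in> E" using C(2) sc assms(4) x0 by (auto simp: E_def act_mult)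
    have adj: "adj X (\<phi> g x\<^sub>0) (\<phi> (g \<otimes> s) x\<^sub>0)"
      using E(1) v False unfolding clique_def complete_subgraph_def by metis
    have "{\<phi> g x\<^sub>0, \<phi> (g \<otimes> s) x\<^sub>0} \<notin> wall B"
    proof
      assume "{\<phi> g x\<^sub>0, \<phi> (g \<otimes> s) x\<^sub>0} \<in> wall B"
      then obtain D' where D': "clique X D'" "rot D' = B" "\<phi> g x\<^sub>0 \<in> D'" "\<phi> (g \<otimes> s) x\<^sub>0 \<in> D'"
        by (auto simp: edges_def induced_def doubleton_eq_iff)
      hence "D' = E" using clique_unique[OF D'(1) E(1) D'(3) v(1) D'(4) v(2)] False by metis
      thus False using D'(2) E(2) assms(5) by simp
    qed
    thus ?thesis using same_side_adj[OF adj] by blast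
  qed
qed

text \<open>Every vertex lies on the side of some vertex of the clique of \<open>B\<close>. This
  holds at the base vertex and is preserved by right multiplication with a generator: a step off the
  wall keeps the side, and a crossing of the wall is a rotation in \<open>B\<close>, which permutes
  the sides.\<close>

lemma gate_exists:
  assumes "B \<in> basis" "g \<in> carrier G"
  shows "\<exists>b\<in>B. same_side B (\<phi> b x\<^sub>0) (\<phi> g x\<^sub>0)"
proof -
  interpret B: subgroup B G using basis_sub[OF assms(1)] .
  have step: "\<exists>b\<in>B. same_side B (\<phi> b x\<^sub>0) (\<phi> (k \<otimes> s) x\<^sub>0)"
    if s: "s \<in> D" "D \<in> basis" and k: "k \<in> carrier G" "\<exists>b\<in>B. same_side B (\<phi> b x\<^sub>0) (\<phi> k x\<^sub>0)" for s D k
  proof (cases "conjugate G k D = B")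
    case False
    thus ?thesis using same_side_step[OF assms(1) s(2,1) k(1)] k(2) same_side_trans by blast
  next
    case True
    obtain b where b: "b \<in> B" "same_side B (\<phi> b x\<^sub>0) (\<phi> k x\<^sub>0)" using k by blast
    have sc: "s \<in> carrier G" "D \<subseteq> carrier G" using basis_carr s by auto
    \<comment> \<open>The crossing step from \<open>k\<close> to \<open>k \<otimes> s\<close> is
      left multiplication by \<open>\<beta>\<close>, which lies in \<open>B\<close> and so carries
      sides of \<open>B\<close> to sides of \<open>B\<close>.\<close>
    define \<beta> where "\<beta> = k \<otimes> s \<otimes> inv k"
    have \<beta>: "\<beta> \<in> B" using True s(1) conjugate_eq[OF sc(2) k(1)] by (auto simp: \<beta>_def)
    have "\<beta> \<otimes> k = k \<otimes> s" using sc k by (simp add: \<beta>_def m_assoc)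
    hence "same_side B (\<phi> (\<beta> \<otimes> b) x\<^sub>0) (\<phi> (k \<otimes> s) x\<^sub>0)"
      using same_side_mult[OF assms(1) \<beta> k(1) _ b(2)] b(1) by simp
    thus ?thesis using \<beta> b(1) by blast
  qed
  have sub: "\<Union>basis \<subseteq> carrier G" using basis_carr by blast
  have "\<forall>k\<in>carrier G. (\<exists>b\<in>B. same_side B (\<phi> b x\<^sub>0) (\<phi> k x\<^sub>0)) \<longrightarrow>
      (\<exists>b\<in>B. same_side B (\<phi> b x\<^sub>0) (\<phi> (k \<otimes> h) x\<^sub>0))" if "h \<in> generate G (\<Union>basis)" for h
    using that
  proof (induction h rule: generate.induct)
    case (incl s)
    thus ?case using step by blast
  next
    case (inv s)
    then obtain D where D: "D \<in> basis" "s \<in> D" by blast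
    hence "inv s \<in> D" using subgroup.m_inv_closed[OF basis_sub] by blast
    thus ?case using step D by blast
  next
    case (eng h1 h2)
    have c: "h1 \<in> carrier G" "h2 \<in> carrier G" using generate_in_carrier[OF sub] eng.hyps by auto
    show ?case
    proof (intro ballI impI)
      fix k assume k: "k \<in> carrier G" "\<exists>b\<in>B. same_side B (\<phi> b x\<^sub>0) (\<phi> k x\<^sub>0)"
      have "\<exists>b\<in>B. same_side B (\<phi> b x\<^sub>0) (\<phi> (k \<otimes> h1) x\<^sub>0)" using eng.IH(1) k by blast
      moreover have "k \<otimes> h1 \<in> carrier G" using k c by simp
      ultimately have "\<exists>b\<in>B. same_side B (\<phi> b x\<^sub>0) (\<phi> ((k \<otimes> h1) \<otimes> h2) x\<^sub>0)" using eng.IH(2) by blast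
      thus "\<exists>b\<in>B. same_side B (\<phi> b x\<^sub>0) (\<phi> (k \<otimes> (h1 \<otimes> h2)) x\<^sub>0)" using k c by (simp add: m_assoc)
    qed
  qed simp
  moreover have "\<exists>b\<in>B. same_side B (\<phi> b x\<^sub>0) (\<phi> \<one> x\<^sub>0)"
    using same_side_refl[of "\<phi> \<one> x\<^sub>0" B] x0 by (intro bexI[of _ \<one>]) auto
  moreover have "g \<in> generate G (\<Union>basis)" using assms(2) basis_generates' by simp
  ultimately have "\<exists>b\<in>B. same_side B (\<phi> b x\<^sub>0) (\<phi> (\<one> \<otimes> g) x\<^sub>0)" by blast
  thus ?thesis using assms(2) by simp
qed

lemma gate_spec:
  assumes "B \<in> basis" "g \<in> carrier G"
  shows "gate B g \<in> B" "same_side B (\<phi> (gate B g) x\<^sub>0) (\<phi> g x\<^sub>0)"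
  using gate_exists[OF assms] gate_unique[OF assms(1)] by auto

sublocale gated_basis G basis gate
proof (rule gated_basis.intro, rule is_group, rule gated_basis_axioms.intro)
  fix B assume B: "B \<in> basis"
  interpret B: subgroup B G using basis_sub[OF B] .
  show "subgroup B G" by (rule basis_sub[OF B])
  show "B \<noteq> {\<one>}"
  proof
    assume "B = {\<one>}"
    moreover obtain C where C: "clique X C" "C = (\<lambda>b. \<phi> b x\<^sub>0) ` B" using basisE[OF B] by metis
    ultimately have "C = {x\<^sub>0}" using x0 by simp
    thus False using C(1) adj_verts unfolding clique_def by blast
  qed
  show "gate B \<one> = \<one>" using same_side_refl[of "\<phi> \<one> x\<^sub>0" B] x0 by (intro gate_unique[OF B]) auto
  fix g assume g: "g \<in> carrier G"
  show "gate B g \<in> B" by (rule gate_spec(1)[OF B g])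
  show "gate B (b \<otimes> g) = b \<otimes> gate B g" if b: "b \<in> B" for b
    using same_side_mult[OF B b g _ gate_spec(2)[OF B g]] gate_spec(1)[OF B g] b
    by (intro gate_unique[OF B]) auto
  show "gate B (g \<otimes> s) = gate B g" if "D \<in> basis" "s \<in> D" "conjugate G g D \<noteq> B" for D s
    using same_side_trans[OF gate_spec(2)[OF B g] same_side_step[OF B that(1,2) g that(3)]]
      gate_spec(1)[OF B g] by (intro gate_unique[OF B]) auto
qed (rule basis_generates')

text \<open>The axioms give freeness on single cliques only. For the whole group it follows from the
  gates, which depend on \<open>g\<close> through \<open>\<phi> g x\<^sub>0\<close> alone, whereas a
  nonempty reduced word has its first letter as a nontrivial gate.\<close>

lemma act_free:
  assumes "g \<in> carrier G" "\<phi> g x\<^sub>0 = x\<^sub>0"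
  shows "g = \<one>"
proof -
  obtain w where w: "reduced w" "prod_word w = g" using carrier_reduced_word[OF assms(1)] by blast
  show ?thesis
  proof (cases w)
    case (Cons s v)
    have "s \<in> letters basis" using w(1) Cons by (simp add: reduced_Cons)
    hence s: "base s \<in> basis" "s \<noteq> \<one>" using base_mem' by (auto simp: letters_def)
    have "gate (base s) g = gate (base s) \<one>" using assms(2) x0 by (simp add: gate_def)
    moreover have "gate (base s) g = s" using gate_reduced_Cons[of s v] w Cons by simp
    ultimately show ?thesis using gate_one s by simp
  qed (use w in simp)
qed

theorem Cayl_iso: "graph_iso (Cayl G basis) X (\<lambda>g. \<phi> g x\<^sub>0)"
  unfolding graph_iso_def
proof (intro conjI ballI)
  have eq: "g = h" if gh: "g \<in> carrier G" "h \<in> carrier G" "\<phi> g x\<^sub>0 = \<phi> h x\<^sub>0" for g h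
  proof -
    have "\<phi> (inv g \<otimes> h) x\<^sub>0 = x\<^sub>0" using gh x0 by (simp add: act_mult flip: gh(3))
    hence "inv g \<otimes> h = \<one>" using act_free gh by simp
    hence "g \<otimes> (inv g \<otimes> h) = g" using gh by simp
    thus ?thesis using gh by simp
  qed
  have "x \<in> (\<lambda>g. \<phi> g x\<^sub>0) ` carrier G" if "x \<in> verts X" for x
    using orbit_transitive[OF that] basis_generates' by auto
  thus "bij_betw (\<lambda>g. \<phi> g x\<^sub>0) (verts (Cayl G basis)) (verts X)"
    using eq x0 by (auto simp: bij_betw_def inj_on_def)
  fix g h assume "g \<in> verts (Cayl G basis)" "h \<in> verts (Cayl G basis)"
  hence gh: "g \<in> carrier G" "h \<in> carrier G" by auto
  define k where "k = inv g \<otimes> h"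
  have k: "k \<in> carrier G" using gh by (simp add: k_def)
  have "adj X (\<phi> g x\<^sub>0) (\<phi> h x\<^sub>0) \<longleftrightarrow> adj X (\<phi> (inv g) (\<phi> g x\<^sub>0)) (\<phi> (inv g) (\<phi> h x\<^sub>0))"
    using gh x0 by (intro act_adj[symmetric]) auto
  also have "\<dots> \<longleftrightarrow> adj X x\<^sub>0 (\<phi> k x\<^sub>0)" using gh x0 by (simp add: k_def act_mult)
  also have "\<dots> \<longleftrightarrow> k \<in> letters basis"
  proof
    assume a: "adj X x\<^sub>0 (\<phi> k x\<^sub>0)"
    then obtain C where C: "clique X C" "x\<^sub>0 \<in> C" "\<phi> k x\<^sub>0 \<in> C" using clique_exists[OF simple] by metis
    then obtain r where r: "r \<in> rot C" "\<phi> k x\<^sub>0 = \<phi> r x\<^sub>0" using clique_orbit[OF C(1,2)] by blast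
    hence "k = r" using eq k rot_carrier[OF C(1)] by blast
    moreover have "k \<noteq> \<one>" using a act_one[OF x0] adj_verts by metis
    ultimately show "k \<in> letters basis" using letterI[OF basisI[OF C(1,2)]] r(1) by blast
  next
    assume "k \<in> letters basis"
    then obtain B where B: "B \<in> basis" "k \<in> B" "k \<noteq> \<one>" by (rule letterE)
    obtain C where C: "clique X C" "x\<^sub>0 \<in> C" "C = (\<lambda>b. \<phi> b x\<^sub>0) ` B" using basisE[OF B(1)] by metis
    have "\<phi> k x\<^sub>0 \<in> C" using C(3) B(2) by blast
    moreover have "\<phi> k x\<^sub>0 \<noteq> x\<^sub>0" using act_free k B(3) by blast
    ultimately show "adj X x\<^sub>0 (\<phi> k x\<^sub>0)"
      using C unfolding clique_def complete_subgraph_def by metis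
  qed
  finally show "adj X (\<phi> g x\<^sub>0) (\<phi> h x\<^sub>0) \<longleftrightarrow> adj (Cayl G basis) g h"
    using gh by (simp add: adj_Cayl k_def)
qed

lemma isomorphic_Cayl: "X \<cong>\<^sub>g Cayl G basis"
  using graph_iso_inv[OF Cayl_iso] unfolding isomorphic_graphs_def by blast

lemma mediangle: "mediangle X"
  using graph_isomorphism.mediangle_f[OF graph_isomorphism.intro[OF Cayl_iso]] mediangle_Cayl simple .

end

section \<open>Free products\<close>

definition word_eval :: "('k, 'n) monoid_scheme \<Rightarrow> ('i \<Rightarrow> 'a \<Rightarrow> 'k) \<Rightarrow> ('i \<times> 'a) list \<Rightarrow> 'k" where
  "word_eval K f w = foldr (\<lambda>(i, a) x. f i a \<otimes>\<^bsub>K\<^esub> x) w \<one>\<^bsub>K\<^esub>"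

lemma word_eval_simps [simp]:
  "word_eval K f [] = \<one>\<^bsub>K\<^esub>"
  "word_eval K f ((i, a) # w) = f i a \<otimes>\<^bsub>K\<^esub> word_eval K f w"
  by (simp_all add: word_eval_def)

lemma eval_word_eq: "eval_word G = word_eval G (\<lambda>A a. a)"
  by (rule ext) (simp add: eval_word_def word_eval_def)

locale free_product_of_groups =
  fixes I :: "'i set" and H :: "'i \<Rightarrow> ('a, 'm) monoid_scheme"
  assumes group_factor: "i \<in> I \<Longrightarrow> group (H i)"
begin

abbreviation "W \<equiv> free_product_words I H"
abbreviation "step \<equiv> free_product_step I H"
abbreviation "F \<equiv> free_product I H"
abbreviation "cls \<equiv> free_product_class I H"

lemma W_Nil [simp]: "[] \<in> W"
  by (simp add: free_product_words_def)

lemma W_Cons [simp]: "(i, a) # w \<in> W \<longleftrightarrow> i \<in> I \<and> a \<in> carrier (H i) \<and> w \<in> W"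
  by (auto simp: free_product_words_def)

lemma W_append [simp]: "v @ w \<in> W \<longleftrightarrow> v \<in> W \<and> w \<in> W"
  by (auto simp: free_product_words_def)

lemma step_append_left: "step v w \<Longrightarrow> u \<in> W \<Longrightarrow> step (u @ v) (u @ w)"
proof (induction rule: free_product_step.induct)
  case (erase x y i)
  thus ?case using free_product_step.erase[of "u @ x" I H y i] by simp
next
  case (merge x y i a b)
  thus ?case using free_product_step.merge[of "u @ x" I H y i a b] by simp
qed

lemma step_append_right: "step v w \<Longrightarrow> u \<in> W \<Longrightarrow> step (v @ u) (w @ u)"
proof (induction rule: free_product_step.induct)
  case (erase x y i)
  thus ?case using free_product_step.erase[of x I H "y @ u" i] by simp
next
  case (merge x y i a b)
  thus ?case using free_product_step.merge[of x I H "y @ u" i a b] by simp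
qed

lemma equivclp_map:
  assumes "equivclp r x y" "\<And>x y. r x y \<Longrightarrow> equivclp s (f x) (f y)"
  shows "equivclp s (f x) (f y)"
  using assms(1)
proof (induction rule: equivclp_induct)
  case (step y z)
  hence "equivclp s (f y) (f z)" using assms(2) equivclp_sym by metis
  thus ?case using step.IH equivclp_trans by metis
qed simp

lemma equiv_append:
  assumes "equivclp step v v'" "equivclp step w w'" "v \<in> W" "w' \<in> W"
  shows "equivclp step (v @ w) (v' @ w')"
proof -
  have "equivclp step (v @ w) (v @ w')"
    by (rule equivclp_map[OF assms(2)]) (use step_append_left assms(3) in blast)
  moreover have "equivclp step (v @ w') (v' @ w')"
    by (rule equivclp_map[OF assms(1), of step "\<lambda>v. v @ w'"]) (use step_append_right assms(4) in blast)
  ultimately show ?thesis by (rule equivclp_trans)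
qed

lemma mem_cls: "v \<in> W \<Longrightarrow> w \<in> cls v \<longleftrightarrow> w \<in> W \<and> equivclp step v w"
  by (auto simp: free_product_class_def free_product_rel_def)

lemma cls_eq_iff:
  assumes "v \<in> W" "w \<in> W"
  shows "cls v = cls w \<longleftrightarrow> equivclp step v w"
proof
  assume "cls v = cls w"
  thus "equivclp step v w" using mem_cls assms by auto
next
  assume e: "equivclp step v w"
  show "cls v = cls w"
  proof (rule Set.set_eqI)
    fix x
    show "x \<in> cls v \<longleftrightarrow> x \<in> cls w"
      using mem_cls assms e equivclp_trans[of step w v x] equivclp_trans[of step v w x] equivclp_sym[of step v w]
      by auto
  qed
qed

lemma carrier_F: "carrier F = cls ` W"
  by (auto simp: free_product_def quotient_def free_product_class_def)

lemma F_E: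
  assumes "x \<in> carrier F"
  obtains w where "w \<in> W" "x = cls w"
  using assms by (auto simp: carrier_F)

lemma cls_mem [simp]: "w \<in> W \<Longrightarrow> cls w \<in> carrier F"
  by (simp add: carrier_F)

lemma one_F: "\<one>\<^bsub>F\<^esub> = cls []"
  by (simp add: free_product_def)

lemma mult_cls:
  assumes "v \<in> W" "w \<in> W"
  shows "cls v \<otimes>\<^bsub>F\<^esub> cls w = cls (v @ w)"
proof -
  have eq: "cls (x @ y) = cls (v @ w)" if "x \<in> cls v" "y \<in> cls w" for x y
    using that assms equiv_append[of v x w y] by (simp add: mem_cls cls_eq_iff equivclp_sym[of step "v @ w" "x @ y"])
  have mem: "v \<in> cls v" "w \<in> cls w" using assms by (auto simp: mem_cls)
  have "cls v \<otimes>\<^bsub>F\<^esub> cls w = (\<Union>x\<in>cls v. \<Union>y\<in>cls w. cls (x @ y))"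
    by (simp add: free_product_def)
  also have "\<dots> = (\<Union>x\<in>cls v. \<Union>y\<in>cls w. cls (v @ w))"
    by (intro SUP_cong refl) (rule eq)
  also have "\<dots> = cls (v @ w)" using mem by blast
  finally show ?thesis .
qed

definition inv_word :: "('i \<times> 'a) list \<Rightarrow> ('i \<times> 'a) list"
  where "inv_word w = rev (map (\<lambda>(i, a). (i, inv\<^bsub>H i\<^esub> a)) w)"

lemma inv_word_W: "w \<in> W \<Longrightarrow> inv_word w \<in> W"
proof (induction w)
  case (Cons x w)
  obtain i a where x: "x = (i, a)" by (cases x)
  have "inv\<^bsub>H i\<^esub> a \<in> carrier (H i)" using Cons.prems x group.inv_closed[OF group_factor] by simp
  thus ?case using Cons x by (simp add: inv_word_def)
qed (simp add: inv_word_def)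

lemma inv_word_left: "w \<in> W \<Longrightarrow> equivclp step (inv_word w @ w) []"
proof (induction w)
  case (Cons x w)
  obtain i a where x: "x = (i, a)" by (cases x)
  have i: "i \<in> I" "a \<in> carrier (H i)" "w \<in> W" using Cons.prems x by auto
  interpret Hi: group "H i" using group_factor i by blast
  have iw: "inv_word w \<in> W" using inv_word_W i by blast
  have "step (inv_word w @ [(i, inv\<^bsub>H i\<^esub> a), (i, a)] @ w) (inv_word w @ [(i, inv\<^bsub>H i\<^esub> a \<otimes>\<^bsub>H i\<^esub> a)] @ w)"
    using i iw by (intro free_product_step.merge) auto
  moreover have "step (inv_word w @ [(i, \<one>\<^bsub>H i\<^esub>)] @ w) (inv_word w @ w)"
    using i iw by (intro free_product_step.erase) auto
  ultimately have "equivclp step (inv_word (x # w) @ x # w) (inv_word w @ w)"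
    using i by (simp add: x inv_word_def) (meson equivclp_trans r_into_equivclp)
  thus ?case using Cons.IH i by (meson equivclp_trans)
qed (simp add: inv_word_def)

lemma group_F: "group F"
proof (rule groupI)
  show "\<one>\<^bsub>F\<^esub> \<in> carrier F" by (simp add: one_F)
  show "x \<otimes>\<^bsub>F\<^esub> y \<in> carrier F" if "x \<in> carrier F" "y \<in> carrier F" for x y
    using that by (auto elim!: F_E simp: mult_cls)
  show "x \<otimes>\<^bsub>F\<^esub> y \<otimes>\<^bsub>F\<^esub> z = x \<otimes>\<^bsub>F\<^esub> (y \<otimes>\<^bsub>F\<^esub> z)"
    if "x \<in> carrier F" "y \<in> carrier F" "z \<in> carrier F" for x y z
    using that by (auto elim!: F_E simp: mult_cls)
  show "\<one>\<^bsub>F\<^esub> \<otimes>\<^bsub>F\<^esub> x = x" if "x \<in> carrier F" for x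
    using that by (auto elim!: F_E simp: mult_cls one_F)
  show "\<exists>y\<in>carrier F. y \<otimes>\<^bsub>F\<^esub> x = \<one>\<^bsub>F\<^esub>" if x: "x \<in> carrier F" for x
  proof -
    obtain w where w: "w \<in> W" "x = cls w" using x by (rule F_E)
    have "cls (inv_word w) \<otimes>\<^bsub>F\<^esub> x = \<one>\<^bsub>F\<^esub>"
      using w inv_word_W inv_word_left by (simp add: mult_cls one_F cls_eq_iff)
    thus ?thesis using inv_word_W w by (intro bexI[of _ "cls (inv_word w)"]) auto
  qed
qed

text \<open>Reduction to normal form by letting the letters act on normal words from the left.\<close>

definition push :: "'i \<times> 'a \<Rightarrow> ('i \<times> 'a) list \<Rightarrow> ('i \<times> 'a) list" where
  "push x w = (case x of (i, a) \<Rightarrow>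
     if a = \<one>\<^bsub>H i\<^esub> then w else
     (case w of [] \<Rightarrow> [(i, a)]
     | (j, b) # v \<Rightarrow>
         if i = j then if a \<otimes>\<^bsub>H i\<^esub> b = \<one>\<^bsub>H i\<^esub> then v else (i, a \<otimes>\<^bsub>H i\<^esub> b) # v else (i, a) # w))"

definition normal_form :: "('i \<times> 'a) list \<Rightarrow> ('i \<times> 'a) list"
  where "normal_form w = foldr push w []"

primrec normal_word :: "('i \<times> 'a) list \<Rightarrow> bool" where
  "normal_word [] \<longleftrightarrow> True"
| "normal_word (x # w) \<longleftrightarrow> fst x \<in> I \<and> snd x \<in> carrier (H (fst x)) - {\<one>\<^bsub>H (fst x)\<^esub>} \<and>
     normal_word w \<and> (w = [] \<or> fst (hd w) \<noteq> fst x)"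

lemma normal_word_W: "normal_word w \<Longrightarrow> w \<in> W"
  by (induction w) auto

lemma normal_push:
  assumes "normal_word w" "i \<in> I" "a \<in> carrier (H i)"
  shows "normal_word (push (i, a) w)"
proof -
  interpret Hi: group "H i" using group_factor assms by blast
  show ?thesis
    using assms by (cases w) (auto simp: push_def split: if_splits)
qed

lemma normal_form_normal: "w \<in> W \<Longrightarrow> normal_word (normal_form w)"
proof (induction w)
  case (Cons x w)
  thus ?case using normal_push by (cases x) (simp add: normal_form_def)
qed (simp add: normal_form_def)

lemma normal_form_id: "normal_word w \<Longrightarrow> normal_form w = w"
proof (induction w)
  case (Cons x w)
  thus ?case by (cases x; cases w) (auto simp: normal_form_def push_def)
qed (simp add: normal_form_def)

text \<open>This is the action law for one factor. It makes the normal form invariant under merging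
  two letters and takes the place of a confluence argument.\<close>

lemma push_push:
  assumes "normal_word w" "i \<in> I" "a \<in> carrier (H i)" "b \<in> carrier (H i)"
  shows "push (i, a) (push (i, b) w) = push (i, a \<otimes>\<^bsub>H i\<^esub> b) w"
proof -
  interpret Hi: group "H i" using group_factor assms by blast
  show ?thesis
  proof (cases w)
    case Nil
    thus ?thesis using assms by (simp add: push_def)
  next
    case (Cons y v)
    obtain j c where y: "y = (j, c)" by (cases y)
    show ?thesis
    proof (cases "i = j")
      case False
      thus ?thesis using assms Cons y by (simp add: push_def)
    next
      case True
      hence c: "c \<in> carrier (H i)" "c \<noteq> \<one>\<^bsub>H i\<^esub>" "normal_word v" "v = [] \<or> fst (hd v) \<noteq> i"
        using assms(1) Cons y by auto
      have w: "w = (i, c) # v" using Cons y True by simp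
      have pv: "push (i, x) v = (i, x) # v" if "x \<noteq> \<one>\<^bsub>H i\<^esub>" for x
        using that c(4) by (cases v) (auto simp: push_def)
      have one: "push (i, \<one>\<^bsub>H i\<^esub>) u = u" for u by (simp add: push_def)
      have pc: "push (i, x) ((i, c) # v) = (if x \<otimes>\<^bsub>H i\<^esub> c = \<one>\<^bsub>H i\<^esub> then v else (i, x \<otimes>\<^bsub>H i\<^esub> c) # v)"
        if "x \<in> carrier (H i)" for x
        using that c by (auto simp: push_def)
      show ?thesis
      proof (cases "b \<otimes>\<^bsub>H i\<^esub> c = \<one>\<^bsub>H i\<^esub>")
        case bc: True
        have "(a \<otimes>\<^bsub>H i\<^esub> b) \<otimes>\<^bsub>H i\<^esub> c = a" using bc assms c by (simp add: Hi.m_assoc)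
        hence "push (i, a \<otimes>\<^bsub>H i\<^esub> b) w = (if a = \<one>\<^bsub>H i\<^esub> then v else (i, a) # v)"
          unfolding w using pc[of "a \<otimes>\<^bsub>H i\<^esub> b"] assms(3,4) by simp
        moreover have "push (i, b) w = v" unfolding w using pc[of b] bc assms(4) by simp
        ultimately show ?thesis using pv[of a] one[of v] by simp
      next
        case bc: False
        have "push (i, a) ((i, b \<otimes>\<^bsub>H i\<^esub> c) # v) =
            (if (a \<otimes>\<^bsub>H i\<^esub> b) \<otimes>\<^bsub>H i\<^esub> c = \<one>\<^bsub>H i\<^esub> then v else (i, (a \<otimes>\<^bsub>H i\<^esub> b) \<otimes>\<^bsub>H i\<^esub> c) # v)"
          using assms c bc by (auto simp: push_def Hi.m_assoc)
        moreover have "push (i, b) w = (i, b \<otimes>\<^bsub>H i\<^esub> c) # v" unfolding w using pc[of b] bc assms(4) by simp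
        moreover have "push (i, a \<otimes>\<^bsub>H i\<^esub> b) w = (if (a \<otimes>\<^bsub>H i\<^esub> b) \<otimes>\<^bsub>H i\<^esub> c = \<one>\<^bsub>H i\<^esub> then v
            else (i, (a \<otimes>\<^bsub>H i\<^esub> b) \<otimes>\<^bsub>H i\<^esub> c) # v)"
          unfolding w using pc[of "a \<otimes>\<^bsub>H i\<^esub> b"] assms(3,4) by simp
        ultimately show ?thesis by simp
      qed
    qed
  qed
qed

lemma normal_form_step: "step v w \<Longrightarrow> normal_form v = normal_form w"
proof (induction rule: free_product_step.induct)
  case (erase u v i)
  thus ?case by (simp add: normal_form_def push_def)
next
  case (merge u v i a b)
  hence "push (i, a) (push (i, b) (normal_form v)) = push (i, a \<otimes>\<^bsub>H i\<^esub> b) (normal_form v)"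
    using push_push normal_form_normal by blast
  thus ?case by (simp add: normal_form_def)
qed

lemma normal_form_equiv: "equivclp step v w \<Longrightarrow> normal_form v = normal_form w"
  by (induction rule: equivclp_induct) (auto dest: normal_form_step)

lemma equiv_push:
  assumes "normal_word w" "i \<in> I" "a \<in> carrier (H i)"
  shows "equivclp step ((i, a) # w) (push (i, a) w)"
proof -
  interpret Hi: group "H i" using group_factor assms by blast
  have W: "w \<in> W" using normal_word_W assms(1) .
  have er: "equivclp step ((i, \<one>\<^bsub>H i\<^esub>) # v) v" if "v \<in> W" for v
    using free_product_step.erase[of "[]" I H v i] that assms by (simp add: r_into_equivclp)
  show ?thesis
  proof (cases "a = \<one>\<^bsub>H i\<^esub>")
    case True
    thus ?thesis using er W by (simp add: push_def)
  next
    case False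
    show ?thesis
    proof (cases w)
      case Nil
      thus ?thesis using False by (simp add: push_def)
    next
      case (Cons y v)
      obtain j c where y: "y = (j, c)" by (cases y)
      show ?thesis
      proof (cases "i = j")
        case True
        hence c: "c \<in> carrier (H i)" "v \<in> W" using W Cons y by auto
        have m: "equivclp step ((i, a) # w) ((i, a \<otimes>\<^bsub>H i\<^esub> c) # v)"
          using free_product_step.merge[of "[]" I H v i a c] c assms Cons y True by (simp add: r_into_equivclp)
        show ?thesis
        proof (cases "a \<otimes>\<^bsub>H i\<^esub> c = \<one>\<^bsub>H i\<^esub>")
          case True
          hence "push (i, a) w = v" using Cons y \<open>i = j\<close> False by (simp add: push_def)
          thus ?thesis using equivclp_trans[OF m] er[OF c(2)] True by simp
        qed (use m Cons y \<open>i = j\<close> \<open>a \<noteq> \<one>\<^bsub>H i\<^esub>\<close> in \<open>simp add: push_def\<close>)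
      qed (use Cons y \<open>a \<noteq> \<one>\<^bsub>H i\<^esub>\<close> in \<open>simp add: push_def\<close>)
    qed
  qed
qed

lemma equiv_normal_form: "w \<in> W \<Longrightarrow> equivclp step w (normal_form w)"
proof (induction w)
  case (Cons x w)
  obtain i a where x: "x = (i, a)" by (cases x)
  have i: "i \<in> I" "a \<in> carrier (H i)" "w \<in> W" using Cons.prems x by auto
  have nw: "normal_word (normal_form w)" using normal_form_normal i by blast
  have "equivclp step ([(i, a)] @ w) ([(i, a)] @ normal_form w)"
    using Cons.IH i normal_word_W[OF nw] by (intro equiv_append) auto
  moreover have "equivclp step ((i, a) # normal_form w) (push (i, a) (normal_form w))"
    using equiv_push nw i by blast
  ultimately show ?case using x by (simp add: normal_form_def) (meson equivclp_trans)
qed (simp add: normal_form_def)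

lemma cls_normal_form: "w \<in> W \<Longrightarrow> cls w = cls (normal_form w)"
  using cls_eq_iff equiv_normal_form normal_word_W normal_form_normal by blast

lemma cls_normal_eq: "normal_word v \<Longrightarrow> normal_word w \<Longrightarrow> cls v = cls w \<Longrightarrow> v = w"
  using cls_eq_iff normal_form_equiv normal_form_id normal_word_W by metis

end

section \<open>Homomorphisms out of a free product and its quotients\<close>

locale free_product_hom = free_product_of_groups I H + K: group K
  for I :: "'i set" and H :: "'i \<Rightarrow> ('a, 'm) monoid_scheme"
    and K :: "('k, 'n) monoid_scheme" (structure) +
  fixes f :: "'i \<Rightarrow> 'a \<Rightarrow> 'k"
  assumes hom_factor: "i \<in> I \<Longrightarrow> f i \<in> hom (H i) K"
begin

lemma f_closed: "i \<in> I \<Longrightarrow> a \<in> carrier (H i) \<Longrightarrow> f i a \<in> carrier K"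
  using hom_factor by (auto simp: hom_def)

lemma word_eval_closed: "w \<in> W \<Longrightarrow> word_eval K f w \<in> carrier K"
proof (induction w)
  case (Cons x w)
  thus ?case using f_closed by (cases x) simp
qed simp

lemma word_eval_append:
  "v \<in> W \<Longrightarrow> w \<in> W \<Longrightarrow> word_eval K f (v @ w) = word_eval K f v \<otimes> word_eval K f w"
proof (induction v)
  case (Cons x v)
  thus ?case using f_closed word_eval_closed by (cases x) (simp add: K.m_assoc)
qed (simp add: word_eval_closed)

lemma f_one: "i \<in> I \<Longrightarrow> f i \<one>\<^bsub>H i\<^esub> = \<one>"
  using hom_one[OF hom_factor group_factor K.is_group] by blast

lemma word_eval_step: "step v w \<Longrightarrow> word_eval K f v = word_eval K f w"
proof (induction rule: free_product_step.induct)
  case (erase u v i)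
  interpret Hi: group "H i" using group_factor erase by blast
  show ?case using erase word_eval_closed f_one by (simp add: word_eval_append)
next
  case (merge u v i a b)
  interpret Hi: group "H i" using group_factor merge by blast
  have "f i (a \<otimes>\<^bsub>H i\<^esub> b) = f i a \<otimes> f i b" using hom_factor[OF merge(3)] merge by (simp add: hom_def)
  thus ?case using merge word_eval_closed f_closed by (simp add: word_eval_append K.m_assoc)
qed

lemma word_eval_equiv: "equivclp step v w \<Longrightarrow> word_eval K f v = word_eval K f w"
  by (induction rule: equivclp_induct) (auto dest: word_eval_step)

definition class_eval :: "('i \<times> 'a) list set \<Rightarrow> 'k"
  where "class_eval c = the_elem (word_eval K f ` c)"

lemma class_eval_cls: "w \<in> W \<Longrightarrow> class_eval (cls w) = word_eval K f w"
proof -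
  assume w: "w \<in> W"
  have "word_eval K f ` cls w = {word_eval K f w}"
  proof (intro subset_antisym subsetI)
    fix y assume "y \<in> word_eval K f ` cls w"
    then obtain v where "v \<in> cls w" "y = word_eval K f v" by blast
    thus "y \<in> {word_eval K f w}" using word_eval_equiv[of w v] w by (simp add: mem_cls)
  next
    have "w \<in> cls w" using w by (simp add: mem_cls)
    thus "y \<in> word_eval K f ` cls w" if "y \<in> {word_eval K f w}" for y using that by blast
  qed
  thus ?thesis by (simp add: class_eval_def)
qed

lemma class_eval_hom: "class_eval \<in> hom F K"
proof (rule homI)
  show "class_eval x \<in> carrier K" if "x \<in> carrier F" for x
    using that by (auto elim!: F_E simp: class_eval_cls word_eval_closed)
  show "class_eval (x \<otimes>\<^bsub>F\<^esub> y) = class_eval x \<otimes> class_eval y" if "x \<in> carrier F" "y \<in> carrier F" for x y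
    using that by (auto elim!: F_E simp: class_eval_cls mult_cls word_eval_append)
qed

sublocale hom: group_hom F K class_eval
  using class_eval_hom group_F K.is_group by (simp add: group_hom_def group_hom_axioms_def)

end

lemma (in group_hom) normal_closure_kernel:
  assumes "S \<subseteq> carrier G" "\<And>s. s \<in> S \<Longrightarrow> h s = \<one>\<^bsub>H\<^esub>" "x \<in> normal_closure G S"
  shows "h x = \<one>\<^bsub>H\<^esub>"
proof -
  have "{g \<otimes> s \<otimes> inv g | g s. g \<in> carrier G \<and> s \<in> S} \<subseteq> kernel G H h"
    using assms(1,2) by (auto simp: kernel_def subset_iff)
  hence "normal_closure G S \<subseteq> kernel G H h"
    unfolding normal_closure_def by (rule G.generate_subgroup_incl) (rule subgroup_kernel)
  thus ?thesis using assms(3) by (auto simp: kernel_def)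
qed

lemma (in group) normal_closure_normal:
  assumes "S \<subseteq> carrier G"
  shows "normal_closure G S \<lhd> G" "S \<subseteq> normal_closure G S"
proof -
  let ?T = "{g \<otimes> s \<otimes> inv g | g s. g \<in> carrier G \<and> s \<in> S}"
  have T: "?T \<subseteq> carrier G" using assms by auto
  have "g \<otimes> t \<otimes> inv g \<in> ?T" if t: "t \<in> ?T" and g: "g \<in> carrier G" for g t
  proof -
    obtain k s where k: "k \<in> carrier G" "s \<in> S" "t = k \<otimes> s \<otimes> inv k" using t by blast
    have "s \<in> carrier G" using k assms by blast
    hence "g \<otimes> t \<otimes> inv g = (g \<otimes> k) \<otimes> s \<otimes> inv (g \<otimes> k)" using k g by (simp add: m_assoc inv_mult_group)
    thus ?thesis using k g by blast
  qed
  thus "normal_closure G S \<lhd> G" unfolding normal_closure_def by (intro normal_generateI[OF T])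
  show "S \<subseteq> normal_closure G S"
  proof
    fix s assume s: "s \<in> S"
    hence "s = \<one> \<otimes> s \<otimes> inv \<one>" using assms by auto
    hence "s \<in> ?T" using s one_closed by blast
    thus "s \<in> normal_closure G S" unfolding normal_closure_def by (rule generate.incl)
  qed
qed

section \<open>Gated bases yield periagroups\<close>

lemma map_alternating: "map f (alternating m a b) = alternating m (f a) (f b)"
  by (induction m arbitrary: a b) auto

lemma carrier_as_group [simp]: "carrier (as_group G A) = A"
  and one_as_group [simp]: "\<one>\<^bsub>as_group G A\<^esub> = \<one>\<^bsub>G\<^esub>"
  and mult_as_group [simp]: "a \<otimes>\<^bsub>as_group G A\<^esub> b = a \<otimes>\<^bsub>G\<^esub> b"
  by (simp_all add: as_group_def)

locale periagroup_presentation = free_product_of_groups I H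
  for I :: "'i set" and H :: "'i \<Rightarrow> ('a, 'm) monoid_scheme" +
  fixes \<Gamma> :: "'i ugraph" and lab :: "'i set \<Rightarrow> nat"
  assumes verts_eq: "verts \<Gamma> = I" and adj_mem: "adj \<Gamma> u v \<Longrightarrow> u \<in> I \<and> v \<in> I"
begin

sublocale F: group F
  by (rule group_F)

abbreviation "N \<equiv> periagroup_kernel \<Gamma> lab H"
abbreviation "relators \<equiv> periagroup_relators \<Gamma> lab H"

lemma alternating_W:
  assumes "u \<in> I" "a \<in> carrier (H u)" "v \<in> I" "b \<in> carrier (H v)"
  shows "alternating m (u, a) (v, b) \<in> W"
  using assms by (induction m arbitrary: u a v b) auto

lemma relatorI:
  assumes "adj \<Gamma> u v" "a \<in> carrier (H u) - {\<one>\<^bsub>H u\<^esub>}" "b \<in> carrier (H v) - {\<one>\<^bsub>H v\<^esub>}"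
  shows "cls (alternating (lab {u, v}) (u, a) (v, b)) \<otimes>\<^bsub>F\<^esub>
    inv\<^bsub>F\<^esub> (cls (alternating (lab {u, v}) (v, b) (u, a))) \<in> relators"
  unfolding periagroup_relators_def Let_def verts_eq using assms by auto

lemma relatorE:
  assumes "r \<in> relators"
  obtains u v a b where "adj \<Gamma> u v" "a \<in> carrier (H u) - {\<one>\<^bsub>H u\<^esub>}" "b \<in> carrier (H v) - {\<one>\<^bsub>H v\<^esub>}"
    "r = cls (alternating (lab {u, v}) (u, a) (v, b)) \<otimes>\<^bsub>F\<^esub>
      inv\<^bsub>F\<^esub> (cls (alternating (lab {u, v}) (v, b) (u, a)))"
    "alternating (lab {u, v}) (u, a) (v, b) \<in> W" "alternating (lab {u, v}) (v, b) (u, a) \<in> W"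
  using assms alternating_W adj_mem unfolding periagroup_relators_def Let_def verts_eq by auto

lemma relators_subset: "relators \<subseteq> carrier F"
  by (auto elim!: relatorE)

sublocale N: normal N F
  using F.normal_closure_normal(1)[OF relators_subset] by (simp add: periagroup_kernel_def verts_eq)

lemma relators_N: "relators \<subseteq> N"
  using F.normal_closure_normal(2)[OF relators_subset] by (simp add: periagroup_kernel_def verts_eq)

lemma coset_eqI:
  assumes "x \<in> carrier F" "y \<in> carrier F" "x \<otimes>\<^bsub>F\<^esub> inv\<^bsub>F\<^esub> y \<in> N"
  shows "N #>\<^bsub>F\<^esub> x = N #>\<^bsub>F\<^esub> y"
proof -
  have "x = (x \<otimes>\<^bsub>F\<^esub> inv\<^bsub>F\<^esub> y) \<otimes>\<^bsub>F\<^esub> y" using assms by (simp add: F.m_assoc)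
  hence "x \<in> N #>\<^bsub>F\<^esub> y" using assms(3) by (force simp: r_coset_def)
  thus ?thesis using F.repr_independence[OF _ assms(2) N.is_subgroup] by simp
qed

text \<open>The universal property of the periagroup, phrased on the free product. It serves for the
  evaluation in \<open>G\<close> as well as for the action on sectors.\<close>

lemma hom_trivial_on_N:
  assumes "free_product_hom I H K f"
    "\<And>u v a b. \<lbrakk>adj \<Gamma> u v; a \<in> carrier (H u) - {\<one>\<^bsub>H u\<^esub>}; b \<in> carrier (H v) - {\<one>\<^bsub>H v\<^esub>}\<rbrakk> \<Longrightarrow>
      word_eval K f (alternating (lab {u, v}) (u, a) (v, b)) =
      word_eval K f (alternating (lab {u, v}) (v, b) (u, a))"
    "x \<in> N"
  shows "free_product_hom.class_eval K f x = \<one>\<^bsub>K\<^esub>"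
proof -
  interpret hm: free_product_hom I H K f by fact
  have "hm.class_eval r = \<one>\<^bsub>K\<^esub>" if rel: "r \<in> relators" for r
    using rel
  proof (rule relatorE)
    fix u v a b
    assume r: "adj \<Gamma> u v" "a \<in> carrier (H u) - {\<one>\<^bsub>H u\<^esub>}" "b \<in> carrier (H v) - {\<one>\<^bsub>H v\<^esub>}"
      "r = cls (alternating (lab {u, v}) (u, a) (v, b)) \<otimes>\<^bsub>F\<^esub>
        inv\<^bsub>F\<^esub> (cls (alternating (lab {u, v}) (v, b) (u, a)))"
      "alternating (lab {u, v}) (u, a) (v, b) \<in> W" "alternating (lab {u, v}) (v, b) (u, a) \<in> W"
    have "hm.class_eval (cls (alternating (lab {u, v}) (u, a) (v, b))) =
        hm.class_eval (cls (alternating (lab {u, v}) (v, b) (u, a)))"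
      using assms(2)[OF r(1-3)] r(5,6) by (simp add: hm.class_eval_cls)
    thus ?thesis using r(4-6) hm.hom.hom_closed by simp
  qed
  thus ?thesis
    using hm.hom.normal_closure_kernel[OF relators_subset] assms(3)
    by (simp add: periagroup_kernel_def verts_eq)
qed

end

lemma free_product_of_subgroups:
  assumes "group G" "\<And>B. B \<in> \<B> \<Longrightarrow> subgroup B G"
  shows "free_product_hom \<B> (as_group G) G (\<lambda>B b. b)"
proof -
  interpret group G by fact
  have "group (as_group G B)" if "B \<in> \<B>" for B
    using subgroup.subgroup_is_group[OF assms(2)[OF that] assms(1)] by (simp add: as_group_def)
  moreover have "(\<lambda>b. b) \<in> hom (as_group G B) G" if "B \<in> \<B>" for B
    using subgroup.mem_carrier[OF assms(2)[OF that]] by (auto intro!: homI)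
  ultimately show ?thesis
    by (intro free_product_hom.intro free_product_of_groups.intro free_product_hom_axioms.intro is_group)
qed

context gated_basis
begin

sublocale fp: free_product_hom \<B> "as_group G" G "\<lambda>B b. b"
  by (rule free_product_of_subgroups[OF is_group subgroup_basis])

lemma word_eval_prod: "word_eval G (\<lambda>B b. b) w = prod_word (map snd w)"
proof (induction w)
  case (Cons x w)
  thus ?case by (cases x) simp
qed simp

text \<open>If the factors are braided, the two sides of a braid relation are different normal words
  with the same value, so the canonical map is not injective. If they are not, every alternating
  word is reduced, so a nonempty normal word never has the value \<open>\<one>\<close> and the
  canonical map is an isomorphism.\<close>

lemma basis_graph_braided:
  assumes "A \<in> \<B>" "B \<in> \<B>" "A \<noteq> B"
  shows "adj (basis_graph G \<B>) A B \<longleftrightarrow> (\<exists>m. braided A B m)"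
proof -
  interpret ab: free_product_hom "{A, B}" "as_group G" G "\<lambda>B b. b"
    using free_product_of_subgroups[OF is_group, of "{A, B}"] subgroup_basis assms by auto
  have can: "canonical_map G = ab.class_eval"
    by (rule ext) (simp add: canonical_map_def ab.class_eval_def eval_word_eq)
  define S where "S = subgroup_generated G (A \<union> B)"
  have ABc: "A \<union> B \<subseteq> carrier G" using basis_subset assms by auto
  have S: "carrier S = generate G (A \<union> B)" "mult S = mult G"
    using ABc by (auto simp: S_def Int_absorb1 subgroup_generated_def)
  have alternates_normal: "alternates C D (map snd w) \<or> alternates D C (map snd w)"
    if "ab.normal_word w" "C = A \<and> D = B" for w C D
  proof -
    have "w \<noteq> [] \<longrightarrow> (fst (hd w) = C \<longrightarrow> alternates C D (map snd w))"
      if "ab.normal_word w" "{C, D} = {A, B}" for w C D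
      using that
    proof (induction w arbitrary: C D)
      case (Cons x w)
      show ?case
      proof (intro impI)
        assume C: "fst (hd (x # w)) = C"
        hence x: "snd x \<in> C - {\<one>}" using Cons.prems(1) by auto
        show "alternates C D (map snd (x # w))"
        proof (cases "w = []")
          case False
          hence "fst (hd w) \<noteq> C" "fst (hd w) \<in> {A, B}" using Cons.prems(1) C by (cases w; auto)+
          hence "fst (hd w) = D" using Cons.prems(2) by auto
          moreover have "{D, C} = {A, B}" using Cons.prems(2) by auto
          ultimately show ?thesis using Cons.IH[of D C] Cons.prems(1) False x by simp
        qed (use x in simp)
      qed
    qed simp
    note * = this
    show ?thesis
    proof (cases "w = []")
      case False
      hence "fst (hd w) \<in> {A, B}" using that(1) by (cases w) auto
      thus ?thesis using *[OF that(1), of A B] *[OF that(1), of B A] that(2) False by (auto simp: insert_commute)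
    qed simp
  qed
  have normal_alternating: "ab.normal_word (alternating m (C, c) (D, d))"
    if "{C, D} = {A, B}" "c \<in> C - {\<one>}" "d \<in> D - {\<one>}" for m C D c d
    using that
  proof (induction m arbitrary: C D c d)
    case (Suc m)
    have CD: "C \<noteq> D" "C \<in> {A, B}" "{D, C} = {A, B}" using Suc.prems(1) assms(3) by auto
    have "alternating m (D, d) (C, c) = [] \<or> fst (hd (alternating m (D, d) (C, c))) \<noteq> C"
      using CD(1) by (cases m) auto
    thus ?case using Suc.IH[OF CD(3) Suc.prems(3,2)] Suc.prems CD by auto
  qed simp
  show ?thesis
  proof
    assume "\<exists>m. braided A B m"
    then obtain m where m: "braided A B m" by blast
    obtain a b where a: "a \<in> A - {\<one>}" and b: "b \<in> B - {\<one>}"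
      using basis_nontrivial_elem assms by metis
    let ?u = "alternating m (A, a) (B, b)" and ?v = "alternating m (B, b) (A, a)"
    have n: "ab.normal_word ?u" "ab.normal_word ?v"
      using normal_alternating[of A B a b m] normal_alternating[of B A b a m] a b by auto
    hence W: "?u \<in> ab.W" "?v \<in> ab.W" using ab.normal_word_W by auto
    have "braid_pair m a b" using m a b by (simp add: braided_def)
    hence "word_eval G (\<lambda>B b. b) ?u = word_eval G (\<lambda>B b. b) ?v"
      by (simp add: word_eval_prod map_alternating braid_pair_def)
    hence eq: "ab.class_eval (ab.cls ?u) = ab.class_eval (ab.cls ?v)" using W by (simp add: ab.class_eval_cls)
    have "0 < m" using m by (simp add: braided_def)
    hence "?u \<noteq> ?v" using assms(3) by (cases m) auto
    hence ne: "ab.cls ?u \<noteq> ab.cls ?v" using ab.cls_normal_eq n by blast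
    have "\<not> inj_on ab.class_eval (carrier ab.F)"
      using eq ne W ab.cls_mem unfolding inj_on_def by blast
    hence "ab.class_eval \<notin> iso ab.F S" by (auto simp: iso_def bij_betw_def)
    thus "adj (basis_graph G \<B>) A B" using assms can by (simp add: basis_graph_def S_def)
  next
    assume "adj (basis_graph G \<B>) A B"
    hence not_iso: "ab.class_eval \<notin> iso ab.F S" using can by (simp add: basis_graph_def S_def)
    show "\<exists>m. braided A B m"
    proof (rule ccontr)
      assume no: "\<nexists>m. braided A B m"
      have gen: "word_eval G (\<lambda>B b. b) w \<in> generate G (A \<union> B)" if "w \<in> ab.W" for w
        using that
      proof (induction w)
        case (Cons x w)
        thus ?case by (cases x) (auto intro: generate.eng generate.incl)
      qed (simp add: generate.one)
      have "ab.class_eval \<in> hom ab.F S"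
        using ab.class_eval_hom gen S by (auto simp: hom_def Pi_iff ab.class_eval_cls elim!: ab.F_E)
      moreover have "inj_on ab.class_eval (carrier ab.F)"
      proof (rule ab.hom.trivial_ker_imp_inj)
        have triv: "x = \<one>\<^bsub>ab.F\<^esub>" if x: "x \<in> carrier ab.F" "ab.class_eval x = \<one>" for x
        proof -
          obtain w0 where w0: "w0 \<in> ab.W" "x = ab.cls w0" using x(1) by (rule ab.F_E)
          define w where "w = ab.normal_form w0"
          have w: "ab.normal_word w" "x = ab.cls w" "w \<in> ab.W"
            using w0 ab.normal_form_normal ab.cls_normal_form ab.normal_word_W by (auto simp: w_def)
          have p: "prod_word (map snd w) = \<one>"
            using x(2) w ab.class_eval_cls by (simp add: word_eval_prod)
          have "reduced (map snd w)"
          proof (rule ccontr)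
            assume nr: "\<not> reduced (map snd w)"
            have "alternates A B (map snd w) \<or> alternates B A (map snd w)"
              using alternates_normal[OF w(1)] by blast
            thus False
              using braided_if_not_reduced[OF assms _ nr]
                braided_if_not_reduced[OF assms(2,1) assms(3)[symmetric] _ nr] no braided_sym by metis
          qed
          hence "length w = 0" using len_reduced p by fastforce
          thus ?thesis using w ab.one_F by simp
        qed
        have "kernel ab.F G ab.class_eval \<subseteq> {\<one>\<^bsub>ab.F\<^esub>}"
        proof
          fix x assume "x \<in> kernel ab.F G ab.class_eval"
          hence "x \<in> carrier ab.F" "ab.class_eval x = \<one>" by (simp_all add: kernel_def)
          thus "x \<in> {\<one>\<^bsub>ab.F\<^esub>}" using triv by simp
        qed
        moreover have "\<one>\<^bsub>ab.F\<^esub> \<in> kernel ab.F G ab.class_eval" unfolding kernel_def by simp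
        ultimately show "kernel ab.F G ab.class_eval = {\<one>\<^bsub>ab.F\<^esub>}" by blast
      qed
      moreover have "ab.class_eval ` carrier ab.F = carrier S"
      proof (intro subset_antisym subsetI)
        fix p assume "p \<in> carrier S"
        hence "p \<in> generate G (\<Union>{A, B})" using S by simp
        then obtain v where v: "set v \<subseteq> letters {A, B}" "prod_word v = p"
          using generate_word[of "{A, B}" p] assms by auto
        define w where "w = map (\<lambda>b. (base b, b)) v"
        have "w \<in> ab.W"
          using v(1) assms base_mem[of _ "{A, B}"] unfolding w_def by (induction v) auto
        moreover have "map snd w = v" by (simp add: w_def comp_def)
        ultimately have "ab.class_eval (ab.cls w) = p" "ab.cls w \<in> carrier ab.F"
          using v by (auto simp: ab.class_eval_cls word_eval_prod)
        thus "p \<in> ab.class_eval ` carrier ab.F" by blast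
      next
        fix p assume "p \<in> ab.class_eval ` carrier ab.F"
        thus "p \<in> carrier S" using gen S by (auto elim!: ab.F_E simp: ab.class_eval_cls)
      qed
      ultimately show False using not_iso by (simp add: iso_def bij_betw_def)
    qed
  qed
qed

text \<open>A label belongs to an unordered pair, so the description ranges over both ways of naming
  its elements; \<open>braided_sym\<close> makes them agree.\<close>

definition label :: "'a set set \<Rightarrow> nat"
  where "label e = (THE m. \<exists>A B. e = {A, B} \<and> A \<in> \<B> \<and> B \<in> \<B> \<and> A \<noteq> B \<and> braided A B m)"

lemma label_eq:
  assumes "A \<in> \<B>" "B \<in> \<B>" "A \<noteq> B" "braided A B m"
  shows "label {A, B} = m"
  unfolding label_def
proof (rule the_equality)
  fix n assume "\<exists>A' B'. {A, B} = {A', B'} \<and> A' \<in> \<B> \<and> B' \<in> \<B> \<and> A' \<noteq> B' \<and> braided A' B' n"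
  hence "braided A B n" using braided_sym by (auto simp: doubleton_eq_iff)
  thus "n = m" using braided_unique assms by blast
qed (use assms in blast)

abbreviation "\<Gamma> \<equiv> basis_graph G \<B>"

lemma basis_graph_verts [simp]: "verts \<Gamma> = \<B>"
  by (simp add: basis_graph_def)

lemma basis_graph_adjD: "adj \<Gamma> A B \<Longrightarrow> A \<in> \<B> \<and> B \<in> \<B> \<and> A \<noteq> B"
  by (simp add: basis_graph_def)

lemma adj_label: "adj \<Gamma> A B \<Longrightarrow> braided A B (label {A, B})"
  using basis_graph_adjD[of A B] basis_graph_braided label_eq by blast

lemma periagroup_data_label: "periagroup_data \<Gamma> label (as_group G)"
  unfolding periagroup_data_def
proof (intro conjI ballI allI impI)
  have "adj \<Gamma> B A" if "adj \<Gamma> A B" for A B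
    using that basis_graph_adjD[OF that] basis_graph_braided braided_sym by metis
  thus "simple_graph \<Gamma>"
    using basis_graph_adjD unfolding simple_graph_def by simp
  show "group (as_group G B)" if "B \<in> verts \<Gamma>" for B using that fp.group_factor by simp
  show "2 \<le> label e" if "e \<in> edges \<Gamma>" for e
    using that adj_label by (auto simp: edges_def braided_def)
  fix A B assume "adj \<Gamma> A B \<and> 2 < label {A, B}"
  thus "order (as_group G A) = 2" "order (as_group G B) = 2"
    using adj_label[of A B] by (auto simp: order_def braided_def)
qed

section \<open>Comparison with the abstract periagroup\<close>

sublocale pr: periagroup_presentation \<B> "as_group G" \<Gamma> label
  by unfold_locales (auto dest: basis_graph_adjD)

abbreviation "N \<equiv> pr.N"

text \<open>The class of a one-letter word in the abstract periagroup. The neutral element lies in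
  every factor and \<open>base\<close> singles out none of them, hence the separate case.\<close>

definition quot :: "'a \<Rightarrow> ('a set \<times> 'a) list set set"
  where "quot b = (if b = \<one> then N else N #>\<^bsub>fp.F\<^esub> fp.cls [(base b, b)])"

lemma quot_eq: "B \<in> \<B> \<Longrightarrow> b \<in> B \<Longrightarrow> quot b = N #>\<^bsub>fp.F\<^esub> fp.cls [(B, b)]"
proof (cases "b = \<one>")
  case True
  assume B: "B \<in> \<B>" "b \<in> B"
  have "fp.step [(B, \<one>)] []"
    using free_product_step.erase[of "[]" \<B> "as_group G" "[]" B] B by simp
  hence "fp.cls [(B, b)] = fp.cls []" using True B by (subst fp.cls_eq_iff) auto
  thus ?thesis using True pr.N.subset by (simp add: quot_def fp.one_F[symmetric])
qed (simp add: quot_def base_eq)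

lemma quot_word:
  assumes "w \<in> fp.W"
  shows "group.prod_word (fp.F Mod N) (map quot (map snd w)) = N #>\<^bsub>fp.F\<^esub> fp.cls w"
proof -
  interpret Q: group "fp.F Mod N" by (rule pr.N.factorgroup_is_group)
  show ?thesis
    using assms
  proof (induction w)
    case Nil
    have "Q.prod_word (map quot (map snd [])) = \<one>\<^bsub>fp.F Mod N\<^esub>" by simp
    thus ?case using pr.N.subset by (simp add: FactGroup_def fp.one_F[symmetric])
  next
    case (Cons x w)
    obtain B b where x: "x = (B, b)" by (cases x)
    have B: "B \<in> \<B>" "b \<in> B" "w \<in> fp.W" using Cons.prems x by auto
    have "Q.prod_word (map quot (map snd (x # w))) =
        quot b \<otimes>\<^bsub>fp.F Mod N\<^esub> Q.prod_word (map quot (map snd w))"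
      by (simp add: x)
    also have "\<dots> = quot b \<otimes>\<^bsub>fp.F Mod N\<^esub> (N #>\<^bsub>fp.F\<^esub> fp.cls w)" by (simp only: Cons.IH[OF B(3)])
    also have "\<dots> = (N #>\<^bsub>fp.F\<^esub> fp.cls [(B, b)]) <#>\<^bsub>fp.F\<^esub> (N #>\<^bsub>fp.F\<^esub> fp.cls w)"
      using B by (simp add: FactGroup_def quot_eq)
    also have "\<dots> = N #>\<^bsub>fp.F\<^esub> (fp.cls [(B, b)] \<otimes>\<^bsub>fp.F\<^esub> fp.cls w)"
      using B by (intro pr.N.rcos_sum) auto
    also have "fp.cls [(B, b)] \<otimes>\<^bsub>fp.F\<^esub> fp.cls w = fp.cls (x # w)" using B x by (simp add: fp.mult_cls)
    finally show ?case .
  qed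
qed

text \<open>The relators of the quotient are the braid relations of length \<open>label\<close>, and
  \<open>label\<close> returns the braid length, so \<open>quot\<close> satisfies
  \<open>rep_braid\<close> by construction.\<close>

lemma braid_representation_quot: "braid_representation G \<B> gate (fp.F Mod N) quot"
proof (rule braid_representation.intro[OF gated_basis_axioms pr.N.factorgroup_is_group braid_representation_axioms.intro])
  fix B assume B: "B \<in> \<B>"
  show "quot b \<in> carrier (fp.F Mod N)" if "b \<in> B" for b
    using quot_eq[OF B that] B that fp.cls_mem[of "[(B, b)]"] by (auto simp: FactGroup_def RCOSETS_def)
  show "quot (a \<otimes> b) = quot a \<otimes>\<^bsub>fp.F Mod N\<^esub> quot b" if "a \<in> B" "b \<in> B" for a b
  proof -
    have ab: "a \<otimes> b \<in> B" using basis_mult B that by blast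
    have "fp.step [(B, a), (B, b)] [(B, a \<otimes> b)]"
      using free_product_step.merge[of "[]" \<B> "as_group G" "[]" B a b] B that by simp
    hence "fp.cls [(B, a), (B, b)] = fp.cls [(B, a \<otimes> b)]" using B that ab by (subst fp.cls_eq_iff) auto
    hence "fp.cls [(B, a)] \<otimes>\<^bsub>fp.F\<^esub> fp.cls [(B, b)] = fp.cls [(B, a \<otimes> b)]" using B that by (simp add: fp.mult_cls)
    moreover have "(N #>\<^bsub>fp.F\<^esub> fp.cls [(B, a)]) <#>\<^bsub>fp.F\<^esub> (N #>\<^bsub>fp.F\<^esub> fp.cls [(B, b)]) =
        N #>\<^bsub>fp.F\<^esub> (fp.cls [(B, a)] \<otimes>\<^bsub>fp.F\<^esub> fp.cls [(B, b)])"
      using B that by (intro pr.N.rcos_sum) auto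
    ultimately show ?thesis using B that ab by (simp add: quot_eq FactGroup_def)
  qed
next
  fix A B a b m
  assume AB: "A \<in> \<B>" "B \<in> \<B>" "A \<noteq> B" "a \<in> A - {\<one>}" "b \<in> B - {\<one>}" "braided A B m"
  hence adj: "adj \<Gamma> A B" using basis_graph_braided by blast
  have m: "label {A, B} = m" using label_eq AB by blast
  have W: "alternating m (A, a) (B, b) \<in> fp.W" "alternating m (B, b) (A, a) \<in> fp.W"
    using pr.alternating_W AB by auto
  have "N #>\<^bsub>fp.F\<^esub> fp.cls (alternating m (A, a) (B, b)) = N #>\<^bsub>fp.F\<^esub> fp.cls (alternating m (B, b) (A, a))"
    using pr.relatorI[OF adj, of a b] pr.relators_N AB(4,5) W m by (intro pr.coset_eqI) auto
  thus "group.prod_word (fp.F Mod N) (map quot (alternating m a b)) =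
      group.prod_word (fp.F Mod N) (map quot (alternating m b a))"
    using quot_word[OF W(1)] quot_word[OF W(2)] by (simp add: map_alternating)
qed

text \<open>One inclusion says that the braid relations hold in \<open>G\<close>. For the other, a
  word with value \<open>\<one>\<close> has the same image under \<open>quot\<close> as the empty
  word by \<open>rep_word_eq\<close>, so its class lies in \<open>N\<close>: the braid relations
  suffice.\<close>

lemma N_eq_kernel: "N = kernel fp.F G fp.class_eval"
proof (intro subset_antisym subsetI)
  fix x assume x: "x \<in> N"
  have "fp.class_eval x = \<one>"
  proof (rule pr.hom_trivial_on_N[OF fp.free_product_hom_axioms _ x])
    fix A B a b
    assume AB: "adj \<Gamma> A B" "a \<in> carrier (as_group G A) - {\<one>\<^bsub>as_group G A\<^esub>}"
      "b \<in> carrier (as_group G B) - {\<one>\<^bsub>as_group G B\<^esub>}"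
    hence "braid_pair (label {A, B}) a b" using adj_label[OF AB(1)] by (simp add: braided_def)
    thus "word_eval G (\<lambda>B b. b) (alternating (label {A, B}) (A, a) (B, b)) =
        word_eval G (\<lambda>B b. b) (alternating (label {A, B}) (B, b) (A, a))"
      by (simp add: word_eval_prod map_alternating braid_pair_def)
  qed
  thus "x \<in> kernel fp.F G fp.class_eval" using x pr.N.subset by (auto simp: kernel_def)
next
  fix x assume "x \<in> kernel fp.F G fp.class_eval"
  hence x: "x \<in> carrier fp.F" "fp.class_eval x = \<one>" by (auto simp: kernel_def)
  obtain w0 where w0: "w0 \<in> fp.W" "x = fp.cls w0" using x(1) by (rule fp.F_E)
  define w where "w = fp.normal_form w0"
  have w: "fp.normal_word w" "x = fp.cls w" "w \<in> fp.W"
    using w0 fp.normal_form_normal fp.cls_normal_form fp.normal_word_W by (auto simp: w_def)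
  interpret br: braid_representation G \<B> gate "fp.F Mod N" quot by (rule braid_representation_quot)
  have "set (map snd w) \<subseteq> letters \<B>"
    using w(1) by (induction w) (auto intro: letterI)
  moreover have "prod_word (map snd w) = prod_word []"
    using x(2) w by (simp add: fp.class_eval_cls word_eval_prod)
  ultimately have "br.K.prod_word (map quot (map snd w)) = br.K.prod_word (map quot [])"
    by (intro br.rep_word_eq) auto
  hence "N #>\<^bsub>fp.F\<^esub> x = \<one>\<^bsub>fp.F Mod N\<^esub>" using quot_word[OF w(3)] w(2) by simp
  hence "N #>\<^bsub>fp.F\<^esub> x = N" by (simp add: FactGroup_def)
  thus "x \<in> N" using fp.hom.G.rcos_self[OF x(1) pr.N.is_subgroup] by simp
qed

theorem periagroup_with_basis: "periagroup_with_basis G \<B>"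
  unfolding periagroup_with_basis_def
proof (intro conjI ballI exI bexI)
  show "group G" by (rule is_group)
  show "subgroup B G" "B \<noteq> {\<one>}" if "B \<in> \<B>" for B
    using that subgroup_basis basis_nontrivial by auto
  show "periagroup_data \<Gamma> label (as_group G)" by (rule periagroup_data_label)
  have "fp.class_eval ` carrier fp.F = carrier G"
  proof (intro subset_antisym subsetI)
    fix g assume "g \<in> carrier G"
    then obtain v where v: "reduced v" "prod_word v = g" using carrier_reduced_word by blast
    define w where "w = map (\<lambda>b. (base b, b)) v"
    have "w \<in> fp.W"
      using reduced_letters[OF v(1)] base_mem' unfolding w_def by (induction v) (auto simp: reduced_def)
    moreover have "map snd w = v" by (simp add: w_def comp_def)
    ultimately have "fp.class_eval (fp.cls w) = g" "fp.cls w \<in> carrier fp.F"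
      using v by (auto simp: fp.class_eval_cls word_eval_prod)
    thus "g \<in> fp.class_eval ` carrier fp.F" by blast
  qed (use fp.hom.hom_closed in auto)
  hence "(\<lambda>X. the_elem (fp.class_eval ` X)) \<in> iso (fp.F Mod N) G"
    using fp.hom.FactGroup_iso_set N_eq_kernel by simp
  thus "(\<lambda>X. the_elem (fp.class_eval ` X)) \<in> iso (periagroup \<Gamma> label (as_group G)) G"
    by (simp add: periagroup_def)
  fix B b assume B: "B \<in> \<B>" "b \<in> B"
  have c: "fp.cls [(B, b)] \<in> carrier fp.F" "fp.class_eval (fp.cls [(B, b)]) = b"
    using B basis_carrier by (auto simp: fp.class_eval_cls)
  have "fp.class_eval x = b" if "x \<in> N #>\<^bsub>fp.F\<^esub> fp.cls [(B, b)]" for x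
  proof -
    obtain n where n: "n \<in> N" "x = n \<otimes>\<^bsub>fp.F\<^esub> fp.cls [(B, b)]" using \<open>x \<in> _\<close> by (auto simp: r_coset_def)
    hence "fp.class_eval n = \<one>" "n \<in> carrier fp.F" unfolding N_eq_kernel by (auto simp: kernel_def)
    thus ?thesis using n(2) c B basis_carrier by simp
  qed
  moreover have "fp.cls [(B, b)] \<in> N #>\<^bsub>fp.F\<^esub> fp.cls [(B, b)]"
    using fp.hom.G.rcos_self[OF c(1) pr.N.is_subgroup] .
  ultimately have "fp.class_eval ` (N #>\<^bsub>fp.F\<^esub> fp.cls [(B, b)]) = {b}"
    by (intro subset_antisym subsetI) (auto intro: image_eqI[where x = "fp.cls [(B, b)]"])
  thus "the_elem (fp.class_eval ` periagroup_inj \<Gamma> label (as_group G) B b) = b"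
    by (simp add: periagroup_inj_def)
qed

end

section \<open>Periagroups yield gated bases\<close>

locale periagroup_basis = group G for G (structure) +
  fixes \<B> :: "'a set set" and lab h
  assumes subgroup_basis: "B \<in> \<B> \<Longrightarrow> subgroup B G"
    and basis_nontrivial: "B \<in> \<B> \<Longrightarrow> B \<noteq> {\<one>}"
    and data: "periagroup_data (basis_graph G \<B>) lab (as_group G)"
    and h_iso: "h \<in> iso (periagroup (basis_graph G \<B>) lab (as_group G)) G"
    and h_inj: "B \<in> \<B> \<Longrightarrow> b \<in> B \<Longrightarrow> h (periagroup_inj (basis_graph G \<B>) lab (as_group G) B b) = b"
begin

abbreviation "\<Gamma> \<equiv> basis_graph G \<B>"

sublocale fp: free_product_hom \<B> "as_group G" G "\<lambda>B b. b"
  by (rule free_product_of_subgroups[OF is_group subgroup_basis])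

sublocale pr: periagroup_presentation \<B> "as_group G" \<Gamma> lab
  by unfold_locales (auto simp: basis_graph_def)

abbreviation "N \<equiv> pr.N"
abbreviation "ev \<equiv> word_eval G (\<lambda>B b. b)"

lemma adjD: "adj \<Gamma> A B \<Longrightarrow> A \<in> \<B> \<and> B \<in> \<B> \<and> A \<noteq> B"
  by (simp add: basis_graph_def)

lemma basis_carr: "B \<in> \<B> \<Longrightarrow> b \<in> B \<Longrightarrow> b \<in> carrier G"
  using subgroup.mem_carrier[OF subgroup_basis] by blast

lemma basis_subset: "B \<in> \<B> \<Longrightarrow> B \<subseteq> carrier G"
  using basis_carr by blast

lemma ev_prod: "ev w = prod_word (map snd w)"
proof (induction w)
  case (Cons x w)
  thus ?case by (cases x) simp
qed simp

lemma h_iso': "h \<in> iso (fp.F Mod N) G"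
  using h_iso by (simp add: periagroup_def pr.verts_eq)

definition \<chi> :: "('a set \<times> 'a) list set \<Rightarrow> 'a"
  where "\<chi> x = h (N #>\<^bsub>fp.F\<^esub> x)"

sublocale chi: group_hom fp.F G \<chi>
proof (unfold group_hom_def group_hom_axioms_def, intro conjI)
  have "h \<circ> (\<lambda>x. N #>\<^bsub>fp.F\<^esub> x) \<in> hom fp.F G"
    using h_iso' by (intro Group.hom_compose[OF pr.N.r_coset_hom_Mod]) (simp add: iso_def)
  thus "\<chi> \<in> hom fp.F G" by (simp add: \<chi>_def[abs_def] comp_def)
qed (use fp.group_F is_group in auto)

text \<open>The hypotheses describe \<open>h\<close> on single letters only. Lifted to the free
  product it is a homomorphism, and so it is evaluation of words in \<open>G\<close>.\<close>

lemma chi_cls: "w \<in> fp.W \<Longrightarrow> \<chi> (fp.cls w) = ev w"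
proof (induction w)
  case Nil
  thus ?case using chi.hom_one by (simp add: fp.one_F)
next
  case (Cons x w)
  obtain B b where x: "x = (B, b)" by (cases x)
  have B: "B \<in> \<B>" "b \<in> B" "w \<in> fp.W" using Cons.prems x by auto
  have "fp.cls (x # w) = fp.cls [(B, b)] \<otimes>\<^bsub>fp.F\<^esub> fp.cls w" using B x by (simp add: fp.mult_cls)
  moreover have "\<chi> (fp.cls [(B, b)]) = b"
    using h_inj[OF B(1,2)] by (simp add: \<chi>_def periagroup_inj_def pr.verts_eq)
  ultimately show ?case using Cons.IH B x by simp
qed

lemma relation:
  assumes "adj \<Gamma> A B" "a \<in> A - {\<one>}" "b \<in> B - {\<one>}"
  shows "prod_word (alternating (lab {A, B}) a b) = prod_word (alternating (lab {A, B}) b a)"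
proof -
  let ?u = "alternating (lab {A, B}) (A, a) (B, b)" and ?v = "alternating (lab {A, B}) (B, b) (A, a)"
  have W: "?u \<in> fp.W" "?v \<in> fp.W" using pr.alternating_W adjD[OF assms(1)] assms by auto
  have r: "fp.cls ?u \<otimes>\<^bsub>fp.F\<^esub> inv\<^bsub>fp.F\<^esub> (fp.cls ?v) \<in> N"
    using pr.relatorI[OF assms(1), of a b] pr.relators_N assms by auto
  hence "N #>\<^bsub>fp.F\<^esub> (fp.cls ?u \<otimes>\<^bsub>fp.F\<^esub> inv\<^bsub>fp.F\<^esub> (fp.cls ?v)) = N #>\<^bsub>fp.F\<^esub> \<one>\<^bsub>fp.F\<^esub>"
    using W by (intro pr.coset_eqI) auto
  hence "\<chi> (fp.cls ?u \<otimes>\<^bsub>fp.F\<^esub> inv\<^bsub>fp.F\<^esub> (fp.cls ?v)) = \<chi> \<one>\<^bsub>fp.F\<^esub>" by (simp add: \<chi>_def)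
  hence "ev ?u \<otimes> inv (ev ?v) = \<one>" using W by (simp add: chi_cls)
  moreover have "ev ?u \<in> carrier G" "ev ?v \<in> carrier G" using W fp.word_eval_closed by auto
  ultimately have "ev ?u = ev ?v" using inv_equality[of "ev ?u" "inv (ev ?v)"] by simp
  thus ?thesis by (simp add: ev_prod map_alternating)
qed

lemma label_ge_2: "adj \<Gamma> A B \<Longrightarrow> 2 \<le> lab {A, B}"
  using data by (auto simp: periagroup_data_def edges_def)

lemma label_gt_2:
  assumes "adj \<Gamma> A B" "2 < lab {A, B}" "a \<in> A - {\<one>}" "b \<in> B - {\<one>}"
  shows "A = {\<one>, a}" "B = {\<one>, b}" "inv a = a" "inv b = b"
proof -
  have card: "card A = 2" "card B = 2"
    using data assms(1,2) by (auto simp: periagroup_data_def order_def)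
  show "A = {\<one>, a}" "B = {\<one>, b}" "inv a = a" "inv b = b"
    using subgroup_card_two[of A a] subgroup_card_two[of B b] subgroup_basis card assms adjD[OF assms(1)] by auto
qed

text \<open>A pair \<open>(R, x)\<close> stands for the sector, delimited by the conjugate \<open>R\<close> of a basis subgroup,
  which is the translate by \<open>x\<close> of the sector containing the neutral element.\<close>

definition sectors :: "('a set \<times> 'a) set"
  where "sectors = {(R, x). R \<subseteq> carrier G \<and> x \<in> R}"

text \<open>The translate by \<open>b\<close> of the sector containing the neutral element contains
  \<open>b\<close>. If \<open>R \<noteq> B\<close>, the edge from \<open>\<one>\<close> to
  \<open>b\<close> should not cross the translated wall, so this is again the sector containing
  \<open>\<one>\<close>, and \<open>x\<close> is merely conjugated. If \<open>R = B\<close>, the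
  wall is fixed and \<open>b\<close> permutes its sectors by left multiplication. For groups of
  order two this is the action of a Coxeter group on its roots.\<close>

definition sector_act :: "'a set \<Rightarrow> 'a \<Rightarrow> 'a set \<times> 'a \<Rightarrow> 'a set \<times> 'a" where
  "sector_act B b = (\<lambda>(R, x) \<in> sectors. (conjugate G b R, if R = B then b \<otimes> x else b \<otimes> x \<otimes> inv b))"

lemma sectors_iff: "(R, x) \<in> sectors \<longleftrightarrow> R \<subseteq> carrier G \<and> x \<in> R"
  by (simp add: sectors_def)

lemma sector_act_apply:
  "(R, x) \<in> sectors \<Longrightarrow> sector_act B b (R, x) = (conjugate G b R, if R = B then b \<otimes> x else b \<otimes> x \<otimes> inv b)"
  by (simp add: sector_act_def)

lemma sector_act_closed:
  assumes "B \<in> \<B>" "b \<in> B" "(R, x) \<in> sectors"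
  shows "sector_act B b (R, x) \<in> sectors"
proof -
  have b: "b \<in> carrier G" using basis_carr assms by blast
  have R: "R \<subseteq> carrier G" "x \<in> R" using assms(3) by (auto simp: sectors_iff)
  have "b \<otimes> x \<otimes> inv b \<in> conjugate G b R" using conjugate_eq[OF R(1) b] R(2) by blast
  moreover have "b \<otimes> x \<in> conjugate G b R" if "R = B"
    using conjugate_self[OF subgroup_basis[OF assms(1)] assms(2)]
      subgroup.m_closed[OF subgroup_basis[OF assms(1)] assms(2)] that R(2) by simp
  ultimately show ?thesis
    using conjugate_subset[OF R(1) b] by (simp add: sector_act_apply[OF assms(3)] sectors_iff)
qed

lemma conjugate_basis_iff:
  assumes "B \<in> \<B>" "b \<in> B" "R \<subseteq> carrier G"
  shows "conjugate G b R = B \<longleftrightarrow> R = B"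
proof -
  have "inv b \<in> B" using subgroup.m_inv_closed[OF subgroup_basis[OF assms(1)] assms(2)] .
  hence "conjugate G (inv b) B = B" using conjugate_self[OF subgroup_basis[OF assms(1)]] by blast
  thus ?thesis
    using conjugate_eq_iff[OF assms(3) basis_subset[OF assms(1)] basis_carr[OF assms(1,2)]] by simp
qed

text \<open>Elements of \<open>B\<close> normalise \<open>B\<close>, so whether the first component
  equals \<open>B\<close> does not change, and each branch of the definition composes with
  itself.\<close>

lemma sector_act_mult:
  assumes "B \<in> \<B>" "a \<in> B" "b \<in> B" "p \<in> sectors"
  shows "sector_act B a (sector_act B b p) = sector_act B (a \<otimes> b) p"
proof -
  obtain R x where p: "p = (R, x)" by (cases p)
  have R: "R \<subseteq> carrier G" "x \<in> R" "x \<in> carrier G" using assms(4) by (auto simp: sectors_iff p)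
  have c: "a \<in> carrier G" "b \<in> carrier G" using assms basis_carr by auto
  have cl: "sector_act B b (R, x) \<in> sectors" using sector_act_closed assms p by blast
  show ?thesis
    using cl assms(4) conjugate_basis_iff[OF assms(1,3) R(1)] R c
    by (auto simp: p sector_act_apply conjugate_mult m_assoc inv_mult_group)
qed

lemma sector_act_one:
  assumes "B \<in> \<B>" "p \<in> sectors"
  shows "sector_act B \<one> p = p"
  using assms by (cases p) (auto simp: sector_act_apply sectors_iff)

lemma sector_act_hom: "B \<in> \<B> \<Longrightarrow> sector_act B \<in> hom (as_group G B) (BijGroup sectors)"
proof -
  assume B: "B \<in> \<B>"
  interpret B: subgroup B G using subgroup_basis[OF B] .
  have bij: "sector_act B b \<in> Bij sectors" if b: "b \<in> B" for b
  proof -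
    have "bij_betw (sector_act B b) sectors sectors"
    proof (rule bij_betw_byWitness[of _ "sector_act B (inv b)"])
      show "\<forall>p\<in>sectors. sector_act B (inv b) (sector_act B b p) = p"
        using sector_act_mult[OF B] sector_act_one[OF B] b by simp
      show "\<forall>p\<in>sectors. sector_act B b (sector_act B (inv b) p) = p"
        using sector_act_mult[OF B] sector_act_one[OF B] b by simp
      show "sector_act B b ` sectors \<subseteq> sectors" "sector_act B (inv b) ` sectors \<subseteq> sectors"
        using sector_act_closed[OF B] b by auto
    qed
    moreover have "sector_act B b \<in> extensional sectors" by (simp add: sector_act_def)
    ultimately show ?thesis by (simp add: Bij_def)
  qed
  have "sector_act B (a \<otimes> b) = compose sectors (sector_act B a) (sector_act B b)" if "a \<in> B" "b \<in> B" for a b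
  proof (rule ext)
    fix p
    show "sector_act B (a \<otimes> b) p = compose sectors (sector_act B a) (sector_act B b) p"
      using sector_act_mult[OF B that, of p]
      by (cases "p \<in> sectors") (auto simp: compose_def sector_act_def)
  qed
  thus ?thesis using bij by (intro homI) (auto simp: BijGroup_def)
qed

sublocale act: free_product_hom \<B> "as_group G" "BijGroup sectors" sector_act
  using sector_act_hom group_BijGroup fp.group_factor
  by (intro free_product_hom.intro free_product_of_groups.intro free_product_hom_axioms.intro)

abbreviation "act_word \<equiv> word_eval (BijGroup sectors) sector_act"

lemma act_word_Bij: "w \<in> fp.W \<Longrightarrow> act_word w \<in> Bij sectors"
  using act.word_eval_closed by (simp add: BijGroup_def)

lemma act_word_closed: "w \<in> fp.W \<Longrightarrow> p \<in> sectors \<Longrightarrow> act_word w p \<in> sectors"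
  using act_word_Bij[of w] by (auto simp: Bij_def bij_betw_def)

lemma Bij_mult:
  "f \<in> Bij S \<Longrightarrow> g \<in> Bij S \<Longrightarrow> x \<in> S \<Longrightarrow> (f \<otimes>\<^bsub>BijGroup S\<^esub> g) x = f (g x)"
  by (simp add: BijGroup_def compose_def)

lemma act_word_Nil: "p \<in> sectors \<Longrightarrow> act_word [] p = p"
  by (simp add: BijGroup_def)

lemma act_word_Cons:
  assumes "(B, b) # w \<in> fp.W" "p \<in> sectors"
  shows "act_word ((B, b) # w) p = sector_act B b (act_word w p)"
proof -
  have "sector_act B b \<in> carrier (BijGroup sectors)"
    by (rule act.f_closed) (use assms(1) in auto)
  hence "sector_act B b \<in> Bij sectors" by (simp add: BijGroup_def)
  moreover have "act_word w \<in> Bij sectors" by (rule act_word_Bij) (use assms(1) in simp)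
  ultimately show ?thesis unfolding word_eval_simps by (rule Bij_mult[OF _ _ assms(2)])
qed

lemma act_word_append:
  assumes "v \<in> fp.W" "w \<in> fp.W" "p \<in> sectors"
  shows "act_word (v @ w) p = act_word v (act_word w p)"
  using act.word_eval_append[OF assms(1,2)] Bij_mult[OF act_word_Bij[OF assms(1)] act_word_Bij[OF assms(2)] assms(3)]
  by simp

text \<open>The sector component of the action of a word, transported back to \<open>R\<close>, collects one factor
  for each letter of the word which crosses the wall \<open>R\<close>.\<close>

primrec crossings :: "('a set \<times> 'a) list \<Rightarrow> 'a set \<Rightarrow> 'a" where
  "crossings [] R = \<one>"
| "crossings (y # w) R = crossings w R \<otimes>
     (if conjugate G (ev w) R = fst y then inv (ev w) \<otimes> snd y \<otimes> ev w else \<one>)"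

lemma ev_closed: "w \<in> fp.W \<Longrightarrow> ev w \<in> carrier G"
  by (rule fp.word_eval_closed)

lemma crossings_closed: "w \<in> fp.W \<Longrightarrow> crossings w R \<in> carrier G"
proof (induction w)
  case (Cons y w)
  thus ?case using ev_closed basis_carr by (cases y) auto
qed simp

text \<open>A letter \<open>b\<close> acting at its own wall multiplies from the left instead of
  conjugating. Written as a conjugation, this costs an extra factor
  \<open>inv (ev w) \<otimes> b \<otimes> ev w\<close> on the right, which is the one collected by
  \<open>crossings\<close>.\<close>

lemma act_word_eq:
  assumes "w \<in> fp.W" "(R, x) \<in> sectors"
  shows "act_word w (R, x) = (conjugate G (ev w) R, ev w \<otimes> (x \<otimes> crossings w R) \<otimes> inv (ev w))"
  using assms(1)
proof (induction w)
  case Nil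
  have "R \<subseteq> carrier G" "x \<in> carrier G" using assms(2) by (auto simp: sectors_iff)
  thus ?case using act_word_Nil[OF assms(2)] by simp
next
  case (Cons y w)
  obtain B b where y: "y = (B, b)" by (cases y)
  have w: "w \<in> fp.W" "B \<in> \<B>" "b \<in> B" "b \<in> carrier G" using Cons.prems y basis_carr by auto
  have R: "R \<subseteq> carrier G" "x \<in> carrier G" using assms(2) by (auto simp: sectors_iff)
  have e: "ev w \<in> carrier G" "crossings w R \<in> carrier G" using ev_closed crossings_closed w by auto
  have "act_word (y # w) (R, x) =
      sector_act B b (conjugate G (ev w) R, ev w \<otimes> (x \<otimes> crossings w R) \<otimes> inv (ev w))"
    using act_word_Cons Cons.prems assms(2) Cons.IH[OF w(1)] y by simp
  moreover have "(conjugate G (ev w) R, ev w \<otimes> (x \<otimes> crossings w R) \<otimes> inv (ev w)) \<in> sectors"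
    using act_word_closed[OF w(1) assms(2)] Cons.IH[OF w(1)] by simp
  ultimately show ?case
    using w R e by (auto simp: sector_act_apply y conjugate_mult m_assoc inv_mult_group)
qed

text \<open>The last letter of a word acts first, hence the reversal. After \<open>n\<close> letters
  have acted, the next one contributes its conjugate by the prefix \<open>p\<close> of length
  \<open>n\<close>; for involutions this is the alternating palindrome of length
  \<open>2 * n + 1\<close>, a reflection of the dihedral group.\<close>

lemma crossings_rev_alternating:
  assumes "A \<in> \<B>" "B \<in> \<B>" "A = {\<one>, a}" "B = {\<one>, b}" "inv a = a" "inv b = b" "R \<subseteq> carrier G"
    "a \<noteq> \<one>" "b \<noteq> \<one>"
  defines "t \<equiv> \<lambda>k. prod_word (alternating (2 * k + 1) a b)"
  shows "crossings (rev (alternating n (A, a) (B, b))) R =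
    prod_word (map (\<lambda>k. if R = {\<one>, t k} then t k else \<one>) [0..<n])"
proof (induction n)
  case (Suc n)
  have ab: "a \<in> carrier G" "b \<in> carrier G" using assms basis_carr by auto
  have t: "t k \<in> carrier G" for k unfolding t_def by (rule prod_word_closed[OF alternating_carrier[OF ab]])
  define l where "l = (if even n then a else b)"
  define L where "L = (if even n then A else B)"
  have lL: "L = {\<one>, l}" "l \<in> carrier G" using assms ab by (auto simp: l_def L_def)
  let ?w = "rev (alternating n (A, a) (B, b))"
  have Suc_n: "rev (alternating (Suc n) (A, a) (B, b)) = (L, l) # ?w"
    using alternating_append[of n 1 "(A, a)" "(B, b)"] by (simp add: l_def L_def)
  define p where "p = prod_word (alternating n a b)"
  have p: "p \<in> carrier G" using alternating_carrier[OF ab] by (auto simp: p_def)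
  have ev: "ev ?w = inv p"
    using prod_rev_alternating[OF ab assms(5,6), of n]
    by (simp add: ev_prod rev_map[symmetric] map_alternating p_def)
  have tn: "t n = p \<otimes> l \<otimes> inv p"
  proof -
    have "alternating (2 * n + 1) a b = alternating n a b @ [l] @ rev (alternating n a b)"
      using alternating_append[of n "Suc n" a b]
      by (simp add: mult_2 l_def rev_alternating)
    hence "t n = prod_word (alternating n a b @ [l] @ rev (alternating n a b))"
      unfolding t_def by (rule arg_cong)
    thus ?thesis
      using alternating_carrier[OF ab, of n] lL prod_rev_alternating[OF ab assms(5,6), of n]
      by (simp add: p_def m_assoc)
  qed
  have "conjugate G (inv p) R = L \<longleftrightarrow> R = conjugate G p L"
    using conjugate_eq_iff[OF assms(7), of L "inv p"] lL p by simp
  also have "conjugate G p L = {\<one>, t n}"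
    using conjugate_eq[of L p] lL p tn by auto
  finally have "conjugate G (ev ?w) R = L \<longleftrightarrow> R = {\<one>, t n}" using ev by simp
  moreover have "inv (ev ?w) \<otimes> l \<otimes> ev ?w = t n" using ev tn p by simp
  ultimately have "crossings (rev (alternating (Suc n) (A, a) (B, b))) R =
      crossings ?w R \<otimes> (if R = {\<one>, t n} then t n else \<one>)"
    unfolding Suc_n by simp
  thus ?case using Suc.IH t by (auto simp: image_subset_iff)
qed simp

text \<open>For label two, \<open>A\<close> and \<open>B\<close> commute elementwise, and both words
  collect the same factors. For larger labels the two sides of the relation meet the same
  reflections in opposite order. Nothing is known about their being distinct, so \<open>R\<close>
  may be met several times, but all nontrivial factors are then equal to one element of
  \<open>R\<close>, and the order does not matter.\<close>

lemma crossings_relation: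
  assumes "adj \<Gamma> A B" "a \<in> A - {\<one>}" "b \<in> B - {\<one>}" "R \<subseteq> carrier G"
  shows "crossings (alternating (lab {A, B}) (A, a) (B, b)) R =
    crossings (alternating (lab {A, B}) (B, b) (A, a)) R"
proof (cases "lab {A, B} = 2")
  case True
  have AB: "A \<in> \<B>" "B \<in> \<B>" "A \<noteq> B" using adjD assms(1) by auto
  have comm: "a' \<otimes> b' = b' \<otimes> a'" if "a' \<in> A" "b' \<in> B" for a' b'
  proof (cases "a' = \<one> \<or> b' = \<one>")
    case False
    hence "prod_word (alternating 2 a' b') = prod_word (alternating 2 b' a')"
      using relation[OF assms(1), of a' b'] that True by simp
    thus ?thesis using that AB basis_carr by (simp add: numeral_2_eq_2)
  qed (use that AB basis_carr in auto)
  have c: "a \<in> carrier G" "b \<in> carrier G" "a \<in> A" "b \<in> B" using assms AB basis_carr by auto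
  have conj: "conjugate G y R = C \<longleftrightarrow> R = C"
    if C: "C \<in> \<B>" "y \<in> carrier G" "\<And>x. x \<in> C \<Longrightarrow> y \<otimes> x = x \<otimes> y" for C y
  proof -
    have "y \<otimes> x \<otimes> inv y = x" if x: "x \<in> C" for x
      using C(3)[OF x] C(2) basis_carr[OF C(1) x] by (simp add: m_assoc)
    hence "conjugate G y C = C" using conjugate_eq[OF basis_subset[OF C(1)] C(2)] by simp
    hence "conjugate G (inv y) C = C"
      using conjugate_eq_iff[OF basis_subset[OF C(1)] basis_subset[OF C(1)] C(2)] by simp
    thus ?thesis using conjugate_eq_iff[OF assms(4) basis_subset[OF C(1)] C(2)] by simp
  qed
  have "conjugate G b R = A \<longleftrightarrow> R = A"
    by (rule conj[OF AB(1) c(2)]) (erule comm[OF _ c(4), symmetric])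
  moreover have "conjugate G a R = B \<longleftrightarrow> R = B"
    by (rule conj[OF AB(2) c(1)]) (erule comm[OF c(3)])
  moreover have "inv b \<otimes> a \<otimes> b = a" "inv a \<otimes> b \<otimes> a = b"
    using comm[OF c(3,4)] c by (simp_all add: m_assoc) (simp flip: comm[OF c(3,4)])
  ultimately show ?thesis
    using c AB(3) assms(4) by (auto simp: True numeral_2_eq_2)
next
  case False
  define m where "m = lab {A, B}"
  have m: "2 < m" using False label_ge_2[OF assms(1)] by (simp add: m_def)
  have AB: "A \<in> \<B>" "B \<in> \<B>" "A \<noteq> B" using adjD assms(1) by auto
  note inv = label_gt_2[OF assms(1) m[unfolded m_def] assms(2,3)]
  have c: "a \<in> carrier G" "b \<in> carrier G" "a \<noteq> \<one>" "b \<noteq> \<one>" using assms AB basis_carr by auto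
  have rel: "prod_word (alternating m a b) = prod_word (alternating m b a)"
    using relation[OF assms(1-3)] by (simp add: m_def)
  define t where "t = (\<lambda>k. prod_word (alternating (2 * k + 1) a b))"
  define t' where "t' = (\<lambda>k. prod_word (alternating (2 * k + 1) b a))"
  define z where "z = (\<lambda>k. if R = {\<one>, t k} then t k else \<one>)"
  have tc: "t k \<in> carrier G" for k unfolding t_def by (rule prod_word_closed[OF alternating_carrier[OF c(1,2)]])
  have tt: "t' k = t (m - 1 - k)" if k: "k < m" for k
  proof -
    \<comment> \<open>The word of length \<open>2 * m\<close> has trivial value. It is cut into two
      alternating words of odd length, and the second, a palindrome in involutions, is its own
      inverse.\<close>
    have "alternating (m + m) a b = alternating (2 * (m - 1 - k) + 1) a b @ alternating (2 * k + 1) b a"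
    proof -
      have "m + m = (2 * (m - 1 - k) + 1) + (2 * k + 1)" using k by linarith
      thus ?thesis by (simp only:) (subst alternating_append, simp)
    qed
    hence "prod_word (alternating (m + m) a b) = t (m - 1 - k) \<otimes> t' k"
      unfolding t_def t'_def
      by (simp only: prod_word_append[OF alternating_carrier[OF c(1,2)] alternating_carrier[OF c(2,1)]])
    hence "t (m - 1 - k) \<otimes> t' k = \<one>"
      using prod_alternating_double[OF c(1,2) inv(3,4) rel] by simp
    moreover have "rev (alternating (2 * k + 1) b a) = alternating (2 * k + 1) b a"
      unfolding rev_alternating by simp
    hence "inv (t' k) = t' k"
      using prod_rev_alternating[OF c(2,1) inv(4,3), of "2 * k + 1"] unfolding t'_def by (simp only:)
    moreover have "t' k \<in> carrier G"
      unfolding t'_def by (rule prod_word_closed[OF alternating_carrier[OF c(2,1)]])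
    ultimately show ?thesis using inv_equality[of "t (m - 1 - k)" "t' k"] tc by simp
  qed
  have one: "crossings (rev (alternating m (A, a) (B, b))) R = prod_word (map z [0..<m])"
    unfolding z_def t_def by (rule crossings_rev_alternating[OF AB(1,2) inv assms(4) c(3,4)])
  have two: "crossings (rev (alternating m (B, b) (A, a))) R = prod_word (map (\<lambda>k. z (m - 1 - k)) [0..<m])"
  proof -
    have "crossings (rev (alternating m (B, b) (A, a))) R =
        prod_word (map (\<lambda>k. if R = {\<one>, t' k} then t' k else \<one>) [0..<m])"
      unfolding t'_def
      by (rule crossings_rev_alternating[OF AB(2,1) inv(2,1) inv(4,3) assms(4) c(4,3)])
    also have "map (\<lambda>k. if R = {\<one>, t' k} then t' k else \<one>) [0..<m] = map (\<lambda>k. z (m - 1 - k)) [0..<m]"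
      using tt by (simp add: z_def)
    finally show ?thesis .
  qed
  have "map (\<lambda>k. z (m - 1 - k)) [0..<m] = rev (map z [0..<m])"
    by (rule nth_equalityI) (auto simp: rev_nth)
  moreover have "\<exists>r\<in>carrier G. \<forall>k. z k \<in> {\<one>, r}"
  proof (cases "\<exists>k. R = {\<one>, t k}")
    case True
    then obtain k where k: "R = {\<one>, t k}" by blast
    have "z j \<in> R" for j using k unfolding z_def by auto
    thus ?thesis using k tc by blast
  next
    case False
    hence "z k = \<one>" for k by (simp add: z_def)
    thus ?thesis by (intro bexI[of _ \<one>]) auto
  qed
  then obtain r where "r \<in> carrier G" "\<forall>k. z k \<in> {\<one>, r}" by blast
  hence "prod_word (rev (map z [0..<m])) = prod_word (map z [0..<m])"
    by (intro prod_word_rev_commuting[of _ r]) auto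
  ultimately have "crossings (rev (alternating m (A, a) (B, b))) R = crossings (rev (alternating m (B, b) (A, a))) R"
    using one two by simp
  thus ?thesis by (simp add: rev_alternating m_def split: if_splits)
qed

lemma act_relation:
  assumes "adj \<Gamma> A B" "a \<in> A - {\<one>}" "b \<in> B - {\<one>}"
  shows "act_word (alternating (lab {A, B}) (A, a) (B, b)) = act_word (alternating (lab {A, B}) (B, b) (A, a))"
proof -
  let ?u = "alternating (lab {A, B}) (A, a) (B, b)" and ?v = "alternating (lab {A, B}) (B, b) (A, a)"
  have W: "?u \<in> fp.W" "?v \<in> fp.W" using pr.alternating_W adjD[OF assms(1)] assms by auto
  have e: "ev ?u = ev ?v" using relation[OF assms] by (simp add: ev_prod map_alternating)
  show ?thesis
  proof (rule extensionalityI[of _ sectors])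
    show "act_word ?u \<in> extensional sectors" "act_word ?v \<in> extensional sectors"
      using act_word_Bij W by (auto simp: Bij_def)
    fix p assume p: "p \<in> sectors"
    obtain R x where Rx: "p = (R, x)" by (cases p)
    hence "R \<subseteq> carrier G" using p by (simp add: sectors_iff)
    thus "act_word ?u p = act_word ?v p"
      using act_word_eq[OF W(1), of R x] act_word_eq[OF W(2), of R x] e crossings_relation[OF assms] p Rx by simp
  qed
qed

text \<open>\<open>h\<close> is injective on the quotient, so words of equal value differ by an
  element of \<open>N\<close>, and \<open>N\<close> acts trivially because the relators do. Thus the
  action on sectors factors through \<open>G\<close>.\<close>

lemma act_word_cong:
  assumes "v \<in> fp.W" "w \<in> fp.W" "ev v = ev w"
  shows "act_word v = act_word w"
proof -
  have "h (N #>\<^bsub>fp.F\<^esub> fp.cls v) = h (N #>\<^bsub>fp.F\<^esub> fp.cls w)"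
    using chi_cls assms by (simp add: \<chi>_def)
  moreover have "N #>\<^bsub>fp.F\<^esub> fp.cls v \<in> carrier (fp.F Mod N)" "N #>\<^bsub>fp.F\<^esub> fp.cls w \<in> carrier (fp.F Mod N)"
    using assms by (auto simp: FactGroup_def RCOSETS_def)
  moreover have "inj_on h (carrier (fp.F Mod N))" using h_iso' by (simp add: iso_def bij_betw_def)
  ultimately have "N #>\<^bsub>fp.F\<^esub> fp.cls v = N #>\<^bsub>fp.F\<^esub> fp.cls w" by (simp add: inj_on_def)
  hence "fp.cls v \<in> N #>\<^bsub>fp.F\<^esub> fp.cls w"
    using fp.hom.G.rcos_self[OF _ pr.N.is_subgroup, of "fp.cls v"] assms by simp
  then obtain n where n: "n \<in> N" "fp.cls v = n \<otimes>\<^bsub>fp.F\<^esub> fp.cls w" by (auto simp: r_coset_def)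
  have "act.class_eval n = \<one>\<^bsub>BijGroup sectors\<^esub>"
  proof (rule pr.hom_trivial_on_N[OF act.free_product_hom_axioms _ n(1)])
    fix A B a b
    assume "adj \<Gamma> A B" "a \<in> carrier (as_group G A) - {\<one>\<^bsub>as_group G A\<^esub>}"
      "b \<in> carrier (as_group G B) - {\<one>\<^bsub>as_group G B\<^esub>}"
    thus "act_word (alternating (lab {A, B}) (A, a) (B, b)) = act_word (alternating (lab {A, B}) (B, b) (A, a))"
      using act_relation by simp
  qed
  moreover have "n \<in> carrier fp.F" using n(1) pr.N.subset by blast
  ultimately have "act.class_eval (fp.cls v) = act.class_eval (fp.cls w)"
    using n(2) assms(2) act.hom.hom_mult[of n "fp.cls w"] act.hom.hom_closed[of "fp.cls w"] by simp
  thus ?thesis using assms by (simp add: act.class_eval_cls)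
qed

section \<open>Gates read off from the action on sectors\<close>

lemma word_exists:
  assumes "g \<in> carrier G"
  shows "\<exists>w. w \<in> fp.W \<and> ev w = g"
proof -
  have "h ` carrier (fp.F Mod N) = carrier G" using h_iso' by (simp add: iso_def bij_betw_def)
  then obtain x where x: "x \<in> carrier fp.F" "g = h (N #>\<^bsub>fp.F\<^esub> x)"
    using assms by (auto simp: FactGroup_def RCOSETS_def)
  obtain w where "w \<in> fp.W" "x = fp.cls w" using x(1) by (rule fp.F_E)
  thus ?thesis using x(2) chi_cls[of w] by (auto simp: \<chi>_def)
qed

definition word_of :: "'a \<Rightarrow> ('a set \<times> 'a) list"
  where "word_of g = (SOME w. w \<in> fp.W \<and> ev w = g)"

lemma word_of: "g \<in> carrier G \<Longrightarrow> word_of g \<in> fp.W" "g \<in> carrier G \<Longrightarrow> ev (word_of g) = g"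
  using someI_ex[OF word_exists] by (auto simp: word_of_def)

text \<open>\<open>g\<close> carries the sector of the wall \<open>conjugate G (inv g) B\<close>
  that contains \<open>\<one>\<close> to the sector of \<open>B\<close> that contains
  \<open>g\<close>. The second component names this sector as a translate of the one containing
  \<open>\<one>\<close>.\<close>

definition gate :: "'a set \<Rightarrow> 'a \<Rightarrow> 'a"
  where "gate B g = snd (act_word (word_of g) (conjugate G (inv g) B, \<one>))"

lemma gate_eq:
  assumes "w \<in> fp.W" "B \<in> \<B>"
  shows "act_word w (conjugate G (inv (ev w)) B, \<one>) = (B, gate B (ev w))"
    and "(conjugate G (inv (ev w)) B, \<one>) \<in> sectors"
proof -
  have e: "ev w \<in> carrier G" using ev_closed assms by blast
  have sub: "subgroup (conjugate G (inv (ev w)) B) G" using subgroup_conjugate subgroup_basis assms(2) e by simp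
  show s: "(conjugate G (inv (ev w)) B, \<one>) \<in> sectors"
    using subgroup.subset[OF sub] subgroup.one_closed[OF sub] by (simp add: sectors_iff)
  have "fst (act_word w (conjugate G (inv (ev w)) B, \<one>)) = B"
    using act_word_eq[OF assms(1) s] basis_subset[OF assms(2)] e by (simp add: conjugate_mult)
  moreover have "act_word (word_of (ev w)) = act_word w" using act_word_cong word_of e assms by blast
  ultimately show "act_word w (conjugate G (inv (ev w)) B, \<one>) = (B, gate B (ev w))"
    by (simp add: gate_def prod_eq_iff)
qed

text \<open>Equivariance comes from a letter of \<open>B\<close> put in front of a word: it acts
  last, at its own wall, by left multiplication. Constancy off the wall comes from a letter appended
  at the end: it acts first, and away from its own wall it conjugates the second component
  \<open>\<one>\<close> to itself.\<close>

lemma gated_basis: "gated_basis G \<B> gate"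
proof (rule gated_basis.intro, rule is_group, rule gated_basis_axioms.intro)
  show "B \<in> \<B> \<Longrightarrow> subgroup B G" "B \<in> \<B> \<Longrightarrow> B \<noteq> {\<one>}" for B
    using subgroup_basis basis_nontrivial by auto
  have "ev w \<in> generate G (\<Union>\<B>)" if "w \<in> fp.W" for w
    using that
  proof (induction w)
    case (Cons x w)
    thus ?case by (cases x) (auto intro: generate.eng generate.incl)
  qed (simp add: generate.one)
  hence "carrier G \<subseteq> generate G (\<Union>\<B>)" using word_exists by blast
  thus "generate G (\<Union>\<B>) = carrier G"
    using generate_incl[of "\<Union>\<B>"] basis_subset by blast
  fix B g assume B: "B \<in> \<B>"
  have "gate B (ev []) = \<one>"
    using gate_eq[OF fp.W_Nil B] act_word_Nil by simp
  thus "gate B \<one> = \<one>" by simp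
  assume "g \<in> carrier G"
  then obtain w where w: "w \<in> fp.W" "ev w = g" using word_exists by blast
  hence g: "g \<in> carrier G" using ev_closed by blast
  note G = gate_eq[OF w(1) B, unfolded w(2)]
  show gB: "gate B g \<in> B"
    using act_word_closed[OF w(1) G(2)] G(1) by (simp add: sectors_iff)
  show "gate B (b \<otimes> g) = b \<otimes> gate B g" if b: "b \<in> B" for b
  proof -
    have W: "(B, b) # w \<in> fp.W" "ev ((B, b) # w) = b \<otimes> g" using B b w by auto
    have bc: "b \<in> carrier G" "inv b \<in> B"
      using b basis_carr[OF B] subgroup.m_inv_closed[OF subgroup_basis[OF B]] by auto
    have "conjugate G (inv g) (conjugate G (inv b) B) = conjugate G (inv (b \<otimes> g)) B"
      using bc g basis_subset[OF B] by (simp add: conjugate_mult inv_mult_group)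
    hence conj: "conjugate G (inv (b \<otimes> g)) B = conjugate G (inv g) B"
      using conjugate_self[OF subgroup_basis[OF B] bc(2)] by simp
    have "(B, gate B (b \<otimes> g)) = act_word ((B, b) # w) (conjugate G (inv g) B, \<one>)"
      using gate_eq(1)[OF W(1) B] W(2) conj by simp
    also have "\<dots> = sector_act B b (B, gate B g)"
      using act_word_Cons[OF W(1) G(2)] G(1) by simp
    also have "\<dots> = (conjugate G b B, b \<otimes> gate B g)"
      using gB basis_subset[OF B] by (simp add: sector_act_apply sectors_iff)
    finally show ?thesis by simp
  qed
  show "gate B (g \<otimes> s) = gate B g" if D: "D \<in> \<B>" "s \<in> D" "conjugate G g D \<noteq> B" for D s
  proof -
    have sc: "s \<in> carrier G" using D basis_carr by blast
    have W: "w @ [(D, s)] \<in> fp.W" "[(D, s)] \<in> fp.W" "ev (w @ [(D, s)]) = g \<otimes> s"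
      using D w sc fp.word_eval_append[OF w(1), of "[(D, s)]"] by auto
    let ?R = "conjugate G (inv (g \<otimes> s)) B"
    note G' = gate_eq[OF W(1) B, unfolded W(3)]
    have Rc: "?R \<subseteq> carrier G" using G'(2) by (simp add: sectors_iff)
    have conj: "conjugate G s ?R = conjugate G (inv g) B"
      using sc g basis_subset[OF B] by (simp add: conjugate_mult inv_mult_group m_assoc)
    \<comment> \<open>Elements of \<open>D\<close> normalise \<open>D\<close>, so
      \<open>?R = D\<close> would mean that the edge from \<open>g\<close> to
      \<open>g \<otimes> s\<close> crosses \<open>B\<close>.\<close>
    have "?R \<noteq> D"
    proof
      assume "?R = D"
      hence "conjugate G (inv g) B = D"
        using conj conjugate_self[OF subgroup_basis[OF D(1)] D(2)] by simp
      hence "conjugate G g D = B"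
        using g basis_subset[OF B] conjugate_mult[of B g "inv g"] by auto
      thus False using D(3) by simp
    qed
    hence "act_word [(D, s)] (?R, \<one>) = (conjugate G (inv g) B, \<one>)"
      using act_word_Cons[OF W(2) G'(2)] act_word_Nil[OF G'(2)] sector_act_apply[OF G'(2)] sc conj by simp
    hence "act_word (w @ [(D, s)]) (?R, \<one>) = (B, gate B g)"
      using act_word_append[OF w(1) W(2) G'(2)] G(1) by simp
    thus ?thesis using G'(1) by simp
  qed
qed

end

theorem theorem1p1:
  fixes G :: "('g, 'm) monoid_scheme"
  shows "(\<forall>(X :: 'v ugraph) \<phi> \<R> x\<^sub>0.
            rotation_system G X \<phi> \<R> \<and> x\<^sub>0 \<in> verts X \<longrightarrow>
              periagroup_with_basis G (rotative_stabilisers_at G X \<phi> \<R> x\<^sub>0) \<and>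
              mediangle X \<and>
              X \<cong>\<^sub>g Cayl G (rotative_stabilisers_at G X \<phi> \<R> x\<^sub>0)) \<and>
         (\<forall>\<B>.
            periagroup_with_basis G \<B> \<longrightarrow>
              mediangle (Cayl G \<B>) \<and>
              rotation_system G (Cayl G \<B>) (left_mult G)
                {conjugate G g B | g B. g \<in> carrier G \<and> B \<in> \<B>})"
proof (intro conjI allI impI)
  fix X :: "'v ugraph" and \<phi> \<R> x\<^sub>0
  assume a: "rotation_system G X \<phi> \<R> \<and> x\<^sub>0 \<in> verts X"
  interpret rotation_system_at G X \<phi> \<R> x\<^sub>0
    using a by (intro rotation_system_at.intro rotation_system_at_axioms.intro) (auto simp: rotation_system_def)
  show "periagroup_with_basis G (rotative_stabilisers_at G X \<phi> \<R> x\<^sub>0)"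
    by (rule periagroup_with_basis)
  show "mediangle X"
    by (rule mediangle)
  show "X \<cong>\<^sub>g Cayl G (rotative_stabilisers_at G X \<phi> \<R> x\<^sub>0)"
    by (rule isomorphic_Cayl)
next
  fix \<B>
  assume a: "periagroup_with_basis G \<B>"
  then obtain lab h where "periagroup_data (basis_graph G \<B>) lab (as_group G)"
    "h \<in> iso (periagroup (basis_graph G \<B>) lab (as_group G)) G"
    "\<forall>B\<in>\<B>. \<forall>b\<in>B. h (periagroup_inj (basis_graph G \<B>) lab (as_group G) B b) = b"
    unfolding periagroup_with_basis_def by blast
  then interpret pb: periagroup_basis G \<B> lab h
    using a by (intro periagroup_basis.intro periagroup_basis_axioms.intro) (auto simp: periagroup_with_basis_def)
  show "mediangle (Cayl G \<B>)"
    by (rule gated_basis.mediangle_Cayl[OF pb.gated_basis])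
  show "rotation_system G (Cayl G \<B>) (left_mult G) {conjugate G g B | g B. g \<in> carrier G \<and> B \<in> \<B>}"
    by (rule gated_basis.rotation_system_Cayl[OF pb.gated_basis])
qed

end
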